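(* Let $n\ge 3$ and let $g$ be a $C^2$ Riemannian metric defined near infinity of $\mathbb R^n$, written in the standard coordinates as $g=g_{ij}dx^idx^j$, with $g_{ij}-\delta_{ij}=o_2(|x|^{-\frac{n-2}{2}})$. Let $\{D_l\}_{l=1}^\infty$ be a sequence of bounded open sets in $\mathbb R^n$ with Lipschitz boundaries $\Sigma_l=\partial D_l$ (on which $g$ is defined), let $|\Sigma_l|$ denote the Euclidean area of $\Sigma_l$ and $r_l=\inf_{x\in\Sigma_l}|x|$. Assume $\lim_{l\to\infty}r_l=\infty$ and $|\Sigma_l|\le C r_l^{n-1}$ for a constant $C$ independent of $l$. Define $\mathfrak m(l)=\frac{1}{2(n-1)\omega_{n-1}}\int_{\Sigma_l}(g_{ij,j}-g_{jj,i})\nu_e^i\,d\sigma_e$ and $\mathfrak m_I(l)=\frac{1}{(n-1)(2-n)\omega_{n-1}}\int_{\Sigma_l}\big(\mathrm{Ric}-\tfrac12R_g g\big)(X,\nu_g)\,d\sigma_g$. Then $\lim_{l\to\infty}\big(\mathfrak m(l)-\mathfrak m_I(l)\big)=0$. In particular (taking $\Sigma_l$ to be the coordinate spheres $S_r=\{|x|=r\}$), $\lim_{r\to\infty}\big(\mathfrak m(r)-\mathfrak m_I(r)\big)=0$, where $\mathfrak m(r),\mathfrak m_I(r)$ are the same integrals over $S_r$.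
   Context: Summation over repeated indices is used; commas denote partial derivatives in the coordinates $x^i$. A function $f$ near infinity satisfies $f=o_k(|x|^{-\tau})$ if $f\in C^k$ and $|x|^{|\alpha|+\tau}|\partial^\alpha f(x)|\to0$ as $x\to\infty$ for all multi-indices $|\alpha|\le k$. On $\Sigma_l$, $\nu_e,d\sigma_e$ are the Euclidean unit outward normal and area element, and $\nu_g,d\sigma_g$ the corresponding quantities for $g$. $\omega_{n-1}$ is the area of the unit sphere in $\mathbb R^n$; $\mathrm{Ric},R_g$ are the Ricci tensor and scalar curvature of $g$; $X=x^i\partial_{x^i}$. *)

theory Defs
  imports "HOL-Analysis.Analysis"
begin

definition unit_ball_vol :: "real \<Rightarrow> real" where
  "unit_ball_vol s = pi powr (s / 2) / Gamma (s / 2 + 1)"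

definition sphere_area :: "nat \<Rightarrow> real" where
  "sphere_area n = 2 * pi powr (real n / 2) / Gamma (real n / 2)"

definition hausdorff_pre :: "real \<Rightarrow> real \<Rightarrow> ('a::euclidean_space) set \<Rightarrow> ennreal" where
  "hausdorff_pre s \<delta> A =
     (INF C \<in> {C :: nat \<Rightarrow> 'a set. A \<subseteq> (\<Union>i. C i) \<and> (\<forall>i. bounded (C i) \<and> diameter (C i) \<le> \<delta>)}.
        (\<Sum>i. ennreal (unit_ball_vol s * (diameter (C i) / 2) powr s)))"

definition hausdorff :: "real \<Rightarrow> ('a::euclidean_space) set \<Rightarrow> ennreal" where
  "hausdorff s A = (SUP \<delta> \<in> {0<..}. hausdorff_pre s \<delta> A)"

definition hmeasure :: "real \<Rightarrow> ('a::euclidean_space) measure" where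
  "hmeasure s = measure_of UNIV (sets borel) (hausdorff s)"

definition surf_int :: "(real^'n) set \<Rightarrow> (real^'n \<Rightarrow> real) \<Rightarrow> real" where
  "surf_int S f = integral\<^sup>L (completion (restrict_space (hmeasure (real CARD('n) - 1)) S)) f"

definition pd :: "'n::finite \<Rightarrow> (real^'n \<Rightarrow> real) \<Rightarrow> real^'n \<Rightarrow> real" where
  "pd i f x = deriv (\<lambda>t. f (x + t *\<^sub>R axis i 1)) 0"

definition partial_ex :: "'n::finite \<Rightarrow> (real^'n \<Rightarrow> real) \<Rightarrow> real^'n \<Rightarrow> bool" where
  "partial_ex i f x \<longleftrightarrow> (\<lambda>t. f (x + t *\<^sub>R axis i 1)) differentiable (at 0)"

definition C2_on :: "(real^'n::finite) set \<Rightarrow> (real^'n \<Rightarrow> real) \<Rightarrow> bool" where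
  "C2_on U f \<longleftrightarrow> open U \<and> continuous_on U f
     \<and> (\<forall>i. \<forall>x\<in>U. partial_ex i f x) \<and> (\<forall>i. continuous_on U (pd i f))
     \<and> (\<forall>i j. \<forall>x\<in>U. partial_ex j (pd i f) x) \<and> (\<forall>i j. continuous_on U (pd j (pd i f)))"

type_synonym 'n metric = "'n \<Rightarrow> 'n \<Rightarrow> real^'n \<Rightarrow> real"

definition riemannian_C2_on :: "(real^'n::finite) set \<Rightarrow> 'n metric \<Rightarrow> bool" where
  "riemannian_C2_on U g \<longleftrightarrow> (\<forall>i j. C2_on U (g i j))
     \<and> (\<forall>x\<in>U. \<forall>i j. g i j x = g j i x)
     \<and> (\<forall>x\<in>U. \<forall>v::real^'n. v \<noteq> 0 \<longrightarrow> (\<Sum>i\<in>UNIV. \<Sum>j\<in>UNIV. g i j x * v$i * v$j) > 0)"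

definition little_o2 :: "(real^'n::finite \<Rightarrow> real) \<Rightarrow> real \<Rightarrow> bool" where
  "little_o2 f \<tau> \<longleftrightarrow>
     ((\<lambda>x. norm x powr \<tau> * f x) \<longlongrightarrow> 0) at_infinity
   \<and> (\<forall>k. ((\<lambda>x. norm x powr (\<tau> + 1) * pd k f x) \<longlongrightarrow> 0) at_infinity)
   \<and> (\<forall>k m. ((\<lambda>x. norm x powr (\<tau> + 2) * pd m (pd k f) x) \<longlongrightarrow> 0) at_infinity)"

definition gmat :: "'n metric \<Rightarrow> real^'n \<Rightarrow> real^'n^'n" where
  "gmat g x = (\<chi> i j. g i j x)"

definition ginv :: "'n::finite metric \<Rightarrow> 'n \<Rightarrow> 'n \<Rightarrow> real^'n \<Rightarrow> real" where
  "ginv g i j x = matrix_inv (gmat g x) $ i $ j"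

definition christoffel :: "'n::finite metric \<Rightarrow> 'n \<Rightarrow> 'n \<Rightarrow> 'n \<Rightarrow> real^'n \<Rightarrow> real" where
  "christoffel g k i j x = (1/2) * (\<Sum>l\<in>UNIV. ginv g k l x *
      (pd i (g j l) x + pd j (g i l) x - pd l (g i j) x))"

definition ricci :: "'n::finite metric \<Rightarrow> 'n \<Rightarrow> 'n \<Rightarrow> real^'n \<Rightarrow> real" where
  "ricci g i j x = (\<Sum>k\<in>UNIV. pd k (christoffel g k i j) x - pd j (christoffel g k i k) x
      + (\<Sum>l\<in>UNIV. christoffel g k k l x * christoffel g l i j x
                 - christoffel g k j l x * christoffel g l i k x))"

definition scalar_curv :: "'n::finite metric \<Rightarrow> real^'n \<Rightarrow> real" where
  "scalar_curv g x = (\<Sum>i\<in>UNIV. \<Sum>j\<in>UNIV. ginv g i j x * ricci g i j x)"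

definition einstein :: "'n::finite metric \<Rightarrow> 'n \<Rightarrow> 'n \<Rightarrow> real^'n \<Rightarrow> real" where
  "einstein g i j x = ricci g i j x - (1/2) * scalar_curv g x * g i j x"

text \<open>v is the Euclidean outward unit normal of D at the boundary point x
  (the boundary has tangent half-space {y. (y-x)\<bullet>v \<le> 0} at x, D lying on the inner side).\<close>
definition outward_normal :: "(real^'n::finite) set \<Rightarrow> real^'n \<Rightarrow> real^'n \<Rightarrow> bool" where
  "outward_normal D x v \<longleftrightarrow> norm v = 1 \<and>
     (\<forall>\<epsilon>>0. \<exists>\<delta>>0. \<forall>y\<in>ball x \<delta>.
        ((y - x) \<bullet> v > \<epsilon> * norm (y - x) \<longrightarrow> y \<notin> closure D)
      \<and> ((y - x) \<bullet> v < - \<epsilon> * norm (y - x) \<longrightarrow> y \<in> D))"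

definition nu_e :: "(real^'n::finite) set \<Rightarrow> real^'n \<Rightarrow> real^'n" where
  "nu_e D x = (SOME v. outward_normal D x v)"

text \<open>Bounded open set with Lipschitz boundary: locally the region below the graph of a
  Lipschitz function over a hyperplane.\<close>
definition lipschitz_domain :: "(real^'n::finite) set \<Rightarrow> bool" where
  "lipschitz_domain D \<longleftrightarrow> open D \<and> bounded D \<and>
     (\<forall>x\<in>frontier D. \<exists>e r L h. norm e = 1 \<and> r > 0 \<and> L-lipschitz_on UNIV h
        \<and> (\<forall>y t. h (y + t *\<^sub>R e) = h y)
        \<and> D \<inter> ball x r = {y \<in> ball x r. y \<bullet> e < h y})"

definition mass_adm :: "'n::finite metric \<Rightarrow> (real^'n) set \<Rightarrow> real" where
  "mass_adm g D = 1 / (2 * (real CARD('n) - 1) * sphere_area CARD('n)) *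
     surf_int (frontier D) (\<lambda>x. \<Sum>i\<in>UNIV. \<Sum>j\<in>UNIV.
        (pd j (g i j) x - pd i (g j j) x) * nu_e D x $ i)"

text \<open>m_I: Ricci-version mass. With nu = nu_e and q = g^{ab} nu_a nu_b one has
  nu_g^j = g^{jk} nu_k / sqrt q and d sigma_g = sqrt (det g) * sqrt q * d sigma_e.\<close>
definition mass_ricci :: "'n::finite metric \<Rightarrow> (real^'n) set \<Rightarrow> real" where
  "mass_ricci g D = 1 / ((real CARD('n) - 1) * (2 - real CARD('n)) * sphere_area CARD('n)) *
     surf_int (frontier D) (\<lambda>x.
        let \<nu> = nu_e D x;
            q = (\<Sum>a\<in>UNIV. \<Sum>b\<in>UNIV. ginv g a b x * \<nu>$a * \<nu>$b);
            \<nu>g = (\<lambda>j. (\<Sum>k\<in>UNIV. ginv g j k x * \<nu>$k) / sqrt q)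
        in (\<Sum>i\<in>UNIV. \<Sum>j\<in>UNIV. einstein g i j x * x$i * \<nu>g j)
           * (sqrt (det (gmat g x)) * sqrt q))"

end

theory Submission
  imports Defs
begin

text \<open>In the coordinates at infinity, \<open>(Ric - R g / 2)(X, \<nu>\<^sub>g) d\<sigma>\<^sub>g = F\<^sub>k \<nu>\<^sub>e\<^sup>k d\<sigma>\<^sub>e\<close> for a continuous vector
  field \<open>F\<close>.  Linearising at the flat metric, \<open>F\<^sub>j = \<partial>\<^sub>k A\<^sub>k\<^sub>j + (2 - n) / 2 (g\<^sub>j\<^sub>l\<^sub>,\<^sub>l - g\<^sub>l\<^sub>l\<^sub>,\<^sub>j) + E\<^sub>j\<close> with \<open>A\<close> a
  \<open>C\<^sup>1\<close> antisymmetric field; the error \<open>E\<close> is quadratic in \<open>g - \<delta>\<close> and its derivatives, hence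
  \<open>o(|x|\<^sup>1\<^sup>-\<^sup>n)\<close>.  The divergence of an antisymmetric field has zero flux through the boundary of a domain,
  and the area bound makes the flux of \<open>E\<close> tend to zero.

  The field \<open>A\<close> lives only near \<open>\<Sigma>\<^sub>l\<close>, so its flux is killed not by the divergence theorem on \<open>D\<^sub>l\<close> but by
  Stokes' theorem on the closed hypersurface \<open>\<Sigma>\<^sub>l\<close>.  A partition of unity reduces this to Lipschitz graphs.
  There Rademacher's theorem and the area formula turn the flux into a Lebesgue integral, which vanishes
  by antisymmetrised integration by parts.\<close>

section \<open>Hausdorff measure\<close>

text \<open>The identity for \<open>F\<close> has a source. The linearised Einstein tensor is
  divergence free and the position field has gradient \<delta>, so their contraction has as
  divergence the trace of that tensor: (2 - n)/2 times the linearised scalar curvature, which is in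
  turn the divergence of the mass integrand. Hence the contraction minus (2 - n)/2 times the mass
  integrand is divergence free, and \<open>potential\<close> is an explicit antisymmetric primitive
  of it. Its flux cannot be estimated away. The decay makes its divergence only o(|x|^(-n/2))
  against an area of order |x|^(n-1), so the flux has to vanish exactly. The metric is only C^2 and
  the boundary only Lipschitz. Neither the antisymmetric field nor the graph function has second
  derivatives, which is why the integration by parts is carried out on difference quotients. The
  exponent (n - 2)/2 enters through one equation: twice it plus two is n. Quadratic terms are
  therefore o(|x|^(-n)), and the position field costs one power.\<close>

lemma unit_ball_vol_pos: "s \<ge> 0 \<Longrightarrow> unit_ball_vol s > 0"
  by (simp add: unit_ball_vol_def Gamma_real_pos)

lemma hausdorff_pre_le:
  assumes "A \<subseteq> (\<Union>i. C i)" "\<And>i. bounded (C i)" "\<And>i. diameter (C i) \<le> \<delta>"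
  shows "hausdorff_pre s \<delta> A \<le> (\<Sum>i. ennreal (unit_ball_vol s * (diameter (C i) / 2) powr s))"
  unfolding hausdorff_pre_def using assms by (intro INF_lower) auto

lemma hausdorff_pre_mono: "A \<subseteq> B \<Longrightarrow> hausdorff_pre s \<delta> A \<le> hausdorff_pre s \<delta> B"
  unfolding hausdorff_pre_def by (intro INF_superset_mono) auto

lemma hausdorff_pre_antimono: "\<delta> \<le> \<delta>' \<Longrightarrow> hausdorff_pre s \<delta>' A \<le> hausdorff_pre s \<delta> A"
  unfolding hausdorff_pre_def by (intro INF_superset_mono) (auto intro: order_trans)

lemma hausdorff_mono: "A \<subseteq> B \<Longrightarrow> hausdorff s A \<le> hausdorff s B"
  unfolding hausdorff_def by (intro SUP_mono') (rule hausdorff_pre_mono)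

lemma hausdorff_pre_le_hausdorff: "\<delta> > 0 \<Longrightarrow> hausdorff_pre s \<delta> A \<le> hausdorff s A"
  unfolding hausdorff_def by (intro SUP_upper) auto

lemma hausdorff_leI: "(\<And>\<delta>. \<delta> > 0 \<Longrightarrow> hausdorff_pre s \<delta> A \<le> b) \<Longrightarrow> hausdorff s A \<le> b"
  unfolding hausdorff_def by (intro SUP_least) auto

lemma hausdorff_pre_empty: "\<delta> > 0 \<Longrightarrow> hausdorff_pre s \<delta> {} = 0"
  using hausdorff_pre_le[of "{}" "\<lambda>_. {}" \<delta> s] by (simp add: diameter_empty)

lemma hausdorff_empty [simp]: "hausdorff s {} = 0"
  using hausdorff_leI[of s "{}" 0] hausdorff_pre_empty by fastforce

lemma hausdorff_pre_approx:
  assumes "hausdorff_pre s \<delta> A < b"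
  obtains C :: "nat \<Rightarrow> 'a::euclidean_space set"
  where "A \<subseteq> (\<Union>i. C i)" "\<And>i. bounded (C i)" "\<And>i. diameter (C i) \<le> \<delta>"
    "(\<Sum>i. ennreal (unit_ball_vol s * (diameter (C i) / 2) powr s)) < b"
  using assms unfolding hausdorff_pre_def INF_less_iff by auto

text \<open>Near-optimal covers of the sets \<open>A i\<close>, with errors adding up to
  \<open>e\<close>, are merged into one cover through the pairing of the natural numbers. The
  infinite case is set apart because a cover strictly below value plus error is available only for
  finite values.\<close>

lemma hausdorff_pre_countably_subadditive:
  fixes A :: "nat \<Rightarrow> 'a::euclidean_space set"
  shows "hausdorff_pre s \<delta> (\<Union>i. A i) \<le> (\<Sum>i. hausdorff_pre s \<delta> (A i))"
proof (cases "(\<Sum>i. hausdorff_pre s \<delta> (A i)) = \<infinity>")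
  case False
  define w where "w S = ennreal (unit_ball_vol s * (diameter S / 2) powr s)" for S :: "'a set"
  have fin: "hausdorff_pre s \<delta> (A i) < \<infinity>" for i
    using False ennreal_suminf_lessD[of "\<lambda>i. hausdorff_pre s \<delta> (A i)" top]
    by (simp add: less_top[symmetric])
  show ?thesis
  proof (rule ennreal_le_epsilon)
    fix e :: real assume "0 < e"
    have "\<exists>C. A i \<subseteq> (\<Union>j. C j) \<and> (\<forall>j. bounded (C j)) \<and> (\<forall>j. diameter (C j) \<le> \<delta>)
        \<and> (\<Sum>j. w (C j)) < hausdorff_pre s \<delta> (A i) + ennreal (e * (1/2) ^ Suc i)" for i
    proof -
      have "hausdorff_pre s \<delta> (A i) < hausdorff_pre s \<delta> (A i) + ennreal (e * (1/2) ^ Suc i)"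
        proof -
        obtain r where r: "hausdorff_pre s \<delta> (A i) = ennreal r" "r \<ge> 0"
          using fin[of i] by (cases "hausdorff_pre s \<delta> (A i)") auto
        have "ennreal r < ennreal (r + e * (1/2) ^ Suc i)"
          using \<open>0 < e\<close> r by (subst ennreal_less_iff) auto
        also have "\<dots> = ennreal r + ennreal (e * (1/2) ^ Suc i)"
          using \<open>0 < e\<close> r by (intro ennreal_plus) auto
        finally show ?thesis unfolding r(1) .
      qed
      then obtain C :: "nat \<Rightarrow> 'a set"
        where C: "A i \<subseteq> (\<Union>j. C j)" "\<And>j. bounded (C j)" "\<And>j. diameter (C j) \<le> \<delta>"
        "(\<Sum>j. ennreal (unit_ball_vol s * (diameter (C j) / 2) powr s))
           < hausdorff_pre s \<delta> (A i) + ennreal (e * (1/2) ^ Suc i)"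
        by (rule hausdorff_pre_approx) blast
      show ?thesis unfolding w_def by (intro exI[of _ C] conjI allI C)
    qed
    then obtain C where C: "\<And>i. A i \<subseteq> (\<Union>j. C i j)" "\<And>i j. bounded (C i j)" "\<And>i j. diameter (C i j) \<le> \<delta>"
        "\<And>i. (\<Sum>j. w (C i j)) < hausdorff_pre s \<delta> (A i) + ennreal (e * (1/2) ^ Suc i)"
      by metis
    have "hausdorff_pre s \<delta> (\<Union>i. A i) \<le> (\<Sum>k. w (case_prod C (prod_decode k)))"
      unfolding w_def
    proof (rule hausdorff_pre_le)
      show "(\<Union>i. A i) \<subseteq> (\<Union>k. case_prod C (prod_decode k))"
      proof safe
        fix x i assume "x \<in> A i"
        then obtain j where "x \<in> C i j" using C(1) by blast
        then have "x \<in> case_prod C (prod_decode (prod_encode (i, j)))" by simp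
        then show "x \<in> (\<Union>k. case_prod C (prod_decode k))" by (rule UN_I[OF UNIV_I])
      qed
      show "bounded (case_prod C (prod_decode k))" "diameter (case_prod C (prod_decode k)) \<le> \<delta>" for k
        by (simp_all only: case_prod_beta C(2,3))
    qed
    also have "\<dots> = (\<Sum>i. \<Sum>j. w (C i j))"
      by (subst suminf_ennreal_2dimen[where f = "\<lambda>(i, j). w (C i j)", symmetric])
         (auto simp: case_prod_beta comp_def intro!: arg_cong[where f = suminf] ext)
    also have "\<dots> \<le> (\<Sum>i. hausdorff_pre s \<delta> (A i) + ennreal (e * (1/2) ^ Suc i))"
      by (intro suminf_le summableI less_imp_le C)
    also have "\<dots> = (\<Sum>i. hausdorff_pre s \<delta> (A i)) + (\<Sum>i. ennreal (e * (1/2) ^ Suc i))"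
      by (intro suminf_add[symmetric] summableI)
    also have "(\<Sum>i. ennreal (e * (1/2) ^ Suc i)) = ennreal e"
    proof -
      have "(\<lambda>i. e * (1/2) ^ Suc i) sums (e * 1)" by (intro sums_mult power_half_series)
      then show ?thesis using \<open>0 < e\<close> by (intro suminf_ennreal_eq) auto
    qed
    finally show "hausdorff_pre s \<delta> (\<Union>i. A i) \<le> (\<Sum>i. hausdorff_pre s \<delta> (A i)) + ennreal e" .
  qed
qed simp

lemma hausdorff_countably_subadditive:
  fixes A :: "nat \<Rightarrow> 'a::euclidean_space set"
  shows "hausdorff s (\<Union>i. A i) \<le> (\<Sum>i. hausdorff s (A i))"
proof (rule hausdorff_leI)
  fix \<delta> :: real assume "\<delta> > 0"
  have "hausdorff_pre s \<delta> (\<Union>i. A i) \<le> (\<Sum>i. hausdorff_pre s \<delta> (A i))"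
    by (rule hausdorff_pre_countably_subadditive)
  also have "\<dots> \<le> (\<Sum>i. hausdorff s (A i))"
    by (intro suminf_le summableI hausdorff_pre_le_hausdorff \<open>\<delta> > 0\<close>)
  finally show "hausdorff_pre s \<delta> (\<Union>i. A i) \<le> (\<Sum>i. hausdorff s (A i))" .
qed

lemma hausdorff_Un_le: "hausdorff s (A \<union> B) \<le> hausdorff s A + hausdorff s B"
proof -
  have "A \<union> B = (\<Union>i. if i = 0 then A else if i = Suc 0 then B else {})"
    by (auto split: if_splits)
  then have "hausdorff s (A \<union> B) \<le> (\<Sum>i. hausdorff s (if i = 0 then A else if i = Suc 0 then B else {}))"
    using hausdorff_countably_subadditive[of s "\<lambda>i. if i = 0 then A else if i = Suc 0 then B else {}"] by (simp only:)
  also have "\<dots> = (\<Sum>i<2. hausdorff s (if i = 0 then A else if i = Suc 0 then B else {}))"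
    by (intro suminf_finite) auto
  finally show ?thesis by (simp add: numeral_2_eq_2)
qed

section \<open>Caratheodory measurability of the Borel sets\<close>

text \<open>A cover by sets of diameter below \<open>d\<close> falls apart: no member meets both
  \<open>A\<close> and \<open>B\<close>, so its sum dominates the sums of a cover of
  \<open>A\<close> and a cover of \<open>B\<close>.\<close>

lemma hausdorff_separated:
  fixes A B :: "'a::euclidean_space set"
  assumes "d > 0" and sep: "\<And>x y. x \<in> A \<Longrightarrow> y \<in> B \<Longrightarrow> dist x y \<ge> d"
  shows "hausdorff s A + hausdorff s B \<le> hausdorff s (A \<union> B)"
proof -
  define w where "w S = ennreal (unit_ball_vol s * (diameter S / 2) powr s)" for S :: "'a set"
  have w0: "w {} = 0" by (simp add: w_def diameter_empty)
  \<comment> \<open>Two independent scales, so that the two suprema can be taken one after the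
    other.\<close>
  have *: "hausdorff_pre s \<delta>1 A + hausdorff_pre s \<delta>2 B \<le> hausdorff s (A \<union> B)" if "\<delta>1 > 0" "\<delta>2 > 0" for \<delta>1 \<delta>2
  proof -
    define \<delta> where "\<delta> = min (min \<delta>1 \<delta>2) (d/2)"
    have \<delta>: "\<delta> > 0" "\<delta> \<le> \<delta>1" "\<delta> \<le> \<delta>2" "\<delta> < d" using that \<open>d > 0\<close> by (auto simp: \<delta>_def)
    have "hausdorff_pre s \<delta> A + hausdorff_pre s \<delta> B \<le> hausdorff_pre s \<delta> (A \<union> B)"
    proof (rule ccontr)
      assume "\<not> ?thesis"
      then have "hausdorff_pre s \<delta> (A \<union> B) < hausdorff_pre s \<delta> A + hausdorff_pre s \<delta> B" by simp
      then obtain C where C: "A \<union> B \<subseteq> (\<Union>i. C i)" "\<And>i. bounded (C i)" "\<And>i. diameter (C i) \<le> \<delta>"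
          and less: "(\<Sum>i. w (C i)) < hausdorff_pre s \<delta> A + hausdorff_pre s \<delta> B"
        unfolding w_def by (rule hausdorff_pre_approx) blast
      define CA where "CA i = (if C i \<inter> A = {} then {} else C i)" for i
      define CB where "CB i = (if C i \<inter> B = {} then {} else C i)" for i
      have dis: "C i \<inter> A = {} \<or> C i \<inter> B = {}" for i
      proof (rule ccontr)
        assume "\<not> ?thesis"
        then obtain x y where "x \<in> C i" "x \<in> A" "y \<in> C i" "y \<in> B" by blast
        then have "d \<le> dist x y" "dist x y \<le> diameter (C i)"
          using sep C(2) diameter_bounded_bound[of "C i"] by auto
        then show False using C(3)[of i] \<delta> by linarith
      qed
      have "hausdorff_pre s \<delta> A \<le> (\<Sum>i. w (CA i))" unfolding w_def
        proof (rule hausdorff_pre_le)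
        show "A \<subseteq> (\<Union>i. CA i)"
        proof
          fix x assume "x \<in> A"
          then obtain i where "x \<in> C i" using C(1) by blast
          then have "x \<in> CA i" using \<open>x \<in> A\<close> by (auto simp: CA_def)
          then show "x \<in> (\<Union>i. CA i)" by blast
        qed
      qed (use C \<delta> in \<open>auto simp: CA_def diameter_empty\<close>)
      moreover have "hausdorff_pre s \<delta> B \<le> (\<Sum>i. w (CB i))" unfolding w_def
        proof (rule hausdorff_pre_le)
        show "B \<subseteq> (\<Union>i. CB i)"
        proof
          fix x assume "x \<in> B"
          then obtain i where "x \<in> C i" using C(1) by blast
          then have "x \<in> CB i" using \<open>x \<in> B\<close> by (auto simp: CB_def)
          then show "x \<in> (\<Union>i. CB i)" by blast
        qed
      qed (use C \<delta> in \<open>auto simp: CB_def diameter_empty\<close>)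
      moreover have "(\<Sum>i. w (CA i)) + (\<Sum>i. w (CB i)) = (\<Sum>i. w (CA i) + w (CB i))"
        by (intro suminf_add summableI)
      moreover have "\<dots> \<le> (\<Sum>i. w (C i))"
        by (intro suminf_le summableI) (use dis in \<open>auto simp: CA_def CB_def w0\<close>)
      ultimately have "hausdorff_pre s \<delta> A + hausdorff_pre s \<delta> B \<le> (\<Sum>i. w (C i))"
        by (metis add_mono order_trans)
      with less show False by simp
    qed
    then have "hausdorff_pre s \<delta>1 A + hausdorff_pre s \<delta>2 B \<le> hausdorff_pre s \<delta> (A \<union> B)"
      using \<delta> by (meson add_mono hausdorff_pre_antimono order_trans)
    also have "\<dots> \<le> hausdorff s (A \<union> B)" by (rule hausdorff_pre_le_hausdorff) fact
    finally show ?thesis .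
  qed
  have "hausdorff s A + hausdorff_pre s \<delta>2 B \<le> hausdorff s (A \<union> B)" if "\<delta>2 > 0" for \<delta>2
    unfolding hausdorff_def[of s A]
    by (subst ennreal_SUP_add_left[symmetric]) (use * that in \<open>auto intro!: SUP_least\<close>)
  then show ?thesis
    unfolding hausdorff_def[of s B] add.commute[of "hausdorff s A"]
    by (subst ennreal_SUP_add_left[symmetric]) (auto intro!: SUP_least)
qed

lemma hausdorff_separated_family:
  fixes A :: "nat \<Rightarrow> 'a::euclidean_space set"
  assumes "\<And>i j x y. i < j \<Longrightarrow> x \<in> A i \<Longrightarrow> y \<in> A j \<Longrightarrow> dist x y \<ge> d i" "\<And>i. d i > 0"
  shows "(\<Sum>i<N. hausdorff s (A i)) \<le> hausdorff s (\<Union>i<N. A i)"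
proof (induction N)
  case (Suc N)
  have "(\<Sum>i<Suc N. hausdorff s (A i)) \<le> hausdorff s (\<Union>i<N. A i) + hausdorff s (A N)"
    using Suc by (simp add: add_mono)
  also have "\<dots> \<le> hausdorff s ((\<Union>i<N. A i) \<union> A N)"
  proof (cases "N = 0")
    case False
    \<comment> \<open>The gap \<open>d i\<close> depends only on the smaller index, so the earlier
      sets keep a common positive distance from the new one.\<close>
    define \<delta> where "\<delta> = Min (d ` {..<N})"
    have "\<delta> > 0" unfolding \<delta>_def using False assms(2) by (subst Min_gr_iff) auto
    moreover have "\<delta> \<le> dist x y" if xy: "x \<in> (\<Union>i<N. A i)" "y \<in> A N" for x y
    proof -
      obtain i where "i < N" "x \<in> A i" using xy by blast
      moreover have "\<delta> \<le> d i" unfolding \<delta>_def using \<open>i < N\<close> by (intro Min_le) auto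
      ultimately show ?thesis using assms(1)[of i N x y] xy by linarith
    qed
    ultimately show ?thesis by (rule hausdorff_separated)
  qed simp
  also have "(\<Union>i<N. A i) \<union> A N = (\<Union>i<Suc N. A i)" by (auto simp: less_Suc_eq)
  finally show ?case .
qed simp

text \<open>Caratheodory's argument. The part of \<open>Z\<close> near but off \<open>F\<close> is
  cut into shells by distance from \<open>F\<close>. Shells whose indices differ by at least two are
  separated, so the measures of the shells form a convergent series, and the shells close to
  \<open>F\<close> contribute arbitrarily little.\<close>

lemma hausdorff_closed_split:
  fixes F Z :: "'a::euclidean_space set"
  assumes "closed F" "F \<noteq> {}"
  shows "hausdorff s (Z \<inter> F) + hausdorff s (Z - F) \<le> hausdorff s Z"
proof (cases "hausdorff s Z = \<infinity>")
  case False
  define Zk where "Zk k = {x \<in> Z. infdist x F \<ge> 1 / real (Suc k)}" for k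
  define R where "R j = {x \<in> Z. 1 / real (Suc (Suc j)) \<le> infdist x F \<and> infdist x F < 1 / real (Suc j)}" for j
  have 1: "hausdorff s (Z \<inter> F) + hausdorff s (Zk k) \<le> hausdorff s Z" for k
  proof -
    have "hausdorff s (Z \<inter> F) + hausdorff s (Zk k) \<le> hausdorff s (Z \<inter> F \<union> Zk k)"
    proof (rule hausdorff_separated)
      show "1 / real (Suc k) \<le> dist x y" if "x \<in> Z \<inter> F" "y \<in> Zk k" for x y
        using that infdist_le[of x F y] by (auto simp: Zk_def dist_commute)
    qed simp
    also have "\<dots> \<le> hausdorff s Z" by (intro hausdorff_mono) (auto simp: Zk_def)
    finally show ?thesis .
  qed
  have sep: "dist x y \<ge> 1 / real (i + 2) - 1 / real (i + 3)"
    if "i + 2 \<le> j" "x \<in> R i" "y \<in> R j" for i j x y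
  proof -
    have "infdist y F < 1 / real (Suc j)" "1 / real (i + 2) \<le> infdist x F" using that by (auto simp: R_def)
    moreover have "1 / real (Suc j) \<le> 1 / real (i + 3)" using that by (intro divide_left_mono) auto
    moreover have "infdist x F \<le> infdist y F + dist x y" by (rule infdist_triangle)
    ultimately show ?thesis by linarith
  qed
  have pos: "0 < 1 / real (n + 2) - 1 / real (n + 3)" for n
    by (simp add: divide_strict_left_mono)
  have even: "(\<Sum>i<N. hausdorff s (R (2 * i + b))) \<le> hausdorff s Z" for b N
  proof -
    have "(\<Sum>i<N. hausdorff s (R (2 * i + b))) \<le> hausdorff s (\<Union>i<N. R (2 * i + b))"
    proof (rule hausdorff_separated_family)
      show "dist x y \<ge> 1 / real (2 * i + b + 2) - 1 / real (2 * i + b + 3)"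
        if "i < j" "x \<in> R (2 * i + b)" "y \<in> R (2 * j + b)" for i j x y
        using that by (intro sep[of _ "2 * j + b"]) simp_all
      show "0 < 1 / real (2 * i + b + 2) - 1 / real (2 * i + b + 3)" for i
        by (rule pos)
    qed
    also have "\<dots> \<le> hausdorff s Z" by (intro hausdorff_mono) (auto simp: R_def)
    finally show ?thesis .
  qed
  \<comment> \<open>Even and odd shells are two separated families, each bounded by the measure of
    \<open>Z\<close>; together they bound the whole series by twice that measure.\<close>
  have "(\<Sum>j<2 * N. hausdorff s (R j)) = (\<Sum>i<N. hausdorff s (R (2 * i + 0))) + (\<Sum>i<N. hausdorff s (R (2 * i + 1)))" for N
    by (induction N) (simp_all add: algebra_simps)
  then have "(\<Sum>j<2 * N. hausdorff s (R j)) \<le> hausdorff s Z + hausdorff s Z" for N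
    using even[of 0 N] even[of 1 N] by (simp only: add_mono)
  moreover have "(\<Sum>j<N. hausdorff s (R j)) \<le> (\<Sum>j<2 * N. hausdorff s (R j))" for N
    by (intro sum_mono2) auto
  ultimately have "(\<Sum>j<N. hausdorff s (R j)) \<le> hausdorff s Z + hausdorff s Z" for N
    using order_trans by blast
  then have "(\<Sum>j. hausdorff s (R j)) \<le> hausdorff s Z + hausdorff s Z"
    by (intro suminf_le_const summableI)
  then have fin: "(\<Sum>j. hausdorff s (R j)) \<noteq> \<infinity>"
    using False by (auto simp: top_unique)
  define r where "r j = enn2real (hausdorff s (R j))" for j
  have r: "hausdorff s (R j) = ennreal (r j)" for j
    unfolding r_def using ennreal_suminf_lessD[of "\<lambda>j. hausdorff s (R j)" top j] fin
    by (simp add: less_top[symmetric])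
  have r0: "r j \<ge> 0" for j by (simp add: r_def)
  have sr: "summable r"
    using fin r0 by (intro summable_suminf_not_top) (auto simp: r)
  show ?thesis
  proof (rule ennreal_le_epsilon)
    fix e :: real assume "e > 0"
    obtain k where k: "norm (\<Sum>i. r (i + k)) < e"
      using suminf_exist_split[OF \<open>e > 0\<close> sr] by blast
    have sub: "Z - F \<subseteq> Zk k \<union> (\<Union>i. R (i + k))"
    proof
      fix x assume x: "x \<in> Z - F"
      then have pos: "infdist x F > 0"
        using assms in_closed_iff_infdist_zero[of F x] infdist_nonneg[of x F] by auto
      obtain m where m: "1 / real (Suc m) < infdist x F" using nat_approx_posE[OF pos] by auto
      \<comment> \<open>The first threshold reached by the distance of \<open>x\<close>; unless it
        is at most \<open>k\<close>, its predecessor names the shell containing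
        \<open>x\<close>.\<close>
      define m' where "m' = (LEAST m. 1 / real (Suc m) \<le> infdist x F)"
      have m': "1 / real (Suc m') \<le> infdist x F" unfolding m'_def by (rule LeastI[of _ m]) (use m in simp)
      show "x \<in> Zk k \<union> (\<Union>i. R (i + k))"
      proof (cases "m' \<le> k")
        case True
        then have "1 / real (Suc k) \<le> 1 / real (Suc m')" by (intro divide_left_mono) auto
        then have "x \<in> Zk k" using x m' by (auto simp: Zk_def)
        then show ?thesis by blast
      next
        case False
        then obtain j where j: "m' = Suc j" "k \<le> j" by (cases m') auto
        then have "\<not> 1 / real (Suc j) \<le> infdist x F" using not_less_Least[of j "\<lambda>m. 1 / real (Suc m) \<le> infdist x F"] m'_def by auto
        then have "x \<in> R (j - k + k)" using x m' j by (auto simp: R_def)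
        then show ?thesis by blast
      qed
    qed
    have "hausdorff s (Z - F) \<le> hausdorff s (Zk k) + hausdorff s (\<Union>i. R (i + k))"
      using hausdorff_mono[OF sub] hausdorff_Un_le order_trans by blast
    also have "hausdorff s (\<Union>i. R (i + k)) \<le> (\<Sum>i. hausdorff s (R (i + k)))"
      by (rule hausdorff_countably_subadditive)
    also have "\<dots> = ennreal (\<Sum>i. r (i + k))" unfolding r
      using sr r0 by (intro suminf_ennreal2) (auto simp: summable_iff_shift)
    also have "\<dots> \<le> ennreal e" using k by (intro ennreal_leI) auto
    finally have "hausdorff s (Z - F) \<le> hausdorff s (Zk k) + ennreal e" by (simp add: add_left_mono)
    then have "hausdorff s (Z \<inter> F) + hausdorff s (Z - F) \<le> hausdorff s (Z \<inter> F) + hausdorff s (Zk k) + ennreal e"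
      by (simp add: add.assoc add_left_mono)
    also have "\<dots> \<le> hausdorff s Z + ennreal e" by (intro add_right_mono 1)
    finally show "hausdorff s (Z \<inter> F) + hausdorff s (Z - F) \<le> hausdorff s Z + ennreal e" .
  qed
qed simp

text \<open>The Caratheodory sets form a sigma-algebra that contains the closed sets by the
  splitting lemma. This is what gives \<open>hmeasure\<close> its values: \<open>measure_of\<close>
  yields the zero measure unless its set function is a measure on the generated
  sigma-algebra.\<close>

lemma measure_space_hausdorff: "measure_space UNIV (sets borel) (hausdorff s :: 'a::euclidean_space set \<Rightarrow> ennreal)"
proof -
  let ?L = "lambda_system UNIV (Pow UNIV) (hausdorff s :: 'a set \<Rightarrow> ennreal)"
  have "outer_measure_space (Pow UNIV) (hausdorff s :: 'a set \<Rightarrow> ennreal)"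
    unfolding outer_measure_space_def positive_def increasing_def countably_subadditive_def
    by (auto intro: hausdorff_mono hausdorff_countably_subadditive)
  then have ms: "measure_space UNIV ?L (hausdorff s)"
    by (rule sigma_algebra.caratheodory_lemma[OF sigma_algebra_Pow])
  then interpret L: sigma_algebra UNIV ?L by (simp add: measure_space_def)
  have "F \<in> ?L" if "closed F" for F
  proof (cases "F = {}")
    case False
    have "hausdorff s (F \<inter> Z) + hausdorff s ((UNIV - F) \<inter> Z) = hausdorff s Z" for Z
    proof (rule antisym)
      show "hausdorff s (F \<inter> Z) + hausdorff s ((UNIV - F) \<inter> Z) \<le> hausdorff s Z"
        using hausdorff_closed_split[OF that False, of s Z] by (simp add: Int_commute Diff_eq)
      have "Z = F \<inter> Z \<union> (UNIV - F) \<inter> Z" by blast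
      then show "hausdorff s Z \<le> hausdorff s (F \<inter> Z) + hausdorff s ((UNIV - F) \<inter> Z)"
        using hausdorff_Un_le by metis
    qed
    then show ?thesis by (simp add: lambda_system_def)
  next
    case True
    then show ?thesis by (auto simp: lambda_system_def)
  qed
  then have "sigma_sets UNIV (Collect closed) \<subseteq> ?L"
    by (intro L.sigma_sets_subset) auto
  then have "sets (borel :: 'a measure) \<subseteq> ?L" by (simp add: borel_eq_closed)
  from measure_down[OF ms _ this] show ?thesis
    using sets.sigma_algebra_axioms[of "borel :: 'a measure"] by simp
qed

lemma sets_hmeasure [simp, measurable_cong]: "sets (hmeasure s) = sets borel"
  unfolding hmeasure_def using sets.sigma_sets_eq[of borel] by (simp add: sets_measure_of_conv)

lemma space_hmeasure [simp]: "space (hmeasure s) = UNIV"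
  unfolding hmeasure_def by (simp add: space_measure_of_conv)

lemma emeasure_hmeasure: "A \<in> sets borel \<Longrightarrow> emeasure (hmeasure s) A = hausdorff s A"
  using measure_space_hausdorff[of s, where 'a = 'a] unfolding hmeasure_def measure_space_def
  by (intro emeasure_measure_of_sigma) auto

section \<open>Lipschitz images and a criterion for finite Hausdorff measure\<close>

lemma hausdorff_lipschitz_image:
  fixes f :: "'a::euclidean_space \<Rightarrow> 'b::euclidean_space"
  assumes L: "L-lipschitz_on A f" "L > 0" and s: "s \<ge> 0"
  shows "hausdorff s (f ` A) \<le> ennreal (L powr s) * hausdorff s A"
proof (rule hausdorff_leI)
  fix \<delta> :: real assume "\<delta> > 0"
  define u where "u = unit_ball_vol s"
  have u: "u > 0" unfolding u_def using s by (rule unit_ball_vol_pos)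
  \<comment> \<open>The factor stands on the left as an inverse, so that the infimum over covers at
    scale \<open>\<delta> / L\<close> is reached by a bound for each single cover.\<close>
  have "ennreal (1 / L powr s) * hausdorff_pre s \<delta> (f ` A) \<le> hausdorff_pre s (\<delta> / L) A"
    unfolding hausdorff_pre_def[of s "\<delta> / L"]
  proof (rule INF_greatest)
    fix C :: "nat \<Rightarrow> 'a set"
    assume "C \<in> {C. A \<subseteq> (\<Union>i. C i) \<and> (\<forall>i. bounded (C i) \<and> diameter (C i) \<le> \<delta> / L)}"
    then have C: "A \<subseteq> (\<Union>i. C i)" "\<And>i. bounded (C i)" "\<And>i. diameter (C i) \<le> \<delta> / L" by auto
    \<comment> \<open>The members are cut down to \<open>A\<close> before being mapped, since
      \<open>f\<close> is Lipschitz only there.\<close>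
    define C' where "C' i = f ` (C i \<inter> A)" for i
    have diam: "diameter (C' i) \<le> L * diameter (C i)" for i
    proof (rule diameter_le)
      show "C' i \<noteq> {} \<or> 0 \<le> L * diameter (C i)"
        using L diameter_ge_0[OF C(2)] by simp
      fix x y assume "x \<in> C' i" "y \<in> C' i"
      then obtain a b where ab: "x = f a" "y = f b" "a \<in> C i" "b \<in> C i" "a \<in> A" "b \<in> A"
        by (auto simp: C'_def)
      have "dist (f a) (f b) \<le> L * dist a b" using L(1) ab by (auto simp: lipschitz_on_def)
      also have "\<dots> \<le> L * diameter (C i)"
        using L(2) ab diameter_bounded_bound[OF C(2)] by (intro mult_left_mono) auto
      finally show "norm (x - y) \<le> L * diameter (C i)" by (simp add: ab dist_norm)
    qed
    have bd: "bounded (C' i)" for i unfolding C'_def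
      using lipschitz_on_subset[OF L(1)] C(2)[of i]
      by (intro bounded_uniformly_continuous_image lipschitz_on_uniformly_continuous[of L])
         (auto intro: bounded_subset)
    have "hausdorff_pre s \<delta> (f ` A) \<le> (\<Sum>i. ennreal (u * (diameter (C' i) / 2) powr s))"
      unfolding u_def
    proof (rule hausdorff_pre_le[OF _ bd])
      show "f ` A \<subseteq> (\<Union>i. C' i)" using C(1) unfolding C'_def by blast
      show "diameter (C' i) \<le> \<delta>" for i
        using diam[of i] C(3)[of i] L(2) by (simp add: field_simps)
    qed
    also have "\<dots> \<le> (\<Sum>i. ennreal (L powr s) * ennreal (u * (diameter (C i) / 2) powr s))"
    proof (intro suminf_le summableI)
      fix i
      have "(diameter (C' i) / 2) powr s \<le> (L * (diameter (C i) / 2)) powr s"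
        using diam[of i] s diameter_ge_0[OF bd[of i]] by (intro powr_mono2) auto
      also have "\<dots> = L powr s * (diameter (C i) / 2) powr s"
        by (rule powr_mult)
      finally have "u * (diameter (C' i) / 2) powr s \<le> L powr s * (u * (diameter (C i) / 2) powr s)"
        using u by (simp add: mult.left_commute)
      then show "ennreal (u * (diameter (C' i) / 2) powr s) \<le> ennreal (L powr s) * ennreal (u * (diameter (C i) / 2) powr s)"
        using u by (subst ennreal_mult[symmetric]) (auto intro: ennreal_leI)
    qed
    also have "\<dots> = ennreal (L powr s) * (\<Sum>i. ennreal (u * (diameter (C i) / 2) powr s))"
      by (rule ennreal_suminf_cmult)
    finally have "ennreal (1 / L powr s) * hausdorff_pre s \<delta> (f ` A)
       \<le> ennreal (1 / L powr s) * (ennreal (L powr s) * (\<Sum>i. ennreal (u * (diameter (C i) / 2) powr s)))"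
      by (intro mult_left_mono) auto
    also have "\<dots> = (\<Sum>i. ennreal (u * (diameter (C i) / 2) powr s))"
      using L(2) by (simp add: mult.assoc[symmetric] ennreal_mult[symmetric])
    finally show "ennreal (1 / L powr s) * hausdorff_pre s \<delta> (f ` A)
       \<le> (\<Sum>i. ennreal (unit_ball_vol s * (diameter (C i) / 2) powr s))" by (simp add: u_def)
  qed
  also have "\<dots> \<le> hausdorff s A"
    using L(2) \<open>\<delta> > 0\<close> by (intro hausdorff_pre_le_hausdorff) simp
  finally have "ennreal (L powr s) * (ennreal (1 / L powr s) * hausdorff_pre s \<delta> (f ` A)) \<le> ennreal (L powr s) * hausdorff s A"
    by (intro mult_left_mono) auto
  moreover have "ennreal (L powr s) * (ennreal (1 / L powr s) * hausdorff_pre s \<delta> (f ` A)) = hausdorff_pre s \<delta> (f ` A)"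
    using L(2) by (simp add: mult.assoc[symmetric] ennreal_mult[symmetric])
  ultimately show "hausdorff_pre s \<delta> (f ` A) \<le> ennreal (L powr s) * hausdorff s A" by simp
qed

lemma hausdorff_isometry_image:
  fixes f :: "'a::euclidean_space \<Rightarrow> 'b::euclidean_space"
  assumes f: "\<And>x y. dist (f x) (f y) = dist x y" and s: "s \<ge> 0"
  shows "hausdorff s (f ` A) = hausdorff s A"
proof (rule antisym)
  have "1-lipschitz_on A f" by (simp add: lipschitz_on_def f)
  from hausdorff_lipschitz_image[OF this _ s] show "hausdorff s (f ` A) \<le> hausdorff s A" by simp
  have inj: "inj f" by (metis f dist_eq_0_iff injI)
  have "1-lipschitz_on (f ` A) (inv f)" by (auto simp: lipschitz_on_def f inv_f_f[OF inj])
  from hausdorff_lipschitz_image[OF this _ s] show "hausdorff s A \<le> hausdorff s (f ` A)"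
    by (simp add: image_image inv_f_f[OF inj])
qed

text \<open>A bound on the cardinalities makes the greatest one attained. It is used to choose a
  maximal separated set without Zorn's lemma.\<close>

lemma finite_le_imp_all_le:
  fixes b :: real
  assumes "\<And>T. finite T \<Longrightarrow> P T \<Longrightarrow> real (card T) \<le> b" "P {}"
  obtains T where "finite T" "P T" "\<And>T'. finite T' \<Longrightarrow> P T' \<Longrightarrow> card T' \<le> card T"
proof -
  have "\<exists>T. (finite T \<and> P T) \<and> (\<forall>T'. finite T' \<and> P T' \<longrightarrow> card T' \<le> card T)"
  proof (rule ex_has_greatest_nat)
    show "finite {} \<and> P {}" using assms(2) by simp
    show "\<forall>T. finite T \<and> P T \<longrightarrow> card T < nat \<lceil>b\<rceil> + 1"
    proof (intro allI impI)
      fix T assume "finite T \<and> P T"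
      then have "real (card T) \<le> b" using assms(1) by blast
      then show "card T < nat \<lceil>b\<rceil> + 1" by linarith
    qed
  qed
  then show ?thesis using that by blast
qed

text \<open>A maximal \<open>\<epsilon>\<close>-separated subset of \<open>S\<close> has at most \<open>O(\<epsilon>\<^sup>1\<^sup>-\<^sup>n)\<close> points because the
  balls of radius \<open>\<epsilon>/2\<close> around them are disjoint.\<close>
lemma hausdorff_finite_of_minkowski:
  fixes S :: "'a::euclidean_space set"
  assumes K: "K \<ge> 0" and mink: "\<And>\<epsilon>. 0 < \<epsilon> \<Longrightarrow> \<epsilon> \<le> 1 \<Longrightarrow> emeasure lborel (\<Union>x\<in>S. ball x \<epsilon>) \<le> ennreal (K * \<epsilon>)"
  shows "hausdorff (real DIM('a) - 1) S < \<infinity>"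
proof -
  define n where "n = DIM('a)"
  have n1: "n \<ge> 1" by (simp add: n_def Suc_leI)
  define V where "V = Ball_Volume.unit_ball_vol (real n)"
  have V: "V > 0" by (simp add: V_def)
  define u where "u = Defs.unit_ball_vol (real n - 1)"
  have u: "u > 0" unfolding u_def using n1 by (intro unit_ball_vol_pos) simp
  \<comment> \<open>The number of balls, at most
    \<open>K * \<epsilon> / (V * (\<epsilon> / 2) ^ n)\<close>, times the weight
    \<open>u * \<epsilon> powr (n - 1)\<close> of one ball; the powers of \<open>\<epsilon>\<close>
    cancel.\<close>
  define B where "B = K * 2 ^ n / V * u"
  have "hausdorff (real n - 1) S \<le> ennreal B"
  proof (rule hausdorff_leI)
    fix \<delta> :: real assume "\<delta> > 0"
    \<comment> \<open>Balls of radius \<open>\<epsilon>\<close> have diameter at most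
      \<open>\<delta>\<close>, and the volume bound is available only up to radius 1.\<close>
    define \<epsilon> where "\<epsilon> = min (\<delta> / 2) 1"
    have \<epsilon>: "\<epsilon> > 0" "\<epsilon> \<le> 1" "2 * \<epsilon> \<le> \<delta>" using \<open>\<delta> > 0\<close> by (auto simp: \<epsilon>_def)
    define P where "P T \<longleftrightarrow> T \<subseteq> S \<and> (\<forall>x\<in>T. \<forall>y\<in>T. x \<noteq> y \<longrightarrow> dist x y \<ge> \<epsilon>)" for T
    have cardle: "real (card T) \<le> K * \<epsilon> / (V * (\<epsilon> / 2) ^ n)" if T: "finite T" "P T" for T
    proof -
      have dj: "disjoint_family_on (\<lambda>x. ball x (\<epsilon> / 2)) T"
        unfolding disjoint_family_on_def
      proof (intro ballI impI)
        fix x y assume xy: "x \<in> T" "y \<in> T" "x \<noteq> y"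
        have "False" if "z \<in> ball x (\<epsilon> / 2) \<inter> ball y (\<epsilon> / 2)" for z
        proof -
          have "dist x y \<le> dist x z + dist y z" by (rule dist_triangle2)
          moreover have "\<epsilon> \<le> dist x y" using T xy by (auto simp: P_def)
          ultimately show False using that by simp
        qed
        then show "ball x (\<epsilon> / 2) \<inter> ball y (\<epsilon> / 2) = {}" by blast
      qed
      have "ennreal (real (card T) * (V * (\<epsilon> / 2) ^ n)) = (\<Sum>x\<in>T. emeasure lborel (ball x (\<epsilon> / 2)))"
        using \<epsilon> V by (simp add: emeasure_ball V_def n_def ennreal_mult ennreal_of_nat_eq_real_of_nat)
      also have "\<dots> = emeasure lborel (\<Union>x\<in>T. ball x (\<epsilon> / 2))"
        by (rule sum_emeasure) (use T dj in auto)
      also have "\<dots> \<le> emeasure lborel (\<Union>x\<in>S. ball x \<epsilon>)"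
      proof (rule emeasure_mono)
        have "ball x (\<epsilon>/2) \<subseteq> ball x \<epsilon>" for x :: 'a using \<epsilon> by (intro subset_ball) simp
        then show "(\<Union>x\<in>T. ball x (\<epsilon> / 2)) \<subseteq> (\<Union>x\<in>S. ball x \<epsilon>)"
          using T(2) unfolding P_def by blast
        show "(\<Union>x\<in>S. ball x \<epsilon>) \<in> sets lborel" by (auto intro: borel_open)
      qed
      also have "\<dots> \<le> ennreal (K * \<epsilon>)" using \<epsilon> by (intro mink) auto
      finally have "real (card T) * (V * (\<epsilon> / 2) ^ n) \<le> K * \<epsilon>"
        using \<epsilon> K by (subst (asm) ennreal_le_iff) auto
      then show ?thesis using V \<epsilon> by (simp add: pos_le_divide_eq)
    qed
    obtain T where T: "finite T" "P T" and Tmax: "\<And>T'. finite T' \<Longrightarrow> P T' \<Longrightarrow> card T' \<le> card T"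
      by (rule finite_le_imp_all_le[of P, OF cardle]) (auto simp: P_def)
    obtain xs where xs: "set xs = T" "distinct xs" using finite_distinct_list[OF T(1)] by blast
    have len: "length xs = card T" using xs distinct_card by fastforce
    define C where "C i = (if i < length xs then cball (xs ! i) \<epsilon> else {})" for i
    have "hausdorff_pre (real n - 1) \<delta> S \<le> (\<Sum>i. ennreal (u * (diameter (C i) / 2) powr (real n - 1)))"
      unfolding u_def
    proof (rule hausdorff_pre_le)
      show "S \<subseteq> (\<Union>i. C i)"
      proof
        fix x assume x: "x \<in> S"
        have "\<exists>y\<in>T. dist x y < \<epsilon> \<or> x = y"
        proof (rule ccontr)
          assume "\<not> ?thesis"
          then have *: "\<forall>y\<in>T. dist x y \<ge> \<epsilon> \<and> x \<noteq> y" by force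
          then have "P (insert x T)" using T(2) x by (auto simp: P_def dist_commute)
          then have "card (insert x T) \<le> card T" using T(1) by (intro Tmax) auto
          then show False using * T(1) by auto
        qed
        then obtain i where "i < length xs" "dist x (xs ! i) \<le> \<epsilon>"
          using xs \<epsilon>(1) by (metis dist_self in_set_conv_nth less_imp_le)
        then have "x \<in> C i" by (auto simp: C_def dist_commute)
        then show "x \<in> (\<Union>i. C i)" by blast
      qed
      show "bounded (C i)" "diameter (C i) \<le> \<delta>" for i
        using \<epsilon> \<open>\<delta> > 0\<close> by (auto simp: C_def diameter_cball)
    qed
    also have "\<dots> = (\<Sum>i<length xs. ennreal (u * (diameter (C i) / 2) powr (real n - 1)))"
      by (intro suminf_finite) (auto simp: C_def)
    also have "\<dots> = (\<Sum>i<length xs. ennreal (u * \<epsilon> powr (real n - 1)))"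
      using \<epsilon> by (intro sum.cong) (auto simp: C_def diameter_cball)
    also have "\<dots> = ennreal (real (card T) * (u * \<epsilon> powr (real n - 1)))"
      using u by (simp add: len ennreal_mult ennreal_of_nat_eq_real_of_nat)
    also have "\<dots> \<le> ennreal (K * \<epsilon> / (V * (\<epsilon> / 2) ^ n) * (u * \<epsilon> powr (real n - 1)))"
      using u by (intro ennreal_leI mult_right_mono cardle T) auto
    also have "K * \<epsilon> / (V * (\<epsilon> / 2) ^ n) * (u * \<epsilon> powr (real n - 1)) = B"
    proof -
      have "\<epsilon> powr (real n - 1) = \<epsilon> ^ n / \<epsilon>"
        using \<epsilon> by (simp add: powr_diff powr_realpow)
      then show ?thesis using \<epsilon> V by (simp add: B_def field_simps power_divide)
    qed
    finally show "hausdorff_pre (real n - 1) \<delta> S \<le> ennreal B" .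
  qed
  then show ?thesis by (simp add: n_def le_less_trans[OF _ ennreal_less_top])
qed

section \<open>Hausdorff measure on hyperplanes compared with Lebesgue measure\<close>

text \<open>Uniqueness of translation-invariant measures by Fubini: the pairs \<open>(x, y)\<close>
  with \<open>x + y\<close> in \<open>A\<close> and \<open>y\<close> in the unit ball are measured
  in both orders, once using invariance of \<open>M\<close> and once invariance of Lebesgue
  measure.\<close>

lemma translation_invariant_eq_lborel:
  fixes M :: "'a::euclidean_space measure"
  assumes sf: "sigma_finite_measure M" and sets [measurable_cong]: "sets M = sets borel"
    and inv: "\<And>v A. A \<in> sets borel \<Longrightarrow> emeasure M ((\<lambda>x. x + v) -` A) = emeasure M A"
    and A [measurable]: "A \<in> sets borel"
  shows "emeasure M A * emeasure lborel (ball 0 1 :: 'a set) = emeasure M (ball 0 1) * emeasure lborel A"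
proof -
  interpret M: sigma_finite_measure M by fact
  interpret MP: pair_sigma_finite M "lborel :: 'a measure" ..
  let ?B = "ball 0 1 :: 'a set"
  have [measurable]: "?B \<in> sets borel" by simp
  have "emeasure M A * emeasure lborel ?B = (\<integral>\<^sup>+y. emeasure M A * indicator ?B y \<partial>lborel)"
    by (simp add: nn_integral_cmult_indicator)
  also have "\<dots> = (\<integral>\<^sup>+y. (\<integral>\<^sup>+x. indicator A (x + y) * indicator ?B y \<partial>M) \<partial>lborel)"
  proof (rule nn_integral_cong)
    fix y :: 'a
    have m: "(\<lambda>x. x + y) -` A \<in> sets M"
      using measurable_sets[of "\<lambda>x. x + y" borel borel A] by (simp add: sets)
    have "(\<integral>\<^sup>+x. indicator A (x + y) \<partial>M) = (\<integral>\<^sup>+x. indicator ((\<lambda>x. x + y) -` A) x \<partial>M)"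
      by (intro nn_integral_cong) (auto simp: indicator_def)
    also have "\<dots> = emeasure M A" using m by (simp add: inv[OF A])
    finally show "emeasure M A * indicator ?B y = (\<integral>\<^sup>+x. indicator A (x + y) * indicator ?B y \<partial>M)"
      by (subst nn_integral_multc) auto
  qed
  also have "\<dots> = (\<integral>\<^sup>+x. (\<integral>\<^sup>+y. indicator A (x + y) * indicator ?B y \<partial>lborel) \<partial>M)"
    by (rule MP.Fubini') measurable
  also have "\<dots> = (\<integral>\<^sup>+x. (\<integral>\<^sup>+y. indicator A y * indicator ?B (y - x) \<partial>lborel) \<partial>M)"
  proof (rule nn_integral_cong)
    fix x :: 'a
    have "(\<integral>\<^sup>+y. indicator A y * indicator ?B (y - x) \<partial>lborel) = (\<integral>\<^sup>+y. indicator A y * indicator ?B (y - x) \<partial>distr lborel borel ((+) x))"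
      by (simp add: lborel_distr_plus)
    also have "\<dots> = (\<integral>\<^sup>+y. indicator A (x + y) * indicator ?B y \<partial>lborel)"
      by (subst nn_integral_distr) auto
    finally show "(\<integral>\<^sup>+y. indicator A (x + y) * indicator ?B y \<partial>lborel) = (\<integral>\<^sup>+y. indicator A y * indicator ?B (y - x) \<partial>lborel)" by simp
  qed
  also have "\<dots> = (\<integral>\<^sup>+y. (\<integral>\<^sup>+x. indicator A y * indicator ?B (y - x) \<partial>M) \<partial>lborel)"
    by (rule MP.Fubini'[symmetric]) measurable
  also have "\<dots> = (\<integral>\<^sup>+y. emeasure M ?B * indicator A y \<partial>lborel)"
  proof (rule nn_integral_cong)
    fix y :: 'a
    \<comment> \<open>The unit ball is symmetric, so the points \<open>x\<close> with
      \<open>y - x\<close> in it form a translate of the ball.\<close>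
    have "(\<integral>\<^sup>+x. indicator ?B (y - x) \<partial>M) = (\<integral>\<^sup>+x. indicator ((\<lambda>x. x + - y) -` ?B) x \<partial>M)"
      by (intro nn_integral_cong) (auto simp: indicator_def norm_minus_commute)
    also have "\<dots> = emeasure M ((\<lambda>x. x + - y) -` ?B)"
      using measurable_sets[of "\<lambda>x. x + - y" borel borel ?B] by (intro nn_integral_indicator) (simp add: sets)
    also have "\<dots> = emeasure M ?B" by (rule inv) simp
    finally show "(\<integral>\<^sup>+x. indicator A y * indicator ?B (y - x) \<partial>M) = emeasure M ?B * indicator A y"
      by (subst nn_integral_cmult) (auto simp: mult.commute)
  qed
  also have "\<dots> = emeasure M ?B * emeasure lborel A"
    by (simp add: nn_integral_cmult_indicator)
  finally show ?thesis .
qed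

text \<open>The \<open>\<epsilon>\<close>-neighbourhood of a flat disc lies in a box of half-width
  \<open>\<epsilon>\<close> across the hyperplane and \<open>R + 1\<close> along it, so its volume
  is linear in \<open>\<epsilon>\<close> and the covering criterion applies.\<close>

lemma hausdorff_hyperplane_axis_finite:
  fixes k :: "'n::finite"
  shows "hausdorff (real CARD('n) - 1) ({z::real^'n. z \<bullet> axis k 1 = 0} \<inter> ball 0 R) < \<infinity>"
proof (cases "R > 0")
  case True
  let ?b = "axis k 1 :: real^'n"
  have bB: "?b \<in> Basis" by (simp add: axis_in_Basis_iff)
  have "hausdorff (real DIM(real^'n) - 1) ({z. z \<bullet> ?b = 0} \<inter> ball 0 R) < \<infinity>"
  proof (rule hausdorff_finite_of_minkowski[where K = "2 * (2 * (R + 1)) ^ (CARD('n) - 1)"])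
    fix \<epsilon> :: real assume \<epsilon>: "0 < \<epsilon>" "\<epsilon> \<le> 1"
    define v where "v = (\<Sum>i\<in>Basis. (if i = ?b then \<epsilon> else R + 1) *\<^sub>R i)"
    have vi: "v \<bullet> i = (if i = ?b then \<epsilon> else R + 1)" if "i \<in> Basis" for i
      using that by (simp add: v_def)
    have sub: "(\<Union>x\<in>{z. z \<bullet> ?b = 0} \<inter> ball 0 R. ball x \<epsilon>) \<subseteq> cbox (- v) v"
    proof
      fix y assume "y \<in> (\<Union>x\<in>{z. z \<bullet> ?b = 0} \<inter> ball 0 R. ball x \<epsilon>)"
      then obtain x where x: "x \<bullet> ?b = 0" "norm x < R" "dist x y < \<epsilon>" by auto
      show "y \<in> cbox (- v) v"
      proof (subst mem_box(2), intro ballI)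
        fix i :: "real^'n" assume i: "i \<in> Basis"
        have 1: "\<bar>(y - x) \<bullet> i\<bar> \<le> norm (y - x)" by (rule Basis_le_norm[OF i])
        have 2: "\<bar>x \<bullet> i\<bar> \<le> norm x" by (rule Basis_le_norm[OF i])
        have 3: "norm (y - x) < \<epsilon>" using x(3) by (simp add: dist_norm norm_minus_commute)
        show "- v \<bullet> i \<le> y \<bullet> i \<and> y \<bullet> i \<le> v \<bullet> i"
        proof (cases "i = ?b")
          case True
          then show ?thesis using 1 3 x(1) vi[OF i] by (auto simp: inner_diff_left)
        next
          case False
          then show ?thesis using 1 2 3 x(2) \<epsilon> vi[OF i] by (auto simp: inner_diff_left)
        qed
      qed
    qed
    have "emeasure lborel (\<Union>x\<in>{z. z \<bullet> ?b = 0} \<inter> ball 0 R. ball x \<epsilon>) \<le> emeasure lborel (cbox (- v) v)"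
      by (rule emeasure_mono[OF sub]) simp
    also have "\<dots> = ennreal (\<Prod>i\<in>Basis. (v - - v) \<bullet> i)"
      by (rule emeasure_lborel_cbox) (use vi \<epsilon> True in auto)
    also have "(\<Prod>i\<in>Basis. (v - - v) \<bullet> i) = (\<Prod>i\<in>Basis. if i = ?b then 2 * \<epsilon> else 2 * (R + 1))"
      by (intro prod.cong refl) (simp only: inner_diff_left inner_minus_left vi, simp)
    also have "\<dots> = 2 * \<epsilon> * (\<Prod>i\<in>Basis - {?b}. if i = ?b then 2 * \<epsilon> else 2 * (R + 1))"
      using bB by (subst prod.remove[of _ ?b]) auto
    also have "(\<Prod>i\<in>Basis - {?b}. if i = ?b then 2 * \<epsilon> else 2 * (R + 1)) = (\<Prod>i\<in>Basis - {?b}. 2 * (R + 1))"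
      by (intro prod.cong) auto
    also have "\<dots> = (2 * (R + 1)) ^ (CARD('n) - 1)"
      using bB by (simp add: card_Diff_singleton)
    finally show "emeasure lborel (\<Union>x\<in>{z. z \<bullet> ?b = 0} \<inter> ball 0 R. ball x \<epsilon>) \<le> ennreal (2 * (2 * (R + 1)) ^ (CARD('n) - 1) * \<epsilon>)"
      by (simp add: mult_ac)
  qed (use True in auto)
  then show ?thesis by simp
next
  case False
  then have eq: "ball (0::real^'n) R = {}" by simp
  show ?thesis unfolding eq by simp
qed

lemma hausdorff_hyperplane_finite:
  fixes u :: "real^'n::finite"
  assumes "norm u = 1"
  shows "hausdorff (real CARD('n) - 1) ({z. z \<bullet> u = 0} \<inter> ball 0 R) < \<infinity>"
proof -
  fix k :: 'n
  obtain f where f: "orthogonal_transformation f" "f u = axis k (1::real)"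
    using orthogonal_transformation_exists[of u "axis k 1"] assms by (auto simp: norm_axis_1)
  have "f ` ({z. z \<bullet> u = 0} \<inter> ball 0 R) \<subseteq> {z. z \<bullet> axis k 1 = 0} \<inter> ball 0 R"
  proof safe
    fix z :: "real^'n" assume "z \<bullet> u = 0" "z \<in> ball 0 R"
    moreover have "f z \<bullet> f u = z \<bullet> u" using f(1) by (simp add: orthogonal_transformation_def)
    moreover have "norm (f z) = norm z" using f(1) by (rule orthogonal_transformation_norm)
    ultimately show "f z \<bullet> axis k 1 = 0" "f z \<in> ball 0 R" by (simp_all add: f(2))
  qed
  then have "hausdorff (real CARD('n) - 1) (f ` ({z. z \<bullet> u = 0} \<inter> ball 0 R)) < \<infinity>"
    by (rule le_less_trans[OF hausdorff_mono hausdorff_hyperplane_axis_finite])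
  moreover have "dist (f x) (f y) = dist x y" for x y
    using f(1) by (simp add: orthogonal_transformation_isometry)
  ultimately show ?thesis by (subst (asm) hausdorff_isometry_image) (auto simp: Suc_leI)
qed

text \<open>The restriction is a density rather than a subspace, so that it remains a Borel measure
  on the whole space and combines with products and pushforwards.\<close>

definition hplane :: "real^'n::finite \<Rightarrow> (real^'n) measure" where
  "hplane u = density (hmeasure (real CARD('n) - 1)) (indicator {z. z \<bullet> u = 0})"

lemma sets_hplane [simp, measurable_cong]: "sets (hplane u) = sets borel"
  by (simp add: hplane_def)

lemma space_hplane [simp]: "space (hplane u) = UNIV"
  by (simp add: hplane_def)

lemma emeasure_hplane:
  fixes u :: "real^'n::finite"
  assumes "A \<in> sets borel"
  shows "emeasure (hplane u) A = hausdorff (real CARD('n) - 1) (A \<inter> {z. z \<bullet> u = 0})"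
proof -
  have [measurable]: "{z. z \<bullet> u = 0} \<in> sets borel" by simp
  have "emeasure (hplane u) A = (\<integral>\<^sup>+x. indicator ({z. z \<bullet> u = 0} \<inter> A) x \<partial>hmeasure (real CARD('n) - 1))"
    unfolding hplane_def using assms
    by (subst emeasure_density) (auto simp: indicator_inter_arith[symmetric])
  also have "\<dots> = hausdorff (real CARD('n) - 1) ({z. z \<bullet> u = 0} \<inter> A)"
    using assms by (simp add: emeasure_hmeasure)
  finally show ?thesis by (simp add: Int_commute)
qed

lemma sigma_finite_hplane:
  fixes u :: "real^'n::finite"
  assumes "norm u = 1"
  shows "sigma_finite_measure (hplane u)"
proof
  let ?A = "range (\<lambda>k::nat. ball (0::real^'n) (real k))"
  have "\<Union> ?A = UNIV" by (auto simp: reals_Archimedean2)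
  moreover have "emeasure (hplane u) (ball 0 (real k)) \<noteq> \<infinity>" for k :: nat
    using hausdorff_hyperplane_finite[OF assms, of "real k"] by (simp add: emeasure_hplane Int_commute)
  ultimately show "\<exists>A. countable A \<and> A \<subseteq> sets (hplane u) \<and> \<Union> A = space (hplane u) \<and> (\<forall>a\<in>A. emeasure (hplane u) a \<noteq> \<infinity>)"
    by (intro exI[of _ ?A]) auto
qed

lemma hplane_isometry:
  fixes u v :: "real^'n::finite"
  assumes f: "\<And>x y. dist (f x) (f y) = dist x y" and b: "bij f" and pl: "\<And>z. f z \<bullet> v = 0 \<longleftrightarrow> z \<bullet> u = 0"
  shows "distr (hplane u) borel f = hplane v"
proof (rule measure_eqI)
  have "1-lipschitz_on UNIV f" by (simp add: lipschitz_on_def f)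
  then have [measurable]: "f \<in> borel_measurable borel"
    by (intro borel_measurable_continuous_onI lipschitz_on_continuous_on)
  fix A assume "A \<in> sets (distr (hplane u) borel f)"
  then have A [measurable]: "A \<in> sets borel" by simp
  have m: "f -` A \<in> sets borel" using measurable_sets[of f borel borel A] by simp
  have "f ` (f -` A \<inter> {z. z \<bullet> u = 0}) = A \<inter> {z. z \<bullet> v = 0}"
  proof (intro equalityI subsetI)
    fix y assume y: "y \<in> A \<inter> {z. z \<bullet> v = 0}"
    obtain x where "y = f x" using b by (metis bij_pointE)
    then show "y \<in> f ` (f -` A \<inter> {z. z \<bullet> u = 0})" using y pl by auto
  qed (use pl in auto)
  then show "emeasure (distr (hplane u) borel f) A = emeasure (hplane v) A"
    using hausdorff_isometry_image[OF f, of "real CARD('n) - 1" "f -` A \<inter> {z. z \<bullet> u = 0}"] m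
    by (simp add: emeasure_distr emeasure_hplane Suc_leI)
qed simp

lemma hplane_translation:
  fixes u :: "real^'n::finite"
  assumes "w \<bullet> u = 0" and [measurable]: "f \<in> borel_measurable borel"
  shows "(\<integral>\<^sup>+z. f (z + w) \<partial>hplane u) = (\<integral>\<^sup>+z. f z \<partial>hplane u)"
proof -
  have "bij (\<lambda>z::real^'n. z + w)" by (rule bij_plus_right)
  then have "hplane u = distr (hplane u) borel (\<lambda>z. z + w)"
    using assms(1) by (intro hplane_isometry[symmetric]) (auto simp: inner_add_left)
  then have "(\<integral>\<^sup>+z. f z \<partial>hplane u) = (\<integral>\<^sup>+z. f z \<partial>distr (hplane u) borel (\<lambda>z. z + w))" by simp
  also have "\<dots> = (\<integral>\<^sup>+z. f (z + w) \<partial>hplane u)" by (subst nn_integral_distr) auto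
  finally show ?thesis by simp
qed

text \<open>Hyperplane measure times length along a direction \<open>e\<close> that need not be
  orthogonal to the hyperplane. For transversal \<open>e\<close> it is invariant under all
  translations, hence a multiple of Lebesgue measure, and the multiple carries the area factor of a
  tilted hyperplane.\<close>

definition skew :: "real^'n::finite \<Rightarrow> real^'n \<Rightarrow> (real^'n) measure" where
  "skew u e = distr (hplane u \<Otimes>\<^sub>M lborel) borel (\<lambda>p. fst p + snd p *\<^sub>R e)"

lemma sets_skew [simp, measurable_cong]: "sets (skew u e) = sets borel"
  by (simp add: skew_def)

lemma emeasure_skew:
  fixes u :: "real^'n::finite"
  assumes "A \<in> sets borel"
  shows "emeasure (skew u e) A = (\<integral>\<^sup>+z. (\<integral>\<^sup>+t. indicator A (z + t *\<^sub>R e) \<partial>lborel) \<partial>hplane u)"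
proof -
  note [measurable] = assms
  have "emeasure (skew u e) A = (\<integral>\<^sup>+x. indicator A x \<partial>skew u e)" by simp
  also have "\<dots> = (\<integral>\<^sup>+p. indicator A (fst p + snd p *\<^sub>R e) \<partial>(hplane u \<Otimes>\<^sub>M lborel))"
    unfolding skew_def by (subst nn_integral_distr) auto
  also have "\<dots> = (\<integral>\<^sup>+z. (\<integral>\<^sup>+t. indicator A (z + t *\<^sub>R e) \<partial>lborel) \<partial>hplane u)"
    by (subst lborel.nn_integral_fst[symmetric]) auto
  finally show ?thesis .
qed

lemma emeasure_skew_swap:
  fixes u :: "real^'n::finite"
  assumes "A \<in> sets borel" "norm u = 1"
  shows "emeasure (skew u e) A = (\<integral>\<^sup>+t. (\<integral>\<^sup>+z. indicator A (z + t *\<^sub>R e) \<partial>hplane u) \<partial>lborel)"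
proof -
  note [measurable] = assms(1)
  interpret S: sigma_finite_measure "hplane u" by (rule sigma_finite_hplane) fact
  interpret SP: pair_sigma_finite "hplane u" "lborel :: real measure" ..
  show ?thesis unfolding emeasure_skew[OF assms(1)] by (rule SP.Fubini'[symmetric]) simp
qed

lemma lborel_translation:
  fixes f :: "'a::euclidean_space \<Rightarrow> ennreal"
  assumes [measurable]: "f \<in> borel_measurable borel"
  shows "(\<integral>\<^sup>+x. f (c + x) \<partial>lborel) = (\<integral>\<^sup>+x. f x \<partial>lborel)"
proof -
  have "(\<integral>\<^sup>+x. f x \<partial>lborel) = (\<integral>\<^sup>+x. f x \<partial>distr lborel borel ((+) c))"
    by (simp add: lborel_distr_plus)
  also have "\<dots> = (\<integral>\<^sup>+x. f (c + x) \<partial>lborel)" by (subst nn_integral_distr) auto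
  finally show ?thesis by simp
qed

text \<open>A translation splits into a multiple of \<open>e\<close>, absorbed by Lebesgue measure
  on the line, and a vector in the hyperplane, absorbed by \<open>hplane u\<close>.\<close>

lemma skew_translation:
  fixes u :: "real^'n::finite"
  assumes A [measurable]: "A \<in> sets borel" and u: "norm u = 1" and eu: "e \<bullet> u \<noteq> 0"
  shows "emeasure (skew u e) ((\<lambda>x. x + v) -` A) = emeasure (skew u e) A"
proof -
  define \<tau> where "\<tau> = (v \<bullet> u) / (e \<bullet> u)"
  define w where "w = v - \<tau> *\<^sub>R e"
  have w: "w \<bullet> u = 0" using eu by (simp add: w_def \<tau>_def inner_diff_left)
  have mA: "(\<lambda>x. x + v) -` A \<in> sets borel"
    using measurable_sets[of "\<lambda>x. x + v" borel borel A] by simp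
  have "emeasure (skew u e) ((\<lambda>x. x + v) -` A) = (\<integral>\<^sup>+t. (\<integral>\<^sup>+z. indicator A ((z + w) + (\<tau> + t) *\<^sub>R e) \<partial>hplane u) \<partial>lborel)"
    unfolding emeasure_skew_swap[OF mA u]
    by (intro nn_integral_cong) (auto simp: indicator_def w_def algebra_simps)
  also have "\<dots> = (\<integral>\<^sup>+t. (\<integral>\<^sup>+z. indicator A (z + (\<tau> + t) *\<^sub>R e) \<partial>hplane u) \<partial>lborel)"
    by (intro nn_integral_cong hplane_translation[OF w, of "\<lambda>z. indicator A (z + _ *\<^sub>R e)"]) simp
  also have "\<dots> = (\<integral>\<^sup>+t. (\<integral>\<^sup>+z. indicator A (z + t *\<^sub>R e) \<partial>hplane u) \<partial>lborel)"
  proof (rule lborel_translation)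
    interpret S: sigma_finite_measure "hplane u" by (rule sigma_finite_hplane) fact
    show "(\<lambda>t. \<integral>\<^sup>+z. indicator A (z + t *\<^sub>R e) \<partial>hplane u) \<in> borel_measurable borel"
      by measurable
  qed
  also have "\<dots> = emeasure (skew u e) A" by (rule emeasure_skew_swap[symmetric, OF A u])
  finally show ?thesis .
qed

text \<open>For a point \<open>z + t *\<^sub>R e\<close> of the ball, pairing with \<open>u\<close>
  bounds \<open>t\<close>, and the triangle inequality then bounds the foot
  \<open>z\<close>.\<close>

lemma skew_bounded_finite:
  fixes u :: "real^'n::finite"
  assumes u: "norm u = 1" and eu: "e \<bullet> u \<noteq> 0"
  shows "emeasure (skew u e) (ball 0 R) < \<infinity>"
proof -
  define T where "T = R / \<bar>e \<bullet> u\<bar>"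
  define Q where "Q = R + T * norm e"
  have "emeasure (skew u e) (ball 0 R) \<le> (\<integral>\<^sup>+z. (\<integral>\<^sup>+t. indicator (ball 0 Q) z * indicator {-T..T} t \<partial>lborel) \<partial>hplane u)"
    unfolding emeasure_skew[OF borel_open[OF open_ball]]
  proof (intro nn_integral_mono_AE)
    have "hplane u = density (hmeasure (real CARD('n) - 1)) (indicator {z. z \<bullet> u = 0})" by (rule hplane_def)
    have "AE z in hplane u. z \<bullet> u = 0"
      unfolding hplane_def by (subst AE_density) (auto simp: indicator_def)
    then show "AE z in hplane u. (\<integral>\<^sup>+t. indicator (ball 0 R) (z + t *\<^sub>R e) \<partial>lborel) \<le> (\<integral>\<^sup>+t. indicator (ball 0 Q) z * indicator {-T..T} t \<partial>lborel)"
    proof (eventually_elim, intro nn_integral_mono)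
      fix z :: "real^'n" and t :: real assume z: "z \<bullet> u = 0"
      have "z + t *\<^sub>R e \<in> ball 0 R \<Longrightarrow> z \<in> ball 0 Q \<and> t \<in> {-T..T}"
      proof -
        assume "z + t *\<^sub>R e \<in> ball 0 R"
        then have n: "norm (z + t *\<^sub>R e) < R" by simp
        have "\<bar>t * (e \<bullet> u)\<bar> = \<bar>(z + t *\<^sub>R e) \<bullet> u\<bar>" using z by (simp add: inner_add_left)
        also have "\<dots> \<le> norm (z + t *\<^sub>R e) * norm u" by (rule Cauchy_Schwarz_ineq2)
        finally have "\<bar>t\<bar> * \<bar>e \<bullet> u\<bar> \<le> R" using n u by (simp add: abs_mult)
        then have t: "\<bar>t\<bar> \<le> T" using eu by (simp add: T_def pos_le_divide_eq)
        have "norm z = norm ((z + t *\<^sub>R e) - t *\<^sub>R e)" by simp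
        also have "\<dots> \<le> norm (z + t *\<^sub>R e) + norm (t *\<^sub>R e)" by (rule norm_triangle_ineq4)
        also have "\<dots> < R + T * norm e" using n t by (simp add: add_less_le_mono mult_right_mono)
        finally show ?thesis using t by (auto simp: Q_def)
      qed
      then show "indicator (ball 0 R) (z + t *\<^sub>R e) \<le> (indicator (ball 0 Q) z * indicator {-T..T} t :: ennreal)"
        by (auto simp: indicator_def)
    qed
  qed
  also have "\<dots> = (\<integral>\<^sup>+z. emeasure lborel {-T..T} * indicator (ball 0 Q) z \<partial>hplane u)"
    by (simp add: nn_integral_cmult mult.commute)
  also have "\<dots> = emeasure lborel {-T..T} * emeasure (hplane u) (ball 0 Q)"
    by (intro nn_integral_cmult_indicator) simp
  also have "\<dots> < \<infinity>"
    using hausdorff_hyperplane_finite[OF u, of Q]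
    by (simp add: emeasure_hplane Int_commute ennreal_mult_less_top emeasure_lborel_Icc_eq)
  finally show ?thesis .
qed

lemma sigma_finite_skew:
  fixes u :: "real^'n::finite"
  assumes "norm u = 1" "e \<bullet> u \<noteq> 0"
  shows "sigma_finite_measure (skew u e)"
proof
  let ?A = "range (\<lambda>k::nat. ball (0::real^'n) (real k))"
  have "\<Union> ?A = UNIV" by (auto simp: reals_Archimedean2)
  moreover have "emeasure (skew u e) (ball 0 (real k)) \<noteq> \<infinity>" for k :: nat
    using skew_bounded_finite[OF assms, of "real k"] by simp
  moreover have "space (skew u e) = UNIV" by (simp add: skew_def)
  ultimately show "\<exists>A. countable A \<and> A \<subseteq> sets (skew u e) \<and> \<Union> A = space (skew u e) \<and> (\<forall>a\<in>A. emeasure (skew u e) a \<noteq> \<infinity>)"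
    by (intro exI[of _ ?A]) auto
qed

text \<open>A shear: \<open>e\<close> is \<open>(e \<bullet> u) *\<^sub>R u\<close> plus a vector in
  the hyperplane. Translation invariance in the hyperplane removes the latter, and the former
  rescales the line parameter.\<close>

lemma skew_oblique:
  fixes u :: "real^'n::finite"
  assumes A [measurable]: "A \<in> sets borel" and u: "norm u = 1" and eu: "e \<bullet> u > 0"
  shows "emeasure (skew u u) A = ennreal (e \<bullet> u) * emeasure (skew u e) A"
proof -
  define w where "w = e - (e \<bullet> u) *\<^sub>R u"
  have uu: "u \<bullet> u = 1" using u by (simp add: dot_square_norm)
  have w: "(t *\<^sub>R w) \<bullet> u = 0" for t by (simp add: w_def inner_diff_left uu)
  interpret S: sigma_finite_measure "hplane u" by (rule sigma_finite_hplane) fact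
  have [measurable]: "(\<lambda>t. \<integral>\<^sup>+z. indicator A (z + t *\<^sub>R u) \<partial>hplane u) \<in> borel_measurable borel"
    by measurable
  have "emeasure (skew u e) A = (\<integral>\<^sup>+t. (\<integral>\<^sup>+z. indicator A ((z + t *\<^sub>R w) + (t * (e \<bullet> u)) *\<^sub>R u) \<partial>hplane u) \<partial>lborel)"
    unfolding emeasure_skew_swap[OF A u]
    by (intro nn_integral_cong) (simp add: w_def algebra_simps)
  also have "\<dots> = (\<integral>\<^sup>+t. (\<integral>\<^sup>+z. indicator A (z + (t * (e \<bullet> u)) *\<^sub>R u) \<partial>hplane u) \<partial>lborel)"
    by (intro nn_integral_cong hplane_translation[OF w, of "\<lambda>z. indicator A (z + _ *\<^sub>R u)"]) simp
  finally have 1: "emeasure (skew u e) A = (\<integral>\<^sup>+t. (\<integral>\<^sup>+z. indicator A (z + (0 + (e \<bullet> u) * t) *\<^sub>R u) \<partial>hplane u) \<partial>lborel)"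
    by (simp add: mult.commute)
  show ?thesis
    unfolding 1 emeasure_skew_swap[OF A u, of u]
    using eu by (subst nn_integral_real_affine[where c = "e \<bullet> u" and t = 0]) auto
qed

lemma skew_rotation:
  fixes u b :: "real^'n::finite"
  assumes "norm u = 1" "norm b = 1"
  shows "emeasure (skew u u) (ball 0 1) = emeasure (skew b b) (ball 0 1)"
proof -
  obtain f where f: "orthogonal_transformation f" "f u = b"
    using orthogonal_transformation_exists[of u b] assms by auto
  have lin: "linear f" using f(1) by (simp add: orthogonal_transformation_def)
  have [measurable]: "f \<in> borel_measurable borel"
    using lin by (intro borel_measurable_continuous_onI linear_continuous_on linear_conv_bounded_linear[THEN iffD1])
  have d: "distr (hplane u) borel f = hplane b"
  proof (rule hplane_isometry)
    show "dist (f x) (f y) = dist x y" for x y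
      using f(1) by (simp add: orthogonal_transformation_isometry)
    show "bij f" using f(1) by (rule orthogonal_transformation_bij)
    show "f z \<bullet> b = 0 \<longleftrightarrow> z \<bullet> u = 0" for z
      using f by (auto simp: orthogonal_transformation_def)
  qed
  have [measurable]: "(ball 0 1 :: (real^'n) set) \<in> sets borel" by simp
  have [measurable]: "(\<lambda>z. \<integral>\<^sup>+t. indicator (ball 0 1) (z + t *\<^sub>R b) \<partial>lborel) \<in> borel_measurable borel"
    by measurable
  have "emeasure (skew b b) (ball 0 1) = (\<integral>\<^sup>+z. (\<integral>\<^sup>+t. indicator (ball 0 1) (z + t *\<^sub>R b) \<partial>lborel) \<partial>distr (hplane u) borel f)"
    unfolding d by (rule emeasure_skew) simp
  also have "\<dots> = (\<integral>\<^sup>+z. (\<integral>\<^sup>+t. indicator (ball 0 1) (f z + t *\<^sub>R b) \<partial>lborel) \<partial>hplane u)"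
    by (subst nn_integral_distr) auto
  also have "\<dots> = (\<integral>\<^sup>+z. (\<integral>\<^sup>+t. indicator (ball 0 1) (z + t *\<^sub>R u) \<partial>lborel) \<partial>hplane u)"
  proof (intro nn_integral_cong)
    fix z t
    have "f z + t *\<^sub>R b = f (z + t *\<^sub>R u)"
      using lin f(2) by (simp add: linear_add linear_scale)
    then have "norm (f z + t *\<^sub>R b) = norm (z + t *\<^sub>R u)"
      using f(1) by (simp add: orthogonal_transformation_norm)
    then show "indicator (ball 0 1) (f z + t *\<^sub>R b) = (indicator (ball 0 1) (z + t *\<^sub>R u) :: ennreal)"
      by (simp add: indicator_def)
  qed
  also have "\<dots> = emeasure (skew u u) (ball 0 1)" by (rule emeasure_skew[symmetric]) simp
  finally show ?thesis by simp
qed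

text \<open>One \<open>c\<close> serves all hyperplanes and directions: a rotation removes the
  dependence on \<open>u\<close>, and the shear leaves exactly the factor
  \<open>1 / (e \<bullet> u)\<close>.\<close>

lemma skew_eq_lborel:
  "\<exists>c\<ge>0. \<forall>(u::real^'n::finite) e A. norm u = 1 \<longrightarrow> e \<bullet> u > 0 \<longrightarrow> A \<in> sets borel \<longrightarrow>
     emeasure (skew u e) A = ennreal (c / (e \<bullet> u)) * emeasure lborel A"
proof -
  fix k :: 'n
  define b where "b = (axis k 1 :: real^'n)"
  have b: "norm b = 1" "b \<bullet> b \<noteq> 0" by (auto simp: b_def inner_axis_axis norm_axis_1)
  define V where "V = measure lborel (ball (0::real^'n) 1)"
  have V: "emeasure lborel (ball (0::real^'n) 1) = ennreal V" "V > 0"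
    by (auto simp: V_def emeasure_ball measure_def)
  define m where "m = enn2real (emeasure (skew b b) (ball 0 1))"
  have m: "emeasure (skew b b) (ball 0 1) = ennreal m" "m \<ge> 0"
    using skew_bounded_finite[OF b, of 1] by (auto simp: m_def)
  have "emeasure (skew u e) A = ennreal ((m / V) / (e \<bullet> u)) * emeasure lborel A"
    if u: "norm u = 1" and eu: "e \<bullet> u > 0" and A: "A \<in> sets borel" for u e :: "real^'n" and A
  proof -
    have uu: "u \<bullet> u = 1" using u by (simp add: dot_square_norm)
    have "emeasure (skew u u) A * ennreal V = ennreal m * emeasure lborel A"
      using translation_invariant_eq_lborel[OF sigma_finite_skew _ _ A, of u u] skew_translation[of _ u u] u uu
        skew_rotation[OF u b(1)] m V by simp
    then have "emeasure (skew u u) A * (ennreal V * ennreal (1 / V)) = ennreal m * emeasure lborel A * ennreal (1 / V)"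
      by (simp add: mult.assoc[symmetric])
    also have "ennreal V * ennreal (1 / V) = 1" using V(2) by (simp add: ennreal_mult[symmetric])
    also have "ennreal m * emeasure lborel A * ennreal (1 / V) = (ennreal m * ennreal (1 / V)) * emeasure lborel A"
      by (simp add: mult_ac)
    also have "ennreal m * ennreal (1 / V) = ennreal (m / V)"
      using V(2) m(2) by (simp add: ennreal_mult[symmetric])
    finally have uuA: "emeasure (skew u u) A = ennreal (m / V) * emeasure lborel A" by simp
    have "ennreal (1 / (e \<bullet> u)) * (ennreal (e \<bullet> u) * emeasure (skew u e) A) = ennreal (1 / (e \<bullet> u)) * (ennreal (m / V) * emeasure lborel A)"
      using skew_oblique[OF A u eu] uuA by simp
    then show ?thesis
      using eu V(2) m(2) by (simp add: ennreal_mult[symmetric] mult.assoc[symmetric] mult.commute[of V])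
  qed
  then show ?thesis using V m by (intro exI[of _ "m / V"]) auto
qed

text \<open>The constant \<open>c\<close> normalises Hausdorff measure on hyperplanes against Lebesgue measure.  Its value is
  irrelevant here: both masses use the same surface measure.\<close>
lemma hausdorff_flat:
  "\<exists>c\<ge>0. \<forall>(e::real^'n::finite) a F. norm e = 1 \<longrightarrow> a \<bullet> e = 0 \<longrightarrow> F \<in> sets borel \<longrightarrow>
     hausdorff (real CARD('n) - 1) (F \<inter> {z. z \<bullet> e = a \<bullet> z})
      = ennreal (c * sqrt (1 + (norm a)\<^sup>2)) * emeasure lborel {y. 0 < y \<bullet> e \<and> y \<bullet> e < 1 \<and> y + (a \<bullet> y - y \<bullet> e) *\<^sub>R e \<in> F}"
proof -
  obtain c where c: "c \<ge> 0" and sk: "\<And>u e :: real^'n. \<And>A. norm u = 1 \<Longrightarrow> e \<bullet> u > 0 \<Longrightarrow> A \<in> sets borel \<Longrightarrow>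
     emeasure (skew u e) A = ennreal (c / (e \<bullet> u)) * emeasure lborel A"
    using skew_eq_lborel by metis
  have "hausdorff (real CARD('n) - 1) (F \<inter> {z. z \<bullet> e = a \<bullet> z})
      = ennreal (c * sqrt (1 + (norm a)\<^sup>2)) * emeasure lborel {y. 0 < y \<bullet> e \<and> y \<bullet> e < 1 \<and> y + (a \<bullet> y - y \<bullet> e) *\<^sub>R e \<in> F}"
    if e: "norm e = 1" and ae: "a \<bullet> e = 0" and F [measurable]: "F \<in> sets borel" for e a :: "real^'n" and F
  proof -
    define J where "J = sqrt (1 + (norm a)\<^sup>2)"
    have J: "J > 0" unfolding J_def by (simp add: add_pos_nonneg)
    \<comment> \<open>The unit normal of the hyperplane
      \<open>z \<bullet> e = a \<bullet> z\<close>; the value \<open>e \<bullet> u = 1 / J\<close>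
      is the source of the factor \<open>sqrt (1 + (norm a)\<^sup>2)\<close>.\<close>
    define u where "u = (1 / J) *\<^sub>R (e - a)"
    have ee: "e \<bullet> e = 1" using e by (simp add: dot_square_norm)
    have ea: "e \<bullet> a = 0" using ae by (simp add: inner_commute)
    have "norm (e - a) = J"
      unfolding J_def norm_eq_sqrt_inner
      by (simp add: inner_diff_left inner_diff_right ee ea ae power2_norm_eq_inner)
    then have u: "norm u = 1" using J by (simp add: u_def)
    have eu: "e \<bullet> u = 1 / J" by (simp add: u_def inner_diff_right ee ea)
    have pl: "{z. z \<bullet> e = a \<bullet> z} = {z. z \<bullet> u = 0}"
      using J by (auto simp: u_def inner_diff_right inner_commute)
    \<comment> \<open>The line along \<open>e\<close> through a point \<open>z\<close> of the
      hyperplane meets \<open>S\<close> in an interval of length one if \<open>z\<close> lies in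
      \<open>F\<close> and not at all otherwise, so \<open>skew u e\<close> assigns to
      \<open>S\<close> the hyperplane measure of \<open>F\<close>.\<close>
    define S where "S = {y. 0 < y \<bullet> e \<and> y \<bullet> e < 1 \<and> y + (a \<bullet> y - y \<bullet> e) *\<^sub>R e \<in> F}"
    have [measurable]: "S \<in> sets borel" 
    proof -
      have "(\<lambda>y. y + (a \<bullet> y - y \<bullet> e) *\<^sub>R e) \<in> borel_measurable borel"
        by (intro borel_measurable_continuous_onI continuous_intros)
      from measurable_sets[OF this F] have "(\<lambda>y. y + (a \<bullet> y - y \<bullet> e) *\<^sub>R e) -` F \<in> sets borel" by simp
      moreover have "{y. 0 < y \<bullet> e} \<in> sets borel" "{y. y \<bullet> e < 1} \<in> sets borel"
        by (intro borel_open open_Collect_less continuous_intros)+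
      moreover have "S = {y. 0 < y \<bullet> e} \<inter> {y. y \<bullet> e < 1} \<inter> (\<lambda>y. y + (a \<bullet> y - y \<bullet> e) *\<^sub>R e) -` F"
        by (auto simp: S_def)
      ultimately show ?thesis by simp
    qed
    have "ennreal (c * J) * emeasure lborel S = emeasure (skew u e) S"
      using sk[OF u, of e S] eu J by simp
    also have "\<dots> = (\<integral>\<^sup>+z. indicator F z \<partial>hplane u)"
      unfolding emeasure_skew[OF \<open>S \<in> sets borel\<close>]
    proof (intro nn_integral_cong_AE)
      have "AE z in hplane u. z \<bullet> u = 0"
        unfolding hplane_def by (subst AE_density) (auto simp: indicator_def)
      then show "AE z in hplane u. (\<integral>\<^sup>+t. indicator S (z + t *\<^sub>R e) \<partial>lborel) = indicator F z"
      proof eventually_elim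
        fix z :: "real^'n" assume z: "z \<bullet> u = 0"
        have "z \<in> {z. z \<bullet> e = a \<bullet> z}" using z pl by blast
        then have ze: "z \<bullet> e = a \<bullet> z" by simp
        have "(\<integral>\<^sup>+t. indicator S (z + t *\<^sub>R e) \<partial>lborel) = (\<integral>\<^sup>+t. indicator F z * indicator {- (z \<bullet> e)<..<1 - z \<bullet> e} t \<partial>lborel)"
        proof (intro nn_integral_cong)
          fix t
          have 1: "(z + t *\<^sub>R e) \<bullet> e = z \<bullet> e + t" by (simp add: inner_add_left ee)
          have 2: "z + t *\<^sub>R e + (a \<bullet> (z + t *\<^sub>R e) - (z + t *\<^sub>R e) \<bullet> e) *\<^sub>R e = z"
            by (simp add: inner_add_left inner_add_right ee ae ze algebra_simps)
          have "z + t *\<^sub>R e \<in> S \<longleftrightarrow> z \<in> F \<and> t \<in> {- (z \<bullet> e)<..<1 - z \<bullet> e}"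
            unfolding S_def mem_Collect_eq 2 unfolding 1 by auto
          then show "indicator S (z + t *\<^sub>R e) = (indicator F z * indicator {- (z \<bullet> e)<..<1 - z \<bullet> e} t :: ennreal)"
            by (simp add: indicator_def)
        qed
        also have "\<dots> = indicator F z" by (simp add: nn_integral_cmult)
        finally show "(\<integral>\<^sup>+t. indicator S (z + t *\<^sub>R e) \<partial>lborel) = indicator F z" .
      qed
    qed
    also have "\<dots> = hausdorff (real CARD('n) - 1) (F \<inter> {z. z \<bullet> e = a \<bullet> z})"
      by (simp add: emeasure_hplane pl)
    finally show ?thesis by (simp add: S_def J_def)
  qed
  then show ?thesis using c by blast
qed

section \<open>Partial derivatives and Rademacher's theorem\<close>

text \<open>The relational form asserts existence together with the value and passes through sum and
  product rules; \<open>pd\<close> is total and says nothing where the derivative fails to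
  exist.\<close>

definition haspd :: "'n::finite \<Rightarrow> (real^'n \<Rightarrow> real) \<Rightarrow> real \<Rightarrow> real^'n \<Rightarrow> bool" where
  "haspd i f f' x \<longleftrightarrow> ((\<lambda>t. f (x + t *\<^sub>R axis i 1)) has_real_derivative f') (at 0)"

text \<open>The increment is switched on one coordinate at a time. Each step is controlled by the
  mean value inequality and by continuity of that partial derivative at the single point
  \<open>x\<close>.\<close>

lemma has_derivative_continuous_partials:
  fixes f :: "real^'n::finite \<Rightarrow> real"
  assumes U: "open U" "x \<in> U" and pd: "\<And>i y. y \<in> U \<Longrightarrow> haspd i f (f' i y) y"
    and cont: "\<And>i. isCont (f' i) x"
  shows "(f has_derivative (\<lambda>v. \<Sum>i\<in>UNIV. f' i x * v $ i)) (at x)"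
  unfolding has_derivative_at_alt
proof (intro conjI allI impI)
  show "bounded_linear (\<lambda>v. \<Sum>i\<in>UNIV. f' i x * v $ i)"
    by (intro bounded_linear_sum bounded_linear_const_mult bounded_linear_vec_nth)
  fix e :: real assume "e > 0"
  define e' where "e' = e / real CARD('n)"
  have e': "e' > 0" using \<open>e > 0\<close> by (simp add: e'_def)
  obtain r where r: "r > 0" "ball x r \<subseteq> U" using U by (auto simp: open_contains_ball)
  have "\<forall>i. \<exists>d>0. \<forall>y. dist y x < d \<longrightarrow> dist (f' i y) (f' i x) < e'"
    using cont e' unfolding continuous_at_eps_delta by blast
  then obtain dd where dd: "\<And>i. dd i > 0" "\<And>i y. dist y x < dd i \<Longrightarrow> dist (f' i y) (f' i x) < e'"
    by metis
  define d where "d = Min (insert r (range dd))"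
  have d: "d > 0" using r dd(1) by (auto simp: d_def)
  have d': "d \<le> r" "d \<le> dd i" for i
    unfolding d_def by (intro Min_le; simp)+
  show "\<exists>d>0. \<forall>y. norm (y - x) < d \<longrightarrow> norm (f y - f x - (\<Sum>i\<in>UNIV. f' i x * (y - x) $ i)) \<le> e * norm (y - x)"
  proof (intro exI[of _ d] conjI allI impI d)
    fix y assume y: "norm (y - x) < d"
    define v where "v = y - x"
    \<comment> \<open>The increment \<open>v\<close> with the coordinates outside \<open>S\<close>
      set to zero.\<close>
    define tr where "tr S = (\<chi> i. if i \<in> S then v $ i else 0)" for S
    have ntr: "norm w \<le> norm v" if "\<And>i. \<bar>w $ i\<bar> \<le> \<bar>v $ i\<bar>" for w :: "real^'n"
      using that by (intro norm_le_componentwise_cart) simp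
    have "\<bar>f (x + tr S) - f x - (\<Sum>i\<in>S. f' i x * v $ i)\<bar> \<le> real (card S) * e' * norm v" if "finite S" for S
      using that
    proof (induction S)
      case empty
      have "tr {} = 0" by (simp add: tr_def vec_eq_iff)
      then show ?case by simp
    next
      case (insert k S)
      \<comment> \<open>With the linear part at \<open>x\<close> subtracted, the derivative along
        the step is at most \<open>e'\<close>.\<close>
      define \<phi> where "\<phi> t = f (x + tr S + t *\<^sub>R axis k 1) - t * f' k x" for t
      have in_ball: "dist (x + tr S + t *\<^sub>R axis k 1) x < d" if "t \<in> closed_segment 0 (v $ k)" for t
      proof -
        have "\<bar>t\<bar> \<le> \<bar>v $ k\<bar>" using that by (auto simp: closed_segment_eq_real_ivl split: if_splits)
        then have "norm (tr S + t *\<^sub>R axis k 1) \<le> norm v"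
          using insert.hyps by (intro ntr) (auto simp: tr_def axis_def)
        moreover have "dist (x + tr S + t *\<^sub>R axis k 1) x = norm (tr S + t *\<^sub>R axis k 1)"
          by (simp add: dist_norm algebra_simps)
        ultimately show ?thesis using y by (simp add: v_def)
      qed
      have der: "(\<phi> has_field_derivative (f' k (x + tr S + t *\<^sub>R axis k 1) - f' k x)) (at t within closed_segment 0 (v $ k))"
        if t: "t \<in> closed_segment 0 (v $ k)" for t
      proof -
        have "x + tr S + t *\<^sub>R axis k 1 \<in> U"
          using in_ball[OF t] d'(1) r by (auto simp: dist_commute)
        from pd[OF this, of k] have "((\<lambda>s. f (x + tr S + (s + t) *\<^sub>R axis k 1)) has_real_derivative f' k (x + tr S + t *\<^sub>R axis k 1)) (at 0)"
          unfolding haspd_def by (simp add: algebra_simps)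
        then have "((\<lambda>s. f (x + tr S + s *\<^sub>R axis k 1)) has_real_derivative f' k (x + tr S + t *\<^sub>R axis k 1)) (at (0 + t))"
          by (subst DERIV_shift)
        then have "(\<phi> has_field_derivative (f' k (x + tr S + t *\<^sub>R axis k 1) - 1 * f' k x)) (at t)"
          unfolding \<phi>_def add_0_left by (rule DERIV_diff[OF _ DERIV_cmult_right[OF DERIV_ident]])
        from has_field_derivative_at_within[OF this] show ?thesis by simp
      qed
      have bnd: "norm (f' k (x + tr S + t *\<^sub>R axis k 1) - f' k x) \<le> e'" if "t \<in> closed_segment 0 (v $ k)" for t
        using dd(2)[of "x + tr S + t *\<^sub>R axis k 1" k] in_ball[OF that] d'(2)[of k] by (simp add: dist_norm)
      have "norm (\<phi> (v $ k) - \<phi> 0) \<le> e' * norm (v $ k - 0)"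
        by (rule field_differentiable_bound[OF convex_closed_segment der bnd]) auto
      also have "\<dots> \<le> e' * norm v"
        using component_le_norm_cart[of v k] e' by (intro mult_left_mono) auto
      finally have 1: "\<bar>\<phi> (v $ k) - \<phi> 0\<bar> \<le> e' * norm v" by simp
      have trk: "tr (insert k S) = tr S + (v $ k) *\<^sub>R axis k 1"
        using insert.hyps by (auto simp: tr_def vec_eq_iff axis_def)
      have "f (x + tr (insert k S)) - f x - (\<Sum>i\<in>insert k S. f' i x * v $ i)
          = (\<phi> (v $ k) - \<phi> 0) + (f (x + tr S) - f x - (\<Sum>i\<in>S. f' i x * v $ i))"
        using insert.hyps by (simp add: \<phi>_def trk algebra_simps)
      then have "\<bar>f (x + tr (insert k S)) - f x - (\<Sum>i\<in>insert k S. f' i x * v $ i)\<bar> \<le> e' * norm v + real (card S) * e' * norm v"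
        using 1 insert.IH by linarith
      then show ?case using insert.hyps by (simp add: algebra_simps)
    qed
    from this[of UNIV] have "\<bar>f (x + tr UNIV) - f x - (\<Sum>i\<in>UNIV. f' i x * v $ i)\<bar> \<le> e * norm v"
      by (simp add: e'_def)
    moreover have "tr UNIV = v" by (simp add: tr_def vec_eq_iff)
    ultimately show "norm (f y - f x - (\<Sum>i\<in>UNIV. f' i x * (y - x) $ i)) \<le> e * norm (y - x)"
      by (simp add: v_def)
  qed
qed

section \<open>Dini derivatives of Lipschitz functions on the line\<close>

text \<open>The last point with \<open>F c \<le> F t\<close> cannot lie before \<open>d\<close>,
  since a step would lead on from it. This chains local increments into a global one and does the
  work of a covering lemma.\<close>

lemma continuous_forward_chain:
  fixes F :: "real \<Rightarrow> real"
  assumes cont: "continuous_on {c..d} F" and cd: "c \<le> d"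
    and step: "\<And>t. c \<le> t \<Longrightarrow> t < d \<Longrightarrow> \<exists>s. t < s \<and> s \<le> d \<and> F t \<le> F s"
  shows "F c \<le> F d"
proof -
  define T where "T = {t \<in> {c..d}. F c \<le> F t}"
  have "closed T" unfolding T_def
    by (intro continuous_closed_preimage_constant[where f = "\<lambda>t. t", simplified] continuous_on_closed_Collect_le continuous_on_const cont) auto
  moreover have "bounded T" unfolding T_def by (rule bounded_subset[of "{c..d}"]) auto
  moreover have "c \<in> T" using cd by (simp add: T_def)
  ultimately obtain m where m: "m \<in> T" "\<And>t. t \<in> T \<Longrightarrow> t \<le> m"
    using compact_attains_sup[of T] by (metis compact_eq_bounded_closed empty_iff)
  have "m = d"
  proof (rule ccontr)
    assume "m \<noteq> d"
    then have "c \<le> m" "m < d" using m(1) by (auto simp: T_def)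
    then obtain s where "m < s" "s \<le> d" "F m \<le> F s" using step by blast
    then have "s \<in> T" using m(1) by (auto simp: T_def)
    then show False using m(2) \<open>m < s\<close> by fastforce
  qed
  then show ?thesis using m(1) by (simp add: T_def)
qed

lemma continuous_backward_chain:
  fixes F :: "real \<Rightarrow> real"
  assumes cont: "continuous_on {c..d} F" and cd: "c \<le> d"
    and step: "\<And>t. c < t \<Longrightarrow> t \<le> d \<Longrightarrow> \<exists>s. c \<le> s \<and> s < t \<and> F s \<le> F t"
  shows "F c \<le> F d"
proof -
  have "- F (- (- d)) \<le> - F (- (- c))"
  proof (rule continuous_forward_chain[of "- d" "- c" "\<lambda>t. - F (- t)"])
    show "continuous_on {- d..- c} (\<lambda>t. - F (- t))"
      by (intro continuous_intros continuous_on_compose2[OF cont]) auto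
    fix t assume "- d \<le> t" "t < - c"
    then obtain s where "c \<le> s" "s < - t" "F s \<le> F (- t)" using step[of "- t"] by auto
    then show "\<exists>s>t. s \<le> - c \<and> - F (- t) \<le> - F (- s)" by (intro exI[of _ "- s"]) auto
  qed (use cd in auto)
  then show ?thesis by simp
qed

text \<open>\<open>upslope \<sigma> q f x\<close>: the upper Dini derivative of \<open>f\<close> at \<open>x\<close>, from the right (\<open>\<sigma> = 1\<close>) or from the left
  (\<open>\<sigma> = -1\<close>), is attained by difference quotients exceeding \<open>q\<close> at arbitrarily small scales.\<close>
definition upslope :: "real \<Rightarrow> real \<Rightarrow> (real \<Rightarrow> real) \<Rightarrow> real \<Rightarrow> bool" where
  "upslope \<sigma> q f x \<longleftrightarrow> (\<forall>n::nat. \<exists>t\<in>{0<..<1 / real (Suc n)}. q < (f (x + \<sigma> * t) - f x) / (\<sigma> * t))"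

lemma upslope_small:
  assumes "upslope \<sigma> q f x" "\<delta> > 0"
  obtains t where "0 < t" "t < \<delta>" "q < (f (x + \<sigma> * t) - f x) / (\<sigma> * t)"
proof -
  obtain n where n: "1 / real (Suc n) < \<delta>" using nat_approx_posE[OF assms(2)] by auto
  obtain t where "t \<in> {0<..<1 / real (Suc n)}" "q < (f (x + \<sigma> * t) - f x) / (\<sigma> * t)"
    using assms(1) unfolding upslope_def by blast
  then show ?thesis using n that by auto
qed

lemma measure_Int_interval_continuous:
  assumes [measurable]: "K \<in> sets borel"
  shows "continuous_on {c..d} (\<lambda>t. measure lborel (K \<inter> {c..t::real}))"
    and "c \<le> s \<Longrightarrow> s \<le> t \<Longrightarrow> measure lborel (K \<inter> {c..t}) - measure lborel (K \<inter> {c..s}) = measure lborel (K \<inter> {s<..t})"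
    and "c \<le> s \<Longrightarrow> s \<le> t \<Longrightarrow> measure lborel (K \<inter> {s<..t}) \<le> t - s"
proof -
  have fm: "K \<inter> {a..b} \<in> fmeasurable lborel" "K \<inter> {a<..b} \<in> fmeasurable lborel" for a b
    by (auto intro!: fmeasurableI2[OF fmeasurable_cbox[of a b, unfolded box_real]])
  have fin: "emeasure lborel (K \<inter> {a..b}) \<noteq> top" "emeasure lborel (K \<inter> {a<..b}) \<noteq> top" for a b
    using fm[of a b] by (auto simp: fmeasurable_def)
  show 1: "measure lborel (K \<inter> {c..t}) - measure lborel (K \<inter> {c..s}) = measure lborel (K \<inter> {s<..t})"
    if "c \<le> s" "s \<le> t" for s t
  proof -
    have "K \<inter> {c..t} = (K \<inter> {c..s}) \<union> (K \<inter> {s<..t})" using that by auto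
    then have "measure lborel (K \<inter> {c..t}) = measure lborel (K \<inter> {c..s}) + measure lborel (K \<inter> {s<..t})"
      using that fin by (simp only:) (intro measure_Union, auto)
    then show ?thesis by simp
  qed
  show 2: "measure lborel (K \<inter> {s<..t}) \<le> t - s" if "c \<le> s" "s \<le> t" for s t
  proof -
    have "measure lborel (K \<inter> {s<..t}) \<le> measure lborel {s<..t}"
      by (intro measure_mono_fmeasurable) (auto intro: fmeasurableI2[OF fmeasurable_cbox[of s t, unfolded box_real]])
    then show ?thesis using that by simp
  qed
  have "1-lipschitz_on {c..d} (\<lambda>t. measure lborel (K \<inter> {c..t}))"
  proof (rule lipschitz_on_leI)
    fix s t assume "s \<in> {c..d}" "t \<in> {c..d}" "s \<le> t"
    then have st: "c \<le> s" "s \<le> t" by auto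
    show "dist (measure lborel (K \<inter> {c..s})) (measure lborel (K \<inter> {c..t})) \<le> 1 * dist s t"
    proof -
      have "measure lborel (K \<inter> {c..s}) \<le> measure lborel (K \<inter> {c..t})"
        using 1[OF st] measure_nonneg[of lborel "K \<inter> {s<..t}"] by linarith
      then show ?thesis using 1[OF st] 2[OF st] st by (simp add: dist_real_def)
    qed
  qed simp
  then show "continuous_on {c..d} (\<lambda>t. measure lborel (K \<inter> {c..t}))"
    by (rule lipschitz_on_continuous_on)
qed

text \<open>The function \<open>f\<close> minus \<open>q\<close> times the measure of
  \<open>K\<close> passed so far admits a non-decreasing step from every point. At points of
  \<open>K\<close> the step comes from the steep difference quotient; off \<open>K\<close> a short
  interval misses \<open>K\<close> and monotonicity of \<open>f\<close> suffices. For
  \<open>\<sigma> = -1\<close> the steps run backwards.\<close>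

lemma upslope_increment:
  fixes f :: "real \<Rightarrow> real"
  assumes f: "mono f" "continuous_on UNIV f" and K: "closed K" "\<And>x. x \<in> K \<Longrightarrow> upslope \<sigma> q f x"
    and \<sigma>: "\<sigma> \<in> {1, -1}" and cd: "c \<le> d" and q: "q \<ge> 0"
  shows "q * measure lborel (K \<inter> {c..d}) \<le> f d - f c"
proof -
  have [measurable]: "K \<in> sets borel" using K(1) by (rule borel_closed)
  note m = measure_Int_interval_continuous[OF this]
  define F where "F t = f t - q * measure lborel (K \<inter> {c..t})" for t
  have cont: "continuous_on {c..d} F" unfolding F_def
    by (intro continuous_intros m(1) continuous_on_subset[OF f(2)]) auto
  \<comment> \<open>The two kinds of step: an interval free of \<open>K\<close>, or one over which
    \<open>f\<close> rises with slope at least \<open>q\<close>, in which case the measure of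
    \<open>K\<close> there is bounded by the length.\<close>
  have inc: "F s \<le> F t" if st: "c \<le> s" "s \<le> t" and h: "K \<inter> {s<..t} = {} \<or> q * (t - s) \<le> f t - f s" for s t
  proof -
    have "q * measure lborel (K \<inter> {s<..t}) \<le> f t - f s"
      using h
    proof
      assume "K \<inter> {s<..t} = {}"
      then show ?thesis using monoD[OF f(1) st(2)] by simp
    next
      assume h: "q * (t - s) \<le> f t - f s"
      have "q * measure lborel (K \<inter> {s<..t}) \<le> q * (t - s)" using q m(3)[OF st] by (intro mult_left_mono)
      with h show ?thesis by simp
    qed
    moreover have "F t - F s = f t - f s - q * measure lborel (K \<inter> {s<..t})"
      unfolding m(2)[OF st, symmetric] by (simp add: F_def algebra_simps)
    ultimately show ?thesis by simp
  qed
  have "F c \<le> F d"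
  proof (cases "\<sigma> = 1")
    case True
    show ?thesis
    proof (rule continuous_forward_chain[OF cont cd])
      fix t assume t: "c \<le> t" "t < d"
      show "\<exists>s. t < s \<and> s \<le> d \<and> F t \<le> F s"
      proof (cases "t \<in> K")
        case K': True
        obtain \<tau> where \<tau>: "0 < \<tau>" "\<tau> < d - t" "q < (f (t + \<sigma> * \<tau>) - f t) / (\<sigma> * \<tau>)"
          using K(2)[OF K'] by (rule upslope_small[of _ _ _ _ "d - t"]) (use t in auto)
        then have "q * (t + \<tau> - t) \<le> f (t + \<tau>) - f t" using True by (simp add: pos_less_divide_eq)
        then show ?thesis using \<tau> t by (intro exI[of _ "t + \<tau>"] conjI inc) auto
      next
        case False
        then obtain r where r: "r > 0" "ball t r \<subseteq> - K" using K(1) open_contains_ball[of "- K"] by (auto simp: open_Compl)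
        define s where "s = min d (t + r / 2)"
        have "K \<inter> {t<..s} = {}" using r by (force simp: s_def dist_real_def)
        then show ?thesis using t r by (intro exI[of _ s] conjI inc) (auto simp: s_def)
      qed
    qed
  next
    case False
    then have s1: "\<sigma> = -1" using \<sigma> by simp
    show ?thesis
    proof (rule continuous_backward_chain[OF cont cd])
      fix t assume t: "c < t" "t \<le> d"
      show "\<exists>s. c \<le> s \<and> s < t \<and> F s \<le> F t"
      proof (cases "t \<in> K")
        case K': True
        obtain \<tau> where \<tau>: "0 < \<tau>" "\<tau> < t - c" "q < (f (t + \<sigma> * \<tau>) - f t) / (\<sigma> * \<tau>)"
          using K(2)[OF K'] by (rule upslope_small[of _ _ _ _ "t - c"]) (use t in auto)
        have "(f (t + \<sigma> * \<tau>) - f t) / (\<sigma> * \<tau>) = (f t - f (t - \<tau>)) / \<tau>"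
          using \<tau>(1) by (simp add: s1 field_simps)
        then have "q * (t - (t - \<tau>)) \<le> f t - f (t - \<tau>)" using \<tau> by (simp add: pos_less_divide_eq)
        then show ?thesis using \<tau> t by (intro exI[of _ "t - \<tau>"] conjI inc) auto
      next
        case False
        then obtain r where r: "r > 0" "ball t r \<subseteq> - K" using K(1) open_contains_ball[of "- K"] by (auto simp: open_Compl)
        define s where "s = max c (t - r / 2)"
        have "K \<inter> {s<..t} = {}" using r by (force simp: s_def dist_real_def)
        then show ?thesis using t r by (intro exI[of _ s] conjI inc) (auto simp: s_def)
      qed
    qed
  qed
  moreover have "measure lborel (K \<inter> {c..c}) = 0"
  proof -
    have "measure lborel (K \<inter> {c..c}) \<le> measure lborel {c..c}"
      by (intro measure_mono_fmeasurable) (auto intro: fmeasurable_compact)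
    then show ?thesis by (simp add: measure_le_0_iff)
  qed
  ultimately show ?thesis by (simp add: F_def)
qed

text \<open>No density points: covering \<open>K\<close> by grid cells inside a slightly larger open set forces
  \<open>|K| \<le> \<theta> |K|\<close>.\<close>
lemma measure_zero_of_thin:
  fixes K :: "real set"
  assumes K: "compact K" and \<theta>: "0 \<le> \<theta>" "\<theta> < 1"
    and thin: "\<And>c d. c \<le> d \<Longrightarrow> measure lborel (K \<inter> {c..d}) \<le> \<theta> * (d - c)"
  shows "measure lborel K = 0"
proof -
  have Kb [measurable]: "K \<in> sets borel" using K by (simp add: borel_compact)
  have Kf: "K \<in> fmeasurable lborel" using K by (simp add: fmeasurable_compact)
  have "measure lborel K \<le> \<theta> * measure lborel K + e" if e: "e > 0" for e :: real
  proof -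
    obtain G where G: "open G" "K \<subseteq> G" "G - K \<in> lmeasurable" "emeasure lebesgue (G - K) < ennreal e"
      using sets_lebesgue_outer_open[of K e] e Kb by auto
    have Gm: "G - K \<in> sets lborel" using G(1) by auto
    have GK: "G - K \<in> fmeasurable lborel" "measure lborel (G - K) < e"
    proof -
      have em: "emeasure lborel (G - K) < ennreal e" using G(4) Gm by (simp add: emeasure_completion)
      then show 1: "G - K \<in> fmeasurable lborel" using Gm by (intro fmeasurableI) (auto intro: less_trans simp: less_top)
      show "measure lborel (G - K) < e" using em e 1 by (subst (asm) emeasure_eq_measure2) (auto simp: ennreal_less_iff)
    qed
    have Gf: "G \<in> fmeasurable lborel" 
      using fmeasurable.Un[OF GK(1) Kf] G(2) by (simp add: Un_absorb2)
    have mG: "measure lborel G \<le> measure lborel K + e"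
    proof -
      have "measure lborel (G - K \<union> K) \<le> measure lborel (G - K) + measure lborel K"
        using GK Kf by (intro measure_Un_le) auto
      then show ?thesis using GK(2) G(2) by (simp add: Un_absorb2)
    qed
    \<comment> \<open>Cells narrower than the distance from \<open>K\<close> to the complement of
      \<open>G\<close> stay inside \<open>G\<close> as soon as they meet \<open>K\<close>.\<close>
    obtain r where r: "r > 0" "\<And>x y. x \<in> K \<Longrightarrow> y \<in> - G \<Longrightarrow> r \<le> dist x y"
      using separate_compact_closed[OF K, of "- G"] G by (auto simp: closed_Compl disjoint_eq_subset_Compl)
    define \<eta> where "\<eta> = r / 2"
    have \<eta>: "\<eta> > 0" "\<eta> < r" using r by (auto simp: \<eta>_def)
    define I where "I j = {real_of_int j * \<eta>..<(real_of_int j + 1) * \<eta>}" for j :: int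
    define J where "J = {j. I j \<inter> K \<noteq> {}}"
    have inI: "x \<in> I \<lfloor>x / \<eta>\<rfloor>" for x
    proof -
      have "real_of_int \<lfloor>x / \<eta>\<rfloor> \<le> x / \<eta>" "x / \<eta> < real_of_int \<lfloor>x / \<eta>\<rfloor> + 1" by linarith+
      then have "real_of_int \<lfloor>x / \<eta>\<rfloor> * \<eta> \<le> x" "x < (real_of_int \<lfloor>x / \<eta>\<rfloor> + 1) * \<eta>"
        using \<eta>(1) by (simp_all only: pos_le_divide_eq pos_divide_less_eq)
      then show ?thesis by (simp add: I_def)
    qed
    have uniq: "j = \<lfloor>x / \<eta>\<rfloor>" if "x \<in> I j" for x j
      using that \<eta> by (intro floor_unique[symmetric]) (auto simp: I_def pos_le_divide_eq pos_divide_less_eq)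
    have finJ: "finite J"
    proof -
      obtain B where B: "\<And>x. x \<in> K \<Longrightarrow> \<bar>x\<bar> \<le> B"
        using compact_imp_bounded[OF K] by (auto simp: bounded_iff)
      have "J \<subseteq> {\<lfloor>- B / \<eta>\<rfloor>..\<lfloor>B / \<eta>\<rfloor>}"
      proof
        fix j assume "j \<in> J"
        then obtain x where x: "x \<in> I j" "x \<in> K" by (auto simp: J_def)
        have "- B / \<eta> \<le> x / \<eta>" "x / \<eta> \<le> B / \<eta>"
          using B[OF x(2)] \<eta> by (intro divide_right_mono; simp)+
        then show "j \<in> {\<lfloor>- B / \<eta>\<rfloor>..\<lfloor>B / \<eta>\<rfloor>}" using uniq[OF x(1)] by (auto intro: floor_mono)
      qed
      then show ?thesis by (rule finite_subset) simp
    qed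
    have If: "I j \<in> fmeasurable lborel" "measure lborel (I j) = \<eta>" for j
      using \<eta> by (auto simp: I_def algebra_simps intro!: fmeasurableI2[OF fmeasurable_cbox[of "real_of_int j * \<eta>" "(real_of_int j + 1) * \<eta>", unfolded box_real]])
    have "measure lborel K \<le> measure lborel (\<Union>j\<in>J. I j \<inter> K)"
    proof (rule measure_mono_fmeasurable)
      show "K \<subseteq> (\<Union>j\<in>J. I j \<inter> K)"
      proof
        fix x assume "x \<in> K"
        then have "x \<in> I \<lfloor>x / \<eta>\<rfloor> \<inter> K" "\<lfloor>x / \<eta>\<rfloor> \<in> J" using inI[of x] by (auto simp: J_def)
        then show "x \<in> (\<Union>j\<in>J. I j \<inter> K)" by blast
      qed
      show "(\<Union>j\<in>J. I j \<inter> K) \<in> fmeasurable lborel" using finJ If(1) Kf by (intro fmeasurable.finite_UN) auto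
    qed simp
    also have "\<dots> \<le> (\<Sum>j\<in>J. measure lborel (I j \<inter> K))"
      using finJ If(1) Kf by (intro measure_UNION_le) auto
    also have "\<dots> \<le> (\<Sum>j\<in>J. \<theta> * \<eta>)"
    proof (rule sum_mono)
      fix j
      have "measure lborel (I j \<inter> K) \<le> measure lborel (K \<inter> {real_of_int j * \<eta>..(real_of_int j + 1) * \<eta>})"
      proof (rule measure_mono_fmeasurable)
        show "K \<inter> {real_of_int j * \<eta>..(real_of_int j + 1) * \<eta>} \<in> fmeasurable lborel"
          using Kf by (intro fmeasurable_Int_fmeasurable) auto
      qed (auto simp: I_def)
      also have "\<dots> \<le> \<theta> * ((real_of_int j + 1) * \<eta> - real_of_int j * \<eta>)"
        using \<eta> by (intro thin) (auto simp: algebra_simps)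
      finally show "measure lborel (I j \<inter> K) \<le> \<theta> * \<eta>" by (simp add: algebra_simps)
    qed
    also have "\<dots> = \<theta> * (\<Sum>j\<in>J. measure lborel (I j))" by (simp add: If(2) sum_distrib_left)
    also have "(\<Sum>j\<in>J. measure lborel (I j)) = measure lborel (\<Union>j\<in>J. I j)"
    proof (rule measure_finite_Union[symmetric])
      show "disjoint_family_on I J" using uniq by (auto simp: disjoint_family_on_def)
      show "emeasure lborel (I j) \<noteq> \<infinity>" for j using If(1)[of j] by (auto simp: fmeasurable_def)
    qed (use finJ If(1) in \<open>auto simp: fmeasurable_def\<close>)
    also have "\<dots> \<le> measure lborel G"
    proof (rule measure_mono_fmeasurable[OF _ _ Gf])
      show "(\<Union>j\<in>J. I j) \<subseteq> G"
      proof
        fix y assume "y \<in> (\<Union>j\<in>J. I j)"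
        then obtain j x where "y \<in> I j" "x \<in> I j" "x \<in> K" by (auto simp: J_def)
        then have "dist x y < r" using \<eta> by (auto simp: I_def dist_real_def algebra_simps abs_if)
        then show "y \<in> G" using r(2)[OF \<open>x \<in> K\<close>, of y] by fastforce
      qed
      show "(\<Union>j\<in>J. I j) \<in> sets lborel" using finJ If(1) by (intro sets.finite_UN) (auto simp: fmeasurable_def)
    qed
    finally have "measure lborel K \<le> \<theta> * measure lborel G" using \<theta> by (simp add: mult_left_mono)
    also have "\<dots> \<le> \<theta> * (measure lborel K + e)" using mG \<theta> by (intro mult_left_mono)
    also have "\<dots> \<le> \<theta> * measure lborel K + e" using \<theta> that by (simp add: algebra_simps mult_left_le_one_le)
    finally show ?thesis .
  qed
  then have "measure lborel K \<le> \<theta> * measure lborel K" by (rule field_le_epsilon)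
  then have "(1 - \<theta>) * measure lborel K \<le> 0" by (simp add: algebra_simps)
  then show ?thesis using \<theta> by (simp add: mult_le_0_iff measure_le_0_iff)
qed

text \<open>The strict inequality makes each condition open in \<open>x\<close>, and the scales
  \<open>1 / real (Suc n)\<close> leave only a countable intersection; \<open>upslope\<close> is
  phrased for this.\<close>

lemma borel_upslope_line:
  fixes h :: "'a::euclidean_space \<Rightarrow> real"
  assumes "continuous_on UNIV h"
  shows "{x. upslope \<sigma> q (\<lambda>t. h (x + t *\<^sub>R v)) 0} \<in> sets borel"
proof -
  have "open {x. q < (h (x + (\<sigma> * t) *\<^sub>R v) - h x) / (\<sigma> * t)}" for t
    unfolding divide_inverse
    by (intro open_Collect_less continuous_intros continuous_on_compose2[OF assms]) auto
  then have "(\<Inter>n::nat. \<Union>t\<in>{0<..<1 / real (Suc n)}. {x. q < (h (x + (\<sigma> * t) *\<^sub>R v) - h x) / (\<sigma> * t)}) \<in> sets borel"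
    by (intro sets.countable_INT'' borel_open open_UN) auto
  moreover have "{x. upslope \<sigma> q (\<lambda>t. h (x + t *\<^sub>R v)) 0} =
     (\<Inter>n::nat. \<Union>t\<in>{0<..<1 / real (Suc n)}. {x. q < (h (x + (\<sigma> * t) *\<^sub>R v) - h x) / (\<sigma> * t)})"
    by (auto simp: upslope_def)
  ultimately show ?thesis by (simp only:)
qed

text \<open>Adding \<open>L * x\<close> makes both \<open>f\<close> and \<open>- f\<close> monotone.
  On a compact subset the increment bounds for slopes \<open>q + L\<close> and
  \<open>- p + L\<close> add up: the terms in \<open>f\<close> cancel, and a fixed fraction below
  one of every interval is left for the set. Such a set is null, and inner regularity removes
  compactness.\<close>

lemma null_upslope_gap:
  fixes f :: "real \<Rightarrow> real"
  assumes L: "L-lipschitz_on UNIV f" and pq: "p < q" and \<sigma>: "\<sigma> \<in> {1, -1}" "\<sigma>' \<in> {1, -1}"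
  shows "{x. upslope \<sigma> q f x \<and> upslope \<sigma>' (- p) (\<lambda>x. - f x) x} \<in> null_sets lborel"
proof -
  let ?E = "{x. upslope \<sigma> q f x \<and> upslope \<sigma>' (- p) (\<lambda>x. - f x) x}"
  have L0: "L \<ge> 0" using lipschitz_on_nonneg[OF L] .
  have cont: "continuous_on UNIV f" using L by (rule lipschitz_on_continuous_on)
  have lip: "\<bar>f x - f y\<bar> \<le> L * \<bar>x - y\<bar>" for x y
    using L by (auto simp: lipschitz_on_def dist_real_def)
  have shift: "upslope s r g x = upslope s r (\<lambda>t. g (x + t *\<^sub>R 1)) 0" for s r g and x :: real
    by (simp add: upslope_def)
  have E: "?E \<in> sets borel"
  proof -
    have "?E = {x. upslope \<sigma> q (\<lambda>t. f (x + t *\<^sub>R 1)) 0} \<inter> {x. upslope \<sigma>' (- p) (\<lambda>t. - f (x + t *\<^sub>R 1)) 0}"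
      by (auto simp: shift[of _ _ f] shift[of _ _ "\<lambda>x. - f x"] simp del: real_scaleR_def)
    then show ?thesis
      using borel_upslope_line[OF cont, of \<sigma> q 1] borel_upslope_line[of "\<lambda>x. - f x" \<sigma>' "- p" 1] cont
      by (auto intro!: continuous_intros)
  qed
  have bdd: "- L \<le> r \<and> r \<le> L" if "r = (f (x + s * t) - f x) / (s * t)" "s \<in> {1, -1}" "t > 0" for r x s t
  proof -
    have "\<bar>s * t\<bar> = t" "s * t \<noteq> 0" using that by auto
    then have "\<bar>r\<bar> \<le> L" using lip[of "x + s * t" x] that by (simp add: abs_divide pos_divide_le_eq)
    then show ?thesis by auto
  qed
  \<comment> \<open>Together with \<open>p < q\<close> this makes the tilted slopes
    \<open>q + L\<close> and \<open>- p + L\<close> nonnegative, as \<open>upslope_increment\<close>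
    requires.\<close>
  have slope1: "q \<le> L" "- L \<le> p" if xE: "x \<in> ?E" for x
  proof -
    obtain t where t: "0 < t" "q < (f (x + \<sigma> * t) - f x) / (\<sigma> * t)"
      using xE upslope_small[of \<sigma> q f x 1] by auto
    show "q \<le> L" using bdd[OF refl \<sigma>(1) t(1), of x] t by auto
    obtain s where s: "0 < s" "- p < (- f (x + \<sigma>' * s) - - f x) / (\<sigma>' * s)"
      using xE upslope_small[of \<sigma>' "- p" "\<lambda>x. - f x" x 1] by auto
    have "(- f (x + \<sigma>' * s) - - f x) / (\<sigma>' * s) = - ((f (x + \<sigma>' * s) - f x) / (\<sigma>' * s))"
      by (simp add: minus_divide_left)
    then show "- L \<le> p" using bdd[OF refl \<sigma>(2) s(1), of x] s by auto
  qed
  have cpt: "measure lborel K = 0" if K: "compact K" "K \<subseteq> ?E" for K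
  proof (cases "K = {}")
    case False
    then have pqL: "q \<le> L" "- L \<le> p" using slope1 K by blast+
    have tilt: "upslope s (r + L) (\<lambda>x. g x + L * x) x" if s: "s \<in> {1, -1}" and u: "upslope s r g x" for s r g x
      unfolding upslope_def
    proof
      fix n :: nat
      obtain t where t: "t \<in> {0<..<1 / real (Suc n)}" "r < (g (x + s * t) - g x) / (s * t)"
        using u unfolding upslope_def by blast
      have "(g (x + s * t) + L * (x + s * t) - (g x + L * x)) / (s * t) = (g (x + s * t) - g x) / (s * t) + L"
        using s t(1) by (auto simp: field_simps)
      then show "\<exists>t\<in>{0<..<1 / real (Suc n)}. r + L < (g (x + s * t) + L * (x + s * t) - (g x + L * x)) / (s * t)"
        using t by (intro bexI[of _ t]) simp_all
    qed
    have mono: "mono (\<lambda>x. f x + L * x)" "mono (\<lambda>x. - f x + L * x)"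
    proof -
      have "\<bar>f x - f y\<bar> \<le> L * (y - x)" if "x \<le> y" for x y using lip[of x y] that by simp
      then show "mono (\<lambda>x. f x + L * x)" "mono (\<lambda>x. - f x + L * x)"
        by (auto simp: mono_def algebra_simps abs_le_iff) (smt (verit) )+
    qed
    \<comment> \<open>The ratio read off from the sum of the two increment bounds; it is below one
      exactly because \<open>p < q\<close>.\<close>
    define \<theta> where "\<theta> = 2 * L / (2 * L + (q - p))"
    have den: "2 * L + (q - p) > 0" using pq L0 by simp
    show ?thesis
    proof (rule measure_zero_of_thin[OF K(1), of \<theta>])
      show "0 \<le> \<theta>" "\<theta> < 1" using den L0 pq by (auto simp: \<theta>_def)
      fix c d :: real assume cd: "c \<le> d"
      have "(q + L) * measure lborel (K \<inter> {c..d}) \<le> (f d + L * d) - (f c + L * c)"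
        by (rule upslope_increment[where \<sigma> = \<sigma>])
           (use K mono \<sigma> cd pqL pq L0 tilt in \<open>auto intro!: continuous_intros cont compact_imp_closed\<close>)
      moreover have "(- p + L) * measure lborel (K \<inter> {c..d}) \<le> (- f d + L * d) - (- f c + L * c)"
      proof (rule upslope_increment[where \<sigma> = \<sigma>' and f = "\<lambda>x. - f x + L * x"])
        show "upslope \<sigma>' (- p + L) (\<lambda>x. - f x + L * x) x" if "x \<in> K" for x
          using that K(2) by (intro tilt \<sigma>) auto
      qed (use K mono \<sigma> cd pqL pq L0 in \<open>auto intro!: continuous_intros cont compact_imp_closed\<close>)
      ultimately have "(2 * L + (q - p)) * measure lborel (K \<inter> {c..d}) \<le> 2 * L * (d - c)"
        by (simp add: algebra_simps)
      then show "measure lborel (K \<inter> {c..d}) \<le> \<theta> * (d - c)"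
        using den by (simp add: \<theta>_def pos_le_divide_eq mult.commute)
    qed
  qed simp
  have "emeasure lborel (?E \<inter> cball 0 R) = 0" for R
  proof (rule ccontr)
    assume ne: "emeasure lborel (?E \<inter> cball 0 R) \<noteq> 0"
    have Em: "?E \<inter> cball 0 R \<in> sets borel" using E by simp
    have "?E \<inter> cball 0 R \<in> fmeasurable lborel"
      using fmeasurableI2[OF fmeasurable_compact[OF compact_cball]] Em by (metis inf_le2 sets_lborel)
    then have mpos: "measure lborel (?E \<inter> cball 0 R) > 0"
      using ne by (metis emeasure_eq_measure2 ennreal_0 zero_less_measure_iff)
    \<comment> \<open>Were the measure positive, a compact subset would miss less than all of it,
      although every compact subset is null.\<close>
    obtain T where T: "closed T" "T \<subseteq> ?E \<inter> cball 0 R" "(?E \<inter> cball 0 R) - T \<in> lmeasurable"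
        "emeasure lebesgue ((?E \<inter> cball 0 R) - T) < ennreal (measure lborel (?E \<inter> cball 0 R))"
      using sets_lebesgue_inner_closed[of "?E \<inter> cball 0 R" "measure lborel (?E \<inter> cball 0 R)"] Em mpos by auto
    have Tc: "compact T" using T(1,2) by (meson bounded_cball bounded_subset compact_eq_bounded_closed le_inf_iff)
    then have "measure lborel T = 0" using T(2) by (intro cpt) auto
    then have T0: "emeasure lborel T = 0" using Tc by (simp add: emeasure_eq_measure2 fmeasurable_compact)
    have Tb: "T \<in> sets borel" using T(1) by (rule borel_closed)
    have "emeasure lborel (?E \<inter> cball 0 R) \<le> emeasure lborel ((?E \<inter> cball 0 R) - T) + emeasure lborel T"
    proof -
      have "?E \<inter> cball 0 R = ((?E \<inter> cball 0 R) - T) \<union> T" using T(2) by auto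
      then show ?thesis using emeasure_subadditive[of "(?E \<inter> cball 0 R) - T" lborel T] Em Tb by simp
    qed
    also have "\<dots> < ennreal (measure lborel (?E \<inter> cball 0 R))"
      using T(4) T0 Em Tb by (simp add: emeasure_completion)
    also have "\<dots> = emeasure lborel (?E \<inter> cball 0 R)"
      using \<open>?E \<inter> cball 0 R \<in> fmeasurable lborel\<close> by (simp add: emeasure_eq_measure2)
    finally show False by simp
  qed
  then have "?E \<inter> cball 0 (real k) \<in> null_sets lborel" for k :: nat using E by auto
  then have "(\<Union>k::nat. ?E \<inter> cball 0 (real k)) \<in> null_sets lborel" by (intro null_sets_UN)
  moreover have "(\<Union>k::nat. ?E \<inter> cball 0 (real k)) = ?E" using real_arch_simple by auto
  ultimately show ?thesis by simp
qed

text \<open>If lower and upper limit of the difference quotients differed, two rationals would fit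
  between them and produce a gap. The Lipschitz bound keeps the common limit finite.\<close>

lemma differentiable_of_no_gap:
  fixes f :: "real \<Rightarrow> real" and x :: real
  assumes L: "L-lipschitz_on UNIV f"
    and no: "\<And>p q \<sigma> \<sigma>'. p \<in> \<rat> \<Longrightarrow> q \<in> \<rat> \<Longrightarrow> p < q \<Longrightarrow> \<sigma> \<in> {1, -1} \<Longrightarrow> \<sigma>' \<in> {1, -1} \<Longrightarrow>
       \<not> (upslope \<sigma> q f x \<and> upslope \<sigma>' (- p) (\<lambda>x. - f x) x)"
  shows "\<exists>D. (f has_real_derivative D) (at x)"
proof -
  define s where "s h = (f (x + h) - f x) / h" for h
  have ev: "eventually (\<lambda>h::real. (g (x + h) - g x) / h \<le> r) (at 0)" if no': "\<And>\<sigma>. \<sigma> \<in> {1, -1} \<Longrightarrow> \<not> upslope \<sigma> r g x" for g and r :: real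
  proof -
    obtain n where n: "\<And>t. t \<in> {0<..<1 / real (Suc n)} \<Longrightarrow> \<not> r < (g (x + 1 * t) - g x) / (1 * t)"
      using no'[of 1] unfolding upslope_def by blast
    obtain m where m: "\<And>t. t \<in> {0<..<1 / real (Suc m)} \<Longrightarrow> \<not> r < (g (x + -1 * t) - g x) / (-1 * t)"
      using no'[of "-1"] unfolding upslope_def by blast
    show ?thesis unfolding eventually_at
    proof (intro exI[of _ "min (1 / real (Suc n)) (1 / real (Suc m))"] conjI ballI impI)
      fix h :: real assume h: "h \<noteq> 0 \<and> dist h 0 < min (1 / real (Suc n)) (1 / real (Suc m))"
      show "(g (x + h) - g x) / h \<le> r"
      proof (cases "h > 0")
        case True then show ?thesis using n[of h] h by (auto simp: not_less)
      next
        case False then show ?thesis using m[of "- h"] h by (auto simp: not_less)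
      qed
    qed auto
  qed
  have bounded: "\<bar>s h\<bar> \<le> L" for h
    using lipschitz_onD[OF L, of "x + h" x] lipschitz_on_nonneg[OF L]
    by (cases "h = 0") (auto simp: s_def dist_real_def abs_divide pos_divide_le_eq)
  let ?l = "Liminf (at 0) (\<lambda>h. ereal (s h))" and ?u = "Limsup (at 0) (\<lambda>h. ereal (s h))"
  have le: "?l \<le> ?u" by (rule Liminf_le_Limsup) simp
  have "?l = ?u"
  proof (rule ccontr)
    assume "?l \<noteq> ?u"
    then have "?l < ?u" using le by simp
    then obtain p where p: "?l < ereal (real_of_rat p)" "ereal (real_of_rat p) < ?u" using ereal_dense3 by blast
    then obtain q where q: "ereal (real_of_rat p) < ereal (real_of_rat q)" "ereal (real_of_rat q) < ?u" using ereal_dense3 by blast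
    consider "\<And>\<sigma>. \<sigma> \<in> {1, -1} \<Longrightarrow> \<not> upslope \<sigma> (real_of_rat q) f x"
      | "\<And>\<sigma>. \<sigma> \<in> {1, -1} \<Longrightarrow> \<not> upslope \<sigma> (- real_of_rat p) (\<lambda>x. - f x) x"
      using no[of "real_of_rat p" "real_of_rat q"] q by auto
    then show False
    proof cases
      case 1
      have "?u \<le> ereal (real_of_rat q)"
        by (rule Limsup_bounded) (use ev[OF 1] in \<open>simp add: s_def\<close>)
      with q show False by simp
    next
      case 2
      have "eventually (\<lambda>h. ereal (real_of_rat p) \<le> ereal (s h)) (at 0)"
      proof (rule eventually_mono[OF ev[OF 2]])
        fix h assume "(- f (x + h) - - f x) / h \<le> - real_of_rat p"
        moreover have "(- f (x + h) - - f x) / h = - s h" by (simp add: s_def minus_divide_left)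
        ultimately show "ereal (real_of_rat p) \<le> ereal (s h)" by simp
      qed
      from Liminf_bounded[OF this] p show False by simp
    qed
  qed
  moreover have "\<bar>?u\<bar> \<noteq> \<infinity>"
  proof -
    have "?u \<le> ereal L" by (rule Limsup_bounded) (use bounded in \<open>auto simp: abs_le_iff\<close>)
    moreover have "ereal (- L) \<le> ?l" by (rule Liminf_bounded) (use bounded in \<open>auto simp: abs_le_iff minus_le_iff\<close>)
    ultimately show ?thesis using le by auto
  qed
  then obtain D where D: "?u = ereal D" by auto
  ultimately have "((\<lambda>h. ereal (s h)) \<longlongrightarrow> ereal D) (at 0)"
    by (subst tendsto_iff_Liminf_eq_Limsup) auto
  then have "(s \<longlongrightarrow> D) (at 0)" by simp
  then show ?thesis unfolding DERIV_def s_def by blast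
qed

section \<open>Directional derivatives almost everywhere and Rademacher's theorem\<close>

text \<open>Translating \<open>E\<close> along \<open>v\<close> and averaging over \<open>t\<close>
  in the unit interval leaves its measure unchanged, while Fubini turns the average into integrals
  over the lines. No coordinates adapted to \<open>v\<close> are needed.\<close>

lemma null_sets_of_null_lines:
  fixes E :: "'a::euclidean_space set"
  assumes E [measurable]: "E \<in> sets borel" and lines: "\<And>x. {t. x + t *\<^sub>R v \<in> E} \<in> null_sets lborel"
  shows "E \<in> null_sets lborel"
proof -
  have "emeasure lborel E = (\<integral>\<^sup>+t. emeasure lborel E * indicator {0..1::real} t \<partial>lborel)"
    by (simp add: nn_integral_cmult_indicator)
  also have "\<dots> = (\<integral>\<^sup>+t. (\<integral>\<^sup>+x. indicator E (x + t *\<^sub>R v) * indicator {0..1} t \<partial>lborel) \<partial>lborel)"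
  proof (rule nn_integral_cong)
    fix t :: real
    have "emeasure lborel E = (\<integral>\<^sup>+x. indicator E x \<partial>distr lborel borel ((+) (t *\<^sub>R v)))"
      by (simp add: lborel_distr_plus)
    also have "\<dots> = (\<integral>\<^sup>+x. indicator E (x + t *\<^sub>R v) \<partial>lborel)"
      by (subst nn_integral_distr) (auto simp: add.commute)
    finally show "emeasure lborel E * indicator {0..1} t = (\<integral>\<^sup>+x. indicator E (x + t *\<^sub>R v) * indicator {0..1} t \<partial>lborel)"
      by (simp add: nn_integral_multc)
  qed
  also have "\<dots> = (\<integral>\<^sup>+x. (\<integral>\<^sup>+t. indicator E (x + t *\<^sub>R v) * indicator {0..1} t \<partial>lborel) \<partial>lborel)"
    by (rule lborel_pair.Fubini') measurable
  also have "\<dots> = (\<integral>\<^sup>+(x::'a). 0 \<partial>lborel)"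
  proof (rule nn_integral_cong)
    fix x :: 'a
    have "(\<integral>\<^sup>+t. indicator E (x + t *\<^sub>R v) * indicator {0..1} t \<partial>lborel) \<le> (\<integral>\<^sup>+t. indicator {t. x + t *\<^sub>R v \<in> E} t \<partial>lborel)"
      by (intro nn_integral_mono) (auto simp: indicator_def)
    also have "\<dots> = 0" using lines[of x] by (auto simp: null_sets_def)
    finally show "(\<integral>\<^sup>+t. indicator E (x + t *\<^sub>R v) * indicator {0..1} t \<partial>lborel) = 0" by simp
  qed
  finally show ?thesis by auto
qed

text \<open>A limit along the fixed sequence \<open>1 / real (Suc n)\<close>, so that it is a Borel
  function of the point even where no derivative exists.\<close>

definition dirder :: "('a::real_normed_vector \<Rightarrow> real) \<Rightarrow> 'a \<Rightarrow> 'a \<Rightarrow> real" where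
  "dirder h v x = lim (\<lambda>n. real (Suc n) * (h (x + (1 / real (Suc n)) *\<^sub>R v) - h x))"

lemma dirder_measurable [measurable]:
  fixes h :: "'a::euclidean_space \<Rightarrow> real"
  assumes [measurable]: "h \<in> borel_measurable borel"
  shows "dirder h v \<in> borel_measurable borel"
  unfolding dirder_def by measurable

lemma dirder_tendsto:
  fixes h :: "'a::real_normed_vector \<Rightarrow> real"
  assumes "((\<lambda>t. h (x + t *\<^sub>R v)) has_real_derivative D) (at 0)"
  shows "(\<lambda>n. real (Suc n) * (h (x + (1 / real (Suc n)) *\<^sub>R v) - h x)) \<longlonglongrightarrow> D"
    and "dirder h v x = D"
proof -
  have "((\<lambda>t. (h (x + t *\<^sub>R v) - h x) / t) \<longlongrightarrow> D) (at 0)"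
    using assms by (simp add: DERIV_def)
  moreover have "filterlim (\<lambda>n. 1 / real (Suc n)) (at 0) sequentially"
    unfolding filterlim_at using LIMSEQ_Suc[OF lim_1_over_n] by (auto intro!: always_eventually)
  ultimately have "((\<lambda>n. (h (x + (1 / real (Suc n)) *\<^sub>R v) - h x) / (1 / real (Suc n))) \<longlongrightarrow> D) sequentially"
    by (rule filterlim_compose)
  then show *: "(\<lambda>n. real (Suc n) * (h (x + (1 / real (Suc n)) *\<^sub>R v) - h x)) \<longlonglongrightarrow> D"
    by (simp add: mult.commute)
  then show "dirder h v x = D" unfolding dirder_def by (rule limI)
qed

lemma lipschitz_on_line:
  fixes h :: "'a::euclidean_space \<Rightarrow> real"
  assumes "L-lipschitz_on UNIV h"
  shows "(L * norm v)-lipschitz_on UNIV (\<lambda>t. h (x + t *\<^sub>R v))"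
proof (rule lipschitz_onI)
  show "dist (h (x + s *\<^sub>R v)) (h (x + t *\<^sub>R v)) \<le> L * norm v * dist s t" for s t
  proof -
    have "dist (x + s *\<^sub>R v) (x + t *\<^sub>R v) = \<bar>s - t\<bar> * norm v"
      by (simp add: dist_norm flip: scaleR_diff_left)
    then show ?thesis
      using lipschitz_onD[OF assms, of "x + s *\<^sub>R v" "x + t *\<^sub>R v"] by (simp add: dist_real_def mult_ac)
  qed
qed (use lipschitz_on_nonneg[OF assms] in simp)

text \<open>The points without derivative along \<open>v\<close> lie in countably many gap sets with
  rational endpoints, and each of these is null on every line parallel to \<open>v\<close>.\<close>

lemma AE_directional_derivative:
  fixes h :: "'a::euclidean_space \<Rightarrow> real"
  assumes L: "L-lipschitz_on UNIV h"
  shows "AE x in lborel. ((\<lambda>t. h (x + t *\<^sub>R v)) has_real_derivative dirder h v x) (at 0)"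
proof -
  define E where "E p q \<sigma> \<sigma>' = {x. upslope \<sigma> q (\<lambda>t. h (x + t *\<^sub>R v)) 0 \<and> upslope \<sigma>' (- p) (\<lambda>t. - h (x + t *\<^sub>R v)) 0}"
    for p q \<sigma> \<sigma>'
  have cont: "continuous_on UNIV h" using L by (rule lipschitz_on_continuous_on)
  have null: "E p q \<sigma> \<sigma>' \<in> null_sets lborel" if pq: "p < q" "\<sigma> \<in> {1, -1}" "\<sigma>' \<in> {1, -1}" for p q \<sigma> \<sigma>'
  proof (rule null_sets_of_null_lines[where v = v])
    have "E p q \<sigma> \<sigma>' = {x. upslope \<sigma> q (\<lambda>t. h (x + t *\<^sub>R v)) 0} \<inter> {x. upslope \<sigma>' (- p) (\<lambda>t. - h (x + t *\<^sub>R v)) 0}"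
      by (auto simp: E_def)
    then show "E p q \<sigma> \<sigma>' \<in> sets borel"
      using borel_upslope_line[OF cont, of \<sigma> q v] borel_upslope_line[of "\<lambda>x. - h x" \<sigma>' "- p" v] cont
      by (auto intro!: continuous_intros)
    fix x
    have "{t. x + t *\<^sub>R v \<in> E p q \<sigma> \<sigma>'} = {s. upslope \<sigma> q (\<lambda>t. h (x + t *\<^sub>R v)) s \<and> upslope \<sigma>' (- p) (\<lambda>t. - h (x + t *\<^sub>R v)) s}"
      by (simp add: E_def upslope_def algebra_simps)
    then show "{t. x + t *\<^sub>R v \<in> E p q \<sigma> \<sigma>'} \<in> null_sets lborel"
      using null_upslope_gap[OF lipschitz_on_line[OF L], of p q \<sigma> \<sigma>' x v] pq by simp
  qed
  have "AE x in lborel. \<forall>p\<in>\<rat>. \<forall>q\<in>\<rat>. \<forall>\<sigma>\<in>{1, -1}. \<forall>\<sigma>'\<in>{1, -1}. p < q \<longrightarrow> x \<notin> E p q \<sigma> \<sigma>'"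
    by (intro AE_ball_countable' countable_rat countable_finite AE_impI AE_not_in null) auto
  then show ?thesis
  proof eventually_elim
    fix x assume no: "\<forall>p\<in>\<rat>. \<forall>q\<in>\<rat>. \<forall>\<sigma>\<in>{1, -1}. \<forall>\<sigma>'\<in>{1, -1}. p < q \<longrightarrow> x \<notin> E p q \<sigma> \<sigma>'"
    have "\<exists>D. ((\<lambda>t. h (x + t *\<^sub>R v)) has_real_derivative D) (at 0)"
    proof (rule differentiable_of_no_gap[OF lipschitz_on_line[OF L]])
      fix p q \<sigma> \<sigma>' :: real assume "p \<in> \<rat>" "q \<in> \<rat>" "p < q" "\<sigma> \<in> {1, -1}" "\<sigma>' \<in> {1, -1}"
      then have "x \<notin> E p q \<sigma> \<sigma>'" using no by blast
      then show "\<not> (upslope \<sigma> q (\<lambda>t. h (x + t *\<^sub>R v)) 0 \<and> upslope \<sigma>' (- p) (\<lambda>t. - h (x + t *\<^sub>R v)) 0)"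
        by (simp add: E_def)
    qed
    then obtain D where "((\<lambda>t. h (x + t *\<^sub>R v)) has_real_derivative D) (at 0)" ..
    with dirder_tendsto(2)[OF this] show "((\<lambda>t. h (x + t *\<^sub>R v)) has_real_derivative dirder h v x) (at 0)" by simp
  qed
qed

lemma dirder_quotient_bound:
  fixes h :: "'a::euclidean_space \<Rightarrow> real"
  assumes "L-lipschitz_on UNIV h"
  shows "\<bar>real (Suc n) * (h (x + (1 / real (Suc n)) *\<^sub>R v) - h x)\<bar> \<le> L * norm v"
proof -
  have "\<bar>h (x + (1 / real (Suc n)) *\<^sub>R v) - h x\<bar> \<le> L * (norm v / real (Suc n))"
    using lipschitz_onD[OF assms, of "x + (1 / real (Suc n)) *\<^sub>R v" x] by (simp add: dist_norm)
  then have "real (Suc n) * \<bar>h (x + (1 / real (Suc n)) *\<^sub>R v) - h x\<bar> \<le> real (Suc n) * (L * (norm v / real (Suc n)))"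
    by (intro mult_left_mono) auto
  then show ?thesis by (simp add: abs_mult del: of_nat_Suc)
qed

text \<open>With \<open>B\<close> bounding \<open>u\<close>, Lebesgue measure with density
  \<open>1 + u x / B\<close> agrees with Lebesgue measure on boxes, hence everywhere; uniqueness of
  densities gives \<open>u = 0\<close>.\<close>

lemma AE_eq_0_of_box_integrals:
  fixes u :: "'a::euclidean_space \<Rightarrow> real"
  assumes [measurable]: "u \<in> borel_measurable borel" and bd: "AE x in lborel. \<bar>u x\<bar> \<le> M"
    and zero: "\<And>a b. (\<integral>x. indicator (box a b) x * u x \<partial>lborel) = 0"
  shows "AE x in lborel. u x = 0"
proof -
  define B where "B = \<bar>M\<bar> + 1"
  have B: "B > 0" "AE x in lborel. \<bar>u x\<bar> \<le> B" using bd by (auto simp: B_def elim!: eventually_mono)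
  define w where "w x = ennreal (1 + u x / B)" for x
  have [measurable]: "w \<in> borel_measurable borel" unfolding w_def by measurable
  have nonneg: "AE x in lborel. 0 \<le> 1 + u x / B"
    using B(2)
  proof eventually_elim
    fix x assume "\<bar>u x\<bar> \<le> B"
    then have "- B / B \<le> u x / B" using B(1) by (intro divide_right_mono) auto
    then show "0 \<le> 1 + u x / B" using B(1) by simp
  qed
  have "lborel = density lborel w"
  proof (rule lborel_eqI)
    fix l v :: 'a assume lv: "\<And>b. b \<in> Basis \<Longrightarrow> l \<bullet> b \<le> v \<bullet> b"
    have bfin: "emeasure lborel (box l v) < \<infinity>" using emeasure_lborel_box_finite by auto
    have int1: "integrable lborel (\<lambda>x. indicator (box l v) x :: real)" using bfin by (intro integrable_real_indicator) auto
    have int2: "integrable lborel (\<lambda>x. indicator (box l v) x * u x)"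
    proof (rule Bochner_Integration.integrable_bound[OF integrable_mult_right[OF int1, of B]])
      show "AE x in lborel. norm (indicator (box l v) x * u x) \<le> norm (B * indicator (box l v) x)"
        using B(2) by eventually_elim (auto simp: indicator_def B_def)
    qed measurable
    have "emeasure (density lborel w) (box l v) = (\<integral>\<^sup>+x. ennreal (indicator (box l v) x + (1 / B) * (indicator (box l v) x * u x)) \<partial>lborel)"
      by (subst emeasure_density) (auto simp: w_def indicator_def intro!: nn_integral_cong)
    also have "\<dots> = ennreal (\<integral>x. indicator (box l v) x + (1 / B) * (indicator (box l v) x * u x) \<partial>lborel)"
      using nonneg by (intro nn_integral_eq_integral Bochner_Integration.integrable_add int1 integrable_mult_right int2)
         (auto simp: indicator_def elim!: eventually_mono)
    also have "(\<integral>x. indicator (box l v) x + (1 / B) * (indicator (box l v) x * u x) \<partial>lborel) = measure lborel (box l v)"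
      by (subst Bochner_Integration.integral_add[OF int1 integrable_mult_right[OF int2]]) (simp add: zero del: mult_eq_0_iff)
    also have "ennreal (measure lborel (box l v)) = emeasure lborel (box l v)"
      using bfin by (simp add: emeasure_eq_ennreal_measure less_top[symmetric])
    also have "\<dots> = (\<Prod>b\<in>Basis. (v - l) \<bullet> b)" using lv by (rule emeasure_lborel_box)
    finally show "emeasure (density lborel w) (box l v) = (\<Prod>b\<in>Basis. (v - l) \<bullet> b)" .
  qed simp
  then have "density lborel (\<lambda>_. 1) = density lborel w" by (simp add: density_1)
  then have "AE x in lborel. 1 = w x"
    by (subst (asm) sigma_finite_measure.density_unique_iff[OF sigma_finite_lborel]) auto
  with nonneg show ?thesis
  proof eventually_elim
    fix x assume "0 \<le> 1 + u x / B" "1 = w x"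
    then have "1 + u x / B = 1" by (simp add: w_def ennreal_eq_1)
    then show "u x = 0" using B(1) by simp
  qed
qed

text \<open>Off the boundary of the box, which is null, the indicator is locally constant.\<close>

lemma tendsto_indicator_box_shift:
  fixes w :: "'a::euclidean_space"
  shows "AE x in lborel. (\<lambda>n. indicator (box a b) (x - (1 / real (Suc n)) *\<^sub>R w) :: real) \<longlonglongrightarrow> indicator (box a b) x"
proof -
  have "frontier (box a b) \<in> null_sets lborel"
  proof -
    have "negligible (frontier (box a b))" by (intro negligible_convex_frontier) simp
    moreover have "frontier (box a b) \<in> sets borel" by (intro borel_closed) simp
    ultimately show ?thesis by (simp add: null_sets_completion_iff negligible_iff_null_sets)
  qed
  then have "AE x in lborel. x \<notin> frontier (box a b)" by (rule AE_not_in)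
  then show ?thesis
  proof eventually_elim
    fix x assume x: "x \<notin> frontier (box a b)"
    have lim: "(\<lambda>n. x - (1 / real (Suc n)) *\<^sub>R w) \<longlonglongrightarrow> x"
      using tendsto_diff[OF tendsto_const tendsto_scaleR[OF LIMSEQ_Suc[OF lim_1_over_n] tendsto_const], of x w] by simp
    have ev: "eventually (\<lambda>n. x - (1 / real (Suc n)) *\<^sub>R w \<in> S) sequentially" if "open S" "x \<in> S" for S
      using topological_tendstoD[OF lim that] .
    show "(\<lambda>n. indicator (box a b) (x - (1 / real (Suc n)) *\<^sub>R w) :: real) \<longlonglongrightarrow> indicator (box a b) x"
    proof (cases "x \<in> box a b")
      case True
      from ev[OF open_box this] show ?thesis
        by (intro tendsto_eventually) (auto elim!: eventually_mono simp: True)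
    next
      case False
      then have "x \<in> - closure (box a b)" using x interior_subset by (auto simp: frontier_def)
      from ev[OF open_Compl[OF closed_closure] this] show ?thesis
        by (intro tendsto_eventually) (auto elim!: eventually_mono simp: False indicator_def dest: closure_subset[THEN subsetD])
    qed
  qed
qed

text \<open>Additivity: translate the first of the two increments back by \<open>w/n\<close> under the integral over a box.\<close>
lemma AE_dirder_add:
  fixes h :: "'a::euclidean_space \<Rightarrow> real"
  assumes L: "L-lipschitz_on UNIV h"
  shows "AE x in lborel. dirder h (v + w) x = dirder h v x + dirder h w x"
proof -
  have L0: "L \<ge> 0" using L by (rule lipschitz_on_nonneg)
  have [measurable]: "h \<in> borel_measurable borel"
    using L by (intro borel_measurable_continuous_onI lipschitz_on_continuous_on)
  define Q where "Q v n x = real (Suc n) * (h (x + (1 / real (Suc n)) *\<^sub>R v) - h x)" for v x and n :: nat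
  have [measurable]: "Q v n \<in> borel_measurable borel" for v n unfolding Q_def by measurable
  have Qlim: "AE x in lborel. (\<lambda>n. Q v n x) \<longlonglongrightarrow> dirder h v x" for v
    using AE_directional_derivative[OF L, of v] unfolding Q_def by eventually_elim (rule dirder_tendsto)
  have Qb: "\<bar>Q v n x\<bar> \<le> L * norm v" for v n x unfolding Q_def by (rule dirder_quotient_bound[OF L])
  have db: "AE x in lborel. \<bar>dirder h v x\<bar> \<le> L * norm v" for v
    using Qlim[of v]
  proof eventually_elim
    fix x assume "(\<lambda>n. Q v n x) \<longlonglongrightarrow> dirder h v x"
    then have "(\<lambda>n. \<bar>Q v n x\<bar>) \<longlonglongrightarrow> \<bar>dirder h v x\<bar>" by (rule tendsto_rabs)
    then show "\<bar>dirder h v x\<bar> \<le> L * norm v" by (rule LIMSEQ_le_const2) (use Qb in auto)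
  qed
  define u where "u x = dirder h (v + w) x - (dirder h v x + dirder h w x)" for x
  have "AE x in lborel. u x = 0"
  proof (rule AE_eq_0_of_box_integrals[where M = "L * norm (v + w) + (L * norm v + L * norm w)"])
    show "u \<in> borel_measurable borel" unfolding u_def by measurable
    show "AE x in lborel. \<bar>u x\<bar> \<le> L * norm (v + w) + (L * norm v + L * norm w)"
      using db[of "v + w"] db[of v] db[of w] by eventually_elim (auto simp: u_def)
    fix a b :: 'a
    obtain R where R: "box a b \<subseteq> ball 0 R" "R > 0"
      using bounded_subset_ballD[OF bounded_box, of a b 0] by auto
    \<comment> \<open>A ball containing every translate of the box that occurs; it supplies the
      dominating functions.\<close>
    define D where "D = ball (0::'a) (R + norm w)"
    have Dfin: "integrable lborel (\<lambda>x. L * norm v' * indicator D x)" for v' :: 'a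
      unfolding D_def by (intro integrable_mult_right integrable_real_indicator) (use emeasure_lborel_ball_finite in auto)
    have boxD: "indicator (box a b) (x - s *\<^sub>R w) \<le> (indicator D x :: real)" if "0 \<le> s" "s \<le> 1" for x s
    proof (cases "x - s *\<^sub>R w \<in> box a b")
      case True
      then have "norm (x - s *\<^sub>R w) < R" using R by auto
      moreover have "norm (s *\<^sub>R w) \<le> norm w" using that by (simp add: mult_left_le_one_le)
      ultimately have "norm x < R + norm w" using norm_triangle_ineq2[of x "s *\<^sub>R w"] by linarith
      then show ?thesis by (simp add: D_def indicator_def)
    qed simp
    have I: "integrable lborel (\<lambda>x. indicator (box a b) (x - s *\<^sub>R w) * f x)"
      if [measurable]: "f \<in> borel_measurable borel" and "AE x in lborel. \<bar>f x\<bar> \<le> L * norm v'" "0 \<le> s" "s \<le> 1" for f s and v' :: 'a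
    proof (rule Bochner_Integration.integrable_bound[OF Dfin[of v']])
      show "AE x in lborel. norm (indicator (box a b) (x - s *\<^sub>R w) * f x) \<le> norm (L * norm v' * indicator D x)"
        using that(2)
      proof eventually_elim
        fix x assume "\<bar>f x\<bar> \<le> L * norm v'"
        then have "indicator (box a b) (x - s *\<^sub>R w) * \<bar>f x\<bar> \<le> indicator D x * (L * norm v')"
          using boxD[OF that(3,4), of x] L0 by (intro mult_mono) auto
        then show "norm (indicator (box a b) (x - s *\<^sub>R w) * f x) \<le> norm (L * norm v' * indicator D x)"
          using L0 by (simp add: abs_mult mult_ac)
      qed
    qed measurable
    have I0: "integrable lborel (\<lambda>x. indicator (box a b) x * f x)"
      if "f \<in> borel_measurable borel" "AE x in lborel. \<bar>f x\<bar> \<le> L * norm v'" for f and v' :: 'a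
      using I[OF that, of 0] by simp
    have lim: "(\<lambda>n. \<integral>x. indicator (box a b) (x - (1 / real (Suc n)) *\<^sub>R (s *\<^sub>R w)) * Q v' n x \<partial>lborel)
        \<longlonglongrightarrow> (\<integral>x. indicator (box a b) x * dirder h v' x \<partial>lborel)" if s: "0 \<le> s" "s \<le> 1" for v' s
    proof (rule integral_dominated_convergence[OF _ _ Dfin[of v']])
      show "AE x in lborel. (\<lambda>n. indicator (box a b) (x - (1 / real (Suc n)) *\<^sub>R (s *\<^sub>R w)) * Q v' n x) \<longlonglongrightarrow> indicator (box a b) x * dirder h v' x"
        using Qlim[of v'] tendsto_indicator_box_shift[of a b "s *\<^sub>R w"]
        by eventually_elim (rule tendsto_mult)
      show "AE x in lborel. norm (indicator (box a b) (x - (1 / real (Suc n)) *\<^sub>R (s *\<^sub>R w)) * Q v' n x) \<le> L * norm v' * indicator D x" for n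
      proof (rule AE_I2)
        fix x :: 'a
        have "indicator (box a b) (x - (s / real (Suc n)) *\<^sub>R w) * \<bar>Q v' n x\<bar> \<le> indicator D x * (L * norm v')"
          using boxD[of "s / real (Suc n)" x] s L0 Qb[of v' n x] by (intro mult_mono) (auto simp: field_simps)
        then show "norm (indicator (box a b) (x - (1 / real (Suc n)) *\<^sub>R (s *\<^sub>R w)) * Q v' n x) \<le> L * norm v' * indicator D x"
          by (simp add: abs_mult mult_ac)
      qed
    qed measurable
    \<comment> \<open>The quotient along \<open>v + w\<close> at \<open>x\<close> is the quotient
      along \<open>v\<close> at \<open>x + w/n\<close> plus the quotient along \<open>w\<close> at
      \<open>x\<close>, with \<open>Suc n\<close> for \<open>n\<close>; translation moves the shift
      from the quotient to the box, where it is harmless in the limit.\<close>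
    have split: "(\<integral>x. indicator (box a b) x * Q (v + w) n x \<partial>lborel) =
       (\<integral>x. indicator (box a b) (x - (1 / real (Suc n)) *\<^sub>R w) * Q v n x \<partial>lborel) + (\<integral>x. indicator (box a b) x * Q w n x \<partial>lborel)" for n
    proof -
      let ?s = "1 / real (Suc n)"
      have "(\<integral>x. indicator (box a b) (x - ?s *\<^sub>R w) * Q v n x \<partial>lborel)
          = (\<integral>x. indicator (box a b) (x - ?s *\<^sub>R w) * Q v n x \<partial>distr lborel borel ((+) (?s *\<^sub>R w)))"
        by (simp add: lborel_distr_plus)
      also have "\<dots> = (\<integral>x. indicator (box a b) x * Q v n (?s *\<^sub>R w + x) \<partial>lborel)"
        by (subst integral_distr) auto
      finally have 1: "(\<integral>x. indicator (box a b) (x - ?s *\<^sub>R w) * Q v n x \<partial>lborel) = (\<integral>x. indicator (box a b) x * Q v n (?s *\<^sub>R w + x) \<partial>lborel)" .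
      have "(\<integral>x. indicator (box a b) x * Q (v + w) n x \<partial>lborel) = (\<integral>x. indicator (box a b) x * Q v n (?s *\<^sub>R w + x) + indicator (box a b) x * Q w n x \<partial>lborel)"
        by (intro Bochner_Integration.integral_cong refl) (simp add: Q_def algebra_simps)
      also have "\<dots> = (\<integral>x. indicator (box a b) x * Q v n (?s *\<^sub>R w + x) \<partial>lborel) + (\<integral>x. indicator (box a b) x * Q w n x \<partial>lborel)"
        by (intro Bochner_Integration.integral_add I0[where v' = v] I0[where v' = w] AE_I2 Qb) measurable
      finally show ?thesis unfolding 1 .
    qed
    have "(\<lambda>n. \<integral>x. indicator (box a b) x * Q (v + w) n x \<partial>lborel) \<longlonglongrightarrow>
        (\<integral>x. indicator (box a b) x * dirder h v x \<partial>lborel) + (\<integral>x. indicator (box a b) x * dirder h w x \<partial>lborel)"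
      unfolding split using lim[of 1 v] lim[of 0 w] by (intro tendsto_add) simp_all
    moreover have "(\<lambda>n. \<integral>x. indicator (box a b) x * Q (v + w) n x \<partial>lborel) \<longlonglongrightarrow> (\<integral>x. indicator (box a b) x * dirder h (v + w) x \<partial>lborel)"
      using lim[of 0 "v + w"] by simp
    ultimately have "(\<integral>x. indicator (box a b) x * dirder h (v + w) x \<partial>lborel) =
        (\<integral>x. indicator (box a b) x * dirder h v x \<partial>lborel) + (\<integral>x. indicator (box a b) x * dirder h w x \<partial>lborel)"
      by (rule LIMSEQ_unique[THEN sym])
    also have "\<dots> = (\<integral>x. indicator (box a b) x * dirder h v x + indicator (box a b) x * dirder h w x \<partial>lborel)"
      by (intro Bochner_Integration.integral_add[symmetric] I0[OF _ db]) measurable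
    finally have "(\<integral>x. indicator (box a b) x * dirder h (v + w) x \<partial>lborel) - (\<integral>x. indicator (box a b) x * dirder h v x + indicator (box a b) x * dirder h w x \<partial>lborel) = 0"
      by simp
    moreover have "(\<integral>x. indicator (box a b) x * u x \<partial>lborel) = (\<integral>x. indicator (box a b) x * dirder h (v + w) x - (indicator (box a b) x * dirder h v x + indicator (box a b) x * dirder h w x) \<partial>lborel)"
      by (intro Bochner_Integration.integral_cong refl) (simp add: u_def algebra_simps)
    moreover have "\<dots> = (\<integral>x. indicator (box a b) x * dirder h (v + w) x \<partial>lborel) - (\<integral>x. indicator (box a b) x * dirder h v x + indicator (box a b) x * dirder h w x \<partial>lborel)"
      by (intro Bochner_Integration.integral_diff Bochner_Integration.integrable_add I0[OF _ db]) measurable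
    ultimately show "(\<integral>x. indicator (box a b) x * u x \<partial>lborel) = 0" by simp
  qed
  then show ?thesis by eventually_elim (simp add: u_def)
qed

text \<open>A total Borel function assembled from sequential limits; it is the derivative only
  almost everywhere.\<close>

definition grad :: "(real^'n::finite \<Rightarrow> real) \<Rightarrow> real^'n \<Rightarrow> real^'n" where
  "grad h x = (\<chi> i. dirder h (axis i 1) x)"

lemma grad_measurable [measurable]:
  fixes h :: "real^'n::finite \<Rightarrow> real"
  assumes [measurable]: "h \<in> borel_measurable borel"
  shows "grad h \<in> borel_measurable borel"
proof (rule borel_measurable_euclidean_space[THEN iffD2, rule_format])
  fix b :: "real^'n" assume "b \<in> Basis"
  then obtain i where "b = axis i 1" by (auto simp: Basis_vec_def)
  then have "(\<lambda>x. grad h x \<bullet> b) = dirder h (axis i 1)" by (simp add: grad_def inner_axis fun_eq_iff)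
  then show "(\<lambda>x. grad h x \<bullet> b) \<in> borel_measurable borel" by simp
qed

lemma AE_dirder_eq_grad:
  fixes h :: "real^'n::finite \<Rightarrow> real"
  assumes L: "L-lipschitz_on UNIV h"
  shows "AE x in lborel. dirder h v x = grad h x \<bullet> v"
proof -
  have scale: "AE x in lborel. dirder h (c *\<^sub>R axis i 1) x = c * dirder h (axis i 1) x" for c :: real and i
    using AE_directional_derivative[OF L, of "axis i 1"]
  proof eventually_elim
    fix x assume d: "((\<lambda>t. h (x + t *\<^sub>R axis i 1)) has_real_derivative dirder h (axis i 1) x) (at 0)"
    have "((\<lambda>t. h (x + (t * c) *\<^sub>R axis i 1)) has_real_derivative dirder h (axis i 1) x * c) (at 0)"
      by (rule DERIV_chain2[where f = "\<lambda>t. h (x + t *\<^sub>R axis i 1)" and g = "\<lambda>t. t * c"])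
         (use d in \<open>auto intro!: derivative_eq_intros\<close>)
    then show "dirder h (c *\<^sub>R axis i 1) x = c * dirder h (axis i 1) x"
      by (intro dirder_tendsto(2)) (simp add: mult.commute)
  qed
  have "AE x in lborel. dirder h (\<Sum>i\<in>S. v $ i *\<^sub>R axis i 1) x = (\<Sum>i\<in>S. v $ i * dirder h (axis i 1) x)" if "finite S" for S
    using that
  proof (induction S)
    case empty
    then show ?case by (simp add: dirder_def)
  next
    case (insert i S)
    from insert.IH AE_dirder_add[OF L, of "v $ i *\<^sub>R axis i 1" "\<Sum>i\<in>S. v $ i *\<^sub>R axis i 1"] scale[of "v $ i" i]
    show ?case by eventually_elim (use insert.hyps in simp)
  qed
  from this[of UNIV] have "AE x in lborel. dirder h (\<Sum>i\<in>UNIV. v $ i *\<^sub>R axis i 1) x = (\<Sum>i\<in>UNIV. v $ i * dirder h (axis i 1) x)" by simp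
  moreover have "(\<Sum>i\<in>UNIV. v $ i *\<^sub>R axis i 1) = v"
    using basis_expansion[of v] by (simp add: scalar_mult_eq_scaleR)
  ultimately show ?thesis by (simp add: grad_def inner_vec_def mult.commute)
qed

text \<open>Almost every point has derivatives in a countable dense set of directions, all given by
  \<open>grad\<close>. At such a point finitely many of these directions approximate the whole unit
  sphere, and the Lipschitz bound transfers their estimates to every direction at once.\<close>

theorem rademacher:
  fixes h :: "real^'n::finite \<Rightarrow> real"
  assumes L: "L-lipschitz_on UNIV h"
  shows "AE x in lborel. (h has_derivative (\<lambda>v. grad h x \<bullet> v)) (at x)"
proof -
  have L0: "L \<ge> 0" using L by (rule lipschitz_on_nonneg)
  obtain V :: "(real^'n) set" where V: "countable V" "\<And>X. open X \<Longrightarrow> X \<noteq> {} \<Longrightarrow> \<exists>d\<in>V. d \<in> X"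
    by (rule countable_dense_setE) blast
  have "AE x in lborel. \<forall>v\<in>V. ((\<lambda>t. h (x + t *\<^sub>R v)) has_real_derivative dirder h v x) (at 0) \<and> dirder h v x = grad h x \<bullet> v"
    by (intro AE_ball_countable' V(1) AE_conjI AE_directional_derivative[OF L] AE_dirder_eq_grad[OF L])
  then show ?thesis
  proof eventually_elim
    fix x assume x: "\<forall>v\<in>V. ((\<lambda>t. h (x + t *\<^sub>R v)) has_real_derivative dirder h v x) (at 0) \<and> dirder h v x = grad h x \<bullet> v"
    define G where "G = grad h x"
    show "(h has_derivative (\<lambda>v. grad h x \<bullet> v)) (at x)"
      unfolding has_derivative_at_alt G_def[symmetric]
    proof (intro conjI allI impI)
      show "bounded_linear ((\<bullet>) G)" by (rule bounded_linear_inner_right)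
      fix e :: real assume "e > 0"
      \<comment> \<open>Three errors share \<open>e\<close>: the difference quotient along the
        approximating direction, the Lipschitz change of \<open>h\<close>, and the change of
        \<open>G \<bullet> v\<close>.\<close>
      define \<epsilon> where "\<epsilon> = e / (1 + L + norm G)"
      have den: "1 + L + norm G > 0" using L0 by (simp add: add_pos_nonneg)
      have \<epsilon>: "\<epsilon> > 0" using \<open>e > 0\<close> den by (simp add: \<epsilon>_def)
      have "compact (sphere (0::real^'n) 1)" by (rule compact_sphere)
      then obtain V0 where V0: "V0 \<subseteq> V" "finite V0" "sphere (0::real^'n) 1 \<subseteq> (\<Union>v\<in>V0. ball v \<epsilon>)"
      proof (rule compactE_image)
        show "sphere (0::real^'n) 1 \<subseteq> (\<Union>v\<in>V. ball v \<epsilon>)"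
        proof
          fix w :: "real^'n"
          obtain d where "d \<in> V" "d \<in> ball w \<epsilon>" using V(2)[of "ball w \<epsilon>"] \<epsilon> by auto
          then show "w \<in> (\<Union>v\<in>V. ball v \<epsilon>)" by (auto simp: dist_commute)
        qed
      qed auto
      have "\<exists>\<delta>>0. \<forall>t. 0 < t \<and> t < \<delta> \<longrightarrow> \<bar>h (x + t *\<^sub>R v) - h x - t * (G \<bullet> v)\<bar> \<le> \<epsilon> * t" if "v \<in> V" for v
      proof -
        have "((\<lambda>t. h (x + t *\<^sub>R v)) has_real_derivative G \<bullet> v) (at 0)"
          using bspec[OF x that] by (auto simp: G_def)
        then have "((\<lambda>t. (h (x + t *\<^sub>R v) - h x) / t) \<longlongrightarrow> G \<bullet> v) (at 0)" by (simp add: DERIV_def)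
        from tendstoD[OF this \<epsilon>] obtain \<delta> where \<delta>: "\<delta> > 0"
            "\<And>t. t \<noteq> 0 \<Longrightarrow> dist t 0 < \<delta> \<Longrightarrow> dist ((h (x + t *\<^sub>R v) - h x) / t) (G \<bullet> v) < \<epsilon>"
          by (auto simp: eventually_at)
        show ?thesis
        proof (intro exI[of _ \<delta>] conjI allI impI \<delta>(1))
          fix t assume t: "0 < t \<and> t < \<delta>"
          have "(h (x + t *\<^sub>R v) - h x) / t - G \<bullet> v = (h (x + t *\<^sub>R v) - h x - t * (G \<bullet> v)) / t"
            using t by (simp add: field_simps)
          then have "\<bar>h (x + t *\<^sub>R v) - h x - t * (G \<bullet> v)\<bar> / t < \<epsilon>"
            using \<delta>(2)[of t] t by (simp add: dist_real_def)
          then show "\<bar>h (x + t *\<^sub>R v) - h x - t * (G \<bullet> v)\<bar> \<le> \<epsilon> * t" using t by (simp add: pos_divide_less_eq)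
        qed
      qed
      then obtain \<delta> where \<delta>: "\<And>v. v \<in> V \<Longrightarrow> \<delta> v > 0"
          "\<And>v t. v \<in> V \<Longrightarrow> 0 < t \<Longrightarrow> t < \<delta> v \<Longrightarrow> \<bar>h (x + t *\<^sub>R v) - h x - t * (G \<bullet> v)\<bar> \<le> \<epsilon> * t"
        by metis
      define d where "d = Min (insert 1 (\<delta> ` V0))"
      have d: "d > 0" using V0 \<delta>(1) by (auto simp: d_def)
      have d': "d \<le> \<delta> v" if "v \<in> V0" for v unfolding d_def using V0 that by (intro Min_le) auto
      show "\<exists>d>0. \<forall>y. norm (y - x) < d \<longrightarrow> norm (h y - h x - G \<bullet> (y - x)) \<le> e * norm (y - x)"
      proof (intro exI[of _ d] conjI allI impI d)
        fix y assume y: "norm (y - x) < d"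
        show "norm (h y - h x - G \<bullet> (y - x)) \<le> e * norm (y - x)"
        proof (cases "y = x")
          case False
          define t where "t = norm (y - x)"
          have t: "t > 0" using False by (simp add: t_def)
          define w where "w = (1 / t) *\<^sub>R (y - x)"
          have w: "norm w = 1" "y = x + t *\<^sub>R w" using t by (simp_all add: w_def t_def)
          then obtain v where v: "v \<in> V0" "dist v w < \<epsilon>" using V0(3) by (auto simp: subset_iff)
          have 1: "\<bar>h (x + t *\<^sub>R v) - h x - t * (G \<bullet> v)\<bar> \<le> \<epsilon> * t"
            using \<delta>(2)[of v t] v V0(1) t y d'[of v] by (auto simp: t_def)
          have "norm (t *\<^sub>R w - t *\<^sub>R v) = t * dist v w"
            using t by (simp add: dist_norm norm_minus_commute flip: scaleR_diff_right)
          then have "\<bar>h y - h (x + t *\<^sub>R v)\<bar> \<le> L * (t * dist v w)"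
            using lipschitz_onD[OF L, of "x + t *\<^sub>R w" "x + t *\<^sub>R v"] w(2) by (simp add: dist_norm)
          also have "\<dots> \<le> L * (t * \<epsilon>)" using L0 t v by (intro mult_left_mono) auto
          finally have 2: "\<bar>h y - h (x + t *\<^sub>R v)\<bar> \<le> L * \<epsilon> * t" by (simp add: mult_ac)
          have "\<bar>G \<bullet> (v - w)\<bar> \<le> norm G * norm (v - w)" by (rule Cauchy_Schwarz_ineq2)
          also have "\<dots> \<le> norm G * \<epsilon>" using v by (intro mult_left_mono) (auto simp: dist_norm)
          finally have "\<bar>t * (G \<bullet> v) - G \<bullet> (y - x)\<bar> \<le> t * (norm G * \<epsilon>)"
            using t w(2) by (simp add: inner_diff_right abs_mult flip: right_diff_distrib)
          then have "\<bar>h y - h x - G \<bullet> (y - x)\<bar> \<le> L * \<epsilon> * t + \<epsilon> * t + t * (norm G * \<epsilon>)"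
            using 1 2 by linarith
          also have "\<dots> = \<epsilon> * (1 + L + norm G) * t" by (simp add: algebra_simps)
          also have "\<epsilon> * (1 + L + norm G) = e" using den by (simp add: \<epsilon>_def)
          finally show ?thesis by (simp add: t_def)
        qed simp
      qed
    qed
  qed
qed

section \<open>The area formula for Lipschitz graphs\<close>

text \<open>Removes the distortion factors of nearly isometric pieces in the limit.\<close>

lemma ennreal_le_of_scaled:
  fixes X Y :: ennreal
  assumes "\<And>\<epsilon>. \<epsilon> > 0 \<Longrightarrow> X \<le> ennreal ((1 + \<epsilon>) powr k) * Y"
  shows "X \<le> Y"
proof (cases "Y = \<infinity>")
  case False
  then obtain y where y: "Y = ennreal y" "y \<ge> 0" by (cases Y) auto
  have "(\<lambda>n. ennreal ((1 + 1 / real (Suc n)) powr k * y)) \<longlonglongrightarrow> ennreal ((1 + 0) powr k * y)"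
    by (intro tendsto_ennrealI tendsto_intros LIMSEQ_Suc[OF lim_1_over_n]) auto
  moreover have "X \<le> ennreal ((1 + 1 / real (Suc n)) powr k * y)" for n
    using assms[of "1 / real (Suc n)"] y by (simp add: ennreal_mult)
  ultimately have "X \<le> ennreal ((1 + 0) powr k * y)" by (intro LIMSEQ_le_const) auto
  then show ?thesis using y by simp
qed simp

text \<open>\<open>sqrt (1 + s\<^sup>2)\<close> is the modulus of \<open>Complex 1 s\<close>, so
  this is the reverse triangle inequality.\<close>

lemma abs_sqrt_one_plus_le: "\<bar>sqrt (1 + s\<^sup>2) - sqrt (1 + t\<^sup>2)\<bar> \<le> \<bar>s - t\<bar>" for s t :: real
proof -
  have "norm (Complex 1 s) - norm (Complex 1 t) \<le> norm (Complex 1 s - Complex 1 t)"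
       "norm (Complex 1 t) - norm (Complex 1 s) \<le> norm (Complex 1 t - Complex 1 s)"
    by (rule norm_triangle_ineq2)+
  moreover have "norm (Complex 1 s - Complex 1 t) = \<bar>s - t\<bar>" "norm (Complex 1 t - Complex 1 s) = \<bar>s - t\<bar>"
    by (auto simp: cmod_def)
  ultimately show ?thesis by (simp add: cmod_def abs_le_iff)
qed

section \<open>Lipschitz graphs over a hyperplane\<close>

text \<open>The graph function is defined on the whole space and constant along \<open>e\<close>, in
  place of a function on the hyperplane orthogonal to \<open>e\<close>. Everything can then be
  integrated against Lebesgue measure of the full space, and \<open>flat\<close> compares the result
  with Hausdorff measure through the constant \<open>c\<close>.\<close>

locale lipschitz_graph =
  fixes e :: "real^'n::finite" and h :: "real^'n \<Rightarrow> real" and L c :: real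
  assumes norm_e: "norm e = 1" and lip: "L-lipschitz_on UNIV h" and inv: "\<And>y t. h (y + t *\<^sub>R e) = h y"
    and c0: "c \<ge> 0"
    and flat: "\<And>a F. a \<bullet> e = 0 \<Longrightarrow> F \<in> sets borel \<Longrightarrow>
     hausdorff (real CARD('n) - 1) (F \<inter> {z. z \<bullet> e = a \<bullet> z})
      = ennreal (c * sqrt (1 + (norm a)\<^sup>2)) * emeasure lborel {y. 0 < y \<bullet> e \<and> y \<bullet> e < 1 \<and> y + (a \<bullet> y - y \<bullet> e) *\<^sub>R e \<in> F}"
begin

abbreviation "G \<equiv> grad h"
definition J :: "real^'n \<Rightarrow> real" where "J y = sqrt (1 + (norm (G y))\<^sup>2)"
definition P :: "real^'n \<Rightarrow> real^'n" where "P y = y + (h y - y \<bullet> e) *\<^sub>R e"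
definition Q :: "real^'n \<Rightarrow> real^'n" where "Q y = y - (y \<bullet> e) *\<^sub>R e"
definition \<Gamma> :: "(real^'n) set" where "\<Gamma> = {x. x \<bullet> e = h x}"
text \<open>Thickness one: for functions constant along \<open>e\<close>, integration over the slab
  is integration over the hyperplane orthogonal to \<open>e\<close>.\<close>

definition slab :: "(real^'n) set" where "slab = {y. 0 < y \<bullet> e \<and> y \<bullet> e < 1}"
definition Dh :: "(real^'n) set" where "Dh = {y. (h has_derivative (\<lambda>v. G y \<bullet> v)) (at y)}"
text \<open>Cylinders along \<open>e\<close>. A decomposition of the hyperplane is expressed as one
  into such sets, and projecting along \<open>e\<close> does not leave them.\<close>

definition invt :: "(real^'n) set \<Rightarrow> bool" where "invt S \<longleftrightarrow> (\<forall>y t. y + t *\<^sub>R e \<in> S \<longleftrightarrow> y \<in> S)"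

lemma L0: "L \<ge> 0" using lip by (rule lipschitz_on_nonneg)

lemma ee: "e \<bullet> e = 1" using norm_e by (simp add: dot_square_norm)

lemma cont_h: "continuous_on UNIV h" using lip by (rule lipschitz_on_continuous_on)

lemma h_meas [measurable]: "h \<in> borel_measurable borel"
  using cont_h by (rule borel_measurable_continuous_onI)

lemma cont_P: "continuous_on UNIV P"
  unfolding P_def by (intro continuous_intros cont_h)

lemma P_meas [measurable]: "P \<in> borel_measurable borel"
  using cont_P by (rule borel_measurable_continuous_onI)

lemma J_meas [measurable]: "J \<in> borel_measurable borel"
  unfolding J_def by measurable

lemma J_ge_1: "J y \<ge> 1" by (simp add: J_def)

lemma closed_\<Gamma>: "closed \<Gamma>"
  unfolding \<Gamma>_def by (intro closed_Collect_eq continuous_intros cont_h)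

lemma open_slab: "open slab"
proof -
  have "slab = {y. 0 < y \<bullet> e} \<inter> {y. y \<bullet> e < 1}" by (auto simp: slab_def)
  then show ?thesis by (auto intro!: open_Int open_Collect_less continuous_intros)
qed

lemma slab_meas [measurable]: "slab \<in> sets borel" using open_slab by simp
lemma \<Gamma>_meas [measurable]: "\<Gamma> \<in> sets borel" using closed_\<Gamma> by (rule borel_closed)

lemma h_Q: "h (Q y) = h y" using inv[of y "- (y \<bullet> e)"] by (simp add: Q_def)
lemma h_P: "h (P y) = h y" using inv by (simp add: P_def)
lemma P_dot: "P y \<bullet> e = h y" by (simp add: P_def inner_add_left ee)
lemma P_in: "P y \<in> \<Gamma>" by (simp add: \<Gamma>_def P_dot h_P)
lemma P_\<Gamma>: "x \<in> \<Gamma> \<Longrightarrow> P x = x" by (simp add: P_def \<Gamma>_def)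
lemma P_inv: "P (y + t *\<^sub>R e) = P y" by (simp add: P_def inv inner_add_left ee algebra_simps)
lemma P_Q: "P y = Q y + h y *\<^sub>R e" by (simp add: P_def Q_def algebra_simps)
lemma G_inv: "G (y + t *\<^sub>R e) = G y"
proof -
  have "h (y + t *\<^sub>R e + v) = h (y + v)" for v using inv[of "y + v" t] by (simp add: algebra_simps)
  then show ?thesis by (simp add: grad_def dirder_def inv)
qed
lemma G_P: "G (P y) = G y" by (simp add: P_def G_inv)
lemma J_P: "J (P y) = J y" by (simp add: J_def G_P)
lemma Q_diff: "Q y - Q z = Q (y - z)" by (simp add: Q_def algebra_simps inner_diff_left)
lemma Q_perp: "Q y \<bullet> e = 0" by (simp add: Q_def inner_diff_left ee)

lemma norm_Q_add: "(norm (Q y + t *\<^sub>R e))\<^sup>2 = (norm (Q y))\<^sup>2 + t\<^sup>2"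
proof -
  have "e \<bullet> Q y = 0" using Q_perp[of y] by (simp only: inner_commute)
  then show ?thesis unfolding power2_norm_eq_inner
    by (simp add: inner_add_left inner_add_right Q_perp ee power2_eq_square)
qed

lemma norm_Q_le_add: "norm (Q y) \<le> norm (Q y + t *\<^sub>R e)"
  by (rule power2_le_imp_le) (simp_all add: norm_Q_add)

lemma norm_Q_le: "norm (Q y) \<le> norm y"
  using norm_Q_le_add[of y "y \<bullet> e"] by (simp add: Q_def)

lemma invt_D: "invt S \<Longrightarrow> y + t *\<^sub>R e \<in> S \<longleftrightarrow> y \<in> S" by (simp add: invt_def)
lemma invt_P: "invt S \<Longrightarrow> P y \<in> S \<longleftrightarrow> y \<in> S" by (simp add: P_def invt_D)
lemma invt_Q: "invt S \<Longrightarrow> Q y \<in> S \<longleftrightarrow> y \<in> S" using invt_D[of S y "- (y \<bullet> e)"] by (simp add: Q_def)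

lemma h_shift: "h (y + t *\<^sub>R e + w) = h (y + w)"
  using inv[of "y + w" t] by (simp add: algebra_simps)

lemma Dh_iff: "y \<in> Dh \<longleftrightarrow> (\<forall>\<epsilon>>0. \<exists>d>0. \<forall>w::real^'n. norm w < d \<longrightarrow> \<bar>h (y + w) - h y - G y \<bullet> w\<bar> \<le> \<epsilon> * norm w)"
proof -
  have "(\<forall>z. norm (z - y) < d \<longrightarrow> norm (h z - h y - G y \<bullet> (z - y)) \<le> \<epsilon> * norm (z - y))
      \<longleftrightarrow> (\<forall>w. norm w < d \<longrightarrow> \<bar>h (y + w) - h y - G y \<bullet> w\<bar> \<le> \<epsilon> * norm w)" for d \<epsilon>
  proof (intro iffI allI impI)
    fix w :: "real^'n" assume "\<forall>z. norm (z - y) < d \<longrightarrow> norm (h z - h y - G y \<bullet> (z - y)) \<le> \<epsilon> * norm (z - y)" "norm w < d"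
    from this(1)[rule_format, of "y + w"] this(2) show "\<bar>h (y + w) - h y - G y \<bullet> w\<bar> \<le> \<epsilon> * norm w" by simp
  next
    fix z assume "\<forall>w. norm w < d \<longrightarrow> \<bar>h (y + w) - h y - G y \<bullet> w\<bar> \<le> \<epsilon> * norm w" "norm (z - y) < d"
    from this(1)[rule_format, of "z - y"] this(2) show "norm (h z - h y - G y \<bullet> (z - y)) \<le> \<epsilon> * norm (z - y)" by simp
  qed
  then show ?thesis
    unfolding Dh_def mem_Collect_eq has_derivative_at_alt by (simp add: bounded_linear_inner_right)
qed

lemma invt_Dh: "invt Dh"
  unfolding invt_def Dh_iff by (simp add: h_shift inv G_inv)

lemma G_perp:
  assumes "y \<in> Dh"
  shows "G y \<bullet> e = 0"
proof -
  have "\<bar>G y \<bullet> e\<bar> \<le> 0 + \<epsilon>" if eps: "\<epsilon> > 0" for \<epsilon>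
  proof -
    obtain d where d: "d > 0" "\<And>w. norm w < d \<Longrightarrow> \<bar>h (y + w) - h y - G y \<bullet> w\<bar> \<le> \<epsilon> * norm w"
      using assms[unfolded Dh_iff, rule_format, OF eps] by blast
    have "\<bar>h (y + (d/2) *\<^sub>R e) - h y - G y \<bullet> ((d/2) *\<^sub>R e)\<bar> \<le> \<epsilon> * norm ((d/2) *\<^sub>R e)"
      using d(1) norm_e by (intro d(2)) simp
    then have "(d/2) * \<bar>G y \<bullet> e\<bar> \<le> (d/2) * \<epsilon>" using d(1) norm_e by (simp add: inv abs_mult mult.commute)
    then show ?thesis using d(1) by simp
  qed
  then have "\<bar>G y \<bullet> e\<bar> \<le> 0" by (rule field_le_epsilon)
  then show ?thesis by simp
qed

text \<open>The defining estimate need only be tested on increments from a countable dense set;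
  continuity of \<open>h\<close> extends it to all increments.\<close>

lemma Dh_meas [measurable]: "Dh \<in> sets borel"
proof -
  obtain W :: "(real^'n) set" where W: "countable W" "\<And>X. open X \<Longrightarrow> X \<noteq> {} \<Longrightarrow> \<exists>d\<in>W. d \<in> X"
    by (rule countable_dense_setE) blast
  have that_pos: "1 / real (Suc m) > 0" for m by simp
  define S where "S m j = (\<Inter>w\<in>{w\<in>W. norm w < 1 / real (Suc j)}. {y. \<bar>h (y + w) - h y - G y \<bullet> w\<bar> \<le> 1 / real (Suc m) * norm w})" for m j :: nat
  have "{y. \<bar>h (y + w) - h y - G y \<bullet> w\<bar> \<le> r} \<in> sets borel" for w r
    by measurable
  then have "S m j \<in> sets borel" for m j unfolding S_def
    by (intro sets.countable_INT'') (use W(1) in auto)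
  then have "(\<Inter>m. \<Union>j. S m j) \<in> sets borel" by (intro sets.countable_INT'' sets.countable_UN'') auto
  moreover have "Dh = (\<Inter>m. \<Union>j. S m j)"
  proof (intro equalityI subsetI INT_I)
    fix y and m :: nat assume "y \<in> Dh"
    then obtain d where d: "d > 0" "\<And>w. norm w < d \<Longrightarrow> \<bar>h (y + w) - h y - G y \<bullet> w\<bar> \<le> 1 / real (Suc m) * norm w"
      unfolding Dh_iff using that_pos[of m] by blast
    obtain j where "1 / real (Suc j) < d" using nat_approx_posE[OF d(1)] by auto
    then have "y \<in> S m j" unfolding S_def using d(2) by auto
    then show "y \<in> (\<Union>j. S m j)" by blast
  next
    fix y assume y: "y \<in> (\<Inter>m. \<Union>j. S m j)"
    show "y \<in> Dh" unfolding Dh_iff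
    proof (intro allI impI)
      fix \<epsilon> :: real assume "\<epsilon> > 0"
      then obtain m where m: "1 / real (Suc m) < \<epsilon>" using nat_approx_posE by auto
      obtain j where j: "y \<in> S m j" using y by blast
      show "\<exists>d>0. \<forall>w. norm w < d \<longrightarrow> \<bar>h (y + w) - h y - G y \<bullet> w\<bar> \<le> \<epsilon> * norm w"
      proof (intro exI[of _ "1 / real (Suc j)"] conjI allI impI)
        fix w :: "real^'n" assume w: "norm w < 1 / real (Suc j)"
        have "\<bar>h (y + w) - h y - G y \<bullet> w\<bar> \<le> 1 / real (Suc m) * norm w"
        proof (rule ccontr)
          assume "\<not> ?thesis"
          then have wX: "w \<in> {w. 1 / real (Suc m) * norm w < \<bar>h (y + w) - h y - G y \<bullet> w\<bar>} \<inter> ball 0 (1 / real (Suc j))"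
            using w by simp
          have "open ({w. 1 / real (Suc m) * norm w < \<bar>h (y + w) - h y - G y \<bullet> w\<bar>} \<inter> ball 0 (1 / real (Suc j)))"
            by (intro open_Int open_ball open_Collect_less continuous_intros continuous_on_compose2[OF cont_h]) auto
          from W(2)[OF this] wX obtain v where "v \<in> W" "v \<in> {w. 1 / real (Suc m) * norm w < \<bar>h (y + w) - h y - G y \<bullet> w\<bar>} \<inter> ball 0 (1 / real (Suc j))"
            by blast
          then have v: "v \<in> W" "1 / real (Suc m) * norm v < \<bar>h (y + v) - h y - G y \<bullet> v\<bar>" "norm v < 1 / real (Suc j)"
            by auto
          have "\<bar>h (y + v) - h y - G y \<bullet> v\<bar> \<le> 1 / real (Suc m) * norm v" using j v unfolding S_def by blast
          then show False using v(2) by simp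
        qed
        also have "\<dots> \<le> \<epsilon> * norm w" using m by (intro mult_right_mono) auto
        finally show "\<bar>h (y + w) - h y - G y \<bullet> w\<bar> \<le> \<epsilon> * norm w" .
      qed simp
    qed
  qed
  ultimately show ?thesis by simp
qed

lemma AE_Dh: "AE y in lborel. y \<in> Dh"
  using rademacher[OF lip] by (simp add: Dh_def)

lemma card_ge_1: "real CARD('n) - 1 \<ge> 0"
  by (simp add: Suc_leI)

text \<open>On a piece where \<open>h\<close> is \<open>\<epsilon>\<close>-close to the linear function \<open>a\<close> in the Lipschitz sense, the graph is
  \<open>(1 + \<epsilon>)\<close>-bi-Lipschitz to a piece of the hyperplane \<open>z \<bullet> e = a \<bullet> z\<close>.\<close>
lemma piece_bounds:
  assumes a: "a \<bullet> e = 0" and \<epsilon>: "\<epsilon> > 0" and B [measurable]: "B \<in> sets borel" and iB: "invt B"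
    and lin: "\<And>y z. y \<in> B \<Longrightarrow> z \<in> B \<Longrightarrow> \<bar>h y - h z - a \<bullet> (y - z)\<bar> \<le> \<epsilon> * norm (Q y - Q z)"
    and Ga: "\<And>y. y \<in> B \<Longrightarrow> norm (G y - a) \<le> \<epsilon>"
  shows "hausdorff (real CARD('n) - 1) (\<Gamma> \<inter> B) \<le> ennreal ((1 + \<epsilon>) powr real CARD('n)) * (\<integral>\<^sup>+y. ennreal (c * J y) * indicator (slab \<inter> B) y \<partial>lborel)"
    and "(\<integral>\<^sup>+y. ennreal (c * J y) * indicator (slab \<inter> B) y \<partial>lborel) \<le> ennreal ((1 + \<epsilon>) powr real CARD('n)) * hausdorff (real CARD('n) - 1) (\<Gamma> \<inter> B)"
proof -
  let ?s = "real CARD('n) - 1"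
  define A where "A = sqrt (1 + (norm a)\<^sup>2)"
  have A1: "A \<ge> 1" by (simp add: A_def)
  \<comment> \<open>Projection along \<open>e\<close> onto the hyperplane \<open>Hp\<close>, the
    flat counterpart of \<open>P\<close>; the two are mutually inverse between the graph and
    \<open>Hp\<close>.\<close>
  define Pa where "Pa y = y + (a \<bullet> y - y \<bullet> e) *\<^sub>R e" for y
  define Hp where "Hp = {z. z \<bullet> e = a \<bullet> z}"
  have ae: "a \<bullet> e = 0" "e \<bullet> a = 0" using a by (auto simp: inner_commute)
  have PaB: "Pa y \<in> B \<longleftrightarrow> y \<in> B" for y unfolding Pa_def by (rule invt_D[OF iB])
  have PaHp: "Pa y \<in> Hp" for y by (simp add: Pa_def Hp_def inner_add_left inner_add_right ee ae)
  have PPa: "Pa (P z) = z" if "z \<in> Hp" for z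
    using that by (simp add: Pa_def P_def Hp_def inner_add_left inner_add_right ee ae algebra_simps)
  have PaP: "P (Pa x) = x" if "x \<in> \<Gamma>" for x
    unfolding Pa_def P_inv using that by (rule P_\<Gamma>)
  have HHp: "hausdorff ?s (Hp \<inter> B) = ennreal (c * A) * emeasure lborel (slab \<inter> B)"
  proof -
    have "{y. 0 < y \<bullet> e \<and> y \<bullet> e < 1 \<and> y + (a \<bullet> y - y \<bullet> e) *\<^sub>R e \<in> B} = slab \<inter> B"
      using PaB by (auto simp: slab_def Pa_def)
    then show ?thesis using flat[OF a B] by (simp add: Hp_def A_def Int_commute)
  qed
  have img1: "Pa ` (\<Gamma> \<inter> B) = Hp \<inter> B"
  proof (intro equalityI subsetI)
    fix z assume "z \<in> Hp \<inter> B"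
    then have "z = Pa (P z)" "P z \<in> \<Gamma> \<inter> B" using PPa P_in invt_P[OF iB] by auto
    then show "z \<in> Pa ` (\<Gamma> \<inter> B)" by blast
  qed (use PaB PaHp in auto)
  have img2: "P ` (Hp \<inter> B) = \<Gamma> \<inter> B"
  proof (intro equalityI subsetI)
    fix x assume "x \<in> \<Gamma> \<inter> B"
    then have "x = P (Pa x)" "Pa x \<in> Hp \<inter> B" using PaP PaHp PaB by auto
    then show "x \<in> P ` (Hp \<inter> B)" by blast
  qed (use invt_P[OF iB] P_in in auto)
  have lip1: "(1 + \<epsilon>)-lipschitz_on (\<Gamma> \<inter> B) Pa"
  proof (rule lipschitz_onI)
    fix x z assume xz: "x \<in> \<Gamma> \<inter> B" "z \<in> \<Gamma> \<inter> B"
    have "Pa x - Pa z = (x - z) + - (h x - h z - a \<bullet> (x - z)) *\<^sub>R e"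
      using xz by (simp add: Pa_def \<Gamma>_def algebra_simps inner_diff_right)
    then have "dist (Pa x) (Pa z) \<le> norm (x - z) + \<bar>h x - h z - a \<bullet> (x - z)\<bar>"
      using norm_triangle_ineq[of "x - z" "- (h x - h z - a \<bullet> (x - z)) *\<^sub>R e"] norm_e by (simp add: dist_norm)
    also have "\<dots> \<le> norm (x - z) + \<epsilon> * norm (x - z)"
      using lin[of x z] xz norm_Q_le[of "x - z"] \<epsilon> by (intro add_left_mono order_trans[OF lin]) (auto simp: Q_diff)
    finally show "dist (Pa x) (Pa z) \<le> (1 + \<epsilon>) * dist x z" by (simp add: dist_norm algebra_simps)
  qed (use \<epsilon> in simp)
  have lip2: "(1 + \<epsilon>)-lipschitz_on (Hp \<inter> B) P"
  proof (rule lipschitz_onI)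
    fix x z assume xz: "x \<in> Hp \<inter> B" "z \<in> Hp \<inter> B"
    have "P x - P z = (x - z) + (h x - h z - a \<bullet> (x - z)) *\<^sub>R e"
      using xz by (simp add: P_def Hp_def algebra_simps inner_diff_right)
    then have "dist (P x) (P z) \<le> norm (x - z) + \<bar>h x - h z - a \<bullet> (x - z)\<bar>"
      using norm_triangle_ineq[of "x - z" "(h x - h z - a \<bullet> (x - z)) *\<^sub>R e"] norm_e by (simp add: dist_norm)
    also have "\<dots> \<le> norm (x - z) + \<epsilon> * norm (x - z)"
      using lin[of x z] xz norm_Q_le[of "x - z"] \<epsilon> by (intro add_left_mono order_trans[OF lin]) (auto simp: Q_diff)
    finally show "dist (P x) (P z) \<le> (1 + \<epsilon>) * dist x z" by (simp add: dist_norm algebra_simps)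
  qed (use \<epsilon> in simp)
  \<comment> \<open>Both area factors are at least one, which turns the additive error
    \<open>\<epsilon>\<close> into a multiplicative one.\<close>
  have JA: "A \<le> (1 + \<epsilon>) * J y" "J y \<le> (1 + \<epsilon>) * A" if "y \<in> B" for y
  proof -
    have "\<bar>J y - A\<bar> \<le> \<bar>norm (G y) - norm a\<bar>" unfolding J_def A_def by (rule abs_sqrt_one_plus_le)
    also have "\<dots> \<le> \<epsilon>" using Ga[OF that] norm_triangle_ineq3[of "G y" a] by linarith
    finally have "A \<le> J y + \<epsilon> * 1" "J y \<le> A + \<epsilon> * 1" by auto
    moreover have "\<epsilon> * 1 \<le> \<epsilon> * J y" "\<epsilon> * 1 \<le> \<epsilon> * A" using \<epsilon> J_ge_1[of y] A1 by (auto intro!: mult_left_mono)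
    ultimately show "A \<le> (1 + \<epsilon>) * J y" "J y \<le> (1 + \<epsilon>) * A" by (simp_all add: algebra_simps)
  qed
  \<comment> \<open>The exponent is the dimension of the graph, from the Lipschitz image, plus one
    for the comparison of area factors.\<close>
  have pw: "(1 + \<epsilon>) powr ?s * (1 + \<epsilon>) = (1 + \<epsilon>) powr real CARD('n)"
    using \<epsilon> by (simp add: powr_diff)
  have int: "ennreal r * emeasure lborel (slab \<inter> B) = (\<integral>\<^sup>+y. ennreal r * indicator (slab \<inter> B) y \<partial>lborel)" for r
    by (simp add: nn_integral_cmult_indicator)
  have cmp1: "ennreal (c * A) * emeasure lborel (slab \<inter> B) \<le> ennreal (1 + \<epsilon>) * (\<integral>\<^sup>+y. ennreal (c * J y) * indicator (slab \<inter> B) y \<partial>lborel)"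
  proof -
    have "(\<integral>\<^sup>+y. ennreal (c * A) * indicator (slab \<inter> B) y \<partial>lborel) \<le> (\<integral>\<^sup>+y. ennreal (1 + \<epsilon>) * (ennreal (c * J y) * indicator (slab \<inter> B) y) \<partial>lborel)"
    proof (rule nn_integral_mono)
      fix y
      have "ennreal (c * A) \<le> ennreal (1 + \<epsilon>) * ennreal (c * J y)" if "y \<in> B"
      proof -
        have "c * A \<le> (1 + \<epsilon>) * (c * J y)"
          using mult_left_mono[OF JA(1)[OF that] c0] by (simp add: mult_ac)
        then show ?thesis using \<epsilon> by (subst ennreal_mult'[symmetric]) (auto intro: ennreal_leI)
      qed
      then show "ennreal (c * A) * indicator (slab \<inter> B) y \<le> ennreal (1 + \<epsilon>) * (ennreal (c * J y) * indicator (slab \<inter> B) y)"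
        by (simp split: split_indicator)
    qed
    also have "\<dots> = ennreal (1 + \<epsilon>) * (\<integral>\<^sup>+y. ennreal (c * J y) * indicator (slab \<inter> B) y \<partial>lborel)"
      by (rule nn_integral_cmult) measurable
    finally show ?thesis unfolding int .
  qed
  have cmp2: "(\<integral>\<^sup>+y. ennreal (c * J y) * indicator (slab \<inter> B) y \<partial>lborel) \<le> ennreal (1 + \<epsilon>) * (ennreal (c * A) * emeasure lborel (slab \<inter> B))"
  proof -
    have "(\<integral>\<^sup>+y. ennreal (c * J y) * indicator (slab \<inter> B) y \<partial>lborel) \<le> (\<integral>\<^sup>+y. ennreal ((1 + \<epsilon>) * (c * A)) * indicator (slab \<inter> B) y \<partial>lborel)"
      using c0 \<epsilon> by (intro nn_integral_mono) (auto simp: indicator_def mult.left_commute[of _ c] intro!: ennreal_leI mult_left_mono JA(2))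
    also have "\<dots> = ennreal ((1 + \<epsilon>) * (c * A)) * emeasure lborel (slab \<inter> B)" by (rule int[symmetric])
    finally show ?thesis using c0 \<epsilon> A1 by (simp add: ennreal_mult mult.assoc)
  qed
  have s0: "?s \<ge> 0" by (rule card_ge_1)
  have "hausdorff ?s (\<Gamma> \<inter> B) \<le> ennreal ((1 + \<epsilon>) powr ?s) * hausdorff ?s (Hp \<inter> B)"
    using hausdorff_lipschitz_image[OF lip2 _ s0] \<epsilon> img2 by simp
  also have "\<dots> \<le> ennreal ((1 + \<epsilon>) powr ?s) * (ennreal (1 + \<epsilon>) * (\<integral>\<^sup>+y. ennreal (c * J y) * indicator (slab \<inter> B) y \<partial>lborel))"
    unfolding HHp by (intro mult_left_mono cmp1) auto
  finally show "hausdorff ?s (\<Gamma> \<inter> B) \<le> ennreal ((1 + \<epsilon>) powr real CARD('n)) * (\<integral>\<^sup>+y. ennreal (c * J y) * indicator (slab \<inter> B) y \<partial>lborel)"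
    using \<epsilon> by (simp add: pw[symmetric] ennreal_mult mult.assoc)
  have "(\<integral>\<^sup>+y. ennreal (c * J y) * indicator (slab \<inter> B) y \<partial>lborel) \<le> ennreal (1 + \<epsilon>) * hausdorff ?s (Hp \<inter> B)"
    unfolding HHp by (rule cmp2)
  also have "\<dots> \<le> ennreal (1 + \<epsilon>) * (ennreal ((1 + \<epsilon>) powr ?s) * hausdorff ?s (\<Gamma> \<inter> B))"
    using hausdorff_lipschitz_image[OF lip1 _ s0] \<epsilon> img1 by (intro mult_left_mono) auto
  finally show "(\<integral>\<^sup>+y. ennreal (c * J y) * indicator (slab \<inter> B) y \<partial>lborel) \<le> ennreal ((1 + \<epsilon>) powr real CARD('n)) * hausdorff ?s (\<Gamma> \<inter> B)"
    using \<epsilon> by (simp add: pw[symmetric] ennreal_mult mult.assoc mult.left_commute)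
qed

text \<open>The graph over a null cylinder is a Lipschitz image of the section of that cylinder by
  the hyperplane orthogonal to \<open>e\<close>, which is null by \<open>flat\<close> with
  \<open>a = 0\<close>.\<close>

lemma null_graph:
  assumes B [measurable]: "B \<in> sets borel" and iB: "invt B" and null: "emeasure lborel B = 0"
  shows "hausdorff (real CARD('n) - 1) (\<Gamma> \<inter> B) = 0"
proof -
  let ?s = "real CARD('n) - 1"
  define Hp where "Hp = {z. z \<bullet> e = 0 \<bullet> z}"
  have "hausdorff ?s (B \<inter> Hp) \<le> ennreal (c * sqrt (1 + (norm (0::real^'n))\<^sup>2)) * emeasure lborel B"
    unfolding Hp_def flat[OF inner_zero_left B]
    by (intro mult_left_mono emeasure_mono) (use invt_D[OF iB] in \<open>auto simp: algebra_simps\<close>, metis add_uminus_conv_diff invt_D[OF iB] scaleR_minus_left)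
  then have z: "hausdorff ?s (B \<inter> Hp) = 0" using null by simp
  have lip': "(1 + L)-lipschitz_on (B \<inter> Hp) P"
  proof (rule lipschitz_onI)
    fix x z assume xz: "x \<in> B \<inter> Hp" "z \<in> B \<inter> Hp"
    have "P x - P z = (x - z) + (h x - h z) *\<^sub>R e"
      using xz by (simp add: P_def Hp_def algebra_simps)
    then have "dist (P x) (P z) \<le> norm (x - z) + \<bar>h x - h z\<bar>"
      using norm_triangle_ineq[of "x - z" "(h x - h z) *\<^sub>R e"] norm_e by (simp add: dist_norm)
    also have "\<dots> \<le> norm (x - z) + L * norm (x - z)"
      using lipschitz_onD[OF lip, of x z] by (simp add: dist_norm)
    finally show "dist (P x) (P z) \<le> (1 + L) * dist x z" by (simp add: dist_norm algebra_simps)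
  qed (use L0 in simp)
  have sub: "\<Gamma> \<inter> B \<subseteq> P ` (B \<inter> Hp)"
  proof
    fix x assume x: "x \<in> \<Gamma> \<inter> B"
    have "x = P (Q x)" using x P_\<Gamma>[of x] P_inv[of x "- (x \<bullet> e)"] by (simp add: Q_def)
    moreover have "Q x \<in> B \<inter> Hp" using x invt_Q[OF iB] Q_perp by (simp add: Hp_def)
    ultimately show "x \<in> P ` (B \<inter> Hp)" by blast
  qed
  have "hausdorff ?s (\<Gamma> \<inter> B) \<le> hausdorff ?s (P ` (B \<inter> Hp))" by (rule hausdorff_mono[OF sub])
  also have "\<dots> \<le> ennreal ((1 + L) powr ?s) * hausdorff ?s (B \<inter> Hp)"
    using L0 by (intro hausdorff_lipschitz_image[OF lip' _ card_ge_1]) simp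
  finally show ?thesis using z by simp
qed

text \<open>Pieces are indexed by a slope and a centre from a countable dense set and by a scale. A
  point belongs to a piece if the linear approximation with that slope holds below that scale and
  its projection lies so close to the centre that any two points of the piece are within the scale
  of each other.\<close>

lemma diff_decomposition:
  assumes \<epsilon>: "\<epsilon> > 0"
  obtains T :: "nat \<Rightarrow> (real^'n) set" and a :: "nat \<Rightarrow> real^'n"
  where "\<And>i. T i \<in> sets borel" "\<And>i. invt (T i)" "disjoint_family T" "(\<Union>i. T i) = Dh"
    "\<And>i. a i \<bullet> e = 0"
    "\<And>i y z. y \<in> T i \<Longrightarrow> z \<in> T i \<Longrightarrow> \<bar>h y - h z - a i \<bullet> (y - z)\<bar> \<le> \<epsilon> * norm (Q y - Q z)"
    "\<And>i y. y \<in> T i \<Longrightarrow> norm (G y - a i) \<le> \<epsilon>"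
proof -
  obtain W :: "(real^'n) set" where W: "countable W" "\<And>X. open X \<Longrightarrow> X \<noteq> {} \<Longrightarrow> \<exists>d\<in>W. d \<in> X"
    by (rule countable_dense_setE) blast
  have Wne: "W \<noteq> {}" using W(2)[of UNIV] by auto
  define E where "E a j = {y. \<forall>w. norm w < 1 / real (Suc j) \<longrightarrow> \<bar>h (y + w) - h y - a \<bullet> w\<bar> \<le> \<epsilon> * norm w}" for a and j :: nat
  \<comment> \<open>The projected slope \<open>Q b\<close> replaces \<open>b\<close>, since
    \<open>flat\<close> demands slopes orthogonal to \<open>e\<close>; nearness is measured by
    \<open>Q\<close>, so the pieces are cylinders.\<close>
  define S where "S p = (case p of (b, j, q) \<Rightarrow> E (Q b) j \<inter> {y. norm (Q y - q) < 1 / (2 * real (Suc j))} \<inter> Dh)" for p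
  define I where "I = W \<times> (UNIV :: nat set) \<times> W"
  have I: "countable I" "I \<noteq> {}" using W Wne by (auto simp: I_def)
  have Em: "E a j \<in> sets borel" for a j
  proof -
    have "E a j = (\<Inter>w\<in>ball 0 (1 / real (Suc j)). {y. \<bar>h (y + w) - h y - a \<bullet> w\<bar> \<le> \<epsilon> * norm w})"
      by (auto simp: E_def)
    also have "closed \<dots>"
      by (intro closed_INT ballI closed_Collect_le continuous_intros continuous_on_compose2[OF cont_h]) auto
    finally show ?thesis by (simp add: borel_closed)
  qed
  have Qi: "Q (y + t *\<^sub>R e) = Q y" for y t by (simp add: Q_def inner_add_left ee algebra_simps)
  have Sm: "S p \<in> sets borel" for p
  proof -
    have "{y. norm (Q y - q) < r} \<in> sets borel" for q r
      unfolding Q_def by (intro borel_open open_Collect_less continuous_intros)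
    then show ?thesis using Em by (auto simp: S_def split: prod.split)
  qed
  have Si: "invt (S p)" for p
    using invt_Dh by (auto simp: S_def invt_def E_def Qi h_shift inv split: prod.split)
  have Sd: "\<bar>h y - h z - Q b \<bullet> (y - z)\<bar> \<le> \<epsilon> * norm (Q y - Q z)" if yz: "y \<in> S (b, j, q)" "z \<in> S (b, j, q)" for b j q y z
  proof -
    have "norm (Q y - Q z) \<le> norm (Q y - q) + norm (Q z - q)"
      using norm_triangle_ineq4[of "Q y - q" "Q z - q"] by simp
    also have "\<dots> < 1 / (2 * real (Suc j)) + 1 / (2 * real (Suc j))" using yz by (intro add_strict_mono) (auto simp: S_def)
    finally have n: "norm (Q y - Q z) < 1 / real (Suc j)" by (simp add: field_simps)
    have "Q z \<in> E (Q b) j"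
      using yz(2) invt_Q[OF Si[of "(b, j, q)"], of z] by (auto simp: S_def)
    then have "\<bar>h (Q z + (Q y - Q z)) - h (Q z) - Q b \<bullet> (Q y - Q z)\<bar> \<le> \<epsilon> * norm (Q y - Q z)"
      using n unfolding E_def by blast
    moreover have "Q b \<bullet> (Q y - Q z) = Q b \<bullet> (y - z)"
      by (simp add: Q_diff) (simp add: Q_def[of "y - z"] inner_diff_right Q_perp)
    ultimately show ?thesis by (simp add: h_Q)
  qed
  have SG: "norm (G y - Q b) \<le> \<epsilon>" if y: "y \<in> S (b, j, q)" for b j q y
  proof -
    have yD: "y \<in> Dh" and yE: "y \<in> E (Q b) j" using y by (auto simp: S_def)
    \<comment> \<open>Testing the derivative and the approximate slope along their own difference
      \<open>v\<close> turns the discrepancy of the two estimates into a bound on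
      \<open>norm v\<close>.\<close>
    define v where "v = G y - Q b"
    have "norm v \<le> \<epsilon> + \<eta>" if eta: "\<eta> > 0" for \<eta>
    proof (cases "v = 0")
      case False
      obtain d where d: "d > 0" "\<And>w. norm w < d \<Longrightarrow> \<bar>h (y + w) - h y - G y \<bullet> w\<bar> \<le> \<eta> * norm w"
        using yD[unfolded Dh_iff, rule_format, OF eta] by blast
      define t where "t = min d (1 / real (Suc j)) / 2 / norm v"
      have t: "t > 0" "t * norm v < d" "t * norm v < 1 / real (Suc j)"
      proof -
        define r where "r = min d (1 / real (Suc j))"
        have r: "r > 0" "r \<le> d" "r \<le> 1 / real (Suc j)" using d(1) by (auto simp: r_def)
        have "t * norm v = r / 2" using False by (simp add: t_def r_def)
        then show "t * norm v < d" "t * norm v < 1 / real (Suc j)" using r by linarith+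
        show "t > 0" using r False by (simp add: t_def flip: r_def)
      qed
      have "\<bar>h (y + t *\<^sub>R v) - h y - G y \<bullet> (t *\<^sub>R v)\<bar> \<le> \<eta> * norm (t *\<^sub>R v)" using t by (intro d(2)) simp
      moreover have "\<bar>h (y + t *\<^sub>R v) - h y - Q b \<bullet> (t *\<^sub>R v)\<bar> \<le> \<epsilon> * norm (t *\<^sub>R v)"
        using t by (intro yE[unfolded E_def mem_Collect_eq, rule_format]) simp
      ultimately have "\<bar>G y \<bullet> (t *\<^sub>R v) - Q b \<bullet> (t *\<^sub>R v)\<bar> \<le> (\<epsilon> + \<eta>) * norm (t *\<^sub>R v)" by (simp add: distrib_right)
      moreover have "G y \<bullet> (t *\<^sub>R v) - Q b \<bullet> (t *\<^sub>R v) = t * (norm v)\<^sup>2"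
        by (simp add: v_def power2_norm_eq_inner inner_diff_left algebra_simps)
      ultimately have "(t * norm v) * norm v \<le> (t * norm v) * (\<epsilon> + \<eta>)"
        using t(1) by (simp add: power2_eq_square abs_mult mult_ac)
      then show ?thesis using t(1) False by simp
    qed (use \<epsilon> eta in simp)
    then have "norm v \<le> \<epsilon>" by (rule field_le_epsilon)
    then show ?thesis by (simp add: v_def)
  qed
  have cover: "y \<in> (\<Union>p\<in>I. S p)" if y: "y \<in> Dh" for y
  proof -
    \<comment> \<open>One half is spent on differentiability at \<open>y\<close>, the other on
      replacing the gradient by a slope from the dense set.\<close>
    have e2: "\<epsilon> / 2 > 0" using \<epsilon> by simp
    obtain d where d: "d > 0" "\<And>w. norm w < d \<Longrightarrow> \<bar>h (y + w) - h y - G y \<bullet> w\<bar> \<le> \<epsilon> / 2 * norm w"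
      using y[unfolded Dh_iff, rule_format, OF e2] by blast
    obtain j where j: "1 / real (Suc j) < d" using nat_approx_posE[OF d(1)] by auto
    obtain b where b: "b \<in> W" "dist (G y) b < \<epsilon> / 2" using W(2)[of "ball (G y) (\<epsilon> / 2)"] e2 by auto
    obtain q where q: "q \<in> W" "dist (Q y) q < 1 / (2 * real (Suc j))" using W(2)[of "ball (Q y) (1 / (2 * real (Suc j)))"] by auto
    have "norm (G y - Q b) \<le> \<epsilon> / 2"
    proof -
      have "Q (G y) = G y" using G_perp[OF y] by (simp add: Q_def)
      then have "norm (G y - Q b) = norm (Q (G y - b))" by (metis Q_diff)
      then show ?thesis using norm_Q_le[of "G y - b"] b(2) by (simp add: dist_norm)
    qed
    then have 1: "\<bar>G y \<bullet> w - Q b \<bullet> w\<bar> \<le> \<epsilon> / 2 * norm w" for w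
      using Cauchy_Schwarz_ineq2[of "G y - Q b" w] mult_right_mono[of "norm (G y - Q b)" "\<epsilon> / 2" "norm w"]
      by (simp add: inner_diff_left)
    have 2: "\<bar>h (y + w) - h y - G y \<bullet> w\<bar> \<le> \<epsilon> / 2 * norm w" if "norm w < 1 / real (Suc j)" for w
      using d(2)[of w] that j by simp
    have "\<bar>h (y + w) - h y - Q b \<bullet> w\<bar> \<le> \<epsilon> / 2 * norm w + \<epsilon> / 2 * norm w" if "norm w < 1 / real (Suc j)" for w
    proof -
      have "h (y + w) - h y - Q b \<bullet> w = (h (y + w) - h y - G y \<bullet> w) + (G y \<bullet> w - Q b \<bullet> w)" by simp
      also have "\<bar>\<dots>\<bar> \<le> \<epsilon> / 2 * norm w + \<epsilon> / 2 * norm w"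
        by (rule order_trans[OF abs_triangle_ineq add_mono[OF 2[OF that] 1[of w]]])
      finally show ?thesis .
    qed
    then have "y \<in> E (Q b) j" by (auto simp: E_def)
    then have "y \<in> S (b, j, q)" using y q by (auto simp: S_def dist_norm)
    then show ?thesis using b q by (auto simp: I_def)
  qed
  define p where "p = from_nat_into I"
  have pI: "range p = I" unfolding p_def using I by (rule range_from_nat_into[rotated])
  define T where "T = disjointed (\<lambda>i. S (p i))"
  define a where "a i = Q (fst (p i))" for i
  have TS: "T i \<subseteq> S (p i)" for i unfolding T_def by (rule disjointed_subset)
  have TS': "T i \<subseteq> S (fst (p i), fst (snd (p i)), snd (snd (p i)))" for i using TS[of i] by simp
  show ?thesis
  proof (rule that[of T a])
    show "T i \<in> sets borel" for i unfolding T_def disjointed_def using Sm by (auto intro!: sets.Diff sets.finite_UN)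
    show "invt (T i)" for i unfolding T_def disjointed_def using Si by (auto simp: invt_def)
    show "disjoint_family T" unfolding T_def by (rule disjoint_family_disjointed)
    have "(\<Union>i. T i) = (\<Union>i. S (p i))" unfolding T_def by (rule UN_disjointed_eq)
    also have "\<dots> = (\<Union>p\<in>I. S p)" by (simp flip: pI)
    also have "\<dots> = Dh" using cover by (auto simp: S_def split: prod.splits)
    finally show "(\<Union>i. T i) = Dh" .
    show "a i \<bullet> e = 0" for i by (simp add: a_def Q_perp)
    show "\<bar>h y - h z - a i \<bullet> (y - z)\<bar> \<le> \<epsilon> * norm (Q y - Q z)" if "y \<in> T i" "z \<in> T i" for i y z
      unfolding a_def by (rule Sd[OF subsetD[OF TS' that(1)] subsetD[OF TS' that(2)]])
    show "norm (G y - a i) \<le> \<epsilon>" if "y \<in> T i" for i y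
      unfolding a_def by (rule SG[OF subsetD[OF TS' that]])
  qed
qed

text \<open>The bounds for single pieces are summed over a countable decomposition of the
  differentiability set and the distortion is sent to one. The remaining points are null on both
  sides, by Rademacher and \<open>null_graph\<close>.\<close>

theorem graph_area_formula:
  assumes F [measurable]: "F \<in> sets borel"
  shows "hausdorff (real CARD('n) - 1) (\<Gamma> \<inter> F) = (\<integral>\<^sup>+y. ennreal (c * J y) * indicator slab y * indicator F (P y) \<partial>lborel)"
proof -
  let ?s = "real CARD('n) - 1"
  let ?H = "hmeasure ?s :: (real^'n) measure"
  \<comment> \<open>The cylinder over \<open>F\<close>: it has the same trace on the graph, and it
    is invariant along \<open>e\<close> as the piecewise bounds require.\<close>
  define B where "B = P -` F"
  have Bm [measurable]: "B \<in> sets borel" using measurable_sets[OF P_meas F] by (simp add: B_def)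
  have iB: "invt B" by (simp add: invt_def B_def P_inv)
  have \<Gamma>B: "\<Gamma> \<inter> F = \<Gamma> \<inter> B" using P_\<Gamma> by (auto simp: B_def)
  have iC: "invt (B - Dh)" "invt (B \<inter> T)" if "invt T" for T using iB invt_Dh that by (auto simp: invt_def)
  define N where "N = density lborel (\<lambda>y. ennreal (c * J y) * indicator slab y)"
  have [measurable_cong]: "sets N = sets borel" by (simp add: N_def)
  have Nint: "emeasure N X = (\<integral>\<^sup>+y. ennreal (c * J y) * indicator (slab \<inter> X) y \<partial>lborel)" if "X \<in> sets borel" for X
    unfolding N_def using that by (subst emeasure_density) (auto simp: indicator_inter_arith mult.assoc)
  have nullD: "hausdorff ?s (\<Gamma> \<inter> (B - Dh)) = 0"
  proof (rule null_graph)
    have "- Dh \<in> null_sets lborel" using AE_Dh AE_iff_null_sets[of "- Dh" lborel] by simp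
    then have "B - Dh \<in> null_sets lborel" by (rule null_sets_subset) auto
    then show "emeasure lborel (B - Dh) = 0" by auto
  qed (use iC[OF invt_Dh] in auto)
  have ND: "emeasure N (B - Dh) = 0"
  proof -
    have "AE y in lborel. ennreal (c * J y) * indicator (slab \<inter> (B - Dh)) y = 0"
      using AE_Dh by eventually_elim (simp add: indicator_def)
    then show ?thesis by (subst Nint) (auto simp: nn_integral_0_iff_AE)
  qed
  have split: "hausdorff ?s (\<Gamma> \<inter> B) = hausdorff ?s (\<Gamma> \<inter> (B \<inter> Dh))" "emeasure N B = emeasure N (B \<inter> Dh)"
  proof -
    have "emeasure ?H (\<Gamma> \<inter> B) = emeasure ?H (\<Gamma> \<inter> (B \<inter> Dh) \<union> \<Gamma> \<inter> (B - Dh))" by (intro arg_cong2[where f = emeasure]) auto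
    also have "\<dots> = emeasure ?H (\<Gamma> \<inter> (B \<inter> Dh)) + emeasure ?H (\<Gamma> \<inter> (B - Dh))"
      by (intro plus_emeasure[symmetric]) auto
    finally show "hausdorff ?s (\<Gamma> \<inter> B) = hausdorff ?s (\<Gamma> \<inter> (B \<inter> Dh))" using nullD by (simp add: emeasure_hmeasure)
    have "emeasure N B = emeasure N (B \<inter> Dh \<union> (B - Dh))" by (intro arg_cong2[where f = emeasure]) auto
    also have "\<dots> = emeasure N (B \<inter> Dh) + emeasure N (B - Dh)"
      by (intro plus_emeasure[symmetric]) auto
    finally show "emeasure N B = emeasure N (B \<inter> Dh)" using ND by simp
  qed
  have both: "hausdorff ?s (\<Gamma> \<inter> (B \<inter> Dh)) \<le> ennreal ((1 + \<epsilon>) powr real CARD('n)) * emeasure N (B \<inter> Dh)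
     \<and> emeasure N (B \<inter> Dh) \<le> ennreal ((1 + \<epsilon>) powr real CARD('n)) * hausdorff ?s (\<Gamma> \<inter> (B \<inter> Dh))" if \<epsilon>: "\<epsilon> > 0" for \<epsilon>
  proof -
    obtain T :: "nat \<Rightarrow> (real^'n) set" and a :: "nat \<Rightarrow> real^'n" where T: "\<And>i. T i \<in> sets borel" "\<And>i. invt (T i)" "disjoint_family T" "(\<Union>i. T i) = Dh"
      and a: "\<And>i. a i \<bullet> e = 0"
      "\<And>i y z. y \<in> T i \<Longrightarrow> z \<in> T i \<Longrightarrow> \<bar>h y - h z - a i \<bullet> (y - z)\<bar> \<le> \<epsilon> * norm (Q y - Q z)"
      "\<And>i y. y \<in> T i \<Longrightarrow> norm (G y - a i) \<le> \<epsilon>"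
      using diff_decomposition[OF \<epsilon>] by blast
    note [measurable] = T(1)
    have dj: "disjoint_family (\<lambda>i. B \<inter> T i)" "disjoint_family (\<lambda>i. \<Gamma> \<inter> (B \<inter> T i))"
      using T(3) by (auto simp: disjoint_family_on_def)
    have H: "hausdorff ?s (\<Gamma> \<inter> (B \<inter> Dh)) = (\<Sum>i. hausdorff ?s (\<Gamma> \<inter> (B \<inter> T i)))"
    proof -
      have "(\<Sum>i. emeasure ?H (\<Gamma> \<inter> (B \<inter> T i))) = emeasure ?H (\<Union>i. \<Gamma> \<inter> (B \<inter> T i))"
        by (rule suminf_emeasure[OF _ dj(2)]) auto
      also have "(\<Union>i. \<Gamma> \<inter> (B \<inter> T i)) = \<Gamma> \<inter> (B \<inter> Dh)" using T(4) by auto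
      finally show ?thesis by (simp add: emeasure_hmeasure)
    qed
    have Ns: "emeasure N (B \<inter> Dh) = (\<Sum>i. emeasure N (B \<inter> T i))"
    proof -
      have "(\<Sum>i. emeasure N (B \<inter> T i)) = emeasure N (\<Union>i. B \<inter> T i)"
        by (rule suminf_emeasure[OF _ dj(1)]) auto
      also have "(\<Union>i. B \<inter> T i) = B \<inter> Dh" using T(4) by auto
      finally show ?thesis by simp
    qed
    have pb: "hausdorff ?s (\<Gamma> \<inter> (B \<inter> T i)) \<le> ennreal ((1 + \<epsilon>) powr real CARD('n)) * emeasure N (B \<inter> T i)"
        "emeasure N (B \<inter> T i) \<le> ennreal ((1 + \<epsilon>) powr real CARD('n)) * hausdorff ?s (\<Gamma> \<inter> (B \<inter> T i))" for i
    proof -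
      have BT: "B \<inter> T i \<in> sets borel" by measurable
      show "hausdorff ?s (\<Gamma> \<inter> (B \<inter> T i)) \<le> ennreal ((1 + \<epsilon>) powr real CARD('n)) * emeasure N (B \<inter> T i)"
        unfolding Nint[OF BT] by (rule piece_bounds(1)[OF a(1)[of i] \<epsilon> BT iC(2)[OF T(2)]]) (auto intro: a)
      show "emeasure N (B \<inter> T i) \<le> ennreal ((1 + \<epsilon>) powr real CARD('n)) * hausdorff ?s (\<Gamma> \<inter> (B \<inter> T i))"
        unfolding Nint[OF BT] by (rule piece_bounds(2)[OF a(1)[of i] \<epsilon> BT iC(2)[OF T(2)]]) (auto intro: a)
    qed
    show ?thesis unfolding H Ns ennreal_suminf_cmult[symmetric]
      by (intro conjI suminf_le summableI pb)
  qed
  have "hausdorff ?s (\<Gamma> \<inter> (B \<inter> Dh)) = emeasure N (B \<inter> Dh)"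
    by (rule antisym; rule ennreal_le_of_scaled[where k = "real CARD('n)"]) (simp_all only: both)
  then have "hausdorff ?s (\<Gamma> \<inter> F) = emeasure N B" using split \<Gamma>B by simp
  also have "\<dots> = (\<integral>\<^sup>+y. ennreal (c * J y) * indicator slab y * indicator F (P y) \<partial>lborel)"
    unfolding Nint[OF Bm] by (intro nn_integral_cong) (auto simp: indicator_def B_def)
  finally show ?thesis .
qed

lemma graph_measure:
  "density (hmeasure (real CARD('n) - 1)) (indicator \<Gamma>) = distr (density lborel (\<lambda>y. ennreal (c * J y) * indicator slab y)) borel P"
proof (rule measure_eqI)
  fix F assume "F \<in> sets (density (hmeasure (real CARD('n) - 1)) (indicator \<Gamma>))"
  then have F [measurable]: "F \<in> sets borel" by simp
  have m: "P -` F \<in> sets borel" using measurable_sets[OF P_meas F] by simp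
  have "emeasure (density (hmeasure (real CARD('n) - 1)) (indicator \<Gamma>)) F = hausdorff (real CARD('n) - 1) (\<Gamma> \<inter> F)"
    by (subst emeasure_density) (auto simp: indicator_inter_arith[symmetric] emeasure_hmeasure)
  also have "\<dots> = emeasure (distr (density lborel (\<lambda>y. ennreal (c * J y) * indicator slab y)) borel P) F"
    unfolding graph_area_formula[OF F] using m
    by (subst emeasure_distr) (auto simp: emeasure_density intro!: nn_integral_cong split: split_indicator)
  finally show "emeasure (density (hmeasure (real CARD('n) - 1)) (indicator \<Gamma>)) F = emeasure (distr (density lborel (\<lambda>y. ennreal (c * J y) * indicator slab y)) borel P) F" .
qed simp

lemma graph_integral:
  fixes f :: "real^'n \<Rightarrow> real"
  assumes [measurable]: "f \<in> borel_measurable borel"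
  shows "(\<integral>x. indicator \<Gamma> x * f x \<partial>hmeasure (real CARD('n) - 1)) = (\<integral>y. indicator slab y * (c * J y * f (P y)) \<partial>lborel)"
proof -
  have "(\<integral>x. indicator \<Gamma> x * f x \<partial>hmeasure (real CARD('n) - 1)) = (\<integral>x. f x \<partial>density (hmeasure (real CARD('n) - 1)) (\<lambda>x. ennreal (indicator \<Gamma> x)))"
    by (subst integral_density) auto
  also have "(\<lambda>x. ennreal (indicator \<Gamma> x)) = indicator \<Gamma>" by (auto simp: indicator_def)
  also have "(\<integral>x. f x \<partial>density (hmeasure (real CARD('n) - 1)) (indicator \<Gamma>)) = (\<integral>y. f (P y) \<partial>density lborel (\<lambda>y. ennreal (c * J y) * indicator slab y))"
    unfolding graph_measure by (subst integral_distr) auto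
  also have "(\<lambda>y. ennreal (c * J y) * indicator slab y) = (\<lambda>y. ennreal (indicator slab y * (c * J y)))"
    by (auto simp: indicator_def)
  also have "(\<integral>y. f (P y) \<partial>density lborel \<dots>) = (\<integral>y. indicator slab y * (c * J y * f (P y)) \<partial>lborel)"
    using c0 J_ge_1 by (subst integral_density) (auto simp: mult_ac order_trans[OF zero_le_one] intro!: AE_I2 mult_nonneg_nonneg)
  finally show ?thesis .
qed

text \<open>Carries Rademacher's theorem from Lebesgue measure to surface measure, where the normal
  has to exist almost everywhere.\<close>

lemma AE_graph_diff: "AE x in hmeasure (real CARD('n) - 1). x \<in> \<Gamma> \<longrightarrow> x \<in> Dh"
proof -
  have "hausdorff (real CARD('n) - 1) (\<Gamma> \<inter> (UNIV - Dh)) = 0"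
  proof (rule null_graph)
    have "- Dh \<in> null_sets lborel" using AE_Dh AE_iff_null_sets[of "- Dh" lborel] by simp
    then show "emeasure lborel (UNIV - Dh) = 0" by (simp add: Compl_eq_Diff_UNIV null_sets_def)
    show "invt (UNIV - Dh)" using invt_Dh by (auto simp: invt_def)
  qed simp
  then have "\<Gamma> \<inter> (UNIV - Dh) \<in> null_sets (hmeasure (real CARD('n) - 1))"
    by (auto simp: null_sets_def emeasure_hmeasure)
  then have "AE x in hmeasure (real CARD('n) - 1). x \<notin> \<Gamma> \<inter> (UNIV - Dh)" by (rule AE_not_in)
  then show ?thesis by eventually_elim auto
qed

end

section \<open>Stokes' theorem on Lipschitz graphs\<close>

lemma central_quotient_tendsto:
  fixes f :: "'a::real_normed_vector \<Rightarrow> real"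
  assumes "(f has_derivative f') (at x)"
  shows "(\<lambda>n. real (Suc n) * (f (x + (1 / real (Suc n)) *\<^sub>R v) - f (x - (1 / real (Suc n)) *\<^sub>R v)) / 2) \<longlonglongrightarrow> f' v"
proof -
  have d: "((\<lambda>t. f (x + t *\<^sub>R w)) has_real_derivative f' w) (at 0)" for w
  proof -
    have "((\<lambda>t::real. x + t *\<^sub>R w) has_derivative (\<lambda>t. t *\<^sub>R w)) (at 0)"
      by (auto intro!: derivative_eq_intros)
    moreover have "(f has_derivative f') (at (x + 0 *\<^sub>R w))" using assms by simp
    ultimately have "((\<lambda>t. f (x + t *\<^sub>R w)) has_derivative (\<lambda>t. f' (t *\<^sub>R w))) (at 0)"
      by (rule has_derivative_compose)
    moreover have "(\<lambda>t. f' (t *\<^sub>R w)) = (*) (f' w)"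
      using has_derivative_linear[OF assms] by (auto simp: linear_scale fun_eq_iff)
    ultimately show ?thesis by (simp add: has_field_derivative_def)
  qed
  have "f' (- v) = - f' v" using has_derivative_linear[OF assms] by (rule linear_neg)
  then have "(\<lambda>n. (real (Suc n) * (f (x + (1 / real (Suc n)) *\<^sub>R v) - f x) - real (Suc n) * (f (x + (1 / real (Suc n)) *\<^sub>R (- v)) - f x)) / 2)
     \<longlonglongrightarrow> (f' v - - f' v) / 2"
    using dirder_tendsto(1)[OF d[of v]] dirder_tendsto(1)[OF d[of "- v"]] by (intro tendsto_intros) auto
  moreover have "(real (Suc n) * (f (x + (1 / real (Suc n)) *\<^sub>R v) - f x) - real (Suc n) * (f (x + (1 / real (Suc n)) *\<^sub>R (- v)) - f x)) / 2
     = real (Suc n) * (f (x + (1 / real (Suc n)) *\<^sub>R v) - f (x - (1 / real (Suc n)) *\<^sub>R v)) / 2" for n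
    by (simp add: algebra_simps)
  moreover have "(f' v - - f' v) / 2 = f' v" by simp
  ultimately show ?thesis by (simp only:)
qed

lemma central_quotient_bound:
  fixes f :: "'a::euclidean_space \<Rightarrow> real"
  assumes "L-lipschitz_on UNIV f"
  shows "\<bar>real (Suc n) * (f (x + (1 / real (Suc n)) *\<^sub>R v) - f (x - (1 / real (Suc n)) *\<^sub>R v)) / 2\<bar> \<le> L * norm v"
proof -
  have "dist (x + (1 / real (Suc n)) *\<^sub>R v) (x - (1 / real (Suc n)) *\<^sub>R v) = norm ((2 / real (Suc n)) *\<^sub>R v)"
    by (simp add: dist_norm flip: scaleR_add_left)
  then have "\<bar>f (x + (1 / real (Suc n)) *\<^sub>R v) - f (x - (1 / real (Suc n)) *\<^sub>R v)\<bar> \<le> L * (2 / real (Suc n) * norm v)"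
    using lipschitz_onD[OF assms, of "x + (1 / real (Suc n)) *\<^sub>R v" "x - (1 / real (Suc n)) *\<^sub>R v"] by (simp add: dist_real_def)
  then have "real (Suc n) * \<bar>f (x + (1 / real (Suc n)) *\<^sub>R v) - f (x - (1 / real (Suc n)) *\<^sub>R v)\<bar> \<le> real (Suc n) * (L * (2 / real (Suc n) * norm v))"
    by (intro mult_left_mono) auto
  then show ?thesis by (simp add: abs_mult del: of_nat_Suc)
qed

context lipschitz_graph begin

lemma slab_shift: "v \<bullet> e = 0 \<Longrightarrow> y + v \<in> slab \<longleftrightarrow> y \<in> slab"
  by (simp add: slab_def inner_add_left)

lemma integral_shift:
  fixes f :: "real^'n \<Rightarrow> real"
  assumes [measurable]: "f \<in> borel_measurable borel" and v: "v \<bullet> e = 0"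
  shows "(\<integral>y. indicator slab y * f (y + v) \<partial>lborel) = (\<integral>y. indicator slab y * f y \<partial>lborel)"
proof -
  have "(\<integral>y. indicator slab y * f y \<partial>lborel) = (\<integral>y. indicator slab y * f y \<partial>distr lborel borel ((+) v))"
    by (simp add: lborel_distr_plus)
  also have "\<dots> = (\<integral>y. indicator slab (v + y) * f (v + y) \<partial>lborel)" by (subst integral_distr) auto
  also have "\<dots> = (\<integral>y. indicator slab y * f (y + v) \<partial>lborel)"
    using slab_shift[OF v] by (intro Bochner_Integration.integral_cong refl) (auto simp: add.commute indicator_def)
  finally show ?thesis by simp
qed

lemma integrable_slab:
  fixes f :: "real^'n \<Rightarrow> real"
  assumes [measurable]: "f \<in> borel_measurable borel" and b: "\<And>y. y \<in> slab \<Longrightarrow> \<bar>f y\<bar> \<le> M" and s: "\<And>y. y \<in> slab \<Longrightarrow> norm y > R \<Longrightarrow> f y = 0"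
  shows "integrable lborel (\<lambda>y. indicator slab y * f y)"
proof (rule Bochner_Integration.integrable_bound)
  show "integrable lborel (\<lambda>y::real^'n. M * indicator (cball 0 R) y)"
    using emeasure_lborel_cball_finite[of "0::real^'n" R] by (intro integrable_mult_right integrable_real_indicator) (auto simp: less_top)
  show "AE y in lborel. norm (indicator slab y * f y) \<le> norm (M * indicator (cball 0 R) y)"
  proof (rule AE_I2)
    fix y show "norm (indicator slab y * f y) \<le> norm (M * indicator (cball 0 R) y)"
      using b[of y] s[of y] by (cases "y \<in> slab"; cases "norm y > R") (auto simp: indicator_def)
  qed
qed measurable

text \<open>Symmetric rather than one-sided, so that translation invariance makes it exactly
  skew-adjoint at every step \<open>n\<close>.\<close>

definition cq :: "real^'n \<Rightarrow> nat \<Rightarrow> (real^'n \<Rightarrow> real) \<Rightarrow> real^'n \<Rightarrow> real" where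
  "cq v n f y = real (Suc n) * (f (y + (1 / real (Suc n)) *\<^sub>R v) - f (y - (1 / real (Suc n)) *\<^sub>R v)) / 2"

lemma cq_measurable [measurable]:
  assumes [measurable]: "f \<in> borel_measurable borel"
  shows "cq v n f \<in> borel_measurable borel"
  unfolding cq_def by measurable

end

text \<open>The support is bounded only inside the slab: the functions of interest are fields
  composed with \<open>P\<close>, which are constant along \<open>e\<close> and never compactly
  supported in the full space.\<close>

locale slab_function = lipschitz_graph e h L c for e :: "real^'n::finite" and h L c +
  fixes F :: "real^'n \<Rightarrow> real" and M R :: real
  assumes lipF: "M-lipschitz_on UNIV F" and supp: "\<And>y. y \<in> slab \<Longrightarrow> norm y > R \<Longrightarrow> F y = 0"
begin

lemma F_meas [measurable]: "F \<in> borel_measurable borel"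
  using lipF by (intro borel_measurable_continuous_onI lipschitz_on_continuous_on)

lemma F_bound: "\<exists>K. \<forall>y\<in>slab. \<bar>F y\<bar> \<le> K"
proof -
  have "compact (F ` cball 0 R)"
    using lipF by (intro compact_continuous_image continuous_on_subset[OF lipschitz_on_continuous_on] ) auto
  then obtain K where K: "\<And>y. y \<in> cball 0 R \<Longrightarrow> \<bar>F y\<bar> \<le> K"
    using compact_imp_bounded by (fastforce simp: bounded_iff)
  have "\<bar>F y\<bar> \<le> max K 0" if "y \<in> slab" for y
    using K[of y] supp[OF that] by (cases "norm y > R") auto
  then show ?thesis by blast
qed

lemma cq_supp:
  assumes v: "v \<bullet> e = 0" and y: "y \<in> slab" "norm y > R + norm v"
  shows "cq v n F y = 0"
proof -
  let ?t = "1 / real (Suc n)"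
  have "?t * norm v \<le> 1 * norm v" by (intro mult_right_mono) auto
  then have t: "norm (?t *\<^sub>R v) \<le> norm v" by simp
  have "norm (y + ?t *\<^sub>R v) > R" "norm (y - ?t *\<^sub>R v) > R"
    using norm_diff_ineq[of y "?t *\<^sub>R v"] norm_triangle_ineq2[of y "?t *\<^sub>R v"] t y(2) by linarith+
  moreover have "y + ?t *\<^sub>R v \<in> slab" "y - ?t *\<^sub>R v \<in> slab"
    using slab_shift[of "?t *\<^sub>R v" y] slab_shift[of "- (?t *\<^sub>R v)" y] v y(1) by auto
  ultimately show ?thesis using supp by (simp add: cq_def)
qed

text \<open>A translation orthogonal to \<open>e\<close> preserves the slab, so every difference
  quotient integrates to zero; dominated convergence passes this to the derivative.\<close>

lemma integral_directional_zero:
  assumes dF: "AE y in lborel. (F has_derivative F' y) (at y)" and v: "v \<bullet> e = 0"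
    and [measurable]: "(\<lambda>y. F' y v) \<in> borel_measurable borel"
  shows "(\<integral>y. indicator slab y * F' y v \<partial>lborel) = 0"
proof -
  have M0: "M \<ge> 0" using lipF by (rule lipschitz_on_nonneg)
  obtain K where K: "\<And>y. y \<in> slab \<Longrightarrow> \<bar>F y\<bar> \<le> K" using F_bound by blast
  have int: "integrable lborel (\<lambda>y. indicator slab y * F (y + w))" if w: "w \<bullet> e = 0" for w
  proof (rule integrable_slab[where M = K and R = "R + norm w"])
    fix y assume y: "y \<in> slab"
    then have yw: "y + w \<in> slab" using slab_shift[OF w] by simp
    show "\<bar>F (y + w)\<bar> \<le> K" by (rule K[OF yw])
    assume "norm y > R + norm w"
    then have "norm (y + w) > R" using norm_diff_ineq[of y w] by linarith
    then show "F (y + w) = 0" using supp[OF yw] by simp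
  qed measurable
  have z: "(\<integral>y. indicator slab y * cq v n F y \<partial>lborel) = 0" for n
  proof -
    let ?t = "1 / real (Suc n)"
    have tv: "(?t *\<^sub>R v) \<bullet> e = 0" "(- (?t *\<^sub>R v)) \<bullet> e = 0" using v by auto
    have "(\<integral>y. indicator slab y * cq v n F y \<partial>lborel)
       = (\<integral>y. (real (Suc n) / 2) * (indicator slab y * F (y + ?t *\<^sub>R v) - indicator slab y * F (y + - (?t *\<^sub>R v))) \<partial>lborel)"
      by (intro Bochner_Integration.integral_cong refl) (simp add: cq_def field_simps del: of_nat_Suc)
    also have "\<dots> = (real (Suc n) / 2) * ((\<integral>y. indicator slab y * F (y + ?t *\<^sub>R v) \<partial>lborel) - (\<integral>y. indicator slab y * F (y + - (?t *\<^sub>R v)) \<partial>lborel))"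
      unfolding integral_mult_right_zero by (intro arg_cong2[where f = "(*)"] refl Bochner_Integration.integral_diff int tv)
    also have "\<dots> = 0" unfolding integral_shift[OF F_meas tv(1)] integral_shift[OF F_meas tv(2)] by simp
    finally show ?thesis .
  qed
  have "(\<lambda>n. \<integral>y. indicator slab y * cq v n F y \<partial>lborel) \<longlonglongrightarrow> (\<integral>y. indicator slab y * F' y v \<partial>lborel)"
  proof (rule integral_dominated_convergence[where w = "\<lambda>y. (M * norm v) * indicator (cball 0 (R + norm v)) y"])
    show "integrable lborel (\<lambda>y::real^'n. (M * norm v) * indicator (cball 0 (R + norm v)) y)"
      using emeasure_lborel_cball_finite[of "0::real^'n" "R + norm v"] by (intro integrable_mult_right integrable_real_indicator) (auto simp: less_top)
    show "AE y in lborel. (\<lambda>n. indicator slab y * cq v n F y) \<longlonglongrightarrow> indicator slab y * F' y v"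
      using dF unfolding cq_def by eventually_elim (intro tendsto_mult_left central_quotient_tendsto)
    show "AE y in lborel. norm (indicator slab y * cq v n F y) \<le> M * norm v * indicator (cball 0 (R + norm v)) y" for n
    proof (rule AE_I2)
      fix y show "norm (indicator slab y * cq v n F y) \<le> M * norm v * indicator (cball 0 (R + norm v)) y"
        using cq_supp[OF v, of y n] central_quotient_bound[OF lipF, of n y v] M0
        by (cases "y \<in> slab"; cases "norm y > R + norm v") (auto simp: cq_def indicator_def)
    qed
  qed measurable
  then show ?thesis unfolding z by (simp add: LIMSEQ_const_iff)
qed

text \<open>Antisymmetrised integration by parts: symmetric difference quotients are skew-adjoint and commute, so the
  discrete version vanishes identically, without second derivatives.\<close>
lemma integral_curl_zero:
  assumes dF: "AE y in lborel. (F has_derivative F' y) (at y)" and v: "v \<bullet> e = 0" and w: "w \<bullet> e = 0"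
    and [measurable]: "\<And>u. (\<lambda>y. F' y u) \<in> borel_measurable borel"
  shows "(\<integral>y. indicator slab y * (F' y v * (G y \<bullet> w) - F' y w * (G y \<bullet> v)) \<partial>lborel) = 0"
proof -
  have M0: "M \<ge> 0" using lipF by (rule lipschitz_on_nonneg)
  obtain K where K: "\<And>y. y \<in> slab \<Longrightarrow> \<bar>F y\<bar> \<le> K" using F_bound by blast
  have int: "integrable lborel (\<lambda>y. indicator slab y * (F y * h (y + u)))" for u
  proof -
    have "compact (h ` cball u R)"
      by (intro compact_continuous_image continuous_on_subset[OF cont_h]) auto
    then obtain K2 where K2: "\<And>y. y \<in> cball u R \<Longrightarrow> \<bar>h y\<bar> \<le> K2"
      using compact_imp_bounded by (fastforce simp: bounded_iff)
    show ?thesis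
    proof (rule integrable_slab[where M = "K * max K2 0" and R = R])
      fix y assume y: "y \<in> slab"
      have K0: "K \<ge> 0" using K[OF y] by simp
      show "\<bar>F y * h (y + u)\<bar> \<le> K * max K2 0"
      proof (cases "norm y > R")
        case True then show ?thesis using supp[OF y] K0 by simp
      next
        case False
        then have "y + u \<in> cball u R" by (simp add: dist_norm)
        then show ?thesis using K[OF y] K2[of "y + u"] K0 by (simp add: abs_mult) (intro mult_mono; simp)
      qed
    qed (use supp in auto)
  qed
  \<comment> \<open>The correlation of \<open>F\<close> and \<open>h\<close> at displacement
    \<open>u\<close>; shifting both arguments changes an integral only through their relative
    displacement.\<close>
  define I where "I u = (\<integral>y. indicator slab y * (F y * h (y + u)) \<partial>lborel)" for u
  have shiftI: "integrable lborel (\<lambda>y. indicator slab y * (F (y + a) * h (y + b)))"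
      "(\<integral>y. indicator slab y * (F (y + a) * h (y + b)) \<partial>lborel) = I (b - a)" if a: "a \<bullet> e = 0" for a b
  proof -
    have eq: "indicator slab y * (F (y + a) * h (y + b)) = indicator slab (y + a) * (F (y + a) * h ((y + a) + (b - a)))" for y
      using slab_shift[OF a, of y] by (simp add: indicator_def)
    have "integrable (distr lborel borel (\<lambda>y. y + a)) (\<lambda>y. indicator slab y * (F y * h (y + (b - a))))"
    proof -
      have "(\<lambda>y. y + a) = (+) a" by (auto simp: add.commute)
      then show ?thesis using int[of "b - a"] lborel_distr_plus[of a] by (simp only:)
    qed
    then show "integrable lborel (\<lambda>y. indicator slab y * (F (y + a) * h (y + b)))"
      unfolding eq by (subst (asm) integrable_distr_eq) auto
    show "(\<integral>y. indicator slab y * (F (y + a) * h (y + b)) \<partial>lborel) = I (b - a)"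
      using integral_shift[of "\<lambda>y. F y * h (y + (b - a))" a] a by (simp add: I_def algebra_simps)
  qed
  \<comment> \<open>Expanding the product of quotients leaves four correlations, and the resulting
    expression is symmetric in \<open>a\<close> and \<open>b\<close>.\<close>
  have prod: "(\<integral>y. indicator slab y * (cq a n F y * cq b n h y) \<partial>lborel)
      = (real (Suc n) / 2)\<^sup>2 * (I ((1 / real (Suc n)) *\<^sub>R (b - a)) - I ((1 / real (Suc n)) *\<^sub>R (- b - a)) - I ((1 / real (Suc n)) *\<^sub>R (b + a)) + I ((1 / real (Suc n)) *\<^sub>R (a - b)))"
    if a: "a \<bullet> e = 0" and b: "b \<bullet> e = 0" for a b n
  proof -
    let ?t = "1 / real (Suc n)"
    define T where "T \<sigma> \<rho> y = indicator slab y * (F (y + \<sigma> *\<^sub>R a) * h (y + \<rho> *\<^sub>R b))" for \<sigma> \<rho> y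
    have Ti: "integrable lborel (T \<sigma> \<rho>)" "integral\<^sup>L lborel (T \<sigma> \<rho>) = I (\<rho> *\<^sub>R b - \<sigma> *\<^sub>R a)" for \<sigma> \<rho>
      unfolding T_def using shiftI[of "\<sigma> *\<^sub>R a" "\<rho> *\<^sub>R b"] a by auto
    have "(\<integral>y. indicator slab y * (cq a n F y * cq b n h y) \<partial>lborel)
       = (\<integral>y. (real (Suc n) / 2)\<^sup>2 * (((T ?t ?t y - T ?t (- ?t) y) - T (- ?t) ?t y) + T (- ?t) (- ?t) y) \<partial>lborel)"
      by (intro Bochner_Integration.integral_cong refl) (simp add: cq_def T_def field_simps power2_eq_square del: of_nat_Suc)
    also have "\<dots> = (real (Suc n) / 2)\<^sup>2 * (((I (?t *\<^sub>R b - ?t *\<^sub>R a) - I (- ?t *\<^sub>R b - ?t *\<^sub>R a)) - I (?t *\<^sub>R b - - ?t *\<^sub>R a)) + I (- ?t *\<^sub>R b - - ?t *\<^sub>R a))"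
      unfolding integral_mult_right_zero
      by (subst Bochner_Integration.integral_add Bochner_Integration.integral_diff, (intro Bochner_Integration.integrable_diff Ti)+)+ (simp only: Ti)
    finally show ?thesis by (simp add: scaleR_diff_right scaleR_add_right)
  qed
  have z: "(\<integral>y. indicator slab y * (cq v n F y * cq w n h y) \<partial>lborel) = (\<integral>y. indicator slab y * (cq w n F y * cq v n h y) \<partial>lborel)" for n
  proof -
    have c: "- w - v = - v - w" by simp
    show ?thesis unfolding prod[OF v w] prod[OF w v] c
      by (rule arg_cong2[where f = "(*)"]) (simp_all add: add.commute[of w v])
  qed
  have lim: "integrable lborel (\<lambda>y. indicator slab y * (F' y a * (G y \<bullet> b)))
     \<and> (\<lambda>n. \<integral>y. indicator slab y * (cq a n F y * cq b n h y) \<partial>lborel) \<longlonglongrightarrow> (\<integral>y. indicator slab y * (F' y a * (G y \<bullet> b)) \<partial>lborel)"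
    if a: "a \<bullet> e = 0" and b: "b \<bullet> e = 0" for a b
  proof (intro conjI)
    have dom: "integrable lborel (\<lambda>y::real^'n. (M * norm a * (L * norm b)) * indicator (cball 0 (R + norm a)) y)"
      using emeasure_lborel_cball_finite[of "0::real^'n" "R + norm a"] by (intro integrable_mult_right integrable_real_indicator) (auto simp: less_top)
    have conv: "AE y in lborel. (\<lambda>n. indicator slab y * (cq a n F y * cq b n h y)) \<longlonglongrightarrow> indicator slab y * (F' y a * (G y \<bullet> b))"
      using dF AE_Dh unfolding cq_def Dh_def mem_Collect_eq
      by eventually_elim (intro tendsto_mult_left tendsto_mult central_quotient_tendsto)
    have bd: "AE y in lborel. norm (indicator slab y * (cq a n F y * cq b n h y)) \<le> M * norm a * (L * norm b) * indicator (cball 0 (R + norm a)) y" for n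
    proof (rule AE_I2)
      fix y
      have "\<bar>cq a n F y\<bar> * \<bar>cq b n h y\<bar> \<le> (M * norm a) * (L * norm b)"
        using central_quotient_bound[OF lipF, of n y a] central_quotient_bound[OF lip, of n y b] M0 unfolding cq_def
        by (intro mult_mono) auto
      then show "norm (indicator slab y * (cq a n F y * cq b n h y)) \<le> M * norm a * (L * norm b) * indicator (cball 0 (R + norm a)) y"
        using cq_supp[OF a, of y n] M0 L0
        by (cases "y \<in> slab"; cases "norm y > R + norm a") (auto simp: indicator_def abs_mult)
    qed
    show "integrable lborel (\<lambda>y. indicator slab y * (F' y a * (G y \<bullet> b)))"
      by (rule integrable_dominated_convergence[OF _ _ dom conv bd]) measurable
    show "(\<lambda>n. \<integral>y. indicator slab y * (cq a n F y * cq b n h y) \<partial>lborel) \<longlonglongrightarrow> (\<integral>y. indicator slab y * (F' y a * (G y \<bullet> b)) \<partial>lborel)"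
      by (rule integral_dominated_convergence[OF _ _ dom conv bd]) measurable
  qed
  have "(\<integral>y. indicator slab y * (F' y v * (G y \<bullet> w)) \<partial>lborel) = (\<integral>y. indicator slab y * (F' y w * (G y \<bullet> v)) \<partial>lborel)"
  proof (rule LIMSEQ_unique)
    show "(\<lambda>n. \<integral>y. indicator slab y * (cq v n F y * cq w n h y) \<partial>lborel) \<longlonglongrightarrow> (\<integral>y. indicator slab y * (F' y v * (G y \<bullet> w)) \<partial>lborel)"
      using lim[OF v w] by (rule conjunct2)
    show "(\<lambda>n. \<integral>y. indicator slab y * (cq v n F y * cq w n h y) \<partial>lborel) \<longlonglongrightarrow> (\<integral>y. indicator slab y * (F' y w * (G y \<bullet> v)) \<partial>lborel)"
      unfolding z using lim[OF w v] by (rule conjunct2)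
  qed
  moreover have "(\<integral>y. indicator slab y * (F' y v * (G y \<bullet> w) - F' y w * (G y \<bullet> v)) \<partial>lborel)
     = (\<integral>y. indicator slab y * (F' y v * (G y \<bullet> w)) \<partial>lborel) - (\<integral>y. indicator slab y * (F' y w * (G y \<bullet> v)) \<partial>lborel)"
    unfolding right_diff_distrib using lim[OF v w] lim[OF w v] by (intro Bochner_Integration.integral_diff) auto
  ultimately show ?thesis by simp
qed

text \<open>The derivative inherits bound and support from the difference quotients that converge to
  it, through dominated convergence.\<close>

lemma integrable_derivative:
  assumes dF: "AE y in lborel. (F has_derivative F' y) (at y)" and v: "v \<bullet> e = 0"
    and [measurable]: "(\<lambda>y. F' y v) \<in> borel_measurable borel"
    and [measurable]: "k \<in> borel_measurable borel" and kb: "AE y in lborel. \<bar>k y\<bar> \<le> N"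
  shows "integrable lborel (\<lambda>y. indicator slab y * (F' y v * k y))"
proof (rule integrable_dominated_convergence[where w = "\<lambda>y. (M * norm v * \<bar>N\<bar>) * indicator (cball 0 (R + norm v)) y" and s = "\<lambda>n y. indicator slab y * (cq v n F y * k y)"])
  have M0: "M \<ge> 0" using lipF by (rule lipschitz_on_nonneg)
  show "integrable lborel (\<lambda>y::real^'n. (M * norm v * \<bar>N\<bar>) * indicator (cball 0 (R + norm v)) y)"
    using emeasure_lborel_cball_finite[of "0::real^'n" "R + norm v"] by (intro integrable_mult_right integrable_real_indicator) (auto simp: less_top)
  show "AE y in lborel. (\<lambda>n. indicator slab y * (cq v n F y * k y)) \<longlonglongrightarrow> indicator slab y * (F' y v * k y)"
    using dF unfolding cq_def by eventually_elim (intro tendsto_mult_left tendsto_mult_right central_quotient_tendsto)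
  show "AE y in lborel. norm (indicator slab y * (cq v n F y * k y)) \<le> M * norm v * \<bar>N\<bar> * indicator (cball 0 (R + norm v)) y" for n
    using kb
  proof eventually_elim
    fix y assume k: "\<bar>k y\<bar> \<le> N"
    have "\<bar>cq v n F y\<bar> * \<bar>k y\<bar> \<le> (M * norm v) * \<bar>N\<bar>"
      using central_quotient_bound[OF lipF, of n y v] M0 k unfolding cq_def by (intro mult_mono) auto
    then show "norm (indicator slab y * (cq v n F y * k y)) \<le> M * norm v * \<bar>N\<bar> * indicator (cball 0 (R + norm v)) y"
      using cq_supp[OF v, of y n] M0
      by (cases "y \<in> slab"; cases "norm y > R + norm v") (auto simp: indicator_def abs_mult)
  qed
qed measurable

end

section \<open>Curvature of asymptotically flat metrics\<close>

lemma haspd_imp_pd: "haspd i f f' x \<Longrightarrow> pd i f x = f'"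
  unfolding haspd_def pd_def by (rule DERIV_imp_deriv)

lemma partial_ex_haspd: "partial_ex i f x \<Longrightarrow> haspd i f (pd i f x) x"
  unfolding haspd_def pd_def partial_ex_def
  using DERIV_deriv_iff_real_differentiable by blast

lemma haspd_const: "haspd i (\<lambda>x. c) 0 x"
  by (simp add: haspd_def)

lemma haspd_add: "haspd i f f' x \<Longrightarrow> haspd i h h' x \<Longrightarrow> haspd i (\<lambda>x. f x + h x) (f' + h') x"
  unfolding haspd_def by (rule DERIV_add)

lemma haspd_diff: "haspd i f f' x \<Longrightarrow> haspd i h h' x \<Longrightarrow> haspd i (\<lambda>x. f x - h x) (f' - h') x"
  unfolding haspd_def by (rule DERIV_diff)

lemma haspd_mult: "haspd i f f' x \<Longrightarrow> haspd i h h' x \<Longrightarrow> haspd i (\<lambda>x. f x * h x) (f' * h x + h' * f x) x"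
  unfolding haspd_def using DERIV_mult[of "\<lambda>t. f (x + t *\<^sub>R axis i 1)" f' 0 UNIV "\<lambda>t. h (x + t *\<^sub>R axis i 1)" h'] by simp

lemma haspd_cmult: "haspd i f f' x \<Longrightarrow> haspd i (\<lambda>x. c * f x) (c * f') x"
  unfolding haspd_def by (rule DERIV_cmult)

lemma haspd_sum: "(\<And>a. a \<in> S \<Longrightarrow> haspd i (f a) (f' a) x) \<Longrightarrow> haspd i (\<lambda>x. \<Sum>a\<in>S. f a x) (\<Sum>a\<in>S. f' a) x"
  unfolding haspd_def by (rule DERIV_sum)

lemma haspd_coord: "haspd i (\<lambda>x. x $ j) (if i = j then 1 else 0) x"
  unfolding haspd_def by (auto intro!: derivative_eq_intros simp: axis_def)

lemma haspd_divide_ex: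
  assumes "haspd i f f' x" "haspd i h h' x" "h x \<noteq> 0"
  shows "\<exists>D. haspd i (\<lambda>x. f x / h x) D x"
  using DERIV_divide[of "\<lambda>t. f (x + t *\<^sub>R axis i 1)" f' 0 UNIV "\<lambda>t. h (x + t *\<^sub>R axis i 1)" h'] assms
  unfolding haspd_def by auto

lemma haspd_prod_ex:
  assumes "finite S" "\<And>a. a \<in> S \<Longrightarrow> \<exists>D. haspd i (f a) D x"
  shows "\<exists>D. haspd i (\<lambda>x. \<Prod>a\<in>S. f a x) D x"
  using assms
proof (induction S)
  case empty
  then show ?case using haspd_const by auto
next
  case (insert a S)
  then obtain D1 D2 where "haspd i (f a) D1 x" "haspd i (\<lambda>x. \<Prod>a\<in>S. f a x) D2 x" by (meson insertCI)
  from haspd_mult[OF this] show ?case using insert.hyps by auto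
qed

lemma eventually_line_in_open:
  fixes x v :: "'a::real_normed_vector"
  assumes "open U" "x \<in> U"
  shows "eventually (\<lambda>t. x + t *\<^sub>R v \<in> U) (at (0::real))"
proof -
  have "isCont (\<lambda>t::real. x + t *\<^sub>R v) 0" by (intro continuous_intros)
  then have "((\<lambda>t::real. x + t *\<^sub>R v) \<longlongrightarrow> x) (at 0)" by (simp add: isCont_def)
  then show ?thesis using assms by (rule topological_tendstoD)
qed

lemma haspd_cong_open:
  assumes "haspd i f f' x" "open U" "x \<in> U" "\<And>y. y \<in> U \<Longrightarrow> f y = h y"
  shows "haspd i h f' x"
proof -
  have "eventually (\<lambda>t. f (x + t *\<^sub>R axis i 1) = h (x + t *\<^sub>R axis i 1)) (nhds 0)"
    using eventually_line_in_open[OF assms(2,3), of "axis i 1"] assms(3,4)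
    by (simp add: eventually_at_filter[symmetric] eventually_nhds_conv_at) (auto elim: eventually_mono)
  then show ?thesis using assms(1) unfolding haspd_def
    by (subst (asm) DERIV_cong_ev[OF refl _ refl]) auto
qed

lemma pd_cong_open:
  assumes "open U" "x \<in> U" "\<And>y. y \<in> U \<Longrightarrow> f y = h y"
  shows "pd i f x = pd i h x"
proof -
  have "eventually (\<lambda>t. f (x + t *\<^sub>R axis i 1) = h (x + t *\<^sub>R axis i 1)) (nhds 0)"
    using eventually_line_in_open[OF assms(1,2), of "axis i 1"] assms(2,3)
    by (simp add: eventually_nhds_conv_at) (auto elim: eventually_mono)
  then show ?thesis unfolding pd_def by (intro deriv_cong_ev) auto
qed

lemma C2_on_haspd:
  assumes "C2_on U f" "x \<in> U"
  shows "haspd i f (pd i f x) x" "haspd j (pd i f) (pd j (pd i f) x) x"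
  using assms by (auto simp: C2_on_def intro: partial_ex_haspd)

lemma haspd_line:
  assumes "haspd i f f' (x + t *\<^sub>R axis i 1)"
  shows "((\<lambda>s. f (x + s *\<^sub>R axis i 1)) has_real_derivative f') (at t)"
proof -
  have "((\<lambda>s. f (x + (s + t) *\<^sub>R axis i 1)) has_real_derivative f') (at 0)"
    using assms unfolding haspd_def by (simp add: algebra_simps)
  then show ?thesis using DERIV_shift[of "\<lambda>s. f (x + s *\<^sub>R axis i 1)" f' 0 t] by simp
qed

text \<open>The mean value theorem is used twice, first in direction \<open>i\<close> on a
  difference in direction \<open>j\<close>, then in direction \<open>j\<close>.\<close>

lemma second_difference_mvt:
  fixes f :: "real^'n::finite \<Rightarrow> real"
  assumes C2: "C2_on U f" and s: "s > 0" and U: "\<And>a b. 0 \<le> a \<Longrightarrow> a \<le> s \<Longrightarrow> 0 \<le> b \<Longrightarrow> b \<le> s \<Longrightarrow> x + a *\<^sub>R axis i 1 + b *\<^sub>R axis j 1 \<in> U"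
  shows "\<exists>a b. 0 < a \<and> a < s \<and> 0 < b \<and> b < s \<and>
     f (x + s *\<^sub>R axis i 1 + s *\<^sub>R axis j 1) - f (x + s *\<^sub>R axis i 1) - f (x + s *\<^sub>R axis j 1) + f x
       = s * s * pd j (pd i f) (x + a *\<^sub>R axis i 1 + b *\<^sub>R axis j 1)"
proof -
  define \<phi> where "\<phi> t = f ((x + s *\<^sub>R axis j 1) + t *\<^sub>R axis i 1) - f (x + t *\<^sub>R axis i 1)" for t
  have d\<phi>: "(\<phi> has_real_derivative (pd i f ((x + s *\<^sub>R axis j 1) + t *\<^sub>R axis i 1) - pd i f (x + t *\<^sub>R axis i 1))) (at t)"
    if "0 \<le> t" "t \<le> s" for t
    unfolding \<phi>_def
  proof (intro DERIV_diff haspd_line C2_on_haspd[OF C2])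
    show "x + s *\<^sub>R axis j 1 + t *\<^sub>R axis i 1 \<in> U" using U[of t s] that s by (simp add: algebra_simps)
    show "x + t *\<^sub>R axis i 1 \<in> U" using U[of t 0] that s by simp
  qed
  obtain a where a: "0 < a" "a < s" "\<phi> s - \<phi> 0 = (s - 0) * (pd i f ((x + s *\<^sub>R axis j 1) + a *\<^sub>R axis i 1) - pd i f (x + a *\<^sub>R axis i 1))"
    using MVT2[OF s d\<phi>] by auto
  have d\<psi>: "((\<lambda>t. pd i f ((x + a *\<^sub>R axis i 1) + t *\<^sub>R axis j 1)) has_real_derivative pd j (pd i f) ((x + a *\<^sub>R axis i 1) + t *\<^sub>R axis j 1)) (at t)"
    if "0 \<le> t" "t \<le> s" for t
    using U[of a t] that a by (intro haspd_line C2_on_haspd[OF C2]) auto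
  obtain b where b: "0 < b" "b < s" "pd i f ((x + a *\<^sub>R axis i 1) + s *\<^sub>R axis j 1) - pd i f ((x + a *\<^sub>R axis i 1) + 0 *\<^sub>R axis j 1)
      = (s - 0) * pd j (pd i f) ((x + a *\<^sub>R axis i 1) + b *\<^sub>R axis j 1)"
    using MVT2[OF s d\<psi>] by auto
  have "\<phi> s - \<phi> 0 = s * (s * pd j (pd i f) (x + a *\<^sub>R axis i 1 + b *\<^sub>R axis j 1))"
    using a(3) b(3) by (simp add: algebra_simps)
  then show ?thesis using a b by (intro exI[of _ a] exI[of _ b]) (simp add: \<phi>_def algebra_simps)
qed

text \<open>The second difference does not depend on the order of the two directions, and both mixed
  derivatives are limits of it after division by \<open>s * s\<close>.\<close>

lemma pd_commute:
  fixes f :: "real^'n::finite \<Rightarrow> real"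
  assumes C2: "C2_on U f" and x: "x \<in> U"
  shows "pd i (pd j f) x = pd j (pd i f) x"
proof -
  have U: "open U" using C2 by (simp add: C2_on_def)
  have cont: "isCont (pd a (pd b f)) x" for a b
    using C2 x by (auto simp: C2_on_def continuous_on_eq_continuous_at)
  have "\<bar>pd i (pd j f) x - pd j (pd i f) x\<bar> \<le> 0 + e" if "e > 0" for e :: real
  proof -
    have e2: "e / 2 > 0" using \<open>e > 0\<close> by simp
    obtain r where r: "r > 0" "ball x r \<subseteq> U" using U x by (auto simp: open_contains_ball)
    obtain r1 where r1: "r1 > 0" "\<And>y. dist y x < r1 \<Longrightarrow> dist (pd i (pd j f) y) (pd i (pd j f) x) < e / 2"
      using cont e2 unfolding continuous_at_eps_delta by blast
    obtain r2 where r2: "r2 > 0" "\<And>y. dist y x < r2 \<Longrightarrow> dist (pd j (pd i f) y) (pd j (pd i f) x) < e / 2"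
      using cont e2 unfolding continuous_at_eps_delta by blast
    define s where "s = min r (min r1 r2) / 3"
    have s: "s > 0" "3 * s \<le> r" "3 * s \<le> r1" "3 * s \<le> r2" using r r1 r2 by (auto simp: s_def)
    have near: "dist (x + a *\<^sub>R axis k 1 + b *\<^sub>R axis l 1) x < 3 * s"
      if "0 \<le> a" "a \<le> s" "0 \<le> b" "b \<le> s" for a b and k l :: 'n
    proof -
      have "dist (x + a *\<^sub>R axis k 1 + b *\<^sub>R axis l 1) x = norm (a *\<^sub>R axis k 1 + b *\<^sub>R axis l 1 :: real^'n)"
        by (simp add: dist_norm algebra_simps)
      also have "\<dots> \<le> norm (a *\<^sub>R axis k 1 :: real^'n) + norm (b *\<^sub>R axis l 1 :: real^'n)" by (rule norm_triangle_ineq)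
      also have "\<dots> = a + b" using that by (simp add: norm_axis_1)
      finally show ?thesis using that s by simp
    qed
    have inU: "x + a *\<^sub>R axis k 1 + b *\<^sub>R axis l 1 \<in> U"
      if "0 \<le> a" "a \<le> s" "0 \<le> b" "b \<le> s" for a b and k l :: 'n
      using near[OF that, of k l] s r by (auto simp: dist_commute)
    let ?\<Delta> = "f (x + s *\<^sub>R axis i 1 + s *\<^sub>R axis j 1) - f (x + s *\<^sub>R axis i 1) - f (x + s *\<^sub>R axis j 1) + f x"
    obtain a b where ab: "0 < a" "a < s" "0 < b" "b < s" "?\<Delta> = s * s * pd j (pd i f) (x + a *\<^sub>R axis i 1 + b *\<^sub>R axis j 1)"
      using second_difference_mvt[OF C2 s(1) inU, of i j] by blast
    obtain c d where cd: "0 < c" "c < s" "0 < d" "d < s"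
        "f (x + s *\<^sub>R axis j 1 + s *\<^sub>R axis i 1) - f (x + s *\<^sub>R axis j 1) - f (x + s *\<^sub>R axis i 1) + f x = s * s * pd i (pd j f) (x + c *\<^sub>R axis j 1 + d *\<^sub>R axis i 1)"
      using second_difference_mvt[OF C2 s(1) inU, of j i] by blast
    have "?\<Delta> = s * s * pd i (pd j f) (x + c *\<^sub>R axis j 1 + d *\<^sub>R axis i 1)"
      using cd(5) by (simp add: algebra_simps)
    with ab(5) s(1) have "pd j (pd i f) (x + a *\<^sub>R axis i 1 + b *\<^sub>R axis j 1) = pd i (pd j f) (x + c *\<^sub>R axis j 1 + d *\<^sub>R axis i 1)"
      by simp
    moreover have "dist (pd j (pd i f) (x + a *\<^sub>R axis i 1 + b *\<^sub>R axis j 1)) (pd j (pd i f) x) < e / 2"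
      using near[of a b i j] ab s by (intro r2(2)) auto
    moreover have "dist (pd i (pd j f) (x + c *\<^sub>R axis j 1 + d *\<^sub>R axis i 1)) (pd i (pd j f) x) < e / 2"
      using near[of c d j i] cd s by (intro r1(2)) auto
    ultimately show ?thesis
      using dist_triangle_half_l[of "pd i (pd j f) (x + c *\<^sub>R axis j 1 + d *\<^sub>R axis i 1)" "pd i (pd j f) x" e "pd j (pd i f) x"]
      by (simp add: dist_real_def del: less_divide_eq_numeral1)
  qed
  then have "\<bar>pd i (pd j f) x - pd j (pd i f) x\<bar> \<le> 0" by (rule field_le_epsilon)
  then show ?thesis by simp
qed

section \<open>Decay at infinity\<close>

text \<open>The relation o(|x|^(-a)) for the function alone, in the weighted form in which exponents
  add under products. Derivatives get their own statements.\<close>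

definition decays :: "real \<Rightarrow> (real^'n::finite \<Rightarrow> real) \<Rightarrow> bool" where
  "decays a f \<longleftrightarrow> ((\<lambda>x. norm x powr a * f x) \<longlongrightarrow> 0) at_infinity"

lemma decays_add: "decays a f \<Longrightarrow> decays a h \<Longrightarrow> decays a (\<lambda>x. f x + h x)"
  unfolding decays_def using tendsto_add[of _ 0 at_infinity _ 0] by (fastforce simp: distrib_left)

lemma decays_diff: "decays a f \<Longrightarrow> decays a h \<Longrightarrow> decays a (\<lambda>x. f x - h x)"
  unfolding decays_def using tendsto_diff[of _ 0 at_infinity _ 0] by (fastforce simp: right_diff_distrib)

lemma decays_sum: "(\<And>i. i \<in> S \<Longrightarrow> decays a (f i)) \<Longrightarrow> decays a (\<lambda>x. \<Sum>i\<in>S. f i x)"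
  unfolding decays_def by (simp add: sum_distrib_left tendsto_null_sum)

lemma decays_mult: "decays a f \<Longrightarrow> decays b h \<Longrightarrow> decays (a + b) (\<lambda>x. f x * h x)"
  unfolding decays_def using tendsto_mult[of "\<lambda>x. norm x powr a * f x" 0 at_infinity "\<lambda>x. norm x powr b * h x" 0]
  by (simp add: powr_add mult_ac)

lemma decays_mult_tendsto: "decays a f \<Longrightarrow> (h \<longlongrightarrow> c) at_infinity \<Longrightarrow> decays a (\<lambda>x. f x * h x)"
  unfolding decays_def using tendsto_mult[of "\<lambda>x. norm x powr a * f x" 0 at_infinity h c]
  by (simp add: mult_ac)

lemma decays_cmult: "decays a f \<Longrightarrow> decays a (\<lambda>x. c * f x)"
  using decays_mult_tendsto[of a f "\<lambda>_. c" c] by (simp add: mult.commute)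

lemma decays_cong:
  assumes "decays a f" "eventually (\<lambda>x. f x = h x) at_infinity"
  shows "decays a h"
proof -
  have "eventually (\<lambda>x. norm x powr a * f x = norm x powr a * h x) at_infinity"
    using assms(2) by eventually_elim simp
  then show ?thesis using assms(1) unfolding decays_def by (rule Lim_transform_eventually[rotated])
qed

lemma eventually_at_infinity_norm_gt: "eventually (\<lambda>x::'a::real_normed_vector. r < norm x) at_infinity"
  unfolding eventually_at_infinity by (intro exI[of _ "r + 1"]) auto

lemma decays_le:
  assumes "decays b f" "a \<le> b"
  shows "decays a f"
  unfolding decays_def
proof (rule Lim_null_comparison)
  show "((\<lambda>x. \<bar>norm x powr b * f x\<bar>) \<longlongrightarrow> 0) at_infinity"
    using assms(1) unfolding decays_def by (simp add: tendsto_rabs_zero)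
  show "eventually (\<lambda>x. norm (norm x powr a * f x) \<le> \<bar>norm x powr b * f x\<bar>) at_infinity"
    using eventually_at_infinity_norm_gt[of 1]
    by eventually_elim (auto simp: abs_mult intro!: mult_right_mono powr_mono assms)
qed

lemma decays_tendsto_0:
  assumes "decays a f" "0 \<le> a"
  shows "(f \<longlongrightarrow> 0) at_infinity"
proof -
  have "decays 0 f" using decays_le assms by blast
  then have "((\<lambda>x. norm x powr 0 * f x) \<longlongrightarrow> 0) at_infinity" unfolding decays_def .
  moreover have "eventually (\<lambda>x. norm x powr 0 * f x = f x) at_infinity"
    using eventually_at_infinity_norm_gt[of 0] by eventually_elim simp
  ultimately show ?thesis by (rule Lim_transform_eventually)
qed

text \<open>The price of contracting with the position field:
  \<open>\<bar>x $ i\<bar> \<le> norm x\<close> costs one power.\<close>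

lemma decays_coord:
  assumes "decays a f"
  shows "decays (a - 1) (\<lambda>x. f x * x $ i)"
  unfolding decays_def
proof (rule Lim_null_comparison)
  show "((\<lambda>x. \<bar>norm x powr a * f x\<bar>) \<longlongrightarrow> 0) at_infinity"
    using assms(1) unfolding decays_def by (simp add: tendsto_rabs_zero)
  show "eventually (\<lambda>x. norm (norm x powr (a - 1) * (f x * x $ i)) \<le> \<bar>norm x powr a * f x\<bar>) at_infinity"
    using eventually_at_infinity_norm_gt[of 0]
  proof eventually_elim
    fix x :: "real^'a" assume x: "0 < norm x"
    have "norm (norm x powr (a - 1) * (f x * x $ i)) = norm x powr (a - 1) * \<bar>f x\<bar> * \<bar>x $ i\<bar>"
      by (simp add: abs_mult)
    also have "\<dots> \<le> norm x powr (a - 1) * \<bar>f x\<bar> * norm x"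
      by (intro mult_left_mono component_le_norm_cart) auto
    also have "\<dots> = \<bar>norm x powr a * f x\<bar>" using x by (simp add: abs_mult powr_diff)
    finally show "norm (norm x powr (a - 1) * (f x * x $ i)) \<le> \<bar>norm x powr a * f x\<bar>" .
  qed
qed

lemma tendsto_det:
  fixes A :: "'a \<Rightarrow> real^'n^'n::finite"
  assumes "\<And>i j. ((\<lambda>x. A x $ i $ j) \<longlongrightarrow> B $ i $ j) F"
  shows "((\<lambda>x. det (A x)) \<longlongrightarrow> det B) F"
  unfolding det_def by (intro tendsto_sum tendsto_mult tendsto_const tendsto_prod assms)

lemma haspd_det_ex:
  fixes A :: "real^'m::finite \<Rightarrow> real^'n^'n::finite"
  assumes "\<And>i j. \<exists>D. haspd k (\<lambda>x. A x $ i $ j) D x"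
  shows "\<exists>D. haspd k (\<lambda>x. det (A x)) D x"
proof -
  have "\<exists>D. haspd k (\<lambda>x. \<Prod>i\<in>UNIV. A x $ i $ p i) D x" for p
    by (intro haspd_prod_ex assms) simp
  then have "\<forall>p. \<exists>D. haspd k (\<lambda>x. \<Prod>i\<in>UNIV. A x $ i $ p i) D x" by blast
  from choice[OF this] obtain D where "\<And>p. haspd k (\<lambda>x. \<Prod>i\<in>UNIV. A x $ i $ p i) (D p) x" by blast
  then have "haspd k (\<lambda>x. \<Sum>p\<in>{p. p permutes UNIV}. of_int (sign p) * (\<Prod>i\<in>UNIV. A x $ i $ p i)) (\<Sum>p\<in>{p. p permutes UNIV}. of_int (sign p) * D p) x"
    by (intro haspd_sum haspd_cmult)
  then show ?thesis unfolding det_def by blast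
qed

section \<open>The metric near infinity and its inverse\<close>

locale af_metric =
  fixes g :: "'n::finite metric" and R0 \<tau> :: real
  assumes tau: "\<tau> = (real CARD('n) - 2) / 2"
    and dim: "CARD('n) \<ge> 3"
    and reg: "riemannian_C2_on {x. R0 < norm x} g"
    and decay: "\<forall>i j. little_o2 (\<lambda>x. g i j x - (if i = j then 1 else 0)) \<tau>"
begin

abbreviation "U \<equiv> {x::real^'n. R0 < norm x}"
abbreviation \<delta> :: "'n \<Rightarrow> 'n \<Rightarrow> real" where "\<delta> i j \<equiv> (if i = j then 1 else 0)"

lemma tau_pos: "\<tau> > 0" using dim by (simp add: tau)

lemma open_U: "open U"
  by (intro open_Collect_less continuous_intros)

lemma ev_U: "eventually (\<lambda>x. x \<in> U) at_infinity"
  using eventually_at_infinity_norm_gt by simp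

lemma C2g: "C2_on U (g i j)" using reg by (simp add: riemannian_C2_on_def)

lemma g_sym: "x \<in> U \<Longrightarrow> g i j x = g j i x"
  using reg by (auto simp: riemannian_C2_on_def)

lemma hp1: "x \<in> U \<Longrightarrow> haspd k (g i j) (pd k (g i j) x) x"
  by (rule C2_on_haspd(1)[OF C2g])

lemma hp2: "x \<in> U \<Longrightarrow> haspd m (pd k (g i j)) (pd m (pd k (g i j)) x) x"
  by (rule C2_on_haspd(2)[OF C2g])

lemma pd_g_sym: "x \<in> U \<Longrightarrow> pd k (g i j) x = pd k (g j i) x"
  by (rule pd_cong_open[OF open_U]) (auto intro: g_sym)

lemma pd2_g_sym: "x \<in> U \<Longrightarrow> pd m (pd k (g i j)) x = pd m (pd k (g j i)) x"
  by (rule pd_cong_open[OF open_U]) (auto intro: pd_g_sym)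

lemma cont_g: "continuous_on U (g i j)" "continuous_on U (pd k (g i j))" "continuous_on U (pd m (pd k (g i j)))"
  using C2g[of i j] by (auto simp: C2_on_def)

lemma decays_g: "decays \<tau> (\<lambda>x. g i j x - \<delta> i j)"
  using decay unfolding little_o2_def decays_def by blast

lemma decays_pd: "decays (\<tau> + 1) (pd k (g i j))"
proof (rule decays_cong)
  show "decays (\<tau> + 1) (pd k (\<lambda>x. g i j x - \<delta> i j))" using decay unfolding little_o2_def decays_def by blast
  show "eventually (\<lambda>x. pd k (\<lambda>x. g i j x - \<delta> i j) x = pd k (g i j) x) at_infinity"
    using ev_U
  proof eventually_elim
    fix x assume "x \<in> U"
    from haspd_diff[OF hp1[OF this] haspd_const] show "pd k (\<lambda>x. g i j x - \<delta> i j) x = pd k (g i j) x"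
      by (intro haspd_imp_pd) simp
  qed
qed

lemma decays_pd2: "decays (\<tau> + 2) (pd m (pd k (g i j)))"
proof (rule decays_cong)
  show "decays (\<tau> + 2) (pd m (pd k (\<lambda>x. g i j x - \<delta> i j)))" using decay unfolding little_o2_def decays_def by blast
  show "eventually (\<lambda>x. pd m (pd k (\<lambda>x. g i j x - \<delta> i j)) x = pd m (pd k (g i j)) x) at_infinity"
    using ev_U
  proof eventually_elim
    fix x assume "x \<in> U"
    then show "pd m (pd k (\<lambda>x. g i j x - \<delta> i j)) x = pd m (pd k (g i j)) x"
    proof (rule pd_cong_open[OF open_U])
      fix y assume "y \<in> U"
      from haspd_diff[OF hp1[OF this] haspd_const] show "pd k (\<lambda>x. g i j x - \<delta> i j) y = pd k (g i j) y"
        by (intro haspd_imp_pd) simp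
    qed
  qed
qed

lemma lim_g: "(g i j \<longlongrightarrow> \<delta> i j) at_infinity"
  by (rule Lim_null[THEN iffD2], rule decays_tendsto_0[OF decays_g]) (use tau_pos in simp)

lemma gmat_kernel:
  assumes "x \<in> U" "gmat g x *v v = 0"
  shows "v = 0"
proof (rule ccontr)
  assume "v \<noteq> 0"
  then have "(\<Sum>i\<in>UNIV. \<Sum>j\<in>UNIV. g i j x * v$i * v$j) > 0"
    using reg assms(1) by (auto simp: riemannian_C2_on_def)
  also have "(\<Sum>i\<in>UNIV. \<Sum>j\<in>UNIV. g i j x * v$i * v$j) = (\<Sum>i\<in>UNIV. v$i * (gmat g x *v v)$i)"
    by (simp add: gmat_def matrix_vector_mult_def sum_distrib_left mult_ac)
  finally show False using assms(2) by simp
qed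

lemma gmat_invertible: "x \<in> U \<Longrightarrow> invertible (gmat g x)"
  using gmat_kernel matrix_left_invertible_ker[of "gmat g x"] invertible_left_inverse by blast

lemma matrix_inv_gmat:
  assumes "x \<in> U"
  shows "gmat g x ** matrix_inv (gmat g x) = mat 1" "matrix_inv (gmat g x) ** gmat g x = mat 1"
proof -
  have "\<exists>B. gmat g x ** B = mat 1 \<and> B ** gmat g x = mat 1"
    using gmat_invertible[OF assms] by (simp add: invertible_def)
  from someI_ex[OF this] show "gmat g x ** matrix_inv (gmat g x) = mat 1" "matrix_inv (gmat g x) ** gmat g x = mat 1"
    by (simp_all add: matrix_inv_def)
qed

lemma ginv_right: "x \<in> U \<Longrightarrow> (\<Sum>j\<in>UNIV. g i j x * ginv g j k x) = \<delta> i k"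
  using matrix_inv_gmat(1)[of x]
  by (auto simp: vec_eq_iff matrix_matrix_mult_def gmat_def ginv_def mat_def)

lemma ginv_left: "x \<in> U \<Longrightarrow> (\<Sum>j\<in>UNIV. ginv g i j x * g j k x) = \<delta> i k"
  using matrix_inv_gmat(2)[of x]
  by (auto simp: vec_eq_iff matrix_matrix_mult_def gmat_def ginv_def mat_def)

abbreviation cof :: "'n \<Rightarrow> 'n \<Rightarrow> real^'n \<Rightarrow> real^'n^'n" where
  "cof k m x \<equiv> (\<chi> i j. if j = k then \<delta> i m else g i j x)"

text \<open>Cramer's rule exhibits the inverse as a quotient of polynomials in the entries, from
  which differentiability, continuity and the limit at infinity are read off.\<close>

lemma ginv_cramer:
  assumes "x \<in> U"
  shows "ginv g k m x = det (cof k m x) / det (gmat g x)"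
proof -
  have d: "det (gmat g x) \<noteq> 0" using gmat_invertible[OF assms] by (simp add: invertible_det_nz)
  define y where "y = (\<chi> i. ginv g i m x)"
  have "gmat g x *v y = axis m 1"
    using ginv_right[OF assms] by (auto simp: vec_eq_iff matrix_vector_mult_def gmat_def y_def axis_def)
  then have "y = (\<chi> k. det (\<chi> i j. if j = k then axis m 1 $ i else gmat g x $ i $ j) / det (gmat g x))"
    by (simp add: cramer[OF d])
  then have "y $ k = det (\<chi> i j. if j = k then axis m 1 $ i else gmat g x $ i $ j) / det (gmat g x)"
    by simp
  then show ?thesis by (simp add: y_def axis_def gmat_def cong: if_cong)
qed

lemma haspd_ginv_ex:
  assumes "x \<in> U"
  shows "\<exists>D. haspd k (ginv g i j) D x"
proof -
  have "\<exists>D. haspd k (\<lambda>x. det (cof i j x)) D x"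
  proof (rule haspd_det_ex)
    fix a b show "\<exists>D. haspd k (\<lambda>x. cof i j x $ a $ b) D x"
    proof (cases "b = i")
      case True
      then show ?thesis using haspd_const[of k "\<delta> a j" x] by (intro exI[of _ 0]) simp
    next
      case False
      then show ?thesis using hp1[OF assms] by auto
    qed
  qed
  moreover have "\<exists>D. haspd k (\<lambda>x. det (gmat g x)) D x"
    by (rule haspd_det_ex) (use hp1[OF assms] in \<open>auto simp: gmat_def\<close>)
  moreover have "det (gmat g x) \<noteq> 0" using gmat_invertible[OF assms] by (simp add: invertible_det_nz)
  ultimately obtain D where "haspd k (\<lambda>x. det (cof i j x) / det (gmat g x)) D x"
    using haspd_divide_ex by blast
  then have "haspd k (ginv g i j) D x"
    by (rule haspd_cong_open[OF _ open_U assms]) (simp add: ginv_cramer)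
  then show ?thesis ..
qed

lemma cont_ginv: "continuous_on U (ginv g i j)"
proof -
  have "isCont (\<lambda>x. det (cof i j x) / det (gmat g x)) x" if x: "x \<in> U" for x
  proof -
    have c: "(g a b \<longlongrightarrow> g a b x) (at x)" for a b
      using cont_g(1)[of a b] x open_U by (auto simp: continuous_on_eq_continuous_at isCont_def)
    have "((\<lambda>x. det (cof i j x)) \<longlongrightarrow> det (cof i j x)) (at x)"
      by (rule tendsto_det) (auto intro: c tendsto_const)
    moreover have "((\<lambda>x. det (gmat g x)) \<longlongrightarrow> det (gmat g x)) (at x)"
      by (rule tendsto_det) (auto intro: c simp: gmat_def)
    moreover have "det (gmat g x) \<noteq> 0" using gmat_invertible[OF x] by (simp add: invertible_det_nz)
    ultimately show ?thesis unfolding isCont_def by (rule tendsto_divide)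
  qed
  then have "continuous_on U (\<lambda>x. det (cof i j x) / det (gmat g x))"
    using open_U by (simp add: continuous_on_eq_continuous_at)
  then show ?thesis by (rule continuous_on_cong[THEN iffD1, rotated -1]) (auto simp: ginv_cramer)
qed

lemma lim_det: "((\<lambda>x. det (gmat g x)) \<longlongrightarrow> 1) at_infinity"
proof -
  have "((\<lambda>x. det (gmat g x)) \<longlongrightarrow> det (mat 1 :: real^'n^'n)) at_infinity"
    by (rule tendsto_det) (use lim_g in \<open>auto simp: gmat_def mat_def\<close>)
  then show ?thesis by simp
qed

lemma lim_ginv: "(ginv g i j \<longlongrightarrow> \<delta> i j) at_infinity"
proof -
  have "((\<lambda>x. det (cof i j x)) \<longlongrightarrow> det (\<chi> a b. if b = i then \<delta> a j else \<delta> a b)) at_infinity"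
    by (rule tendsto_det) (use lim_g in \<open>auto intro: tendsto_const\<close>)
  moreover have "det (\<chi> a b. if b = i then \<delta> a j else \<delta> a b) = \<delta> i j"
  proof -
    have "det (\<chi> a b. if b = i then (mat 1 *v (axis j 1 :: real^'n)) $ a else (mat 1 :: real^'n^'n) $ a $ b) = (axis j 1 :: real^'n) $ i * det (mat 1 :: real^'n^'n)"
      by (rule cramer_lemma)
    then show ?thesis unfolding matrix_vector_mul_lid det_I by (simp add: axis_def mat_def cong: if_cong)
  qed
  ultimately have "((\<lambda>x. det (cof i j x) / det (gmat g x)) \<longlongrightarrow> \<delta> i j / 1) at_infinity"
    using lim_det by (intro tendsto_divide) auto
  then have "((\<lambda>x. det (cof i j x) / det (gmat g x)) \<longlongrightarrow> \<delta> i j) at_infinity" by simp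
  then show ?thesis
    by (rule Lim_transform_eventually) (use ev_U in \<open>eventually_elim, simp add: ginv_cramer\<close>)
qed

text \<open>In matrix terms, the inverse minus the identity is the negative of the inverse times
  \<open>g\<close> minus the identity.\<close>

lemma decays_ginv: "decays \<tau> (\<lambda>x. ginv g i j x - \<delta> i j)"
proof (rule decays_cong)
  show "decays \<tau> (\<lambda>x. (- 1) * (\<Sum>k\<in>UNIV. (g k j x - \<delta> k j) * ginv g i k x))"
    by (intro decays_cmult decays_sum decays_mult_tendsto[OF decays_g lim_ginv])
  show "eventually (\<lambda>x. (- 1) * (\<Sum>k\<in>UNIV. (g k j x - \<delta> k j) * ginv g i k x) = ginv g i j x - \<delta> i j) at_infinity"
    using ev_U
  proof eventually_elim
    fix x assume x: "x \<in> U"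
    have "(\<Sum>k\<in>UNIV. (g k j x - \<delta> k j) * ginv g i k x) = (\<Sum>k\<in>UNIV. ginv g i k x * g k j x) - (\<Sum>k\<in>UNIV. \<delta> k j * ginv g i k x)"
      by (simp add: algebra_simps sum_subtractf)
    also have "(\<Sum>k\<in>UNIV. \<delta> k j * ginv g i k x) = ginv g i j x"
      by (simp add: if_distrib[of "\<lambda>t. t * _"] sum.delta cong: if_cong)
    finally show "(- 1) * (\<Sum>k\<in>UNIV. (g k j x - \<delta> k j) * ginv g i k x) = ginv g i j x - \<delta> i j"
      using ginv_left[OF x] by simp
  qed
qed

definition dginv :: "'n \<Rightarrow> 'n \<Rightarrow> 'n \<Rightarrow> real^'n \<Rightarrow> real" where
  "dginv m i k x = - (\<Sum>a\<in>UNIV. \<Sum>b\<in>UNIV. ginv g i a x * pd m (g a b) x * ginv g b k x)"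

text \<open>Cramer's rule gives only existence of the derivative. Its value comes from
  differentiating the relation between \<open>ginv\<close> and \<open>g\<close> and multiplying by
  the inverse.\<close>

lemma haspd_ginv:
  assumes x: "x \<in> U"
  shows "haspd m (ginv g i k) (dginv m i k x) x"
proof -
  obtain D where D: "\<And>j. haspd m (ginv g i j) (D j) x" using haspd_ginv_ex[OF x] by metis
  have z: "(\<Sum>a\<in>UNIV. D a * g a b x + pd m (g a b) x * ginv g i a x) = 0" for b
  proof -
    have "haspd m (\<lambda>x. \<Sum>a\<in>UNIV. ginv g i a x * g a b x) (\<Sum>a\<in>UNIV. D a * g a b x + pd m (g a b) x * ginv g i a x) x"
      by (intro haspd_sum haspd_mult D hp1 x)
    from haspd_cong_open[OF this open_U x, of "\<lambda>_. \<delta> i b"] have "haspd m (\<lambda>_. \<delta> i b) (\<Sum>a\<in>UNIV. D a * g a b x + pd m (g a b) x * ginv g i a x) x"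
      using ginv_left by auto
    from haspd_imp_pd[OF this] haspd_imp_pd[OF haspd_const[of m "\<delta> i b" x]] show ?thesis by simp
  qed
  have "0 = (\<Sum>b\<in>UNIV. (\<Sum>a\<in>UNIV. D a * g a b x + pd m (g a b) x * ginv g i a x) * ginv g b k x)"
    by (simp add: z)
  also have "\<dots> = (\<Sum>b\<in>UNIV. \<Sum>a\<in>UNIV. D a * (g a b x * ginv g b k x)) + (\<Sum>b\<in>UNIV. \<Sum>a\<in>UNIV. ginv g i a x * pd m (g a b) x * ginv g b k x)"
  proof -
    have "(\<Sum>a\<in>UNIV. D a * g a b x + pd m (g a b) x * ginv g i a x) * ginv g b k x
      = (\<Sum>a\<in>UNIV. D a * (g a b x * ginv g b k x)) + (\<Sum>a\<in>UNIV. ginv g i a x * pd m (g a b) x * ginv g b k x)" for b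
      unfolding sum_distrib_right sum.distrib[symmetric] by (intro sum.cong refl) (simp add: algebra_simps)
    then show ?thesis by (simp only: sum.distrib)
  qed
  also have "(\<Sum>b\<in>UNIV. \<Sum>a\<in>UNIV. D a * (g a b x * ginv g b k x)) = (\<Sum>a\<in>UNIV. D a * (\<Sum>b\<in>UNIV. g a b x * ginv g b k x))"
    unfolding sum_distrib_left by (rule sum.swap)
  also have "\<dots> = D k" by (simp add: ginv_right[OF x] if_distrib[of "\<lambda>t. _ * t"] cong: if_cong)
  also have "(\<Sum>b\<in>UNIV. \<Sum>a\<in>UNIV. ginv g i a x * pd m (g a b) x * ginv g b k x) = - dginv m i k x"
    unfolding dginv_def minus_minus by (rule sum.swap)
  finally have "D k = dginv m i k x" by simp
  then show ?thesis using D[of k] by simp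
qed

lemma cont_dginv: "continuous_on U (dginv m i k)"
  unfolding dginv_def by (intro continuous_intros cont_ginv cont_g)

lemma decays_dginv: "decays (\<tau> + 1) (dginv m i k)"
proof -
  have "decays (\<tau> + 1) (\<lambda>x. (- 1) * (\<Sum>a\<in>UNIV. \<Sum>b\<in>UNIV. pd m (g a b) x * (ginv g i a x * ginv g b k x)))"
    by (intro decays_cmult decays_sum decays_mult_tendsto[OF decays_pd tendsto_mult[OF lim_ginv lim_ginv]])
  then show ?thesis by (rule decays_cong) (simp add: dginv_def mult_ac)
qed

section \<open>Linearisation of the curvature\<close>

text \<open>Twice the Christoffel symbol of the first kind, with \<open>l\<close> the lowered
  index.\<close>

definition chr1 :: "'n \<Rightarrow> 'n \<Rightarrow> 'n \<Rightarrow> real^'n \<Rightarrow> real" where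
  "chr1 l i j x = pd i (g j l) x + pd j (g i l) x - pd l (g i j) x"

definition dchr1 :: "'n \<Rightarrow> 'n \<Rightarrow> 'n \<Rightarrow> 'n \<Rightarrow> real^'n \<Rightarrow> real" where
  "dchr1 m l i j x = pd m (pd i (g j l)) x + pd m (pd j (g i l)) x - pd m (pd l (g i j)) x"

definition dchr :: "'n \<Rightarrow> 'n \<Rightarrow> 'n \<Rightarrow> 'n \<Rightarrow> real^'n \<Rightarrow> real" where
  "dchr m k i j x = (1/2) * (\<Sum>l\<in>UNIV. dginv m k l x * chr1 l i j x + dchr1 m l i j x * ginv g k l x)"

lemma haspd_chr1: "x \<in> U \<Longrightarrow> haspd m (chr1 l i j) (dchr1 m l i j x) x"
  unfolding chr1_def dchr1_def by (intro haspd_add haspd_diff hp2)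

lemma pd_christoffel:
  assumes "x \<in> U"
  shows "pd m (christoffel g k i j) x = dchr m k i j x"
proof (rule haspd_imp_pd)
  have "haspd m (\<lambda>x. (1/2) * (\<Sum>l\<in>UNIV. ginv g k l x * chr1 l i j x)) (dchr m k i j x) x"
    unfolding dchr_def by (intro haspd_cmult haspd_sum haspd_mult haspd_ginv haspd_chr1 assms)
  then show "haspd m (christoffel g k i j) (dchr m k i j x) x"
    by (simp add: christoffel_def[abs_def] chr1_def)
qed

lemma cont_chr: "continuous_on U (chr1 l i j)" "continuous_on U (dchr1 m l i j)" "continuous_on U (dchr m k i j)"
  "continuous_on U (christoffel g k i j)"
  unfolding chr1_def dchr1_def dchr_def christoffel_def by (intro continuous_intros cont_ginv cont_dginv cont_g)+

lemma decays_chr1: "decays (\<tau> + 1) (chr1 l i j)" "decays (\<tau> + 2) (dchr1 m l i j)"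
  unfolding chr1_def dchr1_def by (intro decays_add decays_diff decays_pd decays_pd2)+

lemma decays_christoffel: "decays (\<tau> + 1) (christoffel g k i j)"
proof -
  have "decays (\<tau> + 1) (\<lambda>x. (1/2) * (\<Sum>l\<in>UNIV. chr1 l i j x * ginv g k l x))"
    by (intro decays_cmult decays_sum decays_mult_tendsto[OF decays_chr1(1) lim_ginv])
  then show ?thesis by (rule decays_cong) (simp add: christoffel_def chr1_def mult.commute)
qed

text \<open>Both here and in \<open>decays_quadratic2\<close> the exponents add up to
  \<open>2 * \<tau> + 2\<close>, which is the dimension.\<close>

lemma decays_quadratic: "decays (\<tau> + 1) f \<Longrightarrow> decays (\<tau> + 1) h \<Longrightarrow> decays (real CARD('n)) (\<lambda>x. f x * h x)"
  using decays_mult[of "\<tau> + 1" f "\<tau> + 1" h] by (simp add: field_simps tau)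

lemma decays_quadratic2: "decays (\<tau> + 2) f \<Longrightarrow> decays \<tau> h \<Longrightarrow> decays (real CARD('n)) (\<lambda>x. f x * h x)"
  using decays_mult[of "\<tau> + 2" f "\<tau>" h] by (simp add: field_simps tau)

text \<open>Differentiating the inverse metric, or replacing it by \<delta> next to second
  derivatives, produces only terms quadratic in the deviation from the flat metric.\<close>

lemma decays_dchr: "decays (real CARD('n)) (\<lambda>x. dchr m k i j x - (1/2) * dchr1 m k i j x)"
proof -
  have "decays (real CARD('n)) (\<lambda>x. (1/2) * (\<Sum>l\<in>UNIV. dginv m k l x * chr1 l i j x + dchr1 m l i j x * (ginv g k l x - \<delta> k l)))"
    by (intro decays_cmult decays_sum decays_add decays_quadratic decays_quadratic2 decays_dginv decays_chr1 decays_ginv)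
  moreover have "(1/2) * (\<Sum>l\<in>UNIV. dginv m k l x * chr1 l i j x + dchr1 m l i j x * (ginv g k l x - \<delta> k l)) = dchr m k i j x - (1/2) * dchr1 m k i j x" for x
  proof -
    have "(\<Sum>l\<in>UNIV. dchr1 m l i j x * \<delta> k l) = dchr1 m k i j x"
      by (simp add: if_distrib[of "\<lambda>t. _ * t"] cong: if_cong)
    then show ?thesis
      by (simp add: dchr_def right_diff_distrib sum.distrib sum_subtractf algebra_simps)
  qed
  ultimately show ?thesis by (simp only:)
qed

text \<open>The Ricci tensor linearised at the flat metric.\<close>

definition ric1 :: "'n \<Rightarrow> 'n \<Rightarrow> real^'n \<Rightarrow> real" where
  "ric1 i j x = (\<Sum>k\<in>UNIV. (1/2) * dchr1 k k i j x - (1/2) * dchr1 j k i k x)"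

text \<open>The Ricci tensor with its derivatives of Christoffel symbols written out, which makes
  continuity and decay accessible; the two agree on \<open>U\<close>.\<close>

definition ricx :: "'n \<Rightarrow> 'n \<Rightarrow> real^'n \<Rightarrow> real" where
  "ricx i j x = (\<Sum>k\<in>UNIV. dchr k k i j x - dchr j k i k x
      + (\<Sum>l\<in>UNIV. christoffel g k k l x * christoffel g l i j x - christoffel g k j l x * christoffel g l i k x))"

lemma ricci_eq: "x \<in> U \<Longrightarrow> ricci g i j x = ricx i j x"
  by (simp add: ricci_def ricx_def pd_christoffel)

lemma cont_ricci: "continuous_on U (ricci g i j)"
proof -
  have "continuous_on U (ricx i j)" unfolding ricx_def by (intro continuous_intros cont_chr)
  then show ?thesis by (rule continuous_on_cong[THEN iffD1, rotated -1]) (auto simp: ricci_eq)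
qed

lemma decays_ricci: "decays (real CARD('n)) (\<lambda>x. ricci g i j x - ric1 i j x)"
proof (rule decays_cong)
  show "decays (real CARD('n)) (\<lambda>x. \<Sum>k\<in>UNIV. (dchr k k i j x - (1/2) * dchr1 k k i j x) - (dchr j k i k x - (1/2) * dchr1 j k i k x)
      + (\<Sum>l\<in>UNIV. christoffel g k k l x * christoffel g l i j x - christoffel g k j l x * christoffel g l i k x))"
    by (intro decays_sum decays_add decays_diff decays_dchr decays_quadratic decays_christoffel)
  show "eventually (\<lambda>x. (\<Sum>k\<in>UNIV. (dchr k k i j x - (1/2) * dchr1 k k i j x) - (dchr j k i k x - (1/2) * dchr1 j k i k x)
      + (\<Sum>l\<in>UNIV. christoffel g k k l x * christoffel g l i j x - christoffel g k j l x * christoffel g l i k x)) = ricci g i j x - ric1 i j x) at_infinity"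
    using ev_U
    by eventually_elim (simp add: ricci_eq ricx_def ric1_def algebra_simps flip: sum_subtractf)
qed

lemma decays_ric1: "decays (\<tau> + 2) (ric1 i j)"
  unfolding ric1_def by (intro decays_sum decays_diff decays_cmult decays_chr1)

lemma decays_ricci': "decays (\<tau> + 2) (ricci g i j)"
proof -
  have "decays (\<tau> + 2) (\<lambda>x. (ricci g i j x - ric1 i j x) + ric1 i j x)"
    using dim by (intro decays_add decays_ric1 decays_le[OF decays_ricci]) (simp add: field_simps tau)
  then show ?thesis by simp
qed

lemma decays_scalar: "decays (real CARD('n)) (\<lambda>x. scalar_curv g x - (\<Sum>i\<in>UNIV. ric1 i i x))"
proof -
  have "decays (real CARD('n)) (\<lambda>x. (\<Sum>i\<in>UNIV. \<Sum>j\<in>UNIV. ricci g i j x * (ginv g i j x - \<delta> i j)) + (\<Sum>i\<in>UNIV. ricci g i i x - ric1 i i x))"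
    by (intro decays_add decays_sum decays_quadratic2 decays_ricci decays_ricci' decays_ginv)
  moreover have "(\<Sum>i\<in>UNIV. \<Sum>j\<in>UNIV. ricci g i j x * (ginv g i j x - \<delta> i j)) + (\<Sum>i\<in>UNIV. ricci g i i x - ric1 i i x)
      = scalar_curv g x - (\<Sum>i\<in>UNIV. ric1 i i x)" for x
  proof -
    have "(\<Sum>j\<in>UNIV. ricci g i j x * \<delta> i j) = ricci g i i x" for i
      by (simp add: if_distrib[of "\<lambda>t. _ * t"] cong: if_cong)
    then show ?thesis
      by (simp add: scalar_curv_def right_diff_distrib sum_subtractf mult.commute)
  qed
  ultimately show ?thesis by simp
qed

lemma cont_scalar: "continuous_on U (scalar_curv g)"
  unfolding scalar_curv_def by (intro continuous_intros cont_ginv cont_ricci)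

lemma cont_einstein: "continuous_on U (einstein g i j)"
  unfolding einstein_def by (intro continuous_intros cont_scalar cont_ricci cont_g)

text \<open>The Einstein tensor linearised at the flat metric, its trace being taken with
  \<delta>.\<close>

definition ein1 :: "'n \<Rightarrow> 'n \<Rightarrow> real^'n \<Rightarrow> real" where
  "ein1 i j x = ric1 i j x - (1/2) * (\<Sum>a\<in>UNIV. ric1 a a x) * \<delta> i j"

lemma decays_scalar1: "decays (\<tau> + 2) (\<lambda>x. \<Sum>a\<in>UNIV. ric1 a a x)"
  by (intro decays_sum decays_ric1)

lemma decays_einstein: "decays (real CARD('n)) (\<lambda>x. einstein g i j x - ein1 i j x)"
proof -
  have "decays (real CARD('n)) (\<lambda>x. (ricci g i j x - ric1 i j x) - (1/2) * ((scalar_curv g x - (\<Sum>a\<in>UNIV. ric1 a a x)) * g i j x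
      + (\<Sum>a\<in>UNIV. ric1 a a x) * (g i j x - \<delta> i j)))"
    by (intro decays_diff decays_cmult decays_add decays_ricci decays_mult_tendsto[OF decays_scalar lim_g] decays_quadratic2[OF decays_scalar1 decays_g])
  then show ?thesis by (rule decays_cong) (simp add: einstein_def ein1_def algebra_simps)
qed

lemma decays_ein1: "decays (\<tau> + 2) (ein1 i j)"
proof -
  have "decays (\<tau> + 2) (\<lambda>x. ric1 i j x - (\<Sum>a\<in>UNIV. ric1 a a x) * ((1/2) * \<delta> i j))"
    by (intro decays_diff decays_ric1 decays_mult_tendsto[OF decays_scalar1 tendsto_const])
  then show ?thesis by (rule decays_cong) (simp add: ein1_def)
qed

lemma near_tendsto: "decays \<tau> (\<lambda>x. f x - c) \<Longrightarrow> (f \<longlongrightarrow> c) at_infinity"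
  by (rule Lim_null[THEN iffD2], rule decays_tendsto_0) (use tau_pos in auto)

lemma near_mult:
  assumes "decays \<tau> (\<lambda>x. f x - c)" "decays \<tau> (\<lambda>x. h x - d)"
  shows "decays \<tau> (\<lambda>x. f x * h x - c * d)"
proof -
  have "decays \<tau> (\<lambda>x. (f x - c) * h x + c * (h x - d))"
    by (intro decays_add decays_cmult decays_mult_tendsto[OF assms(1) near_tendsto[OF assms(2)]] assms)
  then show ?thesis by (simp add: algebra_simps)
qed

lemma decays_zero: "decays a (\<lambda>x. 0)"
  by (simp add: decays_def)

lemma near_prod:
  assumes "finite S" "\<And>a. a \<in> S \<Longrightarrow> decays \<tau> (\<lambda>x. f a x - c a)"
  shows "decays \<tau> (\<lambda>x. (\<Prod>a\<in>S. f a x) - (\<Prod>a\<in>S. c a))"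
  using assms
proof (induction S)
  case empty
  show ?case by (simp add: decays_zero)
next
  case (insert a S)
  have "decays \<tau> (\<lambda>x. f a x * (\<Prod>a\<in>S. f a x) - c a * (\<Prod>a\<in>S. c a))"
    using insert by (intro near_mult) auto
  then show ?case using insert.hyps by simp
qed

lemma decays_det: "decays \<tau> (\<lambda>x. det (gmat g x) - 1)"
proof -
  have "decays \<tau> (\<lambda>x. \<Sum>p\<in>{p. p permutes UNIV}. of_int (sign p) * ((\<Prod>i\<in>UNIV. g i (p i) x) - (\<Prod>i\<in>UNIV. \<delta> i (p i))))"
    by (intro decays_sum decays_cmult near_prod decays_g) simp
  then have "decays \<tau> (\<lambda>x. det (gmat g x) - det (mat 1 :: real^'n^'n))"
    by (simp add: det_def gmat_def mat_def right_diff_distrib sum_subtractf)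
  then show ?thesis by simp
qed

text \<open>For \<open>s > 0\<close> the factor \<open>s + 1\<close> is at least one, so
  \<open>s - 1\<close> is dominated by \<open>s * s - 1\<close>.\<close>

lemma decays_sqrt_det: "decays \<tau> (\<lambda>x. sqrt (det (gmat g x)) - 1)"
  unfolding decays_def
proof (rule Lim_null_comparison)
  show "((\<lambda>x. \<bar>norm x powr \<tau> * (det (gmat g x) - 1)\<bar>) \<longlongrightarrow> 0) at_infinity"
    using decays_det unfolding decays_def by (rule tendsto_rabs_zero)
  have "eventually (\<lambda>x. det (gmat g x) > 0) at_infinity"
    using lim_det by (rule order_tendstoD) simp
  then show "eventually (\<lambda>x. norm (norm x powr \<tau> * (sqrt (det (gmat g x)) - 1)) \<le> \<bar>norm x powr \<tau> * (det (gmat g x) - 1)\<bar>) at_infinity"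
  proof eventually_elim
    fix x :: "real^'n" assume d: "det (gmat g x) > 0"
    define s where "s = sqrt (det (gmat g x))"
    have s: "s > 0" "det (gmat g x) = s * s" using d by (auto simp: s_def)
    have "\<bar>s - 1\<bar> * 1 \<le> \<bar>s - 1\<bar> * \<bar>s + 1\<bar>" using s by (intro mult_left_mono) auto
    also have "\<dots> = \<bar>s * s - 1\<bar>" by (simp add: algebra_simps flip: abs_mult)
    finally show "norm (norm x powr \<tau> * (sqrt (det (gmat g x)) - 1)) \<le> \<bar>norm x powr \<tau> * (det (gmat g x) - 1)\<bar>"
      by (simp add: abs_mult s(2) mult_left_mono flip: s_def)
  qed
qed

lemma cont_sqrt_det: "continuous_on U (\<lambda>x. sqrt (det (gmat g x)))"
  unfolding det_def gmat_def by (intro continuous_intros) (auto intro: cont_g)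

section \<open>The two fluxes and the antisymmetric potential\<close>

definition flux_adm :: "'n \<Rightarrow> real^'n \<Rightarrow> real" where
  "flux_adm j x = (\<Sum>l\<in>UNIV. pd l (g j l) x - pd j (g l l) x)"

definition dflux_adm :: "'n \<Rightarrow> 'n \<Rightarrow> real^'n \<Rightarrow> real" where
  "dflux_adm m j x = (\<Sum>l\<in>UNIV. pd m (pd l (g j l)) x - pd m (pd j (g l l)) x)"

text \<open>The factor \<open>sqrt q\<close> of the unit normal of \<open>g\<close> cancels against
  that of its area element, which makes the Ricci mass linear in the Euclidean normal.\<close>

definition flux_ric :: "'n \<Rightarrow> real^'n \<Rightarrow> real" where
  "flux_ric k x = (\<Sum>i\<in>UNIV. \<Sum>j\<in>UNIV. einstein g i j x * x $ i * ginv g j k x) * sqrt (det (gmat g x))"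

text \<open>The linearised Einstein tensor contracted with the position vector is the divergence of this antisymmetric
  field plus a multiple of the ADM flux.\<close>
definition potential :: "'n \<Rightarrow> 'n \<Rightarrow> real^'n \<Rightarrow> real" where
  "potential k j x = (1/2) * ((\<Sum>i\<in>UNIV. x $ i * (pd j (g i k) x - pd k (g i j) x))
     + (x $ k * flux_adm j x - x $ j * flux_adm k x))"

definition dpotential :: "'n \<Rightarrow> 'n \<Rightarrow> 'n \<Rightarrow> real^'n \<Rightarrow> real" where
  "dpotential m k j x = (1/2) * ((\<Sum>i\<in>UNIV. \<delta> m i * (pd j (g i k) x - pd k (g i j) x)
        + (pd m (pd j (g i k)) x - pd m (pd k (g i j)) x) * x $ i)
     + ((\<delta> m k * flux_adm j x + dflux_adm m j x * x $ k) - (\<delta> m j * flux_adm k x + dflux_adm m k x * x $ j)))"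

lemma potential_antisym: "potential k j x = - potential j k x"
  by (simp add: potential_def algebra_simps sum_subtractf)

lemma haspd_flux_adm: "x \<in> U \<Longrightarrow> haspd m (flux_adm j) (dflux_adm m j x) x"
  unfolding flux_adm_def dflux_adm_def by (intro haspd_sum haspd_diff hp2)

lemma haspd_potential: "x \<in> U \<Longrightarrow> haspd m (potential k j) (dpotential m k j x) x"
  unfolding potential_def dpotential_def
  by (intro haspd_cmult haspd_add haspd_sum haspd_mult haspd_diff haspd_coord haspd_flux_adm hp2)

lemma cont_flux_adm: "continuous_on U (flux_adm j)" "continuous_on U (dflux_adm m j)"
  unfolding flux_adm_def dflux_adm_def by (intro continuous_intros cont_g)+

lemma cont_dpotential: "continuous_on U (dpotential m k j)"
  unfolding dpotential_def by (intro continuous_intros cont_g cont_flux_adm)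

lemma cont_flux_ric: "continuous_on U (flux_ric k)"
  unfolding flux_ric_def by (intro continuous_intros cont_einstein cont_ginv cont_sqrt_det)

end

text \<open>The pointwise identity behind \<open>potential\<close>, freed from calculus:
  \<open>P m k i l\<close> stands for the second derivatives of \<open>g i l\<close>,
  \<open>H k i l\<close> for the first derivatives and \<open>X\<close> for the position. The
  first-order terms on the right are one half of \<open>- V j + n * V j - V j\<close> and cancel
  against the added multiple of \<open>V j\<close>; the second-order terms match those of the
  Einstein tensor.\<close>

lemma linearised_einstein_algebra:
  fixes P :: "'n::finite \<Rightarrow> 'n \<Rightarrow> 'n \<Rightarrow> 'n \<Rightarrow> real" and H :: "'n \<Rightarrow> 'n \<Rightarrow> 'n \<Rightarrow> real" and X :: "'n \<Rightarrow> real"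
  assumes P1: "\<And>m k i l. P m k i l = P k m i l"
    and H: "\<And>k i l. H k i l = H k l i"
  defines "\<delta> \<equiv> \<lambda>i j :: 'n. if i = j then 1 else (0::real)"
  defines "ric \<equiv> \<lambda>i j. \<Sum>k\<in>UNIV. (1/2) * (P k i j k + P k j i k - P k k i j) - (1/2) * (P j i k k + P j k i k - P j k i k)"
  defines "V \<equiv> \<lambda>j. \<Sum>l\<in>UNIV. H l j l - H j l l"
  defines "dV \<equiv> \<lambda>m j. \<Sum>l\<in>UNIV. P m l j l - P m j l l"
  shows "(\<Sum>i\<in>UNIV. (ric i j - (1/2) * (\<Sum>a\<in>UNIV. ric a a) * \<delta> i j) * X i) =
    (\<Sum>k\<in>UNIV. (1/2) * ((\<Sum>i\<in>UNIV. \<delta> k i * (H j i k - H k i j) + (P k j i k - P k k i j) * X i)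
      + ((\<delta> k k * V j + dV k j * X k) - (\<delta> k j * V k + dV k k * X j)))) + (2 - real CARD('n)) / 2 * V j"
proof -
  have d1: "(\<Sum>i\<in>UNIV. \<delta> k i * f i) = f k" "(\<Sum>i\<in>UNIV. \<delta> i k * f i) = f k" for f k
    by (auto simp: \<delta>_def if_distrib[of "\<lambda>t. t * _"] cong: if_cong)
  have d2: "\<delta> k k = 1" for k by (simp add: \<delta>_def)
  define Q where "Q i = (\<Sum>k\<in>UNIV. P k j i k - P k k i j)" for i
  \<comment> \<open>Commuting mixed derivatives splits linearised Ricci into a derivative of the
    mass integrand \<open>V\<close> and the part \<open>Q\<close> that comes from the first sum of
    the potential.\<close>
  have ric: "ric i j = (1/2) * dV i j + (1/2) * Q i" for i
  proof -
    have "ric i j = (\<Sum>k\<in>UNIV. (1/2) * (P i k j k - P i j k k) + (1/2) * (P k j i k - P k k i j))"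
      unfolding ric_def by (intro sum.cong refl) (simp add: P1[of i] algebra_simps)
    then show ?thesis by (simp add: dV_def Q_def sum.distrib sum_distrib_left)
  qed
  \<comment> \<open>Linearised scalar curvature is the divergence of the mass integrand.\<close>
  have tr: "(\<Sum>a\<in>UNIV. ric a a) = (\<Sum>k\<in>UNIV. dV k k)"
  proof -
    have "(\<Sum>a\<in>UNIV. ric a a) = (\<Sum>a\<in>UNIV. \<Sum>k\<in>UNIV. P a k a k - (1/2) * P k k a a - (1/2) * P a a k k)"
      unfolding ric_def
    proof (intro sum.cong refl)
      fix a k :: 'n
      show "(1/2) * (P k a a k + P k a a k - P k k a a) - (1/2) * (P a a k k + P a k a k - P a k a k) = P a k a k - (1/2) * P k k a a - (1/2) * P a a k k"
        using P1[of k a a k] by (simp add: field_simps)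
    qed
    also have "\<dots> = (\<Sum>a\<in>UNIV. \<Sum>k\<in>UNIV. P a k a k) - (1/2) * (\<Sum>a\<in>UNIV. \<Sum>k\<in>UNIV. P k k a a) - (1/2) * (\<Sum>a\<in>UNIV. \<Sum>k\<in>UNIV. P a a k k)"
      by (simp add: sum_subtractf sum_distrib_left)
    also have "(\<Sum>a\<in>UNIV. \<Sum>k\<in>UNIV. P k k a a) = (\<Sum>a\<in>UNIV. \<Sum>k\<in>UNIV. P a a k k)" by (rule sum.swap)
    finally show ?thesis by (simp add: dV_def sum_subtractf)
  qed
  have "(\<Sum>i\<in>UNIV. (ric i j - (1/2) * (\<Sum>a\<in>UNIV. ric a a) * \<delta> i j) * X i)
      = (\<Sum>i\<in>UNIV. ric i j * X i) - (1/2) * (\<Sum>a\<in>UNIV. ric a a) * (\<Sum>i\<in>UNIV. \<delta> i j * X i)"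
    by (simp add: left_diff_distrib sum_subtractf sum_distrib_left mult.assoc)
  also have "\<dots> = (1/2) * (\<Sum>i\<in>UNIV. dV i j * X i) + (1/2) * (\<Sum>i\<in>UNIV. Q i * X i) - (1/2) * (\<Sum>k\<in>UNIV. dV k k) * X j"
    by (simp add: d1 tr ric distrib_right sum.distrib sum_distrib_left mult.assoc)
  finally have L: "(\<Sum>i\<in>UNIV. (ric i j - (1/2) * (\<Sum>a\<in>UNIV. ric a a) * \<delta> i j) * X i) = \<dots>" .
  have q: "(\<Sum>k\<in>UNIV. \<Sum>i\<in>UNIV. (P k j i k - P k k i j) * X i) = (\<Sum>i\<in>UNIV. Q i * X i)"
    unfolding Q_def sum_distrib_right by (rule sum.swap)
  have v: "(\<Sum>k\<in>UNIV. H j k k - H k k j) = - V j"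
    by (simp add: V_def sum_subtractf H[of _ j])
  have "(\<Sum>k\<in>UNIV. (1/2) * ((\<Sum>i\<in>UNIV. \<delta> k i * (H j i k - H k i j) + (P k j i k - P k k i j) * X i)
      + ((\<delta> k k * V j + dV k j * X k) - (\<delta> k j * V k + dV k k * X j))))
     = (1/2) * ((\<Sum>k\<in>UNIV. H j k k - H k k j) + (\<Sum>k\<in>UNIV. \<Sum>i\<in>UNIV. (P k j i k - P k k i j) * X i)
       + ((real CARD('n) * V j + (\<Sum>k\<in>UNIV. dV k j * X k)) - (V j + (\<Sum>k\<in>UNIV. dV k k) * X j)))"
    by (simp only: sum_distrib_left[symmetric] sum.distrib sum_subtractf d1 d2 sum_distrib_right[symmetric]) simp
  then show ?thesis unfolding L q v by (simp add: field_simps)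
qed

context af_metric begin

lemma ein1_contracted:
  assumes x: "x \<in> U"
  shows "(\<Sum>i\<in>UNIV. ein1 i j x * x $ i) = (\<Sum>k\<in>UNIV. dpotential k k j x) + (2 - real CARD('n)) / 2 * flux_adm j x"
  unfolding ein1_def ric1_def dchr1_def dpotential_def flux_adm_def dflux_adm_def
  by (rule linearised_einstein_algebra[where P = "\<lambda>m k i l. pd m (pd k (g i l)) x" and H = "\<lambda>k i l. pd k (g i l) x" and X = "\<lambda>i. x $ i"])
     (auto intro: pd_commute[OF C2g x] pd2_g_sym[OF x] pd_g_sym[OF x])

definition err :: "'n \<Rightarrow> real^'n \<Rightarrow> real" where
  "err j x = flux_ric j x - ((\<Sum>k\<in>UNIV. dpotential k k j x) + (2 - real CARD('n)) / 2 * flux_adm j x)"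

lemma cont_err: "continuous_on U (err j)"
  unfolding err_def by (intro continuous_intros cont_flux_ric cont_dpotential cont_flux_adm)

text \<open>Two replacements make up the error: the raised index and volume factor by \<delta>, and
  the Einstein tensor by its linearisation. Each costs a term of order \<open>n\<close>, and the
  position field takes one power away.\<close>

lemma decays_err: "decays (real CARD('n) - 1) (err k)"
proof (rule decays_cong)
  have ed: "decays (real CARD('n)) (\<lambda>x. einstein g i j x * (ginv g j k x * sqrt (det (gmat g x)) - \<delta> j k * 1))" for i j
  proof (rule decays_quadratic2)
    have "decays (\<tau> + 2) (\<lambda>x. (einstein g i j x - ein1 i j x) + ein1 i j x)"
      using dim by (intro decays_add decays_ein1 decays_le[OF decays_einstein]) (simp add: field_simps tau)
    then show "decays (\<tau> + 2) (einstein g i j)" by simp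
  qed (intro near_mult decays_ginv decays_sqrt_det)
  show "decays (real CARD('n) - 1) (\<lambda>x. (\<Sum>i\<in>UNIV. \<Sum>j\<in>UNIV. (einstein g i j x * (ginv g j k x * sqrt (det (gmat g x)) - \<delta> j k * 1)) * x $ i)
      + (\<Sum>i\<in>UNIV. (einstein g i k x - ein1 i k x) * x $ i))"
    by (intro decays_add decays_sum decays_coord ed decays_einstein)
  show "eventually (\<lambda>x. (\<Sum>i\<in>UNIV. \<Sum>j\<in>UNIV. (einstein g i j x * (ginv g j k x * sqrt (det (gmat g x)) - \<delta> j k * 1)) * x $ i)
      + (\<Sum>i\<in>UNIV. (einstein g i k x - ein1 i k x) * x $ i) = err k x) at_infinity"
    using ev_U
  proof eventually_elim
    fix x assume x: "x \<in> U"
    have 1: "(\<Sum>j\<in>UNIV. (einstein g i j x * (ginv g j k x * sqrt (det (gmat g x)) - \<delta> j k * 1)) * x $ i)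
        = (\<Sum>j\<in>UNIV. einstein g i j x * x $ i * ginv g j k x) * sqrt (det (gmat g x)) - einstein g i k x * x $ i" for i
    proof -
      have "(\<Sum>j\<in>UNIV. \<delta> j k * (einstein g i j x * x $ i)) = einstein g i k x * x $ i"
        by (simp add: if_distrib[of "\<lambda>t. t * _"] cong: if_cong)
      moreover have "(\<Sum>j\<in>UNIV. (einstein g i j x * (ginv g j k x * sqrt (det (gmat g x)) - \<delta> j k * 1)) * x $ i)
          = (\<Sum>j\<in>UNIV. einstein g i j x * x $ i * ginv g j k x * sqrt (det (gmat g x)) - \<delta> j k * (einstein g i j x * x $ i))"
        by (intro sum.cong refl) (simp add: algebra_simps)
      ultimately show ?thesis by (simp only: sum_subtractf sum_distrib_right[symmetric])
    qed
    have "err k x = flux_ric k x - (\<Sum>i\<in>UNIV. ein1 i k x * x $ i)"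
      by (simp add: err_def ein1_contracted[OF x])
    then show "(\<Sum>i\<in>UNIV. \<Sum>j\<in>UNIV. (einstein g i j x * (ginv g j k x * sqrt (det (gmat g x)) - \<delta> j k * 1)) * x $ i)
      + (\<Sum>i\<in>UNIV. (einstein g i k x - ein1 i k x) * x $ i) = err k x"
      unfolding 1 flux_ric_def by (simp add: sum_subtractf left_diff_distrib sum_distrib_right)
  qed
qed

end

section \<open>Stokes' theorem on Lipschitz domains\<close>

lemma vec_nth_measurable [measurable (raw)]:
  fixes f :: "'a \<Rightarrow> real^'n::finite"
  assumes "f \<in> borel_measurable M"
  shows "(\<lambda>x. f x $ j) \<in> borel_measurable M"
  by (rule measurable_compose[OF assms borel_measurable_continuous_onI])
     (intro linear_continuous_on bounded_linear_vec_nth)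

lemma haspd_unique: "haspd i f a x \<Longrightarrow> haspd i f b x \<Longrightarrow> a = b"
  using haspd_imp_pd by metis

lemma haspd_locally_zero:
  assumes "open V" "x \<in> V" "\<And>y. y \<in> V \<Longrightarrow> f y = 0"
  shows "haspd i f 0 x"
  by (rule haspd_cong_open[OF haspd_const assms(1,2)]) (simp add: assms(3))

section \<open>Flux of an antisymmetric field through a graph\<close>

context lipschitz_graph begin

lemma lip_P: "(1 + L)-lipschitz_on UNIV P"
proof (rule lipschitz_onI)
  fix x y
  have "P x - P y = Q (x - y) + (h x - h y) *\<^sub>R e" by (simp add: P_Q algebra_simps flip: Q_diff)
  then have "dist (P x) (P y) \<le> norm (Q (x - y)) + \<bar>h x - h y\<bar>"
    using norm_triangle_ineq[of "Q (x - y)" "(h x - h y) *\<^sub>R e"] norm_e by (simp add: dist_norm)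
  also have "\<dots> \<le> norm (x - y) + L * norm (x - y)"
    using lipschitz_onD[OF lip, of x y] norm_Q_le[of "x - y"] by (intro add_mono) (auto simp: dist_norm)
  finally show "dist (P x) (P y) \<le> (1 + L) * dist x y" by (simp add: dist_norm algebra_simps)
qed (use L0 in simp)

lemma G_bound: "y \<in> Dh \<Longrightarrow> \<bar>G y \<bullet> v\<bar> \<le> L * norm v"
proof -
  assume "y \<in> Dh"
  then have "(h has_derivative (\<lambda>v. G y \<bullet> v)) (at y)" by (simp add: Dh_def)
  from tendsto_rabs[OF central_quotient_tendsto[OF this, of v]]
  show ?thesis by (rule LIMSEQ_le_const2) (use central_quotient_bound[OF lip] in blast)
qed

text \<open>Bounds the support of a field composed with \<open>P\<close> inside the slab: the height
  there adds at most one to the radius.\<close>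

lemma norm_le_P: "y \<in> slab \<Longrightarrow> norm y \<le> norm (P y) + 1"
proof -
  assume y: "y \<in> slab"
  have "norm y = norm (Q y + (y \<bullet> e) *\<^sub>R e)" by (simp add: Q_def)
  also have "\<dots> \<le> norm (Q y) + \<bar>y \<bullet> e\<bar>" using norm_triangle_ineq[of "Q y" "(y \<bullet> e) *\<^sub>R e"] norm_e by simp
  also have "\<dots> \<le> norm (P y) + 1" using norm_Q_le_add[of y "h y"] y by (auto simp: P_Q slab_def)
  finally show ?thesis .
qed

lemma P_deriv: "y \<in> Dh \<Longrightarrow> (P has_derivative (\<lambda>v. v + (G y \<bullet> v - v \<bullet> e) *\<^sub>R e)) (at y)"
  unfolding P_def Dh_def by (auto intro!: derivative_eq_intros)

text \<open>Pulled back by \<open>P\<close>, the flux is an integral over the slab of derivatives of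
  \<open>B\<close> against \<open>e - G\<close>. Antisymmetry reduces it to tangential derivatives
  of the pulled-back field with constant coefficients, which integrate to zero, and to
  antisymmetrised products with derivatives of \<open>h\<close>, which vanish by
  \<open>integral_curl_zero\<close>.\<close>

lemma local_stokes:
  fixes B :: "'n \<Rightarrow> 'n \<Rightarrow> real^'n \<Rightarrow> real"
  assumes hp: "\<And>m k j x. haspd m (B k j) (B' m k j x) x"
    and cont: "\<And>m k j. continuous_on UNIV (B' m k j)"
    and supp: "\<And>k j x. norm x > R \<Longrightarrow> B k j x = 0"
    and anti: "\<And>k j x. B k j x = - B j k x"
  shows "(\<integral>x. indicator \<Gamma> x * (\<Sum>k\<in>UNIV. \<Sum>j\<in>UNIV. B' k k j x * (inverse (J x) *\<^sub>R (e - G x)) $ j) \<partial>hmeasure (real CARD('n) - 1)) = 0"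
proof -
  have B'm [measurable]: "B' m k j \<in> borel_measurable borel" for m k j
    using cont by (rule borel_measurable_continuous_onI)
  have fd: "(B k j has_derivative (\<lambda>v. \<Sum>m\<in>UNIV. B' m k j x * v $ m)) (at x)" for k j x
    by (rule has_derivative_continuous_partials[OF open_UNIV UNIV_I hp])
       (use cont in \<open>auto simp: continuous_on_eq_continuous_at\<close>)
  have anti': "B' m k j x = - B' m j k x" for m k j x
  proof (rule haspd_unique[OF hp])
    have "(\<lambda>x. (-1) * B j k x) = B k j" by (simp add: fun_eq_iff anti[of k j])
    then show "haspd m (B k j) (- B' m j k x) x" using haspd_cmult[OF hp[of m j k x], of "-1"] by simp
  qed
  have supp': "B' m k j x = 0" if x: "norm x > R" for m k j x
  proof (rule haspd_unique[OF hp])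
    have "open {y::real^'n. R < norm y}" by (intro open_Collect_less continuous_intros)
    then show "haspd m (B k j) 0 x" by (rule haspd_locally_zero) (use x supp in auto)
  qed
  have lipB: "\<exists>M. M-lipschitz_on UNIV (B k j)" for k j
  proof -
    have "\<exists>K. \<forall>x. \<bar>B' m k j x\<bar> \<le> K" for m
    proof -
      have "compact (B' m k j ` cball 0 R)" by (intro compact_continuous_image continuous_on_subset[OF cont]) auto
      then obtain K where K: "\<And>x. x \<in> cball 0 R \<Longrightarrow> \<bar>B' m k j x\<bar> \<le> K"
        using compact_imp_bounded by (fastforce simp: bounded_iff)
      have "\<bar>B' m k j x\<bar> \<le> max K 0" for x using K[of x] supp'[of x] by (cases "norm x > R") auto
      then show ?thesis by blast
    qed
    then obtain K where K: "\<And>m x. \<bar>B' m k j x\<bar> \<le> K m" by metis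
    define M where "M = (\<Sum>m\<in>UNIV. K m)"
    have K0: "K m \<ge> 0" for m using K[of m 0] by linarith
    have "M-lipschitz_on UNIV (B k j)"
    proof (rule lipschitz_onI)
      fix x y :: "real^'n"
      have "norm (B k j x - B k j y) \<le> M * norm (x - y)"
      proof (rule differentiable_bound[OF convex_UNIV])
        fix z :: "real^'n"
        show "(B k j has_derivative (\<lambda>v. \<Sum>m\<in>UNIV. B' m k j z * v $ m)) (at z within UNIV)" using fd by simp
        show "onorm (\<lambda>v. \<Sum>m\<in>UNIV. B' m k j z * v $ m) \<le> M"
        proof (rule onorm_bound)
          show "0 \<le> M" using K0 by (simp add: M_def sum_nonneg)
          fix v :: "real^'n"
          have "norm (\<Sum>m\<in>UNIV. B' m k j z * v $ m) \<le> (\<Sum>m\<in>UNIV. K m * norm v)"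
            using K K0 component_le_norm_cart by (intro sum_norm_le) (auto simp: abs_mult intro!: mult_mono)
          then show "norm (\<Sum>m\<in>UNIV. B' m k j z * v $ m) \<le> M * norm v" by (simp add: M_def sum_distrib_right)
        qed
      qed auto
      then show "dist (B k j x) (B k j y) \<le> M * dist x y" by (simp add: dist_norm)
    qed (use K0 in \<open>simp add: M_def sum_nonneg\<close>)
    then show ?thesis by blast
  qed
  define F where "F k j y = B k j (P y)" for k j y
  define F' where "F' k j y v = (\<Sum>m\<in>UNIV. B' m k j (P y) * (v + (G y \<bullet> v - v \<bullet> e) *\<^sub>R e) $ m)" for k j y v
  have F'm [measurable]: "(\<lambda>y. F' k j y v) \<in> borel_measurable borel" for k j v
    unfolding F'_def by measurable
  have F'd: "AE y in lborel. (F k j has_derivative F' k j y) (at y)" for k j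
    using AE_Dh
  proof eventually_elim
    fix y assume "y \<in> Dh"
    from has_derivative_compose[OF P_deriv[OF this] fd[of k j "P y"]]
    show "(F k j has_derivative F' k j y) (at y)" by (simp add: F_def[abs_def] F'_def[abs_def])
  qed
  have "\<exists>M. slab_function e h L c (F k j) M (R + 1)" for k j
  proof -
    obtain M where M: "M-lipschitz_on UNIV (B k j)" using lipB by blast
    have "(M * (1 + L))-lipschitz_on UNIV (F k j)"
      unfolding F_def by (rule lipschitz_on_compose2[OF lip_P lipschitz_on_subset[OF M]]) auto
    then have "slab_function e h L c (F k j) (M * (1 + L)) (R + 1)"
    proof unfold_locales
      fix y assume "y \<in> slab" "R + 1 < norm y"
      then show "F k j y = 0" unfolding F_def using norm_le_P[of y] by (intro supp) auto
    qed
    then show ?thesis by blast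
  qed
  then obtain M where sf: "\<And>k j. slab_function e h L c (F k j) (M k j) (R + 1)" by metis
  \<comment> \<open>The coordinate vectors projected orthogonally to \<open>e\<close>, the
    directions in which the slab may be translated.\<close>
  define a where "a k = axis k 1 - (e $ k) *\<^sub>R e" for k
  have ak: "a k \<bullet> e = 0" for k by (simp add: a_def inner_diff_left ee inner_axis' )
  have akm: "a k $ m = (if m = k then 1 else 0) - e $ k * e $ m" for k m by (simp add: a_def axis_def)
  have Ga: "G y \<bullet> a k = G y $ k" if "y \<in> Dh" for y k
    using G_perp[OF that] by (simp add: a_def inner_diff_right inner_axis)
  have Gam [measurable]: "(\<lambda>y. G y \<bullet> v) \<in> borel_measurable borel" for v by measurable
  have anF: "F' k j y v = - F' j k y v" for k j y v
    unfolding F'_def sum_negf[symmetric] by (intro sum.cong refl) (simp add: anti'[of _ k j])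
  have i1: "integrable lborel (\<lambda>y. indicator slab y * (F' k j y (a l) * k'))" for k j l and k' :: real
    by (rule slab_function.integrable_derivative[OF sf F'd ak, where N = "\<bar>k'\<bar>"]) auto
  have i2: "integrable lborel (\<lambda>y. indicator slab y * (F' k j y (a l) * (G y \<bullet> a m)))" for k j l m
  proof (rule slab_function.integrable_derivative[OF sf F'd ak, where N = "L * norm (a m)"])
    show "AE y in lborel. \<bar>G y \<bullet> a m\<bar> \<le> L * norm (a m)" using AE_Dh by eventually_elim (rule G_bound)
  qed measurable
  have z1: "(\<integral>y. indicator slab y * (F' k j y (a l) * k') \<partial>lborel) = 0" for k j l and k' :: real
  proof -
    have "(\<integral>y. indicator slab y * (F' k j y (a l) * k') \<partial>lborel) = (\<integral>y. (indicator slab y * F' k j y (a l)) * k' \<partial>lborel)"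
      by (simp add: mult.assoc)
    also have "\<dots> = 0" using slab_function.integral_directional_zero[OF sf F'd ak F'm] by simp
    finally show ?thesis .
  qed
  have z2: "(\<integral>y. indicator slab y * (F' k j y (a k) * (G y \<bullet> a j) - F' k j y (a j) * (G y \<bullet> a k)) \<partial>lborel) = 0" for k j
    by (rule slab_function.integral_curl_zero[OF sf F'd ak ak F'm])
  \<comment> \<open>The pointwise form of Stokes' theorem: the right-hand side contains tangential
    derivatives of the pulled-back field only.\<close>
  have key: "(\<Sum>k\<in>UNIV. \<Sum>j\<in>UNIV. B' k k j (P y) * (e - G y) $ j)
      = (\<Sum>k\<in>UNIV. \<Sum>j\<in>UNIV. F' k j y (a k) * e $ j - (1/2) * (F' k j y (a k) * (G y \<bullet> a j) - F' k j y (a j) * (G y \<bullet> a k)))"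
    if y: "y \<in> Dh" for y
  proof -
    \<comment> \<open>The derivative of \<open>B\<close> along \<open>e\<close>, which the pullback
      does not determine. It is antisymmetric in \<open>k\<close> and \<open>j\<close> and meets a
      symmetric weight, so it drops out of the sum.\<close>
    define b where "b k j = (\<Sum>m\<in>UNIV. B' m k j (P y) * e $ m)" for k j
    have banti: "b k j = - b j k" for k j
      unfolding b_def sum_negf[symmetric] by (intro sum.cong refl) (simp add: anti'[of _ k j])
    have F'a: "F' k j y (a l) = B' l k j (P y) + (G y $ l - e $ l) * b k j" for k j l
    proof -
      have "F' k j y (a l) = (\<Sum>m\<in>UNIV. B' m k j (P y) * (if m = l then 1 else 0) + (G y $ l - e $ l) * (B' m k j (P y) * e $ m))"
        unfolding F'_def by (intro sum.cong refl) (simp add: akm Ga[OF y] ak algebra_simps)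
      also have "\<dots> = B' l k j (P y) + (G y $ l - e $ l) * b k j"
        by (simp add: sum.distrib b_def sum_distrib_left if_distrib[of "\<lambda>t. _ * t"] cong: if_cong)
      finally show ?thesis .
    qed
    have as: "(\<Sum>k\<in>UNIV. \<Sum>j\<in>UNIV. f k j) = 0" if "\<And>k j. f k j = - f j k" for f :: "'n \<Rightarrow> 'n \<Rightarrow> real"
    proof -
      have "(\<Sum>k\<in>UNIV. \<Sum>j\<in>UNIV. f k j) = (\<Sum>k\<in>UNIV. \<Sum>j\<in>UNIV. f j k)" by (rule sum.swap)
      also have "\<dots> = (\<Sum>k\<in>UNIV. \<Sum>j\<in>UNIV. - f k j)" by (intro sum.cong refl that)
      finally show ?thesis by (simp add: sum_negf)
    qed
    have s1: "(\<Sum>k\<in>UNIV. \<Sum>j\<in>UNIV. (G y $ k - e $ k) * b k j * (e $ j - G y $ j)) = 0"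
    proof (rule as)
      fix k j
      show "(G y $ k - e $ k) * b k j * (e $ j - G y $ j) = - ((G y $ j - e $ j) * b j k * (e $ k - G y $ k))"
        unfolding banti[of k j] by (simp add: algebra_simps)
    qed
    have s2: "(\<Sum>k\<in>UNIV. \<Sum>j\<in>UNIV. (1/2) * (F' k j y (a k) * G y $ j + F' k j y (a j) * G y $ k)) = 0"
    proof (rule as)
      fix k j
      show "(1/2) * (F' k j y (a k) * G y $ j + F' k j y (a j) * G y $ k) = - ((1/2) * (F' j k y (a j) * G y $ k + F' j k y (a k) * G y $ j))"
        unfolding anF[of k j] by (simp add: field_simps)
    qed
    have "(\<Sum>k\<in>UNIV. \<Sum>j\<in>UNIV. B' k k j (P y) * (e - G y) $ j)
      = (\<Sum>k\<in>UNIV. \<Sum>j\<in>UNIV. F' k j y (a k) * (e $ j - G y $ j) - (G y $ k - e $ k) * b k j * (e $ j - G y $ j))"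
      by (intro sum.cong refl) (simp add: F'a algebra_simps)
    also have "\<dots> = (\<Sum>k\<in>UNIV. \<Sum>j\<in>UNIV. F' k j y (a k) * (e $ j - G y $ j))"
      by (simp only: sum_subtractf s1 diff_zero)
    also have "\<dots> = (\<Sum>k\<in>UNIV. \<Sum>j\<in>UNIV. (F' k j y (a k) * e $ j - (1/2) * (F' k j y (a k) * G y $ j - F' k j y (a j) * G y $ k))
        - (1/2) * (F' k j y (a k) * G y $ j + F' k j y (a j) * G y $ k))"
      by (intro sum.cong refl) (simp add: field_simps)
    also have "\<dots> = (\<Sum>k\<in>UNIV. \<Sum>j\<in>UNIV. F' k j y (a k) * e $ j - (1/2) * (F' k j y (a k) * G y $ j - F' k j y (a j) * G y $ k))"
      by (simp only: sum_subtractf s2 diff_zero)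
    finally show ?thesis by (simp add: Ga[OF y])
  qed
  have "(\<integral>x. indicator \<Gamma> x * (\<Sum>k\<in>UNIV. \<Sum>j\<in>UNIV. B' k k j x * (inverse (J x) *\<^sub>R (e - G x)) $ j) \<partial>hmeasure (real CARD('n) - 1))
     = (\<integral>y. indicator slab y * (c * J y * (\<Sum>k\<in>UNIV. \<Sum>j\<in>UNIV. B' k k j (P y) * (inverse (J (P y)) *\<^sub>R (e - G (P y))) $ j)) \<partial>lborel)"
    by (rule graph_integral) measurable
  also have "\<dots> = (\<integral>y. c * (indicator slab y * (\<Sum>k\<in>UNIV. \<Sum>j\<in>UNIV. B' k k j (P y) * (e - G y) $ j)) \<partial>lborel)"
  proof (intro Bochner_Integration.integral_cong refl)
    fix y
    \<comment> \<open>The area factor of the graph cancels the normalisation of its normal.\<close>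
    have J: "J y \<noteq> 0" using J_ge_1[of y] by simp
    have eq: "J y * (\<Sum>k\<in>UNIV. \<Sum>j\<in>UNIV. B' k k j (P y) * (inverse (J y) *\<^sub>R (e - G y)) $ j) = (\<Sum>k\<in>UNIV. \<Sum>j\<in>UNIV. B' k k j (P y) * (e - G y) $ j)"
      unfolding sum_distrib_left by (intro sum.cong refl) (use J in \<open>simp add: field_simps\<close>)
    show "indicator slab y * (c * J y * (\<Sum>k\<in>UNIV. \<Sum>j\<in>UNIV. B' k k j (P y) * (inverse (J (P y)) *\<^sub>R (e - G (P y))) $ j))
       = c * (indicator slab y * (\<Sum>k\<in>UNIV. \<Sum>j\<in>UNIV. B' k k j (P y) * (e - G y) $ j))"
      unfolding J_P G_P eq[symmetric] by (simp only: mult_ac)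
  qed
  also have "\<dots> = c * (\<integral>y. indicator slab y * (\<Sum>k\<in>UNIV. \<Sum>j\<in>UNIV. B' k k j (P y) * (e - G y) $ j) \<partial>lborel)" by simp
  also have "(\<integral>y. indicator slab y * (\<Sum>k\<in>UNIV. \<Sum>j\<in>UNIV. B' k k j (P y) * (e - G y) $ j) \<partial>lborel)
     = (\<integral>y. (\<Sum>k\<in>UNIV. \<Sum>j\<in>UNIV. indicator slab y * (F' k j y (a k) * e $ j) - (1/2) * (indicator slab y * (F' k j y (a k) * (G y \<bullet> a j) - F' k j y (a j) * (G y \<bullet> a k)))) \<partial>lborel)"
  proof (rule integral_cong_AE)
    show "AE y in lborel. indicator slab y * (\<Sum>k\<in>UNIV. \<Sum>j\<in>UNIV. B' k k j (P y) * (e - G y) $ j)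
      = (\<Sum>k\<in>UNIV. \<Sum>j\<in>UNIV. indicator slab y * (F' k j y (a k) * e $ j) - (1/2) * (indicator slab y * (F' k j y (a k) * (G y \<bullet> a j) - F' k j y (a j) * (G y \<bullet> a k))))"
      using AE_Dh
    proof eventually_elim
      fix y assume "y \<in> Dh"
      from key[OF this] show "indicator slab y * (\<Sum>k\<in>UNIV. \<Sum>j\<in>UNIV. B' k k j (P y) * (e - G y) $ j)
        = (\<Sum>k\<in>UNIV. \<Sum>j\<in>UNIV. indicator slab y * (F' k j y (a k) * e $ j) - (1/2) * (indicator slab y * (F' k j y (a k) * (G y \<bullet> a j) - F' k j y (a j) * (G y \<bullet> a k))))"
        by (cases "y \<in> slab") simp_all
    qed
  qed measurable
  also have "\<dots> = (\<Sum>k\<in>UNIV. \<Sum>j\<in>UNIV. (\<integral>y. indicator slab y * (F' k j y (a k) * e $ j) \<partial>lborel)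
       - (1/2) * (\<integral>y. indicator slab y * (F' k j y (a k) * (G y \<bullet> a j) - F' k j y (a j) * (G y \<bullet> a k)) \<partial>lborel))"
  proof -
    have i3: "integrable lborel (\<lambda>y. (1/2) * (indicator slab y * (F' k j y (a k) * (G y \<bullet> a j) - F' k j y (a j) * (G y \<bullet> a k))))" for k j
      unfolding right_diff_distrib[of "indicator slab _"] by (intro integrable_mult_right Bochner_Integration.integrable_diff i2)
    define T where "T k j y = indicator slab y * (F' k j y (a k) * e $ j) - (1/2) * (indicator slab y * (F' k j y (a k) * (G y \<bullet> a j) - F' k j y (a j) * (G y \<bullet> a k)))" for k j y
    have Ti: "integrable lborel (T k j)" for k j
      unfolding T_def by (intro Bochner_Integration.integrable_diff i1 i3)
    have "(\<integral>y. (\<Sum>k\<in>UNIV. \<Sum>j\<in>UNIV. T k j y) \<partial>lborel) = (\<Sum>k\<in>UNIV. \<Sum>j\<in>UNIV. integral\<^sup>L lborel (T k j))"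
      by (simp add: Bochner_Integration.integral_sum Bochner_Integration.integrable_sum Ti)
    also have "\<dots> = (\<Sum>k\<in>UNIV. \<Sum>j\<in>UNIV. (\<integral>y. indicator slab y * (F' k j y (a k) * e $ j) \<partial>lborel)
       - (1/2) * (\<integral>y. indicator slab y * (F' k j y (a k) * (G y \<bullet> a j) - F' k j y (a j) * (G y \<bullet> a k)) \<partial>lborel))"
      unfolding T_def Bochner_Integration.integral_diff[OF i1 i3] integral_mult_right_zero ..
    finally show ?thesis unfolding T_def .
  qed
  also have "\<dots> = 0" by (simp only: z1 z2) simp
  finally show ?thesis by simp
qed

end

section \<open>The outward normal of a domain below a graph\<close>

text \<open>Leaving \<open>x\<close> in direction \<open>v - w\<close> leads out of the closure
  according to \<open>v\<close> and into the domain according to \<open>w\<close>.\<close>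

lemma outward_normal_unique:
  assumes v: "outward_normal D x v" and w: "outward_normal D x w"
  shows "v = w"
proof (rule ccontr)
  assume ne: "v \<noteq> w"
  have n: "v \<bullet> v = 1" "w \<bullet> w = 1" using v w by (auto simp: outward_normal_def dot_square_norm)
  define d where "d = v - w"
  define \<kappa> where "\<kappa> = 1 - v \<bullet> w"
  have "d \<bullet> d = 2 * \<kappa>" by (simp add: d_def \<kappa>_def inner_diff_left inner_diff_right n inner_commute[of w v])
  moreover have "d \<bullet> d > 0" using ne by (simp add: d_def)
  ultimately have \<kappa>: "\<kappa> > 0" by simp
  have dv: "d \<bullet> v = \<kappa>" "d \<bullet> w = - \<kappa>"
    by (simp_all add: d_def \<kappa>_def inner_diff_left n inner_commute[of w v])
  have nd: "norm d > 0" using ne by (simp add: d_def)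
  define \<epsilon> where "\<epsilon> = \<kappa> / (2 * norm d)"
  have \<epsilon>: "\<epsilon> > 0" "\<epsilon> * norm d < \<kappa>" using \<kappa> nd by (auto simp: \<epsilon>_def)
  obtain \<delta>1 where d1: "\<delta>1 > 0" "\<And>y. y \<in> ball x \<delta>1 \<Longrightarrow> (y - x) \<bullet> v > \<epsilon> * norm (y - x) \<Longrightarrow> y \<notin> closure D"
    using v \<epsilon>(1) unfolding outward_normal_def by meson
  obtain \<delta>2 where d2: "\<delta>2 > 0" "\<And>y. y \<in> ball x \<delta>2 \<Longrightarrow> (y - x) \<bullet> w < - \<epsilon> * norm (y - x) \<Longrightarrow> y \<in> D"
    using w \<epsilon>(1) unfolding outward_normal_def by meson
  define t where "t = min \<delta>1 \<delta>2 / (2 * norm d)"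
  have t: "t > 0" using d1 d2 nd by (simp add: t_def)
  have tn: "t * norm d = min \<delta>1 \<delta>2 / 2" using nd by (simp add: t_def)
  have "x + t *\<^sub>R d \<in> ball x \<delta>1" "x + t *\<^sub>R d \<in> ball x \<delta>2" using t tn d1(1) d2(1) by (auto simp: dist_norm)
  moreover have "(x + t *\<^sub>R d - x) \<bullet> v > \<epsilon> * norm (x + t *\<^sub>R d - x)" "(x + t *\<^sub>R d - x) \<bullet> w < - \<epsilon> * norm (x + t *\<^sub>R d - x)"
    using mult_strict_left_mono[OF \<epsilon>(2) t] t by (simp_all add: dv mult_ac)
  ultimately have "x + t *\<^sub>R d \<notin> closure D" "x + t *\<^sub>R d \<in> D" using d1(2) d2(2) by auto
  then show False using closure_subset by blast
qed

context lipschitz_graph begin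

lemma frontier_graph:
  assumes D: "open D" "D \<inter> ball x0 r = {y \<in> ball x0 r. y \<bullet> e < h y}"
  shows "frontier D \<inter> ball x0 r = \<Gamma> \<inter> ball x0 r"
proof -
  have Dm: "y \<in> D \<longleftrightarrow> y \<bullet> e < h y" if "y \<in> ball x0 r" for y
    using D(2) that by blast
  show ?thesis
proof (intro equalityI subsetI)
  fix x assume x: "x \<in> frontier D \<inter> ball x0 r"
  then have xb: "x \<in> ball x0 r" and xc: "x \<in> closure D" and xD: "x \<notin> D"
    using D(1) by (auto simp: frontier_def interior_open)
  have "\<not> x \<bullet> e < h x" using xD Dm[OF xb] by blast
  moreover have "\<not> x \<bullet> e > h x"
  proof
    assume "x \<bullet> e > h x"
    have "open ({y. h y < y \<bullet> e} \<inter> ball x0 r)"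
      by (intro open_Int open_ball open_Collect_less continuous_intros cont_h)
    then obtain y where "y \<in> D" "y \<in> {y. h y < y \<bullet> e} \<inter> ball x0 r"
      using xc \<open>x \<bullet> e > h x\<close> xb open_Int_closure_eq_empty[of "{y. h y < y \<bullet> e} \<inter> ball x0 r" D] by blast
    then show False using Dm[of y] by auto
  qed
  ultimately show "x \<in> \<Gamma> \<inter> ball x0 r" using xb by (simp add: \<Gamma>_def)
next
  fix x assume x: "x \<in> \<Gamma> \<inter> ball x0 r"
  then have xb: "x \<in> ball x0 r" and xe: "x \<bullet> e = h x" by (auto simp: \<Gamma>_def)
  have "x \<notin> D" using Dm[OF xb] xe by auto
  moreover have "x \<in> closure D"
    unfolding closure_approachable
  proof (intro allI impI)
    fix \<epsilon> :: real assume "\<epsilon> > 0"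
    define t where "t = min \<epsilon> (r - dist x0 x) / 2"
    have t: "t > 0" "t < \<epsilon>" "t < r - dist x0 x" using \<open>\<epsilon> > 0\<close> xb by (auto simp: t_def)
    define y where "y = x + (- t) *\<^sub>R e"
    have dy: "dist y x = t" using t(1) norm_e by (simp add: y_def dist_norm)
    have "dist x0 y \<le> dist x0 x + dist y x" by (metis dist_commute dist_triangle)
    then have "y \<in> ball x0 r" using dy t by simp
    moreover have "h y = h x" unfolding y_def by (rule inv)
    moreover have "y \<bullet> e = x \<bullet> e - t" by (simp add: y_def inner_diff_left ee)
    ultimately have "y \<in> D" using Dm[of y] xe t(1) by auto
    then show "\<exists>y\<in>D. dist y x < \<epsilon>" using dy t(2) by blast
  qed
  ultimately show "x \<in> frontier D \<inter> ball x0 r" using D(1) xb by (simp add: frontier_def interior_open)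
qed
qed

text \<open>Differentiability of \<open>h\<close> at \<open>x\<close> says that
  \<open>(y - x) \<bullet> (e - G x)\<close> equals the height of \<open>y\<close> above the graph
  up to \<open>\<epsilon> * norm (y - x)\<close>, so its sign decides on which side \<open>y\<close>
  lies outside a thin double cone.\<close>

lemma outward_normal_graph:
  assumes D: "open D" "D \<inter> ball x0 r = {y \<in> ball x0 r. y \<bullet> e < h y}" and x: "x \<in> \<Gamma>" "x \<in> ball x0 r" "x \<in> Dh"
  shows "outward_normal D x (inverse (J x) *\<^sub>R (e - G x))"
proof -
  have Dm: "y \<in> D \<longleftrightarrow> y \<bullet> e < h y" if "y \<in> ball x0 r" for y
    using D(2) that by blast
  show ?thesis unfolding outward_normal_def
proof (intro conjI allI impI)
  have J: "J x > 0" using J_ge_1[of x] by simp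
  have "(norm (e - G x))\<^sup>2 = (J x)\<^sup>2"
    unfolding power2_norm_eq_inner J_def using G_perp[OF x(3)]
    by (simp add: inner_diff_left inner_diff_right ee inner_commute[of e "G x"] power2_norm_eq_inner)
  then have "norm (e - G x) = J x" using J by (simp add: power2_eq_iff_nonneg)
  then show "norm (inverse (J x) *\<^sub>R (e - G x)) = 1" using J by simp
  fix \<epsilon> :: real assume \<epsilon>: "\<epsilon> > 0"
  obtain d where d: "d > 0" "\<And>w. norm w < d \<Longrightarrow> \<bar>h (x + w) - h x - G x \<bullet> w\<bar> \<le> \<epsilon> * norm w"
    using x(3)[unfolded Dh_iff, rule_format, OF \<epsilon>] by blast
  define \<delta> where "\<delta> = min d (r - dist x0 x)"
  have \<delta>: "\<delta> > 0" "\<delta> \<le> d" "\<delta> \<le> r - dist x0 x" using d(1) x(2) by (auto simp: \<delta>_def)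
  have xe: "x \<bullet> e = h x" using x(1) by (simp add: \<Gamma>_def)
  show "\<exists>\<delta>>0. \<forall>y\<in>ball x \<delta>. (\<epsilon> * norm (y - x) < (y - x) \<bullet> inverse (J x) *\<^sub>R (e - G x) \<longrightarrow> y \<notin> closure D)
      \<and> ((y - x) \<bullet> inverse (J x) *\<^sub>R (e - G x) < - \<epsilon> * norm (y - x) \<longrightarrow> y \<in> D)"
  proof (intro exI[of _ \<delta>] conjI ballI \<delta>(1) impI)
    fix y assume y: "y \<in> ball x \<delta>"
    define w where "w = y - x"
    have wd: "norm w < d" using y \<delta>(2) by (simp add: w_def dist_norm norm_minus_commute)
    have yb: "y \<in> ball x0 r" using y \<delta>(3) dist_triangle[of x0 y x] by simp
    have hy: "\<bar>h y - h x - G x \<bullet> w\<bar> \<le> \<epsilon> * norm w" using d(2)[OF wd] by (simp add: w_def)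
    have wv: "(y - x) \<bullet> inverse (J x) *\<^sub>R (e - G x) = (w \<bullet> e - G x \<bullet> w) / J x"
      by (simp add: w_def inner_diff_right inner_commute[of _ "G x"] divide_inverse mult.commute)
    have ye: "y \<bullet> e = h x + w \<bullet> e" by (simp add: w_def inner_diff_left xe)
    \<comment> \<open>Normalising the normal divides by \<open>J x \<ge> 1\<close>; the threshold
      after multiplying back still exceeds the differentiability error.\<close>
    have J1: "\<epsilon> * norm w \<le> \<epsilon> * norm w * J x" using \<epsilon> mult_left_mono[OF J_ge_1[of x], of "\<epsilon> * norm w"] by simp
    show "y \<notin> closure D" if "\<epsilon> * norm (y - x) < (y - x) \<bullet> inverse (J x) *\<^sub>R (e - G x)"
    proof
      assume yc: "y \<in> closure D"
      have "\<epsilon> * norm w * J x < w \<bullet> e - G x \<bullet> w" using that J unfolding wv by (simp add: w_def pos_less_divide_eq)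
      then have "h y < y \<bullet> e" using J1 hy ye by (simp add: abs_le_iff)
      then have yin: "y \<in> {y. h y < y \<bullet> e} \<inter> ball x0 r" using yb by simp
      have "open ({y. h y < y \<bullet> e} \<inter> ball x0 r)"
        by (intro open_Int open_ball open_Collect_less continuous_intros cont_h)
      then obtain z where "z \<in> D" "z \<in> {y. h y < y \<bullet> e} \<inter> ball x0 r"
        using yc yin open_Int_closure_eq_empty[of "{y. h y < y \<bullet> e} \<inter> ball x0 r" D] by blast
      then show False using Dm[of z] by auto
    qed
    show "y \<in> D" if "(y - x) \<bullet> inverse (J x) *\<^sub>R (e - G x) < - \<epsilon> * norm (y - x)"
    proof -
      have "w \<bullet> e - G x \<bullet> w < - (\<epsilon> * norm w * J x)" using that J unfolding wv by (simp add: w_def pos_divide_less_eq)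
      then have "y \<bullet> e < h y" using J1 hy ye by (simp add: abs_le_iff)
      then show "y \<in> D" using Dm[OF yb] by auto
    qed
  qed
qed
qed

text \<open>Uniqueness of the outward normal pins down the choice in \<open>nu_e\<close>.\<close>

lemma nu_e_graph:
  assumes "open D" "D \<inter> ball x0 r = {y \<in> ball x0 r. y \<bullet> e < h y}" "x \<in> \<Gamma>" "x \<in> ball x0 r" "x \<in> Dh"
  shows "nu_e D x = inverse (J x) *\<^sub>R (e - G x)" and "norm (inverse (J x) *\<^sub>R (e - G x)) = 1"
proof -
  note o = outward_normal_graph[OF assms]
  show "nu_e D x = inverse (J x) *\<^sub>R (e - G x)"
    unfolding nu_e_def
    by (rule some_equality[where P = "outward_normal D x", OF o outward_normal_unique[OF _ o]])
  show "norm (inverse (J x) *\<^sub>R (e - G x)) = 1" using o by (simp add: outward_normal_def)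
qed

end

section \<open>Cutoff functions of class C^1\<close>

lemma DERIV_pos_part_square: "((\<lambda>u. (max 0 u)\<^sup>2) has_real_derivative 2 * max 0 u) (at (u::real))"
proof -
  consider "u > 0" | "u < 0" | "u = 0" by linarith
  then show ?thesis
  proof cases
    case 1
    have "((\<lambda>u. u\<^sup>2) has_real_derivative 2 * max 0 u) (at u)" using 1 by (auto intro!: derivative_eq_intros)
    then show ?thesis
      by (rule has_field_derivative_transform_within_open[of _ _ _ "{0<..}"]) (use 1 in auto)
  next
    case 2
    have "((\<lambda>u. 0) has_real_derivative 2 * max 0 u) (at u)" using 2 by simp
    then show ?thesis
      by (rule has_field_derivative_transform_within_open[of _ _ _ "{..<0}"]) (use 2 in auto)
  next
    case 3
    have "((\<lambda>h. ((max 0 (0 + h))\<^sup>2 - (max 0 0)\<^sup>2) / h) \<longlongrightarrow> 0) (at (0::real))"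
    proof (rule Lim_null_comparison[where g = "\<lambda>h. \<bar>h\<bar>"])
      show "eventually (\<lambda>h. norm (((max 0 (0 + h))\<^sup>2 - (max 0 0)\<^sup>2) / h) \<le> \<bar>h\<bar>) (at (0::real))"
        by (rule always_eventually) (auto simp: max_def power2_eq_square)
      show "((\<lambda>h. \<bar>h\<bar>) \<longlongrightarrow> 0) (at (0::real))" by (rule tendsto_rabs_zero) (rule tendsto_ident_at)
    qed
    then show ?thesis using 3 by (simp add: DERIV_def)
  qed
qed

text \<open>The quotient \<open>p u / (p u + p (1 - u))\<close> with \<open>p\<close> the squared
  positive part. One continuous derivative is enough, since the fields to be cut off are themselves
  only C^1.\<close>

lemma smooth_step:
  "\<exists>\<beta> \<beta>'. (\<forall>u. (\<beta> has_real_derivative \<beta>' u) (at u)) \<and> continuous_on UNIV \<beta>' \<and> (\<forall>u\<le>0. \<beta> u = 0) \<and> (\<forall>u\<ge>1. \<beta> u = (1::real))"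
proof -
  define p where "p u = (max 0 u)\<^sup>2" for u :: real
  define q where "q u = p u + p (1 - u)" for u
  have q: "q u > 0" for u by (cases "u > 0") (auto simp: q_def p_def add_pos_nonneg add_nonneg_pos)
  have dp: "(p has_real_derivative 2 * max 0 u) (at u)" for u unfolding p_def by (rule DERIV_pos_part_square)
  have dp1: "((\<lambda>u. p (1 - u)) has_real_derivative 2 * max 0 (1 - u) * (-1)) (at u)" for u
    by (rule DERIV_chain2[OF dp]) (auto intro!: derivative_eq_intros)
  have dq: "(q has_real_derivative 2 * max 0 u + 2 * max 0 (1 - u) * (-1)) (at u)" for u
    unfolding q_def by (intro DERIV_add dp dp1)
  define \<beta>' where "\<beta>' u = (2 * max 0 u * q u - p u * (2 * max 0 u + 2 * max 0 (1 - u) * (-1))) / (q u * q u)" for u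
  have "((\<lambda>u. p u / q u) has_real_derivative \<beta>' u) (at u)" for u
    unfolding \<beta>'_def using q[of u] by (intro DERIV_divide dp dq) auto
  moreover have "continuous_on UNIV \<beta>'"
    unfolding \<beta>'_def p_def q_def using q unfolding p_def q_def
    by (intro continuous_intros) (metis less_irrefl mult_pos_pos)
  ultimately show ?thesis
    by (intro exI[of _ "\<lambda>u. p u / q u"] exI[of _ \<beta>']) (auto simp: p_def q_def)
qed

lemma bump_function:
  fixes z :: "real^'n::finite"
  assumes \<rho>: "\<rho> > 0"
  obtains \<phi> :: "real^'n \<Rightarrow> real" and \<phi>' where "\<And>i x. haspd i \<phi> (\<phi>' i x) x" "\<And>i. continuous_on UNIV (\<phi>' i)"
    "continuous_on UNIV \<phi>" "\<And>x. x \<in> ball z (\<rho> / 4) \<Longrightarrow> \<phi> x = 1" "\<And>x. x \<notin> cball z (\<rho> / 2) \<Longrightarrow> \<phi> x = 0"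
proof -
  obtain \<beta> \<beta>' :: "real \<Rightarrow> real" where \<beta>: "\<And>u. (\<beta> has_real_derivative \<beta>' u) (at u)" "continuous_on UNIV \<beta>'"
      "\<And>u. u \<le> 0 \<Longrightarrow> \<beta> u = 0" "\<And>u. u \<ge> 1 \<Longrightarrow> \<beta> u = 1"
    using smooth_step by metis
  \<comment> \<open>Chosen so that \<open>u\<close> equals 1 at distance \<open>\<rho> / 4\<close>
    and 0 at distance \<open>\<rho> / 2\<close>: the difference of the squared radii is
    \<open>3 * \<rho>\<^sup>2 / 16\<close>.\<close>
  define k where "k = 16 / (3 * \<rho>\<^sup>2)"
  have k: "k > 0" using \<rho> by (simp add: k_def)
  define N where "N x = (\<Sum>j\<in>UNIV. (x $ j - z $ j) * (x $ j - z $ j))" for x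
  have N: "N x = (dist z x)\<^sup>2" for x
    unfolding dist_norm norm_minus_commute[of z x] by (simp add: N_def power2_norm_eq_inner inner_vec_def)
  define u where "u x = k * (\<rho>\<^sup>2 / 4 - N x)" for x
  have dN: "haspd i N (2 * (x $ i - z $ i)) x" for i x
  proof -
    have "haspd i N (\<Sum>j\<in>UNIV. ((if i = j then 1 else 0) - 0) * (x $ j - z $ j) + ((if i = j then 1 else 0) - 0) * (x $ j - z $ j)) x"
      unfolding N_def by (intro haspd_sum haspd_mult haspd_diff haspd_coord haspd_const)
    also have "(\<Sum>j\<in>UNIV. ((if i = j then 1 else 0) - 0) * (x $ j - z $ j) + ((if i = j then 1 else 0) - 0) * (x $ j - z $ j)) = 2 * (x $ i - z $ i)"
    proof -
      have "(\<Sum>j\<in>UNIV. ((if i = j then 1 else 0) - 0) * (x $ j - z $ j) + ((if i = j then 1 else 0) - 0) * (x $ j - z $ j))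
         = (\<Sum>j\<in>UNIV. if i = j then 2 * (x $ j - z $ j) else 0)"
        by (intro sum.cong refl) auto
      then show ?thesis by simp
    qed
    finally show ?thesis .
  qed
  have du: "haspd i u (k * (0 - 2 * (x $ i - z $ i))) x" for i x
    unfolding u_def by (intro haspd_cmult haspd_diff haspd_const dN)
  have contN: "continuous_on UNIV N" unfolding N_def by (intro continuous_intros)
  have cont\<beta>: "continuous_on UNIV \<beta>" using \<beta>(1) DERIV_isCont continuous_at_imp_continuous_on by blast
  have contu: "continuous_on UNIV u" unfolding u_def by (intro continuous_intros contN)
  show ?thesis
  proof (rule that[of "\<lambda>x. \<beta> (u x)" "\<lambda>i x. \<beta>' (u x) * (k * (0 - 2 * (x $ i - z $ i)))"])
    show "haspd i (\<lambda>x. \<beta> (u x)) (\<beta>' (u x) * (k * (0 - 2 * (x $ i - z $ i)))) x" for i x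
      unfolding haspd_def
    proof (rule DERIV_chain2[where f = \<beta> and g = "\<lambda>t. u (x + t *\<^sub>R axis i 1)"])
      show "((\<lambda>t. u (x + t *\<^sub>R axis i 1)) has_real_derivative k * (0 - 2 * (x $ i - z $ i))) (at 0)"
        using du[of i x] by (simp add: haspd_def)
      show "(\<beta> has_real_derivative \<beta>' (u x)) (at (u (x + 0 *\<^sub>R axis i 1)))" using \<beta>(1)[of "u x"] by simp
    qed
    show "continuous_on UNIV (\<lambda>x. \<beta>' (u x) * (k * (0 - 2 * (x $ i - z $ i))))" for i
      by (intro continuous_intros continuous_on_compose2[OF \<beta>(2) contu]) auto
    show "continuous_on UNIV (\<lambda>x. \<beta> (u x))" by (rule continuous_on_compose2[OF cont\<beta> contu]) auto
    show "\<beta> (u x) = 1" if "x \<in> ball z (\<rho> / 4)" for x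
    proof (rule \<beta>(4))
      have "(dist z x)\<^sup>2 \<le> (\<rho> / 4)\<^sup>2" using that by (intro power_mono) auto
      then have "k * (\<rho>\<^sup>2 / 4 - (\<rho> / 4)\<^sup>2) \<le> u x" unfolding u_def N using k by (intro mult_left_mono) auto
      moreover have "k * (\<rho>\<^sup>2 / 4 - (\<rho> / 4)\<^sup>2) = 1" using \<rho> by (simp add: k_def field_simps power2_eq_square)
      ultimately show "1 \<le> u x" by simp
    qed
    show "\<beta> (u x) = 0" if "x \<notin> cball z (\<rho> / 2)" for x
    proof (rule \<beta>(3))
      have "(\<rho> / 2)\<^sup>2 \<le> (dist z x)\<^sup>2" using that \<rho> by (intro power_mono) auto
      then show "u x \<le> 0" unfolding u_def N using k by (intro mult_nonneg_nonpos) (auto simp: power_divide)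
    qed
  qed
qed

text \<open>\<open>nu_e\<close> is defined by choice and known only almost everywhere; the
  completion in \<open>surf_int\<close> is what makes its integrand measurable.\<close>

lemma borel_measurable_completion_AE:
  fixes f f0 :: "'a \<Rightarrow> real"
  assumes f0: "f0 \<in> borel_measurable M" and ae: "AE x in M. f x = f0 x"
  shows "f \<in> borel_measurable (completion M)"
proof (rule measurableI)
  have C: "complete_measure (completion M)" by unfold_locales
  fix A :: "real set" assume A: "A \<in> sets borel"
  have 1: "f0 -` A \<inter> space (completion M) \<in> sets (completion M)"
    using measurable_sets[OF measurable_completion[OF f0] A] by simp
  have 2: "AE x in completion M. x \<in> f0 -` A \<inter> space (completion M) \<longleftrightarrow> x \<in> f -` A \<inter> space (completion M)"
    using AE_completion[OF ae] by eventually_elim simp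
  show "f -` A \<inter> space (completion M) \<in> sets (completion M)"
    by (rule complete_measure.in_sets_AE[OF C 2 1]) simp
qed simp

section \<open>Charts of a Lipschitz domain and measurability of its normal\<close>

text \<open>Packages the conclusion of \<open>hausdorff_flat\<close> for a given dimension, so that
  a constant can be chosen before the direction \<open>e\<close> of a chart and handed to
  \<open>lipschitz_graph\<close>.\<close>

definition flat_const :: "'n::finite itself \<Rightarrow> real \<Rightarrow> bool" where
  "flat_const _ c \<longleftrightarrow> c \<ge> 0 \<and> (\<forall>(e::real^'n) a F. norm e = 1 \<longrightarrow> a \<bullet> e = 0 \<longrightarrow> F \<in> sets borel \<longrightarrow>
     hausdorff (real CARD('n) - 1) (F \<inter> {z. z \<bullet> e = a \<bullet> z})
      = ennreal (c * sqrt (1 + (norm a)\<^sup>2)) * emeasure lborel {y. 0 < y \<bullet> e \<and> y \<bullet> e < 1 \<and> y + (a \<bullet> y - y \<bullet> e) *\<^sub>R e \<in> F})"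

lemma flat_const_ex: "\<exists>c. flat_const TYPE('n::finite) c"
  unfolding flat_const_def using hausdorff_flat[where 'n = 'n] by blast

lemma lipschitz_domain_graph:
  fixes D :: "(real^'n::finite) set"
  assumes "lipschitz_domain D" "x0 \<in> frontier D"
  shows "\<exists>e h L c r. lipschitz_graph e h L c \<and> r > 0 \<and> D \<inter> ball x0 r = {y \<in> ball x0 r. y \<bullet> e < h y}"
proof -
  obtain c where c: "flat_const TYPE('n) c" using flat_const_ex by blast
  obtain e r L h where *: "norm e = 1" "r > 0" "L-lipschitz_on UNIV h" "\<And>y t. h (y + t *\<^sub>R e) = h y"
      "D \<inter> ball x0 r = {y \<in> ball x0 r. y \<bullet> e < h y}"
    using assms unfolding lipschitz_domain_def by blast
  have "lipschitz_graph e h L c"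
  proof
    show "c \<ge> 0" using c by (simp add: flat_const_def)
    show "hausdorff (real CARD('n) - 1) (F \<inter> {z. z \<bullet> e = a \<bullet> z})
      = ennreal (c * sqrt (1 + (norm a)\<^sup>2)) * emeasure lborel {y. 0 < y \<bullet> e \<and> y \<bullet> e < 1 \<and> y + (a \<bullet> y - y \<bullet> e) *\<^sub>R e \<in> F}"
      if "a \<bullet> e = 0" "F \<in> sets borel" for a F
      using c *(1) that unfolding flat_const_def by blast
  qed (use * in auto)
  then show ?thesis using * by blast
qed

lemma compact_frontier_domain: "lipschitz_domain D \<Longrightarrow> compact (frontier D)"
  by (simp add: lipschitz_domain_def compact_frontier_bounded)

text \<open>In a chart the normal is given by the gradient formula at points of differentiability.
  The value 0 elsewhere keeps the representative Borel and bounded by one.\<close>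

lemma nu_e_borel_local:
  fixes D :: "(real^'n::finite) set"
  assumes D: "lipschitz_domain D" and x0: "x0 \<in> frontier D"
  shows "\<exists>r>0. \<exists>N\<in>borel_measurable borel. (\<forall>x. norm (N x) \<le> 1) \<and>
     (AE x in hmeasure (real CARD('n) - 1). x \<in> frontier D \<inter> ball x0 r \<longrightarrow> nu_e D x = N x)"
proof -
  obtain e h L c r where "lipschitz_graph e h L c" and r: "r > 0" and Dg: "D \<inter> ball x0 r = {y \<in> ball x0 r. y \<bullet> e < h y}"
    using lipschitz_domain_graph[OF assms] by blast
  then interpret lipschitz_graph e h L c by simp
  have oD: "open D" using D by (simp add: lipschitz_domain_def)
  define A where "A = \<Gamma> \<inter> ball x0 r \<inter> Dh"
  have [measurable]: "A \<in> sets borel" by (simp add: A_def)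
  define N where "N x = (if x \<in> A then inverse (J x) *\<^sub>R (e - G x) else 0)" for x
  have "N \<in> borel_measurable borel" unfolding N_def by measurable
  moreover have "norm (N x) \<le> 1" for x
    using nu_e_graph(2)[OF oD Dg, of x] by (auto simp: N_def A_def)
  moreover have "AE x in hmeasure (real CARD('n) - 1). x \<in> frontier D \<inter> ball x0 r \<longrightarrow> nu_e D x = N x"
    using AE_graph_diff
  proof eventually_elim
    fix x assume x: "x \<in> \<Gamma> \<longrightarrow> x \<in> Dh"
    show "x \<in> frontier D \<inter> ball x0 r \<longrightarrow> nu_e D x = N x"
    proof
      assume "x \<in> frontier D \<inter> ball x0 r"
      then have "x \<in> A" using x unfolding A_def frontier_graph[OF oD Dg] by blast
      then show "nu_e D x = N x" using nu_e_graph(1)[OF oD Dg, of x] by (auto simp: N_def A_def)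
    qed
  qed
  ultimately show ?thesis using r by blast
qed

text \<open>Local representatives are glued over a finite subcover, a new chart overriding the
  earlier ones on its ball; agreement almost everywhere survives finitely many such changes.\<close>

lemma nu_e_borel:
  fixes D :: "(real^'n::finite) set"
  assumes D: "lipschitz_domain D"
  obtains N where "N \<in> borel_measurable borel" "\<And>x. norm (N x) \<le> 1"
     "AE x in hmeasure (real CARD('n) - 1). x \<in> frontier D \<longrightarrow> nu_e D x = N x"
proof -
  let ?H = "hmeasure (real CARD('n) - 1) :: (real^'n) measure"
  have "\<forall>x0\<in>frontier D. \<exists>r>0. \<exists>N\<in>borel_measurable borel. (\<forall>x. norm (N x) \<le> 1) \<and> (AE x in ?H. x \<in> frontier D \<inter> ball x0 r \<longrightarrow> nu_e D x = N x)"
    using nu_e_borel_local[OF D] by blast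
  from bchoice[OF this] obtain r where r: "\<And>x0. x0 \<in> frontier D \<Longrightarrow> r x0 > 0"
    "\<And>x0. x0 \<in> frontier D \<Longrightarrow> \<exists>N\<in>borel_measurable borel. (\<forall>x. norm (N x) \<le> 1) \<and> (AE x in ?H. x \<in> frontier D \<inter> ball x0 (r x0) \<longrightarrow> nu_e D x = N x)"
    by blast
  obtain I where I: "I \<subseteq> frontier D" "finite I" "frontier D \<subseteq> (\<Union>x0\<in>I. ball x0 (r x0))"
  proof (rule compactE_image[OF compact_frontier_domain[OF D], of "frontier D" "\<lambda>x0. ball x0 (r x0)"])
    show "frontier D \<subseteq> (\<Union>x0\<in>frontier D. ball x0 (r x0))" using r(1) by force
  qed auto
  have "\<exists>N\<in>borel_measurable borel. (\<forall>x. norm (N x) \<le> 1) \<and> (AE x in ?H. x \<in> frontier D \<inter> (\<Union>x0\<in>K. ball x0 (r x0)) \<longrightarrow> nu_e D x = N x)"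
    if "finite K" "K \<subseteq> frontier D" for K
    using that
  proof (induction K)
    case empty
    show ?case by (intro bexI[of _ "\<lambda>_. 0"]) auto
  next
    case (insert a K)
    then obtain N1 where [measurable]: "N1 \<in> borel_measurable borel" and N1: "\<And>x. norm (N1 x) \<le> 1"
      "AE x in ?H. x \<in> frontier D \<inter> (\<Union>x0\<in>K. ball x0 (r x0)) \<longrightarrow> nu_e D x = N1 x" by auto
    obtain N2 where [measurable]: "N2 \<in> borel_measurable borel" and N2: "\<And>x. norm (N2 x) \<le> 1"
      "AE x in ?H. x \<in> frontier D \<inter> ball a (r a) \<longrightarrow> nu_e D x = N2 x" using r(2)[of a] insert.prems by auto
    define N where "N x = (if x \<in> ball a (r a) then N2 x else N1 x)" for x
    have "N \<in> borel_measurable borel" unfolding N_def by (rule measurable_If_set) auto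
    moreover have "norm (N x) \<le> 1" for x using N1 N2 by (simp add: N_def)
    moreover have "AE x in ?H. x \<in> frontier D \<inter> (\<Union>x0\<in>insert a K. ball x0 (r x0)) \<longrightarrow> nu_e D x = N x"
      using N1(2) N2(2) by eventually_elim (auto simp: N_def)
    ultimately show ?case by blast
  qed
  from this[OF I(2,1)] obtain N where "N \<in> borel_measurable borel" "\<And>x. norm (N x) \<le> 1"
    "AE x in ?H. x \<in> frontier D \<inter> (\<Union>x0\<in>I. ball x0 (r x0)) \<longrightarrow> nu_e D x = N x" by blast
  moreover have "frontier D \<inter> (\<Union>x0\<in>I. ball x0 (r x0)) = frontier D" using I(3) by blast
  ultimately show ?thesis using that by simp
qed

section \<open>Flux integrals against a Borel normal field\<close>

text \<open>Uses a Borel field \<open>N\<close> and an indicator on the whole space, free of the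
  choice and the completion in \<open>surf_int\<close>, so that linearity and bounds are ordinary
  integration.\<close>

definition flux_int :: "(real^'n::finite) set \<Rightarrow> (real^'n \<Rightarrow> real^'n) \<Rightarrow> ('n \<Rightarrow> real^'n \<Rightarrow> real) \<Rightarrow> real" where
  "flux_int S N W = (\<integral>x. indicator S x * (\<Sum>j\<in>UNIV. W j x * N x $ j) \<partial>hmeasure (real CARD('n) - 1))"

lemma flux_int_cong: "(\<And>j x. x \<in> S \<Longrightarrow> W j x = W' j x) \<Longrightarrow> flux_int S N W = flux_int S N W'"
  unfolding flux_int_def by (intro Bochner_Integration.integral_cong refl) (auto simp: indicator_def)

context
  fixes S :: "(real^'n::finite) set" and N :: "real^'n \<Rightarrow> real^'n"
  assumes S: "compact S" and N [measurable]: "N \<in> borel_measurable borel" and N1: "\<And>x. norm (N x) \<le> 1"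
    and fin: "hausdorff (real CARD('n) - 1) S < \<infinity>"
begin

lemma S_borel: "S \<in> sets borel" using S by (simp add: borel_compact)

lemma integrable_indicator_S: "integrable (hmeasure (real CARD('n) - 1)) (\<lambda>x. k * indicator S x :: real)"
  using fin S_borel by (intro integrable_mult_right integrable_real_indicator) (auto simp: emeasure_hmeasure)

lemma flux_meas:
  assumes W: "\<And>j. continuous_on S (W j)"
  shows "(\<lambda>x. indicator S x * (\<Sum>j\<in>UNIV. W j x * N x $ j)) \<in> borel_measurable borel"
proof -
  have [measurable]: "(\<lambda>x. indicator S x * W j x) \<in> borel_measurable borel" for j
    using borel_measurable_continuous_on_indicator[OF S_borel W[of j]] by simp
  have "(\<lambda>x. \<Sum>j\<in>UNIV. (indicator S x * W j x) * N x $ j) \<in> borel_measurable borel" by measurable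
  then show ?thesis by (simp add: sum_distrib_left mult.assoc)
qed

lemma flux_integrable_bound:
  assumes W: "\<And>j. continuous_on S (W j)" and K: "\<And>j x. x \<in> S \<Longrightarrow> \<bar>W j x\<bar> \<le> K"
  shows "integrable (hmeasure (real CARD('n) - 1)) (\<lambda>x. indicator S x * (\<Sum>j\<in>UNIV. W j x * N x $ j))"
    and "\<bar>flux_int S N W\<bar> \<le> real CARD('n) * K * measure (hmeasure (real CARD('n) - 1)) S"
proof -
  have pt: "norm (indicator S x * (\<Sum>j\<in>UNIV. W j x * N x $ j)) \<le> real CARD('n) * K * indicator S x" for x
  proof (cases "x \<in> S")
    case True
    have "norm (\<Sum>j\<in>UNIV. W j x * N x $ j) \<le> (\<Sum>j\<in>(UNIV::'n set). K)"
    proof (rule sum_norm_le)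
      fix j
      have "\<bar>W j x\<bar> * \<bar>N x $ j\<bar> \<le> K * 1"
        using K[OF True, of j] component_le_norm_cart[of "N x" j] N1[of x] by (intro mult_mono) auto
      then show "norm (W j x * N x $ j) \<le> K" by (simp add: abs_mult)
    qed
    then show ?thesis using True by simp
  qed simp
  have m: "(\<lambda>x. indicator S x * (\<Sum>j\<in>UNIV. W j x * N x $ j)) \<in> borel_measurable (hmeasure (real CARD('n) - 1))"
    using flux_meas[OF W] by (simp cong: measurable_cong_sets)
  show int: "integrable (hmeasure (real CARD('n) - 1)) (\<lambda>x. indicator S x * (\<Sum>j\<in>UNIV. W j x * N x $ j))"
    by (rule Bochner_Integration.integrable_bound[OF integrable_indicator_S[of "real CARD('n) * K"] m])
       (use pt in \<open>auto intro!: AE_I2 intro: order_trans[OF _ abs_ge_self]\<close>)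
  have "norm (flux_int S N W) \<le> (\<integral>x. real CARD('n) * K * indicator S x \<partial>hmeasure (real CARD('n) - 1))"
    unfolding flux_int_def by (rule Bochner_Integration.integral_norm_bound_integral[OF int integrable_indicator_S pt])
  also have "\<dots> = real CARD('n) * K * measure (hmeasure (real CARD('n) - 1)) S" using S_borel by simp
  finally show "\<bar>flux_int S N W\<bar> \<le> real CARD('n) * K * measure (hmeasure (real CARD('n) - 1)) S" by simp
qed

lemma flux_integrable:
  assumes W: "\<And>j. continuous_on S (W j)"
  shows "integrable (hmeasure (real CARD('n) - 1)) (\<lambda>x. indicator S x * (\<Sum>j\<in>UNIV. W j x * N x $ j))"
proof -
  have "\<exists>K. \<forall>x\<in>S. \<bar>W j x\<bar> \<le> K" for j
    using compact_imp_bounded[OF compact_continuous_image[OF W S]] by (auto simp: bounded_iff)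
  then obtain K where K: "\<And>j x. x \<in> S \<Longrightarrow> \<bar>W j x\<bar> \<le> K j" by metis
  have "\<bar>W j x\<bar> \<le> (\<Sum>j\<in>UNIV. \<bar>K j\<bar>)" if "x \<in> S" for j x
    using K[OF that, of j] member_le_sum[of j UNIV "\<lambda>j. \<bar>K j\<bar>"] by simp
  then show ?thesis by (rule flux_integrable_bound(1)[OF W])
qed

lemma flux_int_linear:
  assumes "\<And>j. continuous_on S (W j)" "\<And>j. continuous_on S (W' j)"
  shows "flux_int S N (\<lambda>j x. a * W j x + b * W' j x) = a * flux_int S N W + b * flux_int S N W'"
proof -
  have "flux_int S N (\<lambda>j x. a * W j x + b * W' j x) =
     (\<integral>x. a * (indicator S x * (\<Sum>j\<in>UNIV. W j x * N x $ j)) + b * (indicator S x * (\<Sum>j\<in>UNIV. W' j x * N x $ j)) \<partial>hmeasure (real CARD('n) - 1))"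
    unfolding flux_int_def
    by (intro Bochner_Integration.integral_cong refl) (simp add: distrib_right sum.distrib sum_distrib_left algebra_simps)
  also have "\<dots> = a * flux_int S N W + b * flux_int S N W'"
    unfolding flux_int_def
    by (subst Bochner_Integration.integral_add) (auto intro!: integrable_mult_right flux_integrable assms)
  finally show ?thesis .
qed

text \<open>The only passage from the chosen normal and the completed surface measure to Borel
  data.\<close>

lemma surf_int_eq_flux_int:
  assumes ae: "AE x in hmeasure (real CARD('n) - 1). x \<in> S \<longrightarrow> \<nu> x = N x" and W: "\<And>j. continuous_on S (W j)"
  shows "surf_int S (\<lambda>x. \<Sum>j\<in>UNIV. W j x * \<nu> x $ j) = flux_int S N W"
proof -
  let ?H = "hmeasure (real CARD('n) - 1) :: (real^'n) measure"
  let ?M = "restrict_space ?H S"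
  have Sm: "S \<inter> space ?H \<in> sets ?H" using S_borel by simp
  have f0: "(\<lambda>x. \<Sum>j\<in>UNIV. W j x * N x $ j) \<in> borel_measurable ?M"
    using flux_meas[OF W] Sm by (subst borel_measurable_restrict_space_iff) (auto cong: measurable_cong_sets)
  have ae': "AE x in ?M. (\<Sum>j\<in>UNIV. W j x * \<nu> x $ j) = (\<Sum>j\<in>UNIV. W j x * N x $ j)"
    unfolding AE_restrict_space_iff[OF Sm] using ae by eventually_elim simp
  have "surf_int S (\<lambda>x. \<Sum>j\<in>UNIV. W j x * \<nu> x $ j) = integral\<^sup>L (completion ?M) (\<lambda>x. \<Sum>j\<in>UNIV. W j x * N x $ j)"
    unfolding surf_int_def
    by (rule integral_cong_AE[OF borel_measurable_completion_AE[OF f0 ae'] measurable_completion[OF f0] AE_completion[OF ae']])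
  also have "\<dots> = flux_int S N W"
    unfolding integral_completion[OF f0] flux_int_def by (subst integral_restrict_space[OF Sm]) simp
  finally show ?thesis .
qed

end

section \<open>Localisation of Stokes' theorem on a closed hypersurface\<close>

text \<open>The derivatives form a separate argument, so that cutoffs act on field and derivatives
  by the product rule. They are controlled only on \<open>U\<close>, whereas antisymmetry is asked
  everywhere.\<close>

definition C1_antisym :: "(real^'n::finite) set \<Rightarrow> ('n \<Rightarrow> 'n \<Rightarrow> real^'n \<Rightarrow> real) \<Rightarrow> ('n \<Rightarrow> 'n \<Rightarrow> 'n \<Rightarrow> real^'n \<Rightarrow> real) \<Rightarrow> bool" where
  "C1_antisym U A A' \<longleftrightarrow> (\<forall>m k j. \<forall>x\<in>U. haspd m (A k j) (A' m k j x) x) \<and>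
     (\<forall>m k j. continuous_on U (A' m k j)) \<and> (\<forall>k j x. A k j x = - A j k x)"

lemma C1_antisymD:
  assumes "C1_antisym U A A'"
  shows "x \<in> U \<Longrightarrow> haspd m (A k j) (A' m k j x) x" "continuous_on U (A' m k j)" "A k j x = - A j k x"
  using assms unfolding C1_antisym_def by blast+

lemma C1_antisym_continuous:
  assumes "C1_antisym U A A'" "open U"
  shows "continuous_on U (A k j)"
proof -
  have "isCont (A k j) x" if x: "x \<in> U" for x
  proof -
    have "(A k j has_derivative (\<lambda>v. \<Sum>m\<in>UNIV. A' m k j x * v $ m)) (at x)"
      by (rule has_derivative_continuous_partials[OF assms(2) x])
         (use C1_antisymD(1,2)[OF assms(1)] assms(2) x in \<open>auto simp: continuous_on_eq_continuous_at\<close>)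
    then show ?thesis by (rule has_derivative_continuous)
  qed
  then show ?thesis by (simp add: continuous_at_imp_continuous_on)
qed

text \<open>Inside one chart a field supported well within the ball has a globally C^1 form to which
  \<open>local_stokes\<close> applies, and there frontier and normal coincide with those of the
  graph.\<close>

lemma local_domain_stokes:
  fixes D :: "(real^'n::finite) set"
  assumes D: "lipschitz_domain D" and U: "open U" "frontier D \<subseteq> U" and x0: "x0 \<in> frontier D"
    and N [measurable]: "N \<in> borel_measurable borel"
    and ae: "AE x in hmeasure (real CARD('n) - 1). x \<in> frontier D \<longrightarrow> nu_e D x = N x"
  shows "\<exists>r>0. ball x0 r \<subseteq> U \<and> (\<forall>A A'. C1_antisym U A A' \<longrightarrow> (\<forall>k j x. x \<notin> cball x0 (r / 2) \<longrightarrow> A k j x = 0) \<longrightarrow>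
     flux_int (frontier D) N (\<lambda>j x. \<Sum>k\<in>UNIV. A' k k j x) = 0)"
proof -
  let ?H = "hmeasure (real CARD('n) - 1) :: (real^'n) measure"
  let ?S = "frontier D"
  obtain e h L c r0 where lg: "lipschitz_graph e h L c" and r0: "r0 > 0" and Dg0: "D \<inter> ball x0 r0 = {y \<in> ball x0 r0. y \<bullet> e < h y}"
    using lipschitz_domain_graph[OF D x0] by blast
  interpret lipschitz_graph e h L c by (rule lg)
  have oD: "open D" using D by (simp add: lipschitz_domain_def)
  obtain r1 where r1: "r1 > 0" "ball x0 r1 \<subseteq> U" using U x0 by (meson open_contains_ball subsetD)
  define r where "r = min r0 r1"
  have r: "r > 0" "r \<le> r0" "ball x0 r \<subseteq> U" using r0 r1 by (auto simp: r_def)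
  have "ball x0 r \<subseteq> ball x0 r0" using r by (intro subset_ball) simp
  then have Dg: "D \<inter> ball x0 r = {y \<in> ball x0 r. y \<bullet> e < h y}" using Dg0 by blast
  have Sb [measurable]: "?S \<in> sets borel" by (simp add: borel_closed)
  have "flux_int ?S N (\<lambda>j x. \<Sum>k\<in>UNIV. A' k k j x) = 0"
    if A: "C1_antisym U A A'" and zero: "\<And>k j x. x \<notin> cball x0 (r / 2) \<Longrightarrow> A k j x = 0" for A A'
  proof -
    \<comment> \<open>The derivatives extended by zero. They already vanish on the annulus between
      radius \<open>r / 2\<close> and \<open>r\<close>, so the extension is continuous and remains
      the derivative of \<open>A\<close>.\<close>
    define B' where "B' m k j x = (if x \<in> ball x0 r then A' m k j x else 0)" for m k j x
    have oc: "open (- cball x0 (r / 2))" by (simp add: open_Compl)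
    have hz: "haspd m (A k j) 0 x" if "x \<notin> cball x0 (r / 2)" for m k j x
      by (rule haspd_locally_zero[OF oc]) (use that zero in auto)
    have A'0: "A' m k j x = 0" if "x \<in> U" "x \<notin> cball x0 (r / 2)" for m k j x
      using C1_antisymD(1)[OF A that(1)] hz[OF that(2)] by (rule haspd_unique)
    have B'0: "B' m k j x = 0" if "x \<notin> cball x0 (r / 2)" for m k j x
      using A'0[of x] that r(3) by (auto simp: B'_def)
    have hpB: "haspd m (A k j) (B' m k j x) x" for m k j x
    proof (cases "x \<in> ball x0 r")
      case True
      then show ?thesis using C1_antisymD(1)[OF A, of x] r(3) by (auto simp: B'_def)
    next
      case False
      then have "x \<notin> cball x0 (r / 2)" using r(1) by auto
      then show ?thesis using hz[of x m k j] False by (simp add: B'_def)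
    qed
    have contB: "continuous_on UNIV (B' m k j)" for m k j
    proof -
      have "continuous_on (ball x0 r) (B' m k j)"
        using continuous_on_subset[OF C1_antisymD(2)[OF A] r(3)] by (simp add: B'_def cong: continuous_on_cong_simp)
      moreover have "continuous_on (- cball x0 (r / 2)) (B' m k j)"
        using B'0 by (simp cong: continuous_on_cong_simp)
      ultimately have "continuous_on (ball x0 r \<union> - cball x0 (r / 2)) (B' m k j)"
        using oc by (intro continuous_on_open_Un) auto
      moreover have "ball x0 r \<union> - cball x0 (r / 2) = UNIV" using r(1) by auto
      ultimately show ?thesis by simp
    qed
    have [measurable]: "B' m k j \<in> borel_measurable borel" for m k j
      using contB by (rule borel_measurable_continuous_onI)
    have "flux_int ?S N (\<lambda>j x. \<Sum>k\<in>UNIV. A' k k j x) = flux_int ?S N (\<lambda>j x. \<Sum>k\<in>UNIV. B' k k j x)"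
    proof (rule flux_int_cong)
      fix j x assume "x \<in> ?S"
      then have xU: "x \<in> U" using U by blast
      have "A' m k j x = B' m k j x" for m k
      proof (cases "x \<in> ball x0 r")
        case False
        then have "x \<notin> cball x0 (r / 2)" using r(1) by auto
        then show ?thesis using A'0[OF xU] B'0 by simp
      qed (simp add: B'_def)
      then show "(\<Sum>k\<in>UNIV. A' k k j x) = (\<Sum>k\<in>UNIV. B' k k j x)" by simp
    qed
    also have "\<dots> = (\<integral>x. indicator \<Gamma> x * (\<Sum>k\<in>UNIV. \<Sum>j\<in>UNIV. B' k k j x * (inverse (J x) *\<^sub>R (e - G x)) $ j) \<partial>?H)"
      unfolding flux_int_def
    proof (rule integral_cong_AE)
      show "AE x in ?H. indicator ?S x * (\<Sum>j\<in>UNIV. (\<Sum>k\<in>UNIV. B' k k j x) * N x $ j)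
         = indicator \<Gamma> x * (\<Sum>k\<in>UNIV. \<Sum>j\<in>UNIV. B' k k j x * (inverse (J x) *\<^sub>R (e - G x)) $ j)"
        using ae AE_graph_diff
      proof eventually_elim
        fix x assume x1: "x \<in> ?S \<longrightarrow> nu_e D x = N x" and x2: "x \<in> \<Gamma> \<longrightarrow> x \<in> Dh"
        show "indicator ?S x * (\<Sum>j\<in>UNIV. (\<Sum>k\<in>UNIV. B' k k j x) * N x $ j)
         = indicator \<Gamma> x * (\<Sum>k\<in>UNIV. \<Sum>j\<in>UNIV. B' k k j x * (inverse (J x) *\<^sub>R (e - G x)) $ j)"
        proof (cases "x \<in> ball x0 r")
          case True
          have iff: "x \<in> ?S \<longleftrightarrow> x \<in> \<Gamma>" using frontier_graph[OF oD Dg] True by blast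
          show ?thesis
          proof (cases "x \<in> \<Gamma>")
            case xG: True
            have Nx: "N x = inverse (J x) *\<^sub>R (e - G x)"
              using nu_e_graph(1)[OF oD Dg xG True] x1 x2 xG iff by simp
            have "(\<Sum>j\<in>UNIV. (\<Sum>k\<in>UNIV. B' k k j x) * N x $ j) = (\<Sum>k\<in>UNIV. \<Sum>j\<in>UNIV. B' k k j x * N x $ j)"
              unfolding sum_distrib_right by (rule sum.swap)
            then show ?thesis using xG iff unfolding Nx by simp
          qed (use iff in simp)
        next
          case False
          then show ?thesis by (simp add: B'_def)
        qed
      qed
    qed measurable
    also have "\<dots> = 0"
    proof (rule local_stokes[OF hpB contB])
      show "A k j x = 0" if "norm x > norm x0 + r" for k j x
      proof (rule zero)
        show "x \<notin> cball x0 (r / 2)"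
          using that norm_triangle_ineq2[of x x0] r(1) by (auto simp: dist_norm norm_minus_commute)
      qed
      show "A k j x = - A j k x" for k j x by (rule C1_antisymD(3)[OF A])
    qed
    finally show ?thesis .
  qed
  then show ?thesis using r by blast
qed

text \<open>The partition of unity is produced by peeling: a bump for one chart splits off a local
  field without flux, and what is left vanishes near the centre of that chart.\<close>

theorem lipschitz_domain_stokes:
  fixes D :: "(real^'n::finite) set"
  assumes D: "lipschitz_domain D" and fin: "hausdorff (real CARD('n) - 1) (frontier D) < \<infinity>"
    and U: "open U" "frontier D \<subseteq> U" and A: "C1_antisym U A A'"
    and N: "N \<in> borel_measurable borel" "\<And>x. norm (N x) \<le> 1"
    and ae: "AE x in hmeasure (real CARD('n) - 1). x \<in> frontier D \<longrightarrow> nu_e D x = N x"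
  shows "flux_int (frontier D) N (\<lambda>j x. \<Sum>k\<in>UNIV. A' k k j x) = 0"
proof -
  let ?S = "frontier D"
  let ?T = "\<lambda>A'. flux_int ?S N (\<lambda>j x. \<Sum>k\<in>UNIV. A' k k j x)"
  have cS: "compact ?S" using D by (rule compact_frontier_domain)
  have "\<forall>x0\<in>?S. \<exists>r>0. ball x0 r \<subseteq> U \<and> (\<forall>A A'. C1_antisym U A A' \<longrightarrow> (\<forall>k j x. x \<notin> cball x0 (r / 2) \<longrightarrow> A k j x = 0) \<longrightarrow> ?T A' = 0)"
    using local_domain_stokes[OF D U _ N(1) ae] by blast
  from bchoice[OF this] obtain r where r: "\<And>x0. x0 \<in> ?S \<Longrightarrow> r x0 > 0"
    and loc: "\<And>x0 A A'. x0 \<in> ?S \<Longrightarrow> C1_antisym U A A' \<Longrightarrow> (\<And>k j x. x \<notin> cball x0 (r x0 / 2) \<Longrightarrow> A k j x = 0) \<Longrightarrow> ?T A' = 0"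
    by blast
  obtain I where I: "I \<subseteq> ?S" "finite I" "?S \<subseteq> (\<Union>x0\<in>I. ball x0 (r x0 / 4))"
  proof (rule compactE_image[OF cS, of ?S "\<lambda>x0. ball x0 (r x0 / 4)"])
    show "?S \<subseteq> (\<Union>x0\<in>?S. ball x0 (r x0 / 4))" using r(1) by force
  qed auto
  \<comment> \<open>The induction carries an open set \<open>V\<close> on which the field is already
    zero; together with the remaining small balls it must cover the frontier.\<close>
  have "?T A' = 0" if "finite K" "K \<subseteq> ?S" "open V" "?S \<subseteq> V \<union> (\<Union>x0\<in>K. ball x0 (r x0 / 4))"
    "C1_antisym U A A'" "\<And>k j x. x \<in> V \<Longrightarrow> A k j x = 0" for K V A A'
    using that
  proof (induction K arbitrary: V A A' rule: finite_induct)
    case (empty V A A')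
    \<comment> \<open>With no charts left, the field vanishes in a neighbourhood of the frontier,
      and so do its derivatives there.\<close>
    have "A' k k j x = 0" if x: "x \<in> ?S" for k j x
    proof (rule haspd_unique)
      show "haspd k (A k j) (A' k k j x) x" using C1_antisymD(1)[OF empty.prems(4)] U x by auto
      show "haspd k (A k j) 0 x"
        by (rule haspd_locally_zero[OF empty.prems(2)]) (use empty.prems(3,5) x in auto)
    qed
    then have "?T A' = flux_int ?S N (\<lambda>j x. 0)" by (intro flux_int_cong) simp
    then show ?case by (simp add: flux_int_def)
  next
    case (insert a K V A A')
    have aS: "a \<in> ?S" and rpos: "r a > 0" using insert.prems r by auto
    obtain \<phi> :: "real^'n \<Rightarrow> real" and \<phi>' where \<phi>: "\<And>i x. haspd i \<phi> (\<phi>' i x) x" "\<And>i. continuous_on UNIV (\<phi>' i)"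
      "continuous_on UNIV \<phi>" "\<And>x. x \<in> ball a (r a / 4) \<Longrightarrow> \<phi> x = 1" "\<And>x. x \<notin> cball a (r a / 2) \<Longrightarrow> \<phi> x = 0"
      using bump_function[OF rpos, of a] by blast
    note A = insert.prems(4)
    have Ac: "continuous_on U (A k j)" for k j by (rule C1_antisym_continuous[OF A U(1)])
    note A'c = C1_antisymD(2)[OF A] and Ah = C1_antisymD(1)[OF A] and Aa = C1_antisymD(3)[OF A]
    have \<phi>U: "continuous_on U \<phi>" "continuous_on U (\<phi>' i)" for i using \<phi>(2,3) by (auto intro: continuous_on_subset)
    define A1 where "A1 k j x = \<phi> x * A k j x" for k j x
    define A1' where "A1' m k j x = \<phi>' m x * A k j x + A' m k j x * \<phi> x" for m k j x
    define A2 where "A2 k j x = A k j x - A1 k j x" for k j x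
    define A2' where "A2' m k j x = A' m k j x - A1' m k j x" for m k j x
    have c1: "C1_antisym U A1 A1'"
      unfolding C1_antisym_def
    proof (intro conjI allI ballI)
      show "haspd m (A1 k j) (A1' m k j x) x" if "x \<in> U" for m k j x
        unfolding A1_def A1'_def by (intro haspd_mult \<phi>(1) Ah that)
      show "continuous_on U (A1' m k j)" for m k j
        unfolding A1'_def by (intro continuous_intros \<phi>U Ac A'c)
      show "A1 k j x = - A1 j k x" for k j x unfolding A1_def by (subst Aa) simp
    qed
    have c2: "C1_antisym U A2 A2'"
      unfolding C1_antisym_def
    proof (intro conjI allI ballI)
      show "haspd m (A2 k j) (A2' m k j x) x" if "x \<in> U" for m k j x
        unfolding A2_def A2'_def by (intro haspd_diff Ah C1_antisymD(1)[OF c1] that)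
      show "continuous_on U (A2' m k j)" for m k j
        unfolding A2'_def by (intro continuous_intros A'c C1_antisymD(2)[OF c1])
      show "A2 k j x = - A2 j k x" for k j x
        unfolding A2_def using Aa[of k j x] C1_antisymD(3)[OF c1, of k j x] by simp
    qed
    have t1: "?T A1' = 0" by (rule loc[OF aS c1]) (simp add: A1_def \<phi>(5))
    have t2: "?T A2' = 0"
    proof (rule insert.IH[OF _ _ _ c2, of "V \<union> ball a (r a / 4)"])
      show "A2 k j x = 0" if "x \<in> V \<union> ball a (r a / 4)" for k j x
        using that \<phi>(4)[of x] insert.prems(5) by (auto simp: A2_def A1_def)
    qed (use insert.prems in auto)
    have cS': "continuous_on ?S (\<lambda>x. \<Sum>k\<in>UNIV. B' k k j x)" if "C1_antisym U B B'" for B B' j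
      by (intro continuous_intros continuous_on_subset[OF C1_antisymD(2)[OF that] U(2)])
    have "?T A' = flux_int ?S N (\<lambda>j x. 1 * (\<Sum>k\<in>UNIV. A1' k k j x) + 1 * (\<Sum>k\<in>UNIV. A2' k k j x))"
      by (intro flux_int_cong) (simp add: A2'_def sum_subtractf)
    also have "\<dots> = 1 * ?T A1' + 1 * ?T A2'"
      by (rule flux_int_linear[OF cS N fin cS'[OF c1] cS'[OF c2]])
    finally show ?case by (simp add: t1 t2)
  qed
  from this[OF I(2,1) open_empty _ A] show ?thesis using I(3) by simp
qed

section \<open>Comparison of the two masses\<close>

text \<open>On this range both heights are at least \<open>r / 2\<close>, so the sum of heights is
  at least the sum of arguments, and the difference of squares gives slope at most one.\<close>

lemma lipschitz_sqrt_cap: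
  fixes r :: real
  assumes r: "r > 0"
  shows "1-lipschitz_on {0..r / 2} (\<lambda>m. sqrt (r\<^sup>2 - m\<^sup>2))"
proof (rule lipschitz_onI)
  fix a b assume ab: "a \<in> {0..r / 2}" "b \<in> {0..r / 2}"
  have low: "r / 2 \<le> sqrt (r\<^sup>2 - m\<^sup>2)" if "m \<in> {0..r / 2}" for m
  proof (rule real_le_rsqrt)
    have "m\<^sup>2 \<le> (r / 2)\<^sup>2" using that by (intro power_mono) auto
    moreover have "(r / 2)\<^sup>2 = r\<^sup>2 / 4" by (simp add: power_divide)
    ultimately show "(r / 2)\<^sup>2 \<le> r\<^sup>2 - m\<^sup>2" using zero_le_power2[of r] by linarith
  qed
  define A B where "A = sqrt (r\<^sup>2 - a\<^sup>2)" and "B = sqrt (r\<^sup>2 - b\<^sup>2)"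
  have AB: "r / 2 \<le> A" "r / 2 \<le> B" using low ab by (auto simp: A_def B_def)
  have sq: "A\<^sup>2 = r\<^sup>2 - a\<^sup>2" "B\<^sup>2 = r\<^sup>2 - b\<^sup>2"
  proof -
    have "a\<^sup>2 \<le> r\<^sup>2" "b\<^sup>2 \<le> r\<^sup>2" using ab r by (intro power_mono; simp)+
    then show "A\<^sup>2 = r\<^sup>2 - a\<^sup>2" "B\<^sup>2 = r\<^sup>2 - b\<^sup>2" by (simp_all add: A_def B_def)
  qed
  have "(A - B) * (A + B) = (b - a) * (a + b)"
    using sq by (simp add: power2_eq_square algebra_simps)
  then have "\<bar>A - B\<bar> * (A + B) = \<bar>a - b\<bar> * (a + b)"
    using AB r ab by (metis abs_minus_commute abs_mult abs_of_nonneg add_nonneg_nonneg atLeastAtMost_iff half_gt_zero less_imp_le order_trans)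
  then have "\<bar>A - B\<bar> * r \<le> \<bar>a - b\<bar> * r"
    using mult_left_mono[of r "A + B" "\<bar>A - B\<bar>"] mult_left_mono[of "a + b" r "\<bar>a - b\<bar>"] AB ab by auto
  then have "\<bar>A - B\<bar> \<le> \<bar>a - b\<bar>" using r by simp
  then show "dist (sqrt (r\<^sup>2 - a\<^sup>2)) (sqrt (r\<^sup>2 - b\<^sup>2)) \<le> 1 * dist a b" by (simp add: dist_real_def A_def B_def)
qed simp

lemma lipschitz_domain_ball:
  assumes r: "r > 0"
  shows "lipschitz_domain (ball (0::real^'n::finite) r)"
  unfolding lipschitz_domain_def
proof (intro conjI ballI open_ball bounded_ball)
  fix x0 :: "real^'n" assume "x0 \<in> frontier (ball 0 r)"
  then have nx: "norm x0 = r" using r by (simp add: frontier_ball)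
  define e where "e = (1 / r) *\<^sub>R x0"
  have ne: "norm e = 1" using nx r by (simp add: e_def)
  have ee: "e \<bullet> e = 1" using ne by (simp add: dot_square_norm)
  have x0e: "x0 = r *\<^sub>R e" using r by (simp add: e_def)
  define Q where "Q y = y - (y \<bullet> e) *\<^sub>R e" for y
  \<comment> \<open>The spherical cap over the tangent plane, with the radius truncated at
    \<open>r / 2\<close>: the cap becomes vertical at the equator, and the truncation makes the
    function globally Lipschitz without changing it near \<open>x0\<close>.\<close>
  define h where "h y = sqrt (r\<^sup>2 - (min (norm (Q y)) (r / 2))\<^sup>2)" for y
  have Qdiff: "Q y - Q z = Q (y - z)" for y z by (simp add: Q_def algebra_simps inner_diff_left)
  have pyth: "(norm y)\<^sup>2 = (norm (Q y))\<^sup>2 + (y \<bullet> e)\<^sup>2" for y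
    unfolding power2_norm_eq_inner Q_def
    by (simp add: inner_diff_left inner_diff_right ee inner_commute[of e y] power2_eq_square)
  have Qle: "norm (Q y) \<le> norm y" for y using pyth[of y] by (auto intro!: power2_le_imp_le[of "norm (Q y)" "norm y"])
  have lipm: "1-lipschitz_on UNIV (\<lambda>y. min (norm (Q y)) (r / 2))"
  proof (rule lipschitz_onI)
    fix y z
    have "\<bar>norm (Q y) - norm (Q z)\<bar> \<le> norm (Q y - Q z)" by (rule norm_triangle_ineq3)
    also have "\<dots> \<le> norm (y - z)" unfolding Qdiff by (rule Qle)
    finally show "dist (min (norm (Q y)) (r / 2)) (min (norm (Q z)) (r / 2)) \<le> 1 * dist y z"
      by (auto simp: dist_real_def dist_norm min_def)
  qed simp
  have liph: "1-lipschitz_on UNIV h"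
  proof -
    have "1-lipschitz_on ((\<lambda>y. min (norm (Q y)) (r / 2)) ` UNIV) (\<lambda>m. sqrt (r\<^sup>2 - m\<^sup>2))"
      by (rule lipschitz_on_subset[OF lipschitz_sqrt_cap[OF r]]) (use r in auto)
    from lipschitz_on_compose2[OF lipm this] show ?thesis by (simp add: h_def[abs_def])
  qed
  have inv: "h (y + t *\<^sub>R e) = h y" for y t
    by (simp add: h_def Q_def inner_add_left ee algebra_simps)
  have loc: "y \<in> ball 0 r \<longleftrightarrow> y \<bullet> e < h y" if y: "y \<in> ball x0 (r / 2)" for y
  proof -
    have d: "norm (y - x0) < r / 2" using y by (simp add: dist_norm norm_minus_commute)
    have Qy: "norm (Q y) < r / 2"
    proof -
      have "Q x0 = 0" by (simp add: Q_def x0e ee)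
      then have "norm (Q y) = norm (Q (y - x0))" using Qdiff[of y x0] by simp
      then show ?thesis using Qle[of "y - x0"] d by simp
    qed
    have ye: "y \<bullet> e > 0"
    proof -
      have "\<bar>(y - x0) \<bullet> e\<bar> \<le> norm (y - x0) * norm e" by (rule Cauchy_Schwarz_ineq2)
      then have "\<bar>y \<bullet> e - r\<bar> < r / 2" using d ne by (simp add: inner_diff_left x0e ee)
      then show ?thesis using r by linarith
    qed
    have hy: "h y = sqrt (r\<^sup>2 - (norm (Q y))\<^sup>2)" using Qy by (simp add: h_def)
    have "y \<in> ball 0 r \<longleftrightarrow> (norm y)\<^sup>2 < r\<^sup>2" using r by (auto intro: power_strict_mono power_less_imp_less_base)
    also have "\<dots> \<longleftrightarrow> (y \<bullet> e)\<^sup>2 < r\<^sup>2 - (norm (Q y))\<^sup>2" unfolding pyth[of y] by linarith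
    also have "\<dots> \<longleftrightarrow> y \<bullet> e < h y"
      unfolding hy using ye by (metis abs_of_pos real_sqrt_abs real_sqrt_less_iff)
    finally show ?thesis .
  qed
  show "\<exists>e r' L h. norm e = 1 \<and> 0 < r' \<and> L-lipschitz_on UNIV h \<and> (\<forall>y t. h (y + t *\<^sub>R e) = h y) \<and> ball 0 r \<inter> ball x0 r' = {y \<in> ball x0 r'. y \<bullet> e < h y}"
  proof (intro exI conjI allI)
    show "norm e = 1" by (rule ne)
    show "0 < r / 2" using r by simp
    show "1-lipschitz_on UNIV h" by (rule liph)
    show "h (y + t *\<^sub>R e) = h y" for y t by (rule inv)
    show "ball 0 r \<inter> ball x0 (r / 2) = {y \<in> ball x0 (r / 2). y \<bullet> e < h y}" using loc by blast
  qed
qed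

text \<open>The right-hand side is the chord of the convex power over the unit interval.\<close>

lemma power_one_plus_le: "0 \<le> \<epsilon> \<Longrightarrow> \<epsilon> \<le> 1 \<Longrightarrow> (1 + \<epsilon>) ^ n \<le> 1 + (2 ^ n - 1) * (\<epsilon>::real)"
proof (induction n)
  case (Suc n)
  have "(1 + \<epsilon>) ^ Suc n \<le> (1 + \<epsilon>) * (1 + (2 ^ n - 1) * \<epsilon>)"
    using Suc by (simp add: mult_left_mono)
  also have "\<dots> = 1 + 2 ^ n * \<epsilon> + (2 ^ n - 1) * (\<epsilon> * \<epsilon>)" by (simp add: algebra_simps)
  also have "\<dots> \<le> 1 + 2 ^ n * \<epsilon> + (2 ^ n - 1) * (\<epsilon> * 1)"
    using Suc.prems by (intro add_left_mono mult_left_mono) auto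
  finally show ?case by (simp add: algebra_simps)
qed simp

lemma hausdorff_unit_sphere_finite:
  assumes "CARD('n::finite) \<ge> 1"
  shows "hausdorff (real CARD('n) - 1) (sphere (0::real^'n) 1) < \<infinity>"
proof -
  let ?n = "CARD('n)"
  define V where "V = Ball_Volume.unit_ball_vol (real ?n)"
  have V: "V \<ge> 0" by (simp add: V_def)
  have "hausdorff (real DIM(real^'n) - 1) (sphere (0::real^'n) 1) < \<infinity>"
  \<comment> \<open>The neighbourhood of the sphere lies in the shell between radii
    \<open>1 - \<epsilon>\<close> and \<open>1 + \<epsilon>\<close>. The chord bound above and
    Bernoulli's inequality below give the two summands of the constant.\<close>
  proof (rule hausdorff_finite_of_minkowski[where K = "V * ((2 ^ ?n - 1) + real ?n)"])
    show "0 \<le> V * ((2 ^ ?n - 1) + real ?n)" using V by (intro mult_nonneg_nonneg add_nonneg_nonneg) auto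
    fix \<epsilon> :: real assume \<epsilon>: "0 < \<epsilon>" "\<epsilon> \<le> 1"
    have "(\<Union>x\<in>sphere (0::real^'n) 1. ball x \<epsilon>) \<subseteq> ball 0 (1 + \<epsilon>) - ball 0 (1 - \<epsilon>)"
    proof
      fix y :: "real^'n" assume "y \<in> (\<Union>x\<in>sphere 0 1. ball x \<epsilon>)"
      then obtain x where x: "norm x = 1" "norm (x - y) < \<epsilon>" by (auto simp: dist_norm)
      then show "y \<in> ball 0 (1 + \<epsilon>) - ball 0 (1 - \<epsilon>)"
        using norm_triangle_ineq3[of x y] by auto
    qed
    then have "emeasure lborel (\<Union>x\<in>sphere (0::real^'n) 1. ball x \<epsilon>) \<le> emeasure lborel (ball (0::real^'n) (1 + \<epsilon>) - ball 0 (1 - \<epsilon>))"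
      by (intro emeasure_mono) auto
    also have "\<dots> = emeasure lborel (ball (0::real^'n) (1 + \<epsilon>)) - emeasure lborel (ball (0::real^'n) (1 - \<epsilon>))"
      using \<epsilon> emeasure_lborel_ball_finite[of "0::real^'n" "1 - \<epsilon>"] by (intro emeasure_Diff) (auto simp: subset_ball)
    also have "\<dots> = ennreal (V * (1 + \<epsilon>) ^ ?n - V * (1 - \<epsilon>) ^ ?n)"
      using \<epsilon> V by (simp add: emeasure_ball V_def ennreal_minus)
    also have "\<dots> \<le> ennreal (V * ((2 ^ ?n - 1) + real ?n) * \<epsilon>)"
    proof (rule ennreal_leI)
      have "(1 + \<epsilon>) ^ ?n \<le> 1 + (2 ^ ?n - 1) * \<epsilon>" using \<epsilon> by (intro power_one_plus_le) auto
      moreover have "1 + real ?n * (- \<epsilon>) \<le> (1 + - \<epsilon>) ^ ?n" using \<epsilon> by (intro Bernoulli_inequality) auto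
      ultimately have "(1 + \<epsilon>) ^ ?n - (1 - \<epsilon>) ^ ?n \<le> ((2 ^ ?n - 1) + real ?n) * \<epsilon>"
        by (simp add: algebra_simps)
      from mult_left_mono[OF this V] show "V * (1 + \<epsilon>) ^ ?n - V * (1 - \<epsilon>) ^ ?n \<le> V * ((2 ^ ?n - 1) + real ?n) * \<epsilon>"
        by (simp add: algebra_simps)
    qed
    finally show "emeasure lborel (\<Union>x\<in>sphere (0::real^'n) 1. ball x \<epsilon>) \<le> ennreal (V * ((2 ^ ?n - 1) + real ?n) * \<epsilon>)" .
  qed
  then show ?thesis by simp
qed

lemma hausdorff_sphere_le:
  assumes "CARD('n::finite) \<ge> 1"
  obtains K where "K \<ge> 0" "\<And>r. r > 0 \<Longrightarrow> hausdorff (real CARD('n) - 1) (sphere (0::real^'n) r) \<le> ennreal (K * r ^ (CARD('n) - 1))"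
proof -
  let ?s = "real CARD('n) - 1"
  define K where "K = enn2real (hausdorff ?s (sphere (0::real^'n) 1))"
  have K: "hausdorff ?s (sphere (0::real^'n) 1) = ennreal K" "K \<ge> 0"
    using hausdorff_unit_sphere_finite[OF assms] by (auto simp: K_def)
  have "hausdorff ?s (sphere (0::real^'n) r) \<le> ennreal (K * r ^ (CARD('n) - 1))" if r: "r > 0" for r
  proof -
    have "sphere (0::real^'n) r \<subseteq> (\<lambda>x. r *\<^sub>R x) ` sphere 0 1"
    proof
      fix x :: "real^'n" assume "x \<in> sphere 0 r"
      then have "x = r *\<^sub>R ((1 / r) *\<^sub>R x)" "(1 / r) *\<^sub>R x \<in> sphere 0 1" using r by auto
      then show "x \<in> (\<lambda>x. r *\<^sub>R x) ` sphere 0 1" by blast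
    qed
    then have "hausdorff ?s (sphere (0::real^'n) r) \<le> hausdorff ?s ((\<lambda>x. r *\<^sub>R x) ` sphere (0::real^'n) 1)" by (rule hausdorff_mono)
    also have "\<dots> \<le> ennreal (r powr ?s) * hausdorff ?s (sphere (0::real^'n) 1)"
    proof (rule hausdorff_lipschitz_image[OF _ r])
      show "r-lipschitz_on (sphere 0 1) (\<lambda>x::real^'n. r *\<^sub>R x)"
        using r by (auto intro!: lipschitz_onI simp: dist_norm simp flip: scaleR_diff_right)
      show "?s \<ge> 0" using assms by simp
    qed
    also have "r powr ?s = r ^ (CARD('n) - 1)"
      using r assms by (simp add: powr_realpow[symmetric] of_nat_diff)
    finally show ?thesis using K(2) r unfolding K(1) by (simp add: ennreal_mult[symmetric] mult.commute)
  qed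
  then show ?thesis using K(2) that by blast
qed

section \<open>The two masses as fluxes and their difference\<close>

context af_metric begin

lemma mass_adm_eq:
  assumes "frontier D \<subseteq> U"
  shows "mass_adm g D = 1 / (2 * (real CARD('n) - 1) * sphere_area CARD('n)) * surf_int (frontier D) (\<lambda>x. \<Sum>i\<in>UNIV. flux_adm i x * nu_e D x $ i)"
  unfolding mass_adm_def flux_adm_def sum_distrib_right ..

text \<open>With \<open>w\<close> the normal raised by the inverse metric, \<open>q\<close> is the
  squared length of \<open>w\<close> in \<open>g\<close>, hence positive unless
  \<open>w = 0\<close>, and \<open>sqrt q\<close> cancels. The vector \<open>v\<close> is arbitrary
  because \<open>nu_e\<close> is unspecified at points without a normal.\<close>

lemma ricci_integrand:
  fixes v :: "real^'n"
  assumes x: "x \<in> U"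
  shows "(let \<nu> = v;
            q = (\<Sum>a\<in>UNIV. \<Sum>b\<in>UNIV. ginv g a b x * \<nu>$a * \<nu>$b);
            \<nu>g = (\<lambda>j. (\<Sum>k\<in>UNIV. ginv g j k x * \<nu>$k) / sqrt q)
        in (\<Sum>i\<in>UNIV. \<Sum>j\<in>UNIV. einstein g i j x * x$i * \<nu>g j)
           * (sqrt (det (gmat g x)) * sqrt q)) = (\<Sum>k\<in>UNIV. flux_ric k x * v $ k)"
proof -
  define w where "w = (\<chi> j. \<Sum>k\<in>UNIV. ginv g j k x * v $ k)"
  define q where "q = (\<Sum>a\<in>UNIV. \<Sum>b\<in>UNIV. ginv g a b x * v$a * v$b)"
  have gw: "(\<Sum>j\<in>UNIV. g i j x * w $ j) = v $ i" for i
  proof -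
    have "(\<Sum>j\<in>UNIV. g i j x * w $ j) = (\<Sum>j\<in>UNIV. \<Sum>k\<in>UNIV. g i j x * ginv g j k x * v $ k)"
      by (simp add: w_def sum_distrib_left mult.assoc)
    also have "\<dots> = (\<Sum>k\<in>UNIV. (\<Sum>j\<in>UNIV. g i j x * ginv g j k x) * v $ k)"
      unfolding sum_distrib_right by (rule sum.swap)
    also have "\<dots> = v $ i" by (simp add: ginv_right[OF x] if_distrib[of "\<lambda>t. t * _"] cong: if_cong)
    finally show ?thesis .
  qed
  have qw: "q = (\<Sum>i\<in>UNIV. \<Sum>j\<in>UNIV. g i j x * w $ i * w $ j)"
  proof -
    have "(\<Sum>i\<in>UNIV. \<Sum>j\<in>UNIV. g i j x * w $ i * w $ j) = (\<Sum>i\<in>UNIV. w $ i * (\<Sum>j\<in>UNIV. g i j x * w $ j))"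
      by (simp add: sum_distrib_left mult_ac)
    also have "\<dots> = (\<Sum>i\<in>UNIV. w $ i * v $ i)" by (simp only: gw)
    also have "\<dots> = q" by (simp add: q_def w_def sum_distrib_right sum_distrib_left mult_ac)
    finally show ?thesis ..
  qed
  have R: "(\<Sum>k\<in>UNIV. flux_ric k x * v $ k) = (\<Sum>i\<in>UNIV. \<Sum>j\<in>UNIV. einstein g i j x * x $ i * w $ j) * sqrt (det (gmat g x))"
  proof -
    have "(\<Sum>k\<in>UNIV. flux_ric k x * v $ k) = (\<Sum>k\<in>UNIV. \<Sum>i\<in>UNIV. \<Sum>j\<in>UNIV. einstein g i j x * x $ i * ginv g j k x * v $ k) * sqrt (det (gmat g x))"
      by (simp add: flux_ric_def sum_distrib_right sum_distrib_left mult_ac)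
    also have "(\<Sum>k\<in>UNIV. \<Sum>i\<in>UNIV. \<Sum>j\<in>UNIV. einstein g i j x * x $ i * ginv g j k x * v $ k)
       = (\<Sum>i\<in>UNIV. \<Sum>k\<in>UNIV. \<Sum>j\<in>UNIV. einstein g i j x * x $ i * ginv g j k x * v $ k)" by (rule sum.swap)
    also have "\<dots> = (\<Sum>i\<in>UNIV. \<Sum>j\<in>UNIV. \<Sum>k\<in>UNIV. einstein g i j x * x $ i * ginv g j k x * v $ k)"
      by (intro sum.cong refl sum.swap)
    also have "\<dots> = (\<Sum>i\<in>UNIV. \<Sum>j\<in>UNIV. einstein g i j x * x $ i * w $ j)"
      by (simp add: w_def sum_distrib_left mult_ac)
    finally show ?thesis .
  qed
  have "(\<Sum>i\<in>UNIV. \<Sum>j\<in>UNIV. einstein g i j x * x $ i * (w $ j / sqrt q)) * (sqrt (det (gmat g x)) * sqrt q)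
     = (\<Sum>k\<in>UNIV. flux_ric k x * v $ k)"
  proof (cases "w = 0")
    case True
    then show ?thesis unfolding R by simp
  next
    case False
    then have "q > 0" unfolding qw using reg x by (auto simp: riemannian_C2_on_def)
    then have "sqrt q \<noteq> 0" by simp
    moreover have "(\<Sum>i\<in>UNIV. \<Sum>j\<in>UNIV. einstein g i j x * x $ i * (w $ j / sqrt q)) = (\<Sum>i\<in>UNIV. \<Sum>j\<in>UNIV. einstein g i j x * x $ i * w $ j) / sqrt q"
      by (simp add: sum_divide_distrib)
    ultimately show ?thesis unfolding R by simp
  qed
  then show ?thesis unfolding Let_def q_def w_def by simp
qed

lemma mass_ricci_eq:
  assumes "frontier D \<subseteq> U"
  shows "mass_ricci g D = 1 / ((real CARD('n) - 1) * (2 - real CARD('n)) * sphere_area CARD('n)) * surf_int (frontier D) (\<lambda>x. \<Sum>k\<in>UNIV. flux_ric k x * nu_e D x $ k)"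
  unfolding mass_ricci_def surf_int_def
  by (intro arg_cong2[where f = "(*)"] refl Bochner_Integration.integral_cong ricci_integrand)
     (use assms in \<open>auto simp: space_restrict_space\<close>)

text \<open>Once both masses carry the prefactor \<open>k\<close>, the potential has no flux and the
  multiples of \<open>flux_adm\<close> agree, so the difference is exactly the flux of
  \<open>err\<close>.\<close>

lemma mass_difference_bound:
  assumes D: "lipschitz_domain D" and fU: "frontier D \<subseteq> U"
    and area: "hausdorff (real CARD('n) - 1) (frontier D) \<le> ennreal a" and a: "a \<ge> 0"
    and K: "\<And>j x. x \<in> frontier D \<Longrightarrow> \<bar>err j x\<bar> \<le> K" and K0: "K \<ge> 0"
  shows "\<bar>mass_adm g D - mass_ricci g D\<bar> \<le> \<bar>1 / ((real CARD('n) - 1) * (2 - real CARD('n)) * sphere_area CARD('n))\<bar> * (real CARD('n) * K * a)"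
proof -
  let ?S = "frontier D"
  define k where "k = 1 / ((real CARD('n) - 1) * (2 - real CARD('n)) * sphere_area CARD('n))"
  have fin: "hausdorff (real CARD('n) - 1) ?S < \<infinity>" using area by (rule le_less_trans) simp
  have cS: "compact ?S" using D by (rule compact_frontier_domain)
  obtain N where N: "N \<in> borel_measurable borel" "\<And>x. norm (N x) \<le> 1"
     "AE x in hmeasure (real CARD('n) - 1). x \<in> ?S \<longrightarrow> nu_e D x = N x"
    using nu_e_borel[OF D] by blast
  note fS = continuous_on_subset[OF _ fU]
  have cpot: "continuous_on ?S (\<lambda>x. \<Sum>k\<in>UNIV. dpotential k k j x)" for j
    by (intro continuous_intros fS cont_dpotential)
  have stokes: "flux_int ?S N (\<lambda>j x. \<Sum>k\<in>UNIV. dpotential k k j x) = 0"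
  proof -
    have "C1_antisym U potential dpotential"
      unfolding C1_antisym_def using haspd_potential cont_dpotential potential_antisym by blast
    from lipschitz_domain_stokes[OF D fin open_U fU this N] show ?thesis .
  qed
  have adm: "mass_adm g D = k * ((2 - real CARD('n)) / 2) * flux_int ?S N flux_adm"
  proof -
    \<comment> \<open>The ratio of the two prefactors is the factor \<open>(2 - n) / 2\<close> that
      the linearisation produces; the normalisations of the two masses agree for this
      reason.\<close>
    have "1 / (2 * (m - 1) * s) = 1 / ((m - 1) * (2 - m) * s) * ((2 - m) / 2)" if "m \<noteq> 2" for m s :: real
      using that by (cases "s = 0"; cases "m = 1") (auto simp: divide_simps)
    then have k: "1 / (2 * (real CARD('n) - 1) * sphere_area CARD('n)) = k * ((2 - real CARD('n)) / 2)"
      using dim by (simp only: k_def)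
    show ?thesis
      unfolding mass_adm_eq[OF fU] k using surf_int_eq_flux_int[OF cS N(1,2) fin N(3), of flux_adm] fS[OF cont_flux_adm(1)] by simp
  qed
  have ric: "mass_ricci g D = k * flux_int ?S N flux_ric"
    unfolding mass_ricci_eq[OF fU] k_def using surf_int_eq_flux_int[OF cS N(1,2) fin N(3), of flux_ric] fS[OF cont_flux_ric] by simp
  have "flux_int ?S N flux_ric = flux_int ?S N (\<lambda>j x. 1 * (1 * (\<Sum>k\<in>UNIV. dpotential k k j x) + ((2 - real CARD('n)) / 2) * flux_adm j x) + 1 * err j x)"
    by (intro flux_int_cong) (simp add: err_def)
  also have "\<dots> = 1 * flux_int ?S N (\<lambda>j x. 1 * (\<Sum>k\<in>UNIV. dpotential k k j x) + ((2 - real CARD('n)) / 2) * flux_adm j x) + 1 * flux_int ?S N err"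
    by (rule flux_int_linear[OF cS N(1,2) fin]) (intro continuous_intros cpot fS cont_flux_adm cont_err)+
  also have "flux_int ?S N (\<lambda>j x. 1 * (\<Sum>k\<in>UNIV. dpotential k k j x) + ((2 - real CARD('n)) / 2) * flux_adm j x)
      = 1 * flux_int ?S N (\<lambda>j x. \<Sum>k\<in>UNIV. dpotential k k j x) + ((2 - real CARD('n)) / 2) * flux_int ?S N flux_adm"
    by (rule flux_int_linear[OF cS N(1,2) fin]) (intro cpot fS cont_flux_adm)+
  finally have "mass_adm g D - mass_ricci g D = - (k * flux_int ?S N err)"
    unfolding adm ric stokes by (simp add: algebra_simps)
  then have "\<bar>mass_adm g D - mass_ricci g D\<bar> = \<bar>k\<bar> * \<bar>flux_int ?S N err\<bar>" by (simp add: abs_mult)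
  also have "\<dots> \<le> \<bar>k\<bar> * (real CARD('n) * K * measure (hmeasure (real CARD('n) - 1)) ?S)"
    by (intro mult_left_mono flux_integrable_bound(2)[OF cS N(1,2) fin fS[OF cont_err] K]) auto
  also have "\<dots> \<le> \<bar>k\<bar> * (real CARD('n) * K * a)"
  proof -
    have "measure (hmeasure (real CARD('n) - 1)) ?S = enn2real (hausdorff (real CARD('n) - 1) ?S)"
      by (simp add: measure_def emeasure_hmeasure borel_closed)
    also have "\<dots> \<le> a" using enn2real_mono[OF area] a by simp
    finally show ?thesis using K0 by (intro mult_left_mono) auto
  qed
  finally show ?thesis by (simp add: k_def)
qed

text \<open>The threshold depends only on \<open>C\<close> and \<open>\<eta>\<close>, not on the
  domain, so it serves sequences of domains and the family of balls alike.\<close>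

lemma mass_difference_small:
  assumes C: "C \<ge> 0" and \<eta>: "\<eta> > 0"
  obtains R where "\<And>D r. lipschitz_domain D \<Longrightarrow> frontier D \<subseteq> U \<Longrightarrow> r > R \<Longrightarrow> (\<And>x. x \<in> frontier D \<Longrightarrow> r \<le> norm x) \<Longrightarrow>
     hausdorff (real CARD('n) - 1) (frontier D) \<le> ennreal (C * r ^ (CARD('n) - 1)) \<Longrightarrow> \<bar>mass_adm g D - mass_ricci g D\<bar> < \<eta>"
proof -
  define k where "k = \<bar>1 / ((real CARD('n) - 1) * (2 - real CARD('n)) * sphere_area CARD('n))\<bar> * real CARD('n) * C"
  have k: "k \<ge> 0" using C by (simp add: k_def)
  \<comment> \<open>The final bound is \<open>k * \<epsilon>\<close>; adding one keeps the quotient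
    meaningful when \<open>k\<close> is zero.\<close>
  define \<epsilon> where "\<epsilon> = \<eta> / (2 * (k + 1))"
  have \<epsilon>: "\<epsilon> > 0" using \<eta> k by (simp add: \<epsilon>_def)
  have "eventually (\<lambda>x. \<forall>j. \<bar>norm x powr (real CARD('n) - 1) * err j x\<bar> < \<epsilon>) at_infinity"
  proof (rule eventually_all_finite)
    fix j show "eventually (\<lambda>x. \<bar>norm x powr (real CARD('n) - 1) * err j x\<bar> < \<epsilon>) at_infinity"
      using tendstoD[OF decays_err[of j, unfolded decays_def] \<epsilon>] by simp
  qed
  then obtain R1 where R1: "\<And>j x. R1 \<le> norm x \<Longrightarrow> \<bar>norm x powr (real CARD('n) - 1) * err j x\<bar> < \<epsilon>"
    unfolding eventually_at_infinity by blast
  show ?thesis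
  proof (rule that[of "max R1 0"])
    fix D r assume D: "lipschitz_domain D" "frontier D \<subseteq> U" and r: "r > max R1 0" and rx: "\<And>x. x \<in> frontier D \<Longrightarrow> r \<le> norm x"
      and area: "hausdorff (real CARD('n) - 1) (frontier D) \<le> ennreal (C * r ^ (CARD('n) - 1))"
    have r0: "r > 0" using r by simp
    define p where "p = r ^ (CARD('n) - 1)"
    have p: "p > 0" using r0 by (simp add: p_def)
    have err: "\<bar>err j x\<bar> \<le> \<epsilon> / p" if x: "x \<in> frontier D" for j x
    proof -
      have "p = r powr (real CARD('n) - 1)"
        unfolding p_def using r0 dim by (simp add: powr_realpow[symmetric] of_nat_diff)
      also have "\<dots> \<le> norm x powr (real CARD('n) - 1)" using rx[OF x] r0 dim by (intro powr_mono2) auto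
      finally have "p * \<bar>err j x\<bar> \<le> norm x powr (real CARD('n) - 1) * \<bar>err j x\<bar>" by (rule mult_right_mono) simp
      also have "\<dots> < \<epsilon>" using R1[of x j] rx[OF x] r by (simp add: abs_mult)
      finally show ?thesis using p by (simp add: pos_le_divide_eq mult.commute)
    qed
    have "\<bar>mass_adm g D - mass_ricci g D\<bar> \<le> \<bar>1 / ((real CARD('n) - 1) * (2 - real CARD('n)) * sphere_area CARD('n))\<bar> * (real CARD('n) * (\<epsilon> / p) * (C * p))"
      by (rule mass_difference_bound[OF D area[folded p_def] _ err]) (use C p \<epsilon> in auto)
    also have "\<dots> = k * \<epsilon>" using p by (simp add: k_def)
    also have "\<dots> < \<eta>"
    proof -
      have "k * \<epsilon> \<le> (k + 1) * \<epsilon>" using \<epsilon> by simp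
      also have "\<dots> = \<eta> / 2" using k by (simp add: \<epsilon>_def field_simps)
      finally show ?thesis using \<eta> by simp
    qed
    finally show "\<bar>mass_adm g D - mass_ricci g D\<bar> < \<eta>" .
  qed
qed

end

theorem theorem2p2:
  fixes g :: "'n::finite metric"
    and R0 C :: real
    and D :: "nat \<Rightarrow> (real^'n) set"
  assumes dim: "CARD('n) \<ge> 3"
    and reg: "riemannian_C2_on {x. R0 < norm x} g"
    and decay: "\<forall>i j. little_o2 (\<lambda>x. g i j x - (if i = j then 1 else 0)) ((real CARD('n) - 2) / 2)"
    and lip: "\<forall>l. lipschitz_domain (D l)"
    and on_dom: "\<forall>l. frontier (D l) \<subseteq> {x. R0 < norm x}"
    and r_inf: "filterlim (\<lambda>l. Inf (norm ` frontier (D l))) at_top sequentially"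
    and area: "\<forall>l. hausdorff (real CARD('n) - 1) (frontier (D l))
                   \<le> ennreal (C * Inf (norm ` frontier (D l)) ^ (CARD('n) - 1))"
  shows "(\<lambda>l. mass_adm g (D l) - mass_ricci g (D l)) \<longlonglongrightarrow> 0
       \<and> ((\<lambda>r. mass_adm g (ball 0 r) - mass_ricci g (ball 0 r)) \<longlongrightarrow> 0) at_top"
proof -
  interpret af_metric g R0 "(real CARD('n) - 2) / 2"
    by unfold_locales (use dim reg decay in auto)
  have "(\<lambda>l. mass_adm g (D l) - mass_ricci g (D l)) \<longlonglongrightarrow> 0"
  proof (rule tendstoI)
    fix \<eta> :: real assume \<eta>: "\<eta> > 0"
    \<comment> \<open>The sign of \<open>C\<close> is not prescribed, so its absolute value is used
      in the area bound.\<close>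
    have C0: "\<bar>C\<bar> \<ge> 0" by simp
    obtain R where R: "\<And>D r. lipschitz_domain D \<Longrightarrow> frontier D \<subseteq> U \<Longrightarrow> r > R \<Longrightarrow> (\<And>x. x \<in> frontier D \<Longrightarrow> r \<le> norm x) \<Longrightarrow>
       hausdorff (real CARD('n) - 1) (frontier D) \<le> ennreal (\<bar>C\<bar> * r ^ (CARD('n) - 1)) \<Longrightarrow> \<bar>mass_adm g D - mass_ricci g D\<bar> < \<eta>"
      using mass_difference_small[OF C0 \<eta>] by blast
    have "eventually (\<lambda>l. Inf (norm ` frontier (D l)) > max R 0) sequentially"
      using r_inf unfolding filterlim_at_top_dense by blast
    then show "eventually (\<lambda>l. dist (mass_adm g (D l) - mass_ricci g (D l)) 0 < \<eta>) sequentially"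
    proof eventually_elim
      fix l assume r: "Inf (norm ` frontier (D l)) > max R 0"
      have "\<bar>mass_adm g (D l) - mass_ricci g (D l)\<bar> < \<eta>"
      proof (rule R)
        show "Inf (norm ` frontier (D l)) \<le> norm x" if "x \<in> frontier (D l)" for x
          using that by (intro cInf_lower) (auto intro: bdd_belowI[of _ 0])
        have "C * Inf (norm ` frontier (D l)) ^ (CARD('n) - 1) \<le> \<bar>C\<bar> * Inf (norm ` frontier (D l)) ^ (CARD('n) - 1)"
          using r by (intro mult_right_mono) auto
        then show "hausdorff (real CARD('n) - 1) (frontier (D l)) \<le> ennreal (\<bar>C\<bar> * Inf (norm ` frontier (D l)) ^ (CARD('n) - 1))"
          using area by (meson ennreal_leI order_trans)
      qed (use lip on_dom r in auto)
      then show "dist (mass_adm g (D l) - mass_ricci g (D l)) 0 < \<eta>" by (simp add: dist_real_def)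
    qed
  qed
  moreover have "((\<lambda>r. mass_adm g (ball 0 r) - mass_ricci g (ball 0 r)) \<longlongrightarrow> 0) at_top"
  proof (rule tendstoI)
    fix \<eta> :: real assume \<eta>: "\<eta> > 0"
    obtain K where K: "K \<ge> 0" "\<And>r. r > 0 \<Longrightarrow> hausdorff (real CARD('n) - 1) (sphere (0::real^'n) r) \<le> ennreal (K * r ^ (CARD('n) - 1))"
      using hausdorff_sphere_le[where 'n = 'n] dim by (metis le_trans one_le_numeral)
    obtain R where R: "\<And>D r. lipschitz_domain D \<Longrightarrow> frontier D \<subseteq> U \<Longrightarrow> r > R \<Longrightarrow> (\<And>x. x \<in> frontier D \<Longrightarrow> r \<le> norm x) \<Longrightarrow>
       hausdorff (real CARD('n) - 1) (frontier D) \<le> ennreal (K * r ^ (CARD('n) - 1)) \<Longrightarrow> \<bar>mass_adm g D - mass_ricci g D\<bar> < \<eta>"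
      using mass_difference_small[OF K(1) \<eta>] by blast
    show "eventually (\<lambda>r. dist (mass_adm g (ball 0 r) - mass_ricci g (ball 0 r)) 0 < \<eta>) at_top"
      \<comment> \<open>Beyond \<open>R0\<close> the sphere lies where the metric is defined, and a
        positive radius makes it the frontier of the ball.\<close>
      using eventually_gt_at_top[of "max R (max R0 0)"]
    proof eventually_elim
      fix r assume r: "r > max R (max R0 0)"
      then have fr: "frontier (ball (0::real^'n) r) = sphere 0 r" by (simp add: frontier_ball)
      have "\<bar>mass_adm g (ball 0 r) - mass_ricci g (ball 0 r)\<bar> < \<eta>"
        by (rule R[OF lipschitz_domain_ball, of r r]) (use r K(2) fr in auto)
      then show "dist (mass_adm g (ball 0 r) - mass_ricci g (ball 0 r)) 0 < \<eta>" by (simp add: dist_real_def)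
    qed
  qed
  ultimately show ?thesis by simp
qed

end
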